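(* Let $\Bbbk$ be a field and let $(A,d_A)$ be a c.b.l.f. positive $\mathbb{Z}^n$-graded dg-$\Bbbk$-algebra. Any c.b.l.f. dimensional $(A,d_A)$-module $(M,d_M)$ admits a quasi-isomorphic cover by a c.b.l.f. cell module $(P,d_P)$, i.e. there is a c.b.l.f. cell module $(P,d_P)$ and a surjective quasi-isomorphism of dg-modules $(P,d_P)\to(M,d_M)$.
   Context: A $\mathbb{Z}^n$-graded dg-$\Bbbk$-algebra is $A=\bigoplus_{(h,\boldsymbol g)\in\mathbb{Z}\times\mathbb{Z}^n}A^h_{\boldsymbol g}$ with differential $d_A(A^h_{\boldsymbol g})\subset A^{h-1}_{\boldsymbol g}$ (homological degree $h$). Modules are $\mathbb{Z}^n$-graded left dg-modules, with maps preserving all gradings and commuting with differentials. Fix an additive total order $\prec$ on $\mathbb{Z}^n$. A cone is $C=\{\sum_{i=1}^n\alpha_iv_i\mid\alpha_i\ge0\}\subset\mathbb{R}^n$ with $v_i\in\mathbb{Z}^n$, compatible with $\prec$ if all $0\prec v_i$. $\mathbb{Z}_C[[x_1,\dots,x_n]]$ is the set of integral formal series $\sum a_{\boldsymbol k}x^{\boldsymbol k}$ with $a_{\boldsymbol k}=0$ for $\boldsymbol k\notin C$. $(A,d_A)$ is c.b.l.f. positive if: (1) $A^h_{\boldsymbol g}=0$ for $h<0$; (2) $\bigoplus_hA^h_{\boldsymbol g}$ is finite-dimensional for every $\boldsymbol g$ and $\sum_{(h,\boldsymbol g)}\dim(A^h_{\boldsymbol g})x^{\boldsymbol g}\in\mathbb{Z}_{C_A}[[x_1,\dots,x_n]]$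 for some cone $C_A$ compatible with $\prec$; (3) $A_0^0$ is semi-simple; (4) $A_0^h=0$ for $h>0$. A dg-module $M$ is c.b.l.f. dimensional if $\bigoplus_hM^h_{\boldsymbol g}$ is finite-dimensional for each $\boldsymbol g$, there are $\boldsymbol e\in\mathbb{Z}^n$ and a compatible cone $C_M$ with $M_{\boldsymbol g}=0$ whenever $\boldsymbol g-\boldsymbol e\notin C_M$, and $M$ is bounded from below in homological degree. It is c.b.l.f. generated (as graded $A$-module) if it is generated by homogeneous elements of which only finitely many have any given $\mathbb{Z}^n$-degree $\boldsymbol g$, none having $\boldsymbol g-\boldsymbol e\notin C$ (for some $\boldsymbol e$ and compatible cone $C$), and it is bounded from below in homological degree. A relatively projective module is a direct summand of a free module in the category of dg-modules. $Y$ satisfies property (P) if it has an exhaustive filtration by dg-submodules $0=F_0\subset F_1\subset F_2\subset\cdots\subset Y$ with each $F_{r+1}/F_r$ isomorphic as dg-module to a relatively projective module. A c.b.l.f. cell module is a dg-module satisfying property (P) which, as graded $A$-module, is c.b.l.f. generated for the $\mathbb{Z}^n$-grading and bounded from below for the homological grading. *)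

theory Defs
  imports "HOL-Analysis.Finite_Cartesian_Product" "HOL-Algebra.Module" "HOL-Algebra.AbelCoset"
begin

section \<open>Graded objects\<close>

text \<open>One record type serves for dg-algebras over a field (scalars: the field) and for left
  dg-modules over a dg-algebra (scalars: the algebra; the fields \<open>mult\<close> and \<open>one\<close> inherited from
  \<^typ>\<open>('r, 'm) module\<close> are then irrelevant, as usual in \<^theory>\<open>HOL-Algebra.Module\<close>).
  The piece \<open>M\<^sup>h\<^sub>g\<close> of homological degree \<open>h\<close> and \<open>\<int>\<^sup>n\<close>-degree \<open>g\<close> is \<open>piece M h g\<close>.\<close>

record ('r, 'm, 'n::finite) dg_struct = "('r, 'm) module" +
  piece :: "int \<Rightarrow> int ^ 'n \<Rightarrow> 'm set"
  diff :: "'m \<Rightarrow> 'm"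

text \<open>The family is normalised to be zero outside \<open>I\<close>, so that the unique existence of the
  decomposition is unique existence of a function.\<close>

definition internal_direct_sum :: "('m, 'x) ring_scheme \<Rightarrow> 'i set \<Rightarrow> ('i \<Rightarrow> 'm set) \<Rightarrow> bool" where
  "internal_direct_sum M I V \<longleftrightarrow>
     (\<forall>i\<in>I. additive_subgroup (V i) M) \<and>
     (\<forall>x\<in>carrier M. \<exists>!f. (\<forall>i\<in>I. f i \<in> V i) \<and> (\<forall>i. i \<notin> I \<longrightarrow> f i = \<zero>\<^bsub>M\<^esub>) \<and>
        finite {i. f i \<noteq> \<zero>\<^bsub>M\<^esub>} \<and> x = finsum M f {i. f i \<noteq> \<zero>\<^bsub>M\<^esub>})"

definition graded_by_pieces :: "('r, 'm, 'n::finite) dg_struct \<Rightarrow> bool" where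
  "graded_by_pieces M \<longleftrightarrow> internal_direct_sum M UNIV (\<lambda>(h, g). piece M h g)"

definition koszul_sign :: "('m, 'x) ring_scheme \<Rightarrow> int \<Rightarrow> 'm \<Rightarrow> 'm" where
  "koszul_sign M h x = (if even h then x else \<ominus>\<^bsub>M\<^esub> x)"

section \<open>dg-algebras and dg-modules\<close>

locale dg_algebra = K?: field K + Module.module K A + A?: ring A
  for K :: "('k, 'x) ring_scheme" (structure)
    and A :: "('k, 'a, 'n::finite) dg_struct" (structure) +
  assumes smult_mult_left:
      "\<lbrakk>c \<in> carrier K; a \<in> carrier A; b \<in> carrier A\<rbrakk>
        \<Longrightarrow> (c \<odot>\<^bsub>A\<^esub> a) \<otimes>\<^bsub>A\<^esub> b = c \<odot>\<^bsub>A\<^esub> (a \<otimes>\<^bsub>A\<^esub> b)"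
    and smult_mult_right:
      "\<lbrakk>c \<in> carrier K; a \<in> carrier A; b \<in> carrier A\<rbrakk>
        \<Longrightarrow> a \<otimes>\<^bsub>A\<^esub> (c \<odot>\<^bsub>A\<^esub> b) = c \<odot>\<^bsub>A\<^esub> (a \<otimes>\<^bsub>A\<^esub> b)"
    and graded: "graded_by_pieces A"
    and piece_smult: "\<lbrakk>c \<in> carrier K; a \<in> piece A h g\<rbrakk> \<Longrightarrow> c \<odot>\<^bsub>A\<^esub> a \<in> piece A h g"
    and one_piece: "\<one>\<^bsub>A\<^esub> \<in> piece A 0 0"
    and mult_piece:
      "\<lbrakk>a \<in> piece A h g; b \<in> piece A h' g'\<rbrakk> \<Longrightarrow> a \<otimes>\<^bsub>A\<^esub> b \<in> piece A (h + h') (g + g')"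
    and diff_add:
      "\<lbrakk>a \<in> carrier A; b \<in> carrier A\<rbrakk> \<Longrightarrow> diff A (a \<oplus>\<^bsub>A\<^esub> b) = diff A a \<oplus>\<^bsub>A\<^esub> diff A b"
    and diff_smult:
      "\<lbrakk>c \<in> carrier K; a \<in> carrier A\<rbrakk> \<Longrightarrow> diff A (c \<odot>\<^bsub>A\<^esub> a) = c \<odot>\<^bsub>A\<^esub> diff A a"
    and diff_piece: "a \<in> piece A h g \<Longrightarrow> diff A a \<in> piece A (h - 1) g"
    and diff_diff: "a \<in> carrier A \<Longrightarrow> diff A (diff A a) = \<zero>\<^bsub>A\<^esub>"
    and leibniz:
      "\<lbrakk>a \<in> piece A h g; b \<in> carrier A\<rbrakk>
        \<Longrightarrow> diff A (a \<otimes>\<^bsub>A\<^esub> b) = (diff A a \<otimes>\<^bsub>A\<^esub> b) \<oplus>\<^bsub>A\<^esub> koszul_sign A h (a \<otimes>\<^bsub>A\<^esub> diff A b)"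

text \<open>Unital left modules over a not necessarily commutative ring; the locale
  \<^locale>\<open>Module.module\<close> requires a commutative one.\<close>

locale left_module = R?: ring R + M?: abelian_group M
  for R :: "('a, 'x) ring_scheme" (structure) and M :: "('a, 'm, 'y) module_scheme" (structure) +
  assumes act_closed: "\<lbrakk>a \<in> carrier R; x \<in> carrier M\<rbrakk> \<Longrightarrow> a \<odot>\<^bsub>M\<^esub> x \<in> carrier M"
    and act_l_distr:
      "\<lbrakk>a \<in> carrier R; b \<in> carrier R; x \<in> carrier M\<rbrakk>
        \<Longrightarrow> (a \<oplus>\<^bsub>R\<^esub> b) \<odot>\<^bsub>M\<^esub> x = (a \<odot>\<^bsub>M\<^esub> x) \<oplus>\<^bsub>M\<^esub> (b \<odot>\<^bsub>M\<^esub> x)"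
    and act_r_distr:
      "\<lbrakk>a \<in> carrier R; x \<in> carrier M; y \<in> carrier M\<rbrakk>
        \<Longrightarrow> a \<odot>\<^bsub>M\<^esub> (x \<oplus>\<^bsub>M\<^esub> y) = (a \<odot>\<^bsub>M\<^esub> x) \<oplus>\<^bsub>M\<^esub> (a \<odot>\<^bsub>M\<^esub> y)"
    and act_assoc:
      "\<lbrakk>a \<in> carrier R; b \<in> carrier R; x \<in> carrier M\<rbrakk>
        \<Longrightarrow> (a \<otimes>\<^bsub>R\<^esub> b) \<odot>\<^bsub>M\<^esub> x = a \<odot>\<^bsub>M\<^esub> (b \<odot>\<^bsub>M\<^esub> x)"
    and act_one: "x \<in> carrier M \<Longrightarrow> \<one>\<^bsub>R\<^esub> \<odot>\<^bsub>M\<^esub> x = x"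

text \<open>The ground field acts on a dg-module through \<open>c \<mapsto> c \<cdot> 1\<^sub>A\<close>, which lies in \<open>A\<^sup>0\<^sub>0\<close> and is a
  cycle. So the pieces are subspaces and the differential is linear without further axioms.\<close>

locale dg_module = left_module A M
  for A :: "('k, 'a, 'n::finite) dg_struct" (structure)
    and M :: "('a, 'm, 'n) dg_struct" (structure) +
  assumes graded: "graded_by_pieces M"
    and act_piece:
      "\<lbrakk>a \<in> piece A h g; x \<in> piece M h' g'\<rbrakk> \<Longrightarrow> a \<odot>\<^bsub>M\<^esub> x \<in> piece M (h + h') (g + g')"
    and diff_add:
      "\<lbrakk>x \<in> carrier M; y \<in> carrier M\<rbrakk> \<Longrightarrow> diff M (x \<oplus>\<^bsub>M\<^esub> y) = diff M x \<oplus>\<^bsub>M\<^esub> diff M y"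
    and diff_piece: "x \<in> piece M h g \<Longrightarrow> diff M x \<in> piece M (h - 1) g"
    and diff_diff: "x \<in> carrier M \<Longrightarrow> diff M (diff M x) = \<zero>\<^bsub>M\<^esub>"
    and leibniz:
      "\<lbrakk>a \<in> piece A h g; x \<in> carrier M\<rbrakk>
        \<Longrightarrow> diff M (a \<odot>\<^bsub>M\<^esub> x) = (diff A a \<odot>\<^bsub>M\<^esub> x) \<oplus>\<^bsub>M\<^esub> koszul_sign M h (a \<odot>\<^bsub>M\<^esub> diff M x)"

definition dg_hom ::
  "('k, 'a, 'n::finite) dg_struct \<Rightarrow> ('a, 'm, 'n) dg_struct \<Rightarrow> ('a, 'p, 'n) dg_struct \<Rightarrow>
    ('m \<Rightarrow> 'p) \<Rightarrow> bool" where
  "dg_hom A M N f \<longleftrightarrow>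
     f \<in> carrier M \<rightarrow> carrier N \<and>
     (\<forall>x\<in>carrier M. \<forall>y\<in>carrier M. f (x \<oplus>\<^bsub>M\<^esub> y) = f x \<oplus>\<^bsub>N\<^esub> f y) \<and>
     (\<forall>a\<in>carrier A. \<forall>x\<in>carrier M. f (a \<odot>\<^bsub>M\<^esub> x) = a \<odot>\<^bsub>N\<^esub> f x) \<and>
     (\<forall>h g. f ` piece M h g \<subseteq> piece N h g) \<and>
     (\<forall>x\<in>carrier M. f (diff M x) = diff N (f x))"

definition dg_isomorphic ::
  "('k, 'a, 'n::finite) dg_struct \<Rightarrow> ('a, 'm, 'n) dg_struct \<Rightarrow> ('a, 'p, 'n) dg_struct \<Rightarrow> bool" where
  "dg_isomorphic A M N \<longleftrightarrow> (\<exists>f. dg_hom A M N f \<and> bij_betw f (carrier M) (carrier N))"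

subsection \<open>Homology\<close>

definition cycles :: "('r, 'm, 'n::finite) dg_struct \<Rightarrow> 'm set" where
  "cycles M = {x \<in> carrier M. diff M x = \<zero>\<^bsub>M\<^esub>}"

definition boundaries :: "('r, 'm, 'n::finite) dg_struct \<Rightarrow> 'm set" where
  "boundaries M = diff M ` carrier M"

definition homology :: "('r, 'm, 'n::finite) dg_struct \<Rightarrow> 'm set monoid" where
  "homology M = (M\<lparr>carrier := cycles M\<rparr>) A_Mod (boundaries M)"

text \<open>The union below is over one and the same coset when \<open>f\<close> is a morphism.\<close>

definition homology_map ::
  "('a, 'p, 'n::finite) dg_struct \<Rightarrow> ('m \<Rightarrow> 'p) \<Rightarrow> 'm set \<Rightarrow> 'p set" where
  "homology_map N f X = (\<Union>x\<in>X. boundaries N +>\<^bsub>N\<^esub> f x)"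

definition quasi_isomorphism ::
  "('k, 'a, 'n::finite) dg_struct \<Rightarrow> ('a, 'm, 'n) dg_struct \<Rightarrow> ('a, 'p, 'n) dg_struct \<Rightarrow>
    ('m \<Rightarrow> 'p) \<Rightarrow> bool" where
  "quasi_isomorphism A M N f \<longleftrightarrow>
     dg_hom A M N f \<and> homology_map N f \<in> iso (homology M) (homology N)"

subsection \<open>Submodules, quotients, free modules\<close>

definition dg_restrict :: "('r, 'm, 'n::finite) dg_struct \<Rightarrow> 'm set \<Rightarrow> ('r, 'm, 'n) dg_struct" where
  "dg_restrict M N = M\<lparr>carrier := N, piece := \<lambda>h g. N \<inter> piece M h g\<rparr>"

definition dg_submodule ::
  "('k, 'a, 'n::finite) dg_struct \<Rightarrow> ('a, 'm, 'n) dg_struct \<Rightarrow> 'm set \<Rightarrow> bool" where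
  "dg_submodule A M N \<longleftrightarrow> N \<subseteq> carrier M \<and> dg_module A (dg_restrict M N)"

definition dg_quotient ::
  "('r, 'm, 'n::finite) dg_struct \<Rightarrow> 'm set \<Rightarrow> ('r, 'm set, 'n) dg_struct" where
  "dg_quotient M N =
     \<lparr>carrier = a_rcosets\<^bsub>M\<^esub> N, mult = undefined, one = undefined,
      zero = N, add = set_add M,
      smult = (\<lambda>a X. \<Union>x\<in>X. N +>\<^bsub>M\<^esub> (a \<odot>\<^bsub>M\<^esub> x)),
      piece = (\<lambda>h g. (\<lambda>x. N +>\<^bsub>M\<^esub> x) ` piece M h g),
      diff = (\<lambda>X. \<Union>x\<in>X. N +>\<^bsub>M\<^esub> diff M x)\<rparr>"

text \<open>The free dg-module on generators \<open>e\<^sub>i\<close> (\<open>i \<in> I\<close>) of bidegree \<open>(p i, q i)\<close> with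
  \<open>d e\<^sub>i = 0\<close>, i.e. a direct sum of shifted copies of \<open>A\<close>. The function \<open>f\<close> stands for
  \<open>\<Sum>\<^sub>i f(i) e\<^sub>i\<close>; as the coefficients are to the left of the generators, no signs occur.\<close>

definition free_dg_module ::
  "('k, 'a, 'n::finite) dg_struct \<Rightarrow> 'i set \<Rightarrow> ('i \<Rightarrow> int) \<Rightarrow> ('i \<Rightarrow> int ^ 'n) \<Rightarrow>
    ('a, 'i \<Rightarrow> 'a, 'n) dg_struct" where
  "free_dg_module A I p q =
    (let F = {f. (\<forall>i\<in>I. f i \<in> carrier A) \<and> (\<forall>i. i \<notin> I \<longrightarrow> f i = \<zero>\<^bsub>A\<^esub>) \<and>
                 finite {i. f i \<noteq> \<zero>\<^bsub>A\<^esub>}}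
     in \<lparr>carrier = F, mult = undefined, one = undefined,
         zero = (\<lambda>i. \<zero>\<^bsub>A\<^esub>), add = (\<lambda>f f' i. f i \<oplus>\<^bsub>A\<^esub> f' i),
         smult = (\<lambda>a f i. a \<otimes>\<^bsub>A\<^esub> f i),
         piece = (\<lambda>h g. {f \<in> F. \<forall>i\<in>I. f i \<in> piece A (h - p i) (g - q i)}),
         diff = (\<lambda>f i. diff A (f i))\<rparr>)"

definition direct_summand ::
  "('k, 'a, 'n::finite) dg_struct \<Rightarrow> ('a, 'm, 'n) dg_struct \<Rightarrow> 'm set \<Rightarrow> bool" where
  "direct_summand A F N \<longleftrightarrow>
     dg_submodule A F N \<and>
     (\<exists>N'. dg_submodule A F N' \<and> N \<inter> N' = {\<zero>\<^bsub>F\<^esub>} \<and> N <+>\<^bsub>F\<^esub> N' = carrier F)"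

text \<open>The free module is indexed by a subset of the type of elements of \<open>Q\<close>. This loses no
  generality: if \<open>Q\<close> is a retract of a free module with generators \<open>e\<^sub>i\<close>, the retraction factors
  through the free module on the set of the nonzero images of the \<open>e\<^sub>i\<close>, with their degrees.\<close>

definition relatively_projective ::
  "('k, 'a, 'n::finite) dg_struct \<Rightarrow> ('a, 'q, 'n) dg_struct \<Rightarrow> bool" where
  "relatively_projective A Q \<longleftrightarrow>
     (\<exists>(I :: 'q set) p q N. direct_summand A (free_dg_module A I p q) N \<and>
        dg_isomorphic A Q (dg_restrict (free_dg_module A I p q) N))"

definition property_P ::
  "('k, 'a, 'n::finite) dg_struct \<Rightarrow> ('a, 'p, 'n) dg_struct \<Rightarrow> bool" where
  "property_P A Y \<longleftrightarrow>
     (\<exists>F :: nat \<Rightarrow> 'p set.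
        F 0 = {\<zero>\<^bsub>Y\<^esub>} \<and>
        (\<forall>r. dg_submodule A Y (F r)) \<and>
        (\<forall>r. F r \<subseteq> F (Suc r)) \<and>
        (\<Union>r. F r) = carrier Y \<and>
        (\<forall>r. relatively_projective A (dg_quotient (dg_restrict Y (F (Suc r))) (F r))))"

section \<open>Cones and local finiteness\<close>

definition additive_total_order :: "(int ^ 'n::finite \<Rightarrow> int ^ 'n \<Rightarrow> bool) \<Rightarrow> bool" where
  "additive_total_order lt \<longleftrightarrow>
     irreflp lt \<and> transp lt \<and> totalp lt \<and> (\<forall>x y z. lt x y \<longrightarrow> lt (x + z) (y + z))"

definition real_vec :: "int ^ 'n::finite \<Rightarrow> real ^ 'n" where
  "real_vec v = (\<chi> j. real_of_int (v $ j))"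

definition cone_of :: "('n::finite \<Rightarrow> int ^ 'n) \<Rightarrow> (real ^ 'n) set" where
  "cone_of v = {\<Sum>i\<in>UNIV. \<alpha> i *\<^sub>R real_vec (v i) | \<alpha>. \<forall>i. \<alpha> i \<ge> 0}"

definition compatible_cone ::
  "(int ^ 'n::finite \<Rightarrow> int ^ 'n \<Rightarrow> bool) \<Rightarrow> (real ^ 'n) set \<Rightarrow> bool" where
  "compatible_cone lt C \<longleftrightarrow> (\<exists>v. (\<forall>i. lt 0 (v i)) \<and> C = cone_of v)"

text \<open>\<open>\<int>\<^sub>C[[x\<^sub>1, \<dots>, x\<^sub>n]]\<close>, a series being identified with its coefficient function.\<close>

definition series_in_cone :: "(real ^ 'n::finite) set \<Rightarrow> (int ^ 'n \<Rightarrow> int) set" where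
  "series_in_cone C = {a. \<forall>k. real_vec k \<notin> C \<longrightarrow> a k = 0}"

text \<open>In the next three definitions \<open>sc\<close> is the scalar multiplication by elements of \<open>K\<close>.\<close>

definition spans ::
  "('k, 'x) ring_scheme \<Rightarrow> ('k \<Rightarrow> 'm \<Rightarrow> 'm) \<Rightarrow> ('m, 'y) ring_scheme \<Rightarrow> 'm set \<Rightarrow> 'm set \<Rightarrow> bool" where
  "spans K sc M B V \<longleftrightarrow>
     finite B \<and> B \<subseteq> V \<and> (\<forall>v\<in>V. \<exists>c \<in> B \<rightarrow> carrier K. v = (\<Oplus>\<^bsub>M\<^esub>b\<in>B. sc (c b) b))"

definition fin_dim ::
  "('k, 'x) ring_scheme \<Rightarrow> ('k \<Rightarrow> 'm \<Rightarrow> 'm) \<Rightarrow> ('m, 'y) ring_scheme \<Rightarrow> 'm set \<Rightarrow> bool" where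
  "fin_dim K sc M V \<longleftrightarrow> (\<exists>B. spans K sc M B V)"

text \<open>Meaningful for finite-dimensional \<open>V\<close> only.\<close>

definition vdim ::
  "('k, 'x) ring_scheme \<Rightarrow> ('k \<Rightarrow> 'm \<Rightarrow> 'm) \<Rightarrow> ('m, 'y) ring_scheme \<Rightarrow> 'm set \<Rightarrow> nat" where
  "vdim K sc M V = (LEAST d. \<exists>B. spans K sc M B V \<and> card B = d)"

text \<open>\<open>M\<^sub>g = \<Oplus>\<^sub>h M\<^sup>h\<^sub>g\<close> as a subset of \<open>M\<close>.\<close>

definition zpart :: "('r, 'm, 'n::finite) dg_struct \<Rightarrow> int ^ 'n \<Rightarrow> 'm set" where
  "zpart M g = {finsum M x H | x H. finite H \<and> (\<forall>h\<in>H. x h \<in> piece M h g)}"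

definition bounded_below :: "('r, 'm, 'n::finite) dg_struct \<Rightarrow> bool" where
  "bounded_below M \<longleftrightarrow> (\<exists>b. \<forall>h g. h < b \<longrightarrow> piece M h g = {\<zero>\<^bsub>M\<^esub>})"

subsection \<open>Semi-simple rings\<close>

definition left_ideal :: "('a, 'x) ring_scheme \<Rightarrow> 'a set \<Rightarrow> bool" where
  "left_ideal R L \<longleftrightarrow>
     additive_subgroup L R \<and> (\<forall>a\<in>carrier R. \<forall>x\<in>L. a \<otimes>\<^bsub>R\<^esub> x \<in> L)"

definition simple_left_ideal :: "('a, 'x) ring_scheme \<Rightarrow> 'a set \<Rightarrow> bool" where
  "simple_left_ideal R L \<longleftrightarrow>
     left_ideal R L \<and> L \<noteq> {\<zero>\<^bsub>R\<^esub>} \<and>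
     (\<forall>L'. left_ideal R L' \<and> L' \<subseteq> L \<longrightarrow> L' = {\<zero>\<^bsub>R\<^esub>} \<or> L' = L)"

text \<open>The left regular module is a direct sum of simple modules; the zero ring is allowed.\<close>

definition semisimple_ring :: "('a, 'x) ring_scheme \<Rightarrow> bool" where
  "semisimple_ring R \<longleftrightarrow>
     ring R \<and> (\<exists>\<L>. (\<forall>L\<in>\<L>. simple_left_ideal R L) \<and> internal_direct_sum R \<L> (\<lambda>L. L))"

subsection \<open>c.b.l.f. conditions\<close>

definition graded_dimension ::
  "('k, 'x) ring_scheme \<Rightarrow> ('k, 'a, 'n::finite) dg_struct \<Rightarrow> int ^ 'n \<Rightarrow> int" where
  "graded_dimension K A g =
     (\<Sum>h | piece A h g \<noteq> {\<zero>\<^bsub>A\<^esub>}. int (vdim K (smult A) A (piece A h g)))"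

definition cblf_positive ::
  "(int ^ 'n::finite \<Rightarrow> int ^ 'n \<Rightarrow> bool) \<Rightarrow> ('k, 'x) ring_scheme \<Rightarrow>
    ('k, 'a, 'n) dg_struct \<Rightarrow> bool" where
  "cblf_positive lt K A \<longleftrightarrow>
     (\<forall>h g. h < 0 \<longrightarrow> piece A h g = {\<zero>\<^bsub>A\<^esub>}) \<and>
     (\<forall>g. fin_dim K (smult A) A (zpart A g)) \<and>
     (\<exists>C. compatible_cone lt C \<and> graded_dimension K A \<in> series_in_cone C) \<and>
     semisimple_ring (A\<lparr>carrier := piece A 0 0\<rparr>) \<and>
     (\<forall>h > 0. piece A h 0 = {\<zero>\<^bsub>A\<^esub>})"

definition cblf_dimensional ::
  "(int ^ 'n::finite \<Rightarrow> int ^ 'n \<Rightarrow> bool) \<Rightarrow> ('k, 'x) ring_scheme \<Rightarrow>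
    ('k, 'a, 'n) dg_struct \<Rightarrow> ('a, 'm, 'n) dg_struct \<Rightarrow> bool" where
  "cblf_dimensional lt K A M \<longleftrightarrow>
     (\<forall>g. fin_dim K (\<lambda>c x. (c \<odot>\<^bsub>A\<^esub> \<one>\<^bsub>A\<^esub>) \<odot>\<^bsub>M\<^esub> x) M (zpart M g)) \<and>
     (\<exists>e C. compatible_cone lt C \<and>
        (\<forall>g. real_vec (g - e) \<notin> C \<longrightarrow> zpart M g = {\<zero>\<^bsub>M\<^esub>})) \<and>
     bounded_below M"

definition generates ::
  "('k, 'a, 'n::finite) dg_struct \<Rightarrow> ('a, 'm, 'n) dg_struct \<Rightarrow> 'm set \<Rightarrow> bool" where
  "generates A M X \<longleftrightarrow>
     X \<subseteq> carrier M \<and>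
     (\<forall>m\<in>carrier M. \<exists>Y a. finite Y \<and> Y \<subseteq> X \<and> a \<in> Y \<rightarrow> carrier A \<and>
        m = (\<Oplus>\<^bsub>M\<^esub>x\<in>Y. a x \<odot>\<^bsub>M\<^esub> x))"

text \<open>Zero lies in every piece, whence \<open>{\<zero>}\<close> rather than \<open>{}\<close> in the cone condition.\<close>

definition cblf_generated ::
  "(int ^ 'n::finite \<Rightarrow> int ^ 'n \<Rightarrow> bool) \<Rightarrow> ('k, 'a, 'n) dg_struct \<Rightarrow>
    ('a, 'm, 'n) dg_struct \<Rightarrow> bool" where
  "cblf_generated lt A M \<longleftrightarrow>
     (\<exists>X. X \<subseteq> (\<Union>h g. piece M h g) \<and> generates A M X \<and>
        (\<forall>g. finite (X \<inter> (\<Union>h. piece M h g))) \<and>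
        (\<exists>e C. compatible_cone lt C \<and>
           (\<forall>g. real_vec (g - e) \<notin> C \<longrightarrow> X \<inter> (\<Union>h. piece M h g) \<subseteq> {\<zero>\<^bsub>M\<^esub>}))) \<and>
     bounded_below M"

definition cblf_cell_module ::
  "(int ^ 'n::finite \<Rightarrow> int ^ 'n \<Rightarrow> bool) \<Rightarrow> ('k, 'a, 'n) dg_struct \<Rightarrow>
    ('a, 'm, 'n) dg_struct \<Rightarrow> bool" where
  "cblf_cell_module lt A P \<longleftrightarrow>
     dg_module A P \<and> property_P A P \<and> cblf_generated lt A P \<and> bounded_below P"

text \<open>HOL cannot quantify existentially over types, so the existence of a module has to be
  asserted in a given type of elements. The one below contains the bar resolution: it is the
  type of cosets of formal linear combinations of words \<open>(a\<^sub>0, \<dots>, a\<^sub>k; m)\<close>.\<close>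

type_synonym ('k, 'a, 'm) bar_elem = "('a list \<times> 'm \<Rightarrow> 'k) set"

end

theory Submission
  imports Defs "HOL-Analysis.Cartesian_Space"
begin

text \<open>The module \<open>P\<close> is a semi-free resolution, built from cells \<open>A \<epsilon> x\<close> with \<open>\<epsilon>\<close> an idempotent of
  \<open>A\<^sup>0\<^sub>0\<close>: each new generator \<open>x = \<epsilon> x\<close> has its boundary \<open>d x\<close> in what is already there. Such a module is a
  ``twisted module'': finitely supported coefficient families \<open>f\<close>, standing for \<open>\<Sum>\<^sub>i f(i) x\<^sub>i\<close>, with a
  differential determined by the Leibniz rule and the coefficients \<open>z i j\<close> of \<open>d x\<^sub>i = \<Sum>\<^sub>j z i j x\<^sub>j\<close>
  (\<open>T_dg_module\<close>).

  A morphism \<open>f\<close> is a surjective quasi-isomorphism as soon as every pair \<open>(m, z)\<close> with \<open>d z = 0\<close> and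
  \<open>f z = d m\<close> is of the form \<open>(f y, d y)\<close> (\<open>lifting_quasi_isomorphism\<close>). A pair which is not of this form
  acquires it when a generator \<open>x\<close> with \<open>d x = z\<close> and \<open>f x = m\<close> is attached (\<open>attach_valid\<close>). Attaching
  generators creates new cycles, so the whole difficulty is to get by with finitely many generators
  in each weight \<open>g \<in> \<int>\<^sup>n\<close>.

  Different weights are separated by a cone. The cones of \<open>A\<close> and \<open>M\<close> lie in one compatible cone \<open>C\<close>
  which carries an additive integer function \<open>L\<close>, positive on its nonzero lattice points and with finite
  sublevel sets (\<open>common_cone\<close>). A generator of weight \<open>g\<close> only affects weights in \<open>g + C\<close>. The weights
  can therefore be treated in the order of \<open>L\<close>; those of equal \<open>L\<close> do not interact, and later
  generators leave a finished weight untouched (\<open>weight_done_preserved\<close>).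

  Inside one weight \<open>g\<close> a new generator only contributes \<open>A\<^sub>0 \<epsilon> x\<close>, where \<open>A\<^sub>0 = A\<^sup>0\<^sub>0\<close> is semi-simple; the
  idempotents are taken primitive, so that \<open>A\<^sub>0 \<epsilon>\<close> is simple. First, generators with \<open>d x = 0\<close> are
  attached until all cycles of \<open>M\<^sub>g\<close> are images of cycles. Each one enlarges the subspace of such images in
  the finite-dimensional \<open>M\<^sub>g\<close>, so this ends (\<open>complete_cycles\<close>). Afterwards generators are attached for
  the pairs \<open>(m, z)\<close> that do not lift. Suppose \<open>y + a x\<close> is a cycle with image \<open>d m'\<close>. As the cycle \<open>d m'\<close>
  is already the image of a cycle, \<open>a (m, z)\<close> lifts without the help of \<open>x\<close>; by simplicity of
  \<open>A\<^sub>0 \<epsilon>\<close> this forces \<open>a = 0\<close>. So no new pairs appear: all the pairs to be lifted stay in the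
  finite-dimensional space in which the second phase started, the subspace of liftable pairs grows strictly,
  and the process ends (\<open>complete_weight\<close>). The only use of dimensions is that chains of subspaces are
  bounded, which is recorded by a bounded strictly monotone rank.

  Property (P) holds because \<open>A\<close> lives in degrees \<open>h \<ge> 0\<close>: then \<open>d x\<^sub>i\<close> only involves generators of smaller
  homological degree, so the generators of degree below \<open>b + r\<close> span the steps \<open>F\<^sub>r\<close> of a filtration.
  Its quotients are sums of untwisted cells \<open>A \<epsilon>\<close>, that is, summands of free modules
  (\<open>property_P_image\<close>).\<close>

section \<open>Additive maps and graded groups\<close>

lemma (in abelian_group) additive_zero:
  assumes "abelian_group H" "F \<in> carrier G \<rightarrow> carrier H"
    and "\<And>x y. \<lbrakk>x \<in> carrier G; y \<in> carrier G\<rbrakk> \<Longrightarrow> F (x \<oplus> y) = F x \<oplus>\<^bsub>H\<^esub> F y"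
  shows "F \<zero> = \<zero>\<^bsub>H\<^esub>"
proof -
  interpret H: abelian_group H by fact
  have "F \<zero> \<in> carrier H" "F \<zero> \<oplus>\<^bsub>H\<^esub> F \<zero> = F \<zero>"
    using assms(2) assms(3)[of \<zero> \<zero>] by auto
  then show ?thesis
    by (metis H.add.l_cancel_one)
qed

lemma (in abelian_group) additive_finsum:
  assumes "abelian_group H" "F \<in> carrier G \<rightarrow> carrier H"
    and add: "\<And>x y. \<lbrakk>x \<in> carrier G; y \<in> carrier G\<rbrakk> \<Longrightarrow> F (x \<oplus> y) = F x \<oplus>\<^bsub>H\<^esub> F y"
    and "f \<in> S \<rightarrow> carrier G" "finite S"
  shows "F (finsum G f S) = finsum H (\<lambda>i. F (f i)) S"
  using assms(5,4)
proof (induction S)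
  case empty
  interpret H: abelian_group H by fact
  show ?case using additive_zero[of H F, OF assms(1-3)] by simp
next
  case (insert x S)
  interpret H: abelian_group H by fact
  from insert.prems have "f \<in> S \<rightarrow> carrier G" "f x \<in> carrier G" by auto
  moreover have "(\<lambda>i. F (f i)) \<in> S \<rightarrow> carrier H"
    using calculation assms(2) by auto
  ultimately show ?case
    using insert assms(2) by (simp add: add Pi_iff)
qed

lemma (in abelian_group) additive_uminus:
  assumes "abelian_group H" "F \<in> carrier G \<rightarrow> carrier H"
    and add: "\<And>x y. \<lbrakk>x \<in> carrier G; y \<in> carrier G\<rbrakk> \<Longrightarrow> F (x \<oplus> y) = F x \<oplus>\<^bsub>H\<^esub> F y"
    and x: "x \<in> carrier G"
  shows "F (\<ominus> x) = \<ominus>\<^bsub>H\<^esub> F x"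
proof -
  interpret H: abelian_group H by fact
  have "F x \<oplus>\<^bsub>H\<^esub> F (\<ominus> x) = \<zero>\<^bsub>H\<^esub>"
    using add[of x "\<ominus> x"] x additive_zero[of H F, OF assms(1-3)] by (simp add: r_neg)
  then show ?thesis
    using assms(2) x by (metis H.minus_equality H.a_comm PiE a_inv_closed)
qed

lemma (in abelian_group) finsum_in_subgroup:
  assumes "additive_subgroup V G" "f \<in> S \<rightarrow> V"
  shows "finsum G f S \<in> V"
proof (cases "finite S")
  case True
  then show ?thesis using assms(2)
  proof (induction S)
    case empty
    then show ?case using assms(1) by (simp add: additive_subgroup.zero_closed)
  next
    case (insert x S)
    have "V \<subseteq> carrier G" using assms(1) by (simp add: additive_subgroup.a_subset)
    with insert show ?case using additive_subgroup.a_closed[OF assms(1)]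
      by (subst finsum_insert) auto
  qed
next
  case False
  then show ?thesis using assms(1) by (simp add: additive_subgroup.zero_closed)
qed

lemma (in abelian_group) additive_subgroupI':
  assumes "V \<subseteq> carrier G" "\<zero> \<in> V" "\<And>x y. x \<in> V \<Longrightarrow> y \<in> V \<Longrightarrow> x \<oplus> y \<in> V"
    "\<And>x. x \<in> V \<Longrightarrow> \<ominus> x \<in> V"
  shows "additive_subgroup V G"
  by (rule additive_subgroupI, rule add.subgroupI) (use assms in auto)

lemma (in abelian_group) additive_subgroup_uminus:
  assumes "additive_subgroup V G" "x \<in> V"
  shows "\<ominus> x \<in> V"
proof -
  interpret V: additive_subgroup V G by fact
  show ?thesis using V.a_subgroup assms(2)
    by (metis a_inv_def subgroup.m_inv_closed)
qed

text \<open>The long form of the description is that of \<open>internal_direct_sum\<close> for the index set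
  \<open>UNIV\<close>, so that the unique existence in a grading applies to it as it stands.\<close>

definition component :: "('r, 'm, 'n::finite) dg_struct \<Rightarrow> int \<times> (int ^ 'n) \<Rightarrow> 'm \<Rightarrow> 'm" where
  "component M i x = (THE f. (\<forall>i\<in>UNIV. f i \<in> piece M (fst i) (snd i)) \<and>
      (\<forall>i. i \<notin> UNIV \<longrightarrow> f i = \<zero>\<^bsub>M\<^esub>) \<and>
      finite {i. f i \<noteq> \<zero>\<^bsub>M\<^esub>} \<and> x = finsum M f {i. f i \<noteq> \<zero>\<^bsub>M\<^esub>}) i"

locale graded_group = abelian_group M for M :: "('r, 'm, 'n::finite) dg_struct" (structure) +
  assumes graded_group_graded: "graded_by_pieces M"
begin

lemma piece_subgroup: "additive_subgroup (piece M h g) M"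
  using graded_group_graded unfolding graded_by_pieces_def internal_direct_sum_def by auto

lemma piece_carrier: "x \<in> piece M h g \<Longrightarrow> x \<in> carrier M"
  using piece_subgroup additive_subgroup.a_subset by blast

lemma piece_zero [simp]: "\<zero> \<in> piece M h g"
  by (rule additive_subgroup.zero_closed[OF piece_subgroup])

lemma piece_add: "x \<in> piece M h g \<Longrightarrow> y \<in> piece M h g \<Longrightarrow> x \<oplus> y \<in> piece M h g"
  by (rule additive_subgroup.a_closed[OF piece_subgroup])

lemma piece_uminus: "x \<in> piece M h g \<Longrightarrow> \<ominus> x \<in> piece M h g"
  by (rule additive_subgroup_uminus[OF piece_subgroup])

lemma component_ex1:
  assumes "x \<in> carrier M"
  shows "\<exists>!f. (\<forall>i\<in>UNIV. f i \<in> piece M (fst i) (snd i)) \<and>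
      (\<forall>i. i \<notin> UNIV \<longrightarrow> f i = \<zero>\<^bsub>M\<^esub>) \<and>
      finite {i. f i \<noteq> \<zero>\<^bsub>M\<^esub>} \<and> x = finsum M f {i. f i \<noteq> \<zero>\<^bsub>M\<^esub>}"
  using graded_group_graded assms
  unfolding graded_by_pieces_def internal_direct_sum_def case_prod_beta by blast

lemma
  assumes x: "x \<in> carrier M"
  shows component_piece: "component M (h, g) x \<in> piece M h g"
    and component_finite: "finite {i. component M i x \<noteq> \<zero>}"
    and component_sum: "(\<Oplus>i\<in>{i. component M i x \<noteq> \<zero>}. component M i x) = x"
proof -
  from component_ex1[OF x] obtain f where
    f: "(\<forall>i\<in>UNIV. f i \<in> piece M (fst i) (snd i)) \<and>
      (\<forall>i. i \<notin> UNIV \<longrightarrow> f i = \<zero>\<^bsub>M\<^esub>) \<and>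
      finite {i. f i \<noteq> \<zero>\<^bsub>M\<^esub>} \<and> x = finsum M f {i. f i \<noteq> \<zero>\<^bsub>M\<^esub>}" by blast
  have *: "component M i x = f i" for i
    using fun_cong[OF the1_equality[of _ f, OF component_ex1[OF x] f], of i]
    by (simp only: component_def)
  show "component M (h, g) x \<in> piece M h g"
    "finite {i. component M i x \<noteq> \<zero>}"
    "(\<Oplus>i\<in>{i. component M i x \<noteq> \<zero>}. component M i x) = x"
    unfolding * using f by (metis UNIV_I fst_conv snd_conv, blast, simp)
qed

lemma component_closed: "x \<in> carrier M \<Longrightarrow> component M i x \<in> carrier M"
  using component_piece piece_carrier by (metis prod.collapse)

lemma component_unique:
  assumes "\<And>h g. y (h, g) \<in> piece M h g" "finite S" "\<And>i. i \<notin> S \<Longrightarrow> y i = \<zero>"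
    and "x = finsum M y S"
  shows "component M i x = y i"
proof -
  have cl: "y j \<in> carrier M" for j using assms(1) piece_carrier by (metis prod.collapse)
  have sub: "{i. y i \<noteq> \<zero>} \<subseteq> S" using assms(3) by auto
  have s: "x = finsum M y {i. y i \<noteq> \<zero>}"
    unfolding assms(4)
    by (rule add.finprod_mono_neutral_cong_right) (use assms(2) sub cl in auto)
  have x: "x \<in> carrier M" unfolding s using cl by (intro finsum_closed) auto
  have "(\<forall>i\<in>UNIV. y i \<in> piece M (fst i) (snd i)) \<and> (\<forall>i. i \<notin> UNIV \<longrightarrow> y i = \<zero>\<^bsub>M\<^esub>) \<and>
      finite {i. y i \<noteq> \<zero>\<^bsub>M\<^esub>} \<and> x = finsum M y {i. y i \<noteq> \<zero>\<^bsub>M\<^esub>}"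
    using assms(1) sub assms(2) s by (auto intro: finite_subset)
  from fun_cong[OF the1_equality[of _ y, OF component_ex1[OF x] this], of i]
  show ?thesis by (simp only: component_def)
qed

lemma component_sum_superset:
  assumes "x \<in> carrier M" "finite S" "{i. component M i x \<noteq> \<zero>} \<subseteq> S"
  shows "(\<Oplus>i\<in>S. component M i x) = x"
proof -
  have "(\<Oplus>i\<in>S. component M i x) = (\<Oplus>i\<in>{i. component M i x \<noteq> \<zero>}. component M i x)"
    by (rule add.finprod_mono_neutral_cong_right) (use assms in \<open>auto intro: component_closed\<close>)
  then show ?thesis using component_sum assms(1) by simp
qed

lemma component_add:
  assumes "x \<in> carrier M" "y \<in> carrier M"
  shows "component M i (x \<oplus> y) = component M i x \<oplus> component M i y"
proof -
  let ?S = "{i. component M i x \<noteq> \<zero>} \<union> {i. component M i y \<noteq> \<zero>}"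
  have fin: "finite ?S" using assms component_finite by auto
  show ?thesis
  proof (rule component_unique[of "\<lambda>i. component M i x \<oplus> component M i y" ?S])
    show "x \<oplus> y = (\<Oplus>i\<in>?S. component M i x \<oplus> component M i y)"
      using finsum_addf[of "\<lambda>i. component M i x" ?S "\<lambda>i. component M i y"]
        component_sum_superset[OF assms(1) fin] component_sum_superset[OF assms(2) fin] assms
      by (simp add: Pi_iff component_closed)
  qed (use fin assms in \<open>auto intro!: piece_add component_piece\<close>)
qed

lemma component_same: "x \<in> piece M h g \<Longrightarrow> component M (h, g) x = x"
  and component_other: "x \<in> piece M h g \<Longrightarrow> i \<noteq> (h, g) \<Longrightarrow> component M i x = \<zero>"
proof -
  assume x: "x \<in> piece M h g"
  have *: "component M j x = (if j = (h, g) then x else \<zero>)" for j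
    by (rule component_unique[of "\<lambda>j. if j = (h, g) then x else \<zero>" "{(h, g)}"])
      (auto simp: x piece_carrier[OF x])
  show "component M (h, g) x = x" using * by simp
  show "i \<noteq> (h, g) \<Longrightarrow> component M i x = \<zero>" using * by simp
qed

lemma component_zero [simp]: "component M i \<zero> = \<zero>"
  using component_same[OF piece_zero, of "fst i" "snd i"] by (simp only: prod.collapse)

lemma component_finsum:
  assumes "f \<in> S \<rightarrow> carrier M" "finite S"
  shows "component M i (finsum M f S) = (\<Oplus>j\<in>S. component M i (f j))"
  by (rule additive_finsum[OF abelian_group_axioms, of "component M i" f S])
    (use assms in \<open>auto intro: component_add component_closed\<close>)

lemma component_uminus:
  assumes "x \<in> carrier M"
  shows "component M i (\<ominus> x) = \<ominus> component M i x"
  by (rule additive_uminus[OF abelian_group_axioms, of "component M i" x])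
    (use assms in \<open>auto intro: component_add component_closed\<close>)

text \<open>Reduces statements about additive maps to homogeneous elements, on which the axioms of dg-algebras
  and dg-modules are formulated.\<close>

lemma graded_induct [consumes 1, case_names zero add piece]:
  assumes "x \<in> carrier M" "P \<zero>"
    and "\<And>x y. \<lbrakk>x \<in> carrier M; y \<in> carrier M; P x; P y\<rbrakk> \<Longrightarrow> P (x \<oplus> y)"
    and "\<And>x h g. x \<in> piece M h g \<Longrightarrow> P x"
  shows "P x"
proof -
  have "P (finsum M (\<lambda>i. component M i x) S)" if "finite S" for S
    using that
  proof (induction S)
    case (insert i S)
    have "P (component M i x)"
      using assms(4)[OF component_piece[OF assms(1)], of "fst i" "snd i"] by simp
    with insert show ?case
      using component_closed[OF assms(1)] by (simp add: assms(3))
  qed (simp add: assms(2))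
  from this[OF component_finite[OF assms(1)]] show ?thesis
    using component_sum[OF assms(1)] by simp
qed

lemma piece_eqI:
  assumes "x \<in> carrier M" "y \<in> carrier M" "\<And>i. component M i x = component M i y"
  shows "x = y"
proof -
  have *: "(\<lambda>i. component M i x) = (\<lambda>i. component M i y)" using assms(3) by (rule ext)
  have "x = (\<Oplus>i\<in>{i. component M i x \<noteq> \<zero>}. component M i x)"
    using component_sum[OF assms(1)] by simp
  also have "\<dots> = y" unfolding * fun_cong[OF *] by (rule component_sum[OF assms(2)])
  finally show ?thesis .
qed

lemma piece_iff_component:
  "x \<in> piece M h g \<longleftrightarrow> x \<in> carrier M \<and> (\<forall>i. i \<noteq> (h, g) \<longrightarrow> component M i x = \<zero>)"
proof
  assume *: "x \<in> carrier M \<and> (\<forall>i. i \<noteq> (h, g) \<longrightarrow> component M i x = \<zero>)"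
  then have x: "x \<in> carrier M" "\<And>i. i \<noteq> (h, g) \<Longrightarrow> component M i x = \<zero>" by auto
  have "x = component M (h, g) x"
  proof (rule piece_eqI)
    fix i show "component M i x = component M i (component M (h, g) x)"
      using x component_same[OF component_piece[OF x(1), of h g]]
         component_other[OF component_piece[OF x(1), of h g], of i] by metis
  qed (auto simp: x(1) component_closed)
  then show "x \<in> piece M h g" using component_piece[OF x(1)] by metis
qed (blast intro: component_other piece_carrier)

lemma zpart_iff:
  "x \<in> zpart M g \<longleftrightarrow> x \<in> carrier M \<and> (\<forall>h g'. g' \<noteq> g \<longrightarrow> component M (h, g') x = \<zero>)"
proof
  assume "x \<in> zpart M g"
  then obtain y H where y: "finite H" "\<forall>h\<in>H. y h \<in> piece M h g" "x = finsum M y H"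
    unfolding zpart_def by auto
  have yc: "y \<in> H \<rightarrow> carrier M" using y(2) by (blast intro: piece_carrier)
  have "component M (h, g') x = \<zero>" if "g' \<noteq> g" for h g'
    unfolding y(3) component_finsum[OF yc y(1)]
  proof (rule add.finprod_one_eqI)
    fix k assume "k \<in> H"
    with y(2) have "y k \<in> piece M k g" by blast
    then show "component M (h, g') (y k) = \<zero>" by (rule component_other) (use that in simp)
  qed
  then show "x \<in> carrier M \<and> (\<forall>h g'. g' \<noteq> g \<longrightarrow> component M (h, g') x = \<zero>)"
    using y(1,3) yc by simp
next
  assume "x \<in> carrier M \<and> (\<forall>h g'. g' \<noteq> g \<longrightarrow> component M (h, g') x = \<zero>)"
  then have x: "x \<in> carrier M" and x0: "\<And>h g'. component M (h, g') x \<noteq> \<zero> \<Longrightarrow> g' = g" by auto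
  let ?H = "fst ` {i. component M i x \<noteq> \<zero>}"
  have fin: "finite ?H" using component_finite[OF x] by simp
  have "i \<in> (\<lambda>h. (h, g)) ` ?H" if "component M i x \<noteq> \<zero>" for i
  proof (rule image_eqI[of _ _ "fst i"])
    show "i = (fst i, g)" using x0[of "fst i" "snd i"] that by (cases i) simp
    show "fst i \<in> ?H" using that by blast
  qed
  then have "{i. component M i x \<noteq> \<zero>} \<subseteq> (\<lambda>h. (h, g)) ` ?H" by blast
  from component_sum_superset[OF x _ this]
  have "x = (\<Oplus>i\<in>(\<lambda>h. (h, g)) ` ?H. component M i x)"
    using fin by simp
  also have "\<dots> = (\<Oplus>h\<in>?H. component M (h, g) x)"
    by (rule add.finprod_reindex) (simp_all add: x component_closed inj_on_def)
  finally have "x = (\<Oplus>h\<in>?H. component M (h, g) x)" .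
  with fin component_piece[OF x, of _ g] show "x \<in> zpart M g"
    unfolding zpart_def by blast
qed

lemma zpart_subgroup: "additive_subgroup (zpart M g) M"
  by (rule additive_subgroupI') (auto simp: zpart_iff component_add component_uminus)

lemma piece_zpart: "x \<in> piece M h g \<Longrightarrow> x \<in> zpart M g"
  by (auto simp: zpart_iff component_other piece_carrier)

lemma zero_zpart [simp]: "\<zero> \<in> zpart M g"
  using zpart_subgroup additive_subgroup.zero_closed by blast

lemma zpart_carrier: "x \<in> zpart M g \<Longrightarrow> x \<in> carrier M"
  by (simp add: zpart_iff)

lemma zpart_eq_zero_iff: "zpart M g = {\<zero>} \<longleftrightarrow> (\<forall>h. piece M h g = {\<zero>})"
proof
  assume *: "zpart M g = {\<zero>}"
  show "\<forall>h. piece M h g = {\<zero>}"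
  proof (intro allI equalityI subsetI)
    fix h x assume "x \<in> piece M h g"
    then show "x \<in> {\<zero>}" using piece_zpart * by blast
  qed simp
next
  assume *: "\<forall>h. piece M h g = {\<zero>}"
  have "x = \<zero>" if x: "x \<in> zpart M g" for x
  proof (rule piece_eqI)
    fix i :: "int \<times> (int ^ 'n)"
    obtain h g' where i: "i = (h, g')" by (cases i)
    have "component M (h, g') x = \<zero>"
      using x component_piece[OF zpart_carrier[OF x], of h g] *
      by (cases "g' = g") (auto simp: zpart_iff)
    then show "component M i x = component M i \<zero>" by (simp add: i)
  qed (use zpart_carrier[OF x] in simp_all)
  then show "zpart M g = {\<zero>}" by auto
qed

end

text \<open>Additive projections \<open>c i\<close> onto the pieces determine the grading: applied to any
  decomposition of \<open>x\<close> into homogeneous terms, \<open>c i\<close> returns its term of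
  degree \<open>i\<close>, so the decomposition is unique.\<close>

lemma graded_by_piecesI:
  fixes M :: "('r, 'm, 'n::finite) dg_struct" (structure)
  assumes "abelian_group M"
    and sub: "\<And>h g. additive_subgroup (piece M h g) M"
    and c_in: "\<And>h g x. x \<in> carrier M \<Longrightarrow> c (h, g) x \<in> piece M h g"
    and c_add: "\<And>i x y. \<lbrakk>x \<in> carrier M; y \<in> carrier M\<rbrakk> \<Longrightarrow> c i (x \<oplus> y) = c i x \<oplus> c i y"
    and c_same: "\<And>h g x. x \<in> piece M h g \<Longrightarrow> c (h, g) x = x"
    and c_other: "\<And>h g i x. x \<in> piece M h g \<Longrightarrow> i \<noteq> (h, g) \<Longrightarrow> c i x = \<zero>"
    and c_fin: "\<And>x. x \<in> carrier M \<Longrightarrow> finite {i. c i x \<noteq> \<zero>}"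
    and c_sum: "\<And>x. x \<in> carrier M \<Longrightarrow> (\<Oplus>i\<in>{i. c i x \<noteq> \<zero>}. c i x) = x"
  shows "graded_by_pieces M"
proof -
  interpret abelian_group M by fact
  have pcar: "x \<in> piece M h g \<Longrightarrow> x \<in> carrier M" for x h g
    using sub additive_subgroup.a_subset by blast
  have ccar: "x \<in> carrier M \<Longrightarrow> c i x \<in> carrier M" for x i
    using c_in pcar by (metis prod.collapse)
  have uniq: "f = (\<lambda>i. c i x)"
    if x: "x \<in> carrier M" and f: "\<And>i. f i \<in> piece M (fst i) (snd i)" "finite {i. f i \<noteq> \<zero>}"
      "x = finsum M f {i. f i \<noteq> \<zero>}" for x f
  proof
    fix i
    have fcar: "f i \<in> carrier M" for i using f(1) pcar by blast
    \<comment> \<open>\<open>c i\<close> picks the term of index \<open>i\<close> out of any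
                    decomposition\<close>
    have cf: "c i (f j) = (if i = j then f i else \<zero>)" for j
    proof (cases "i = j")
      case True
      then show ?thesis using c_same[OF f(1), of j] by simp
    next
      case False
      then show ?thesis using c_other[OF f(1), of i j] by simp
    qed
    have "c i x = (\<Oplus>j\<in>{i. f i \<noteq> \<zero>}. c i (f j))"
      unfolding f(3) by (rule additive_finsum[OF abelian_group_axioms])
        (use f(2) in \<open>auto intro: ccar c_add fcar\<close>)
    also have "\<dots> = (\<Oplus>j\<in>{i. f i \<noteq> \<zero>}. if i = j then f i else \<zero>)"
      by (simp only: cf)
    also have "\<dots> = f i"
    proof (cases "f i = \<zero>")
      case True
      have "(\<Oplus>j\<in>{i. f i \<noteq> \<zero>}. if i = j then f i else \<zero>) = \<zero>"
        by (rule add.finprod_one_eqI) (use True in auto)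
      then show ?thesis using True by simp
    next
      case False
      then show ?thesis using add.finprod_singleton[of i _ "\<lambda>_. f i"] f(2) fcar by simp
    qed
    finally show "f i = c i x" by simp
  qed
  show ?thesis
    unfolding graded_by_pieces_def internal_direct_sum_def case_prod_beta
  proof (intro conjI ballI)
    fix i show "additive_subgroup (piece M (fst i) (snd i)) M" by (rule sub)
  next
    fix x assume x: "x \<in> carrier M"
    show "\<exists>!f. (\<forall>i\<in>UNIV. f i \<in> piece M (fst i) (snd i)) \<and> (\<forall>i. i \<notin> UNIV \<longrightarrow> f i = \<zero>) \<and>
      finite {i. f i \<noteq> \<zero>} \<and> x = finsum M f {i. f i \<noteq> \<zero>}"
    proof (rule ex1I[of _ "\<lambda>i. c i x"])
      have "c i x \<in> piece M (fst i) (snd i)" for i using c_in[OF x, of "fst i" "snd i"] by simp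
      then show "(\<forall>i\<in>UNIV. c i x \<in> piece M (fst i) (snd i)) \<and> (\<forall>i. i \<notin> UNIV \<longrightarrow> c i x = \<zero>) \<and>
        finite {i. c i x \<noteq> \<zero>} \<and> x = finsum M (\<lambda>i. c i x) {i. c i x \<noteq> \<zero>}"
        using c_fin[OF x] c_sum[OF x] by simp
    qed (use uniq[OF x] in blast)
  qed
qed

section \<open>The sign involution and the Leibniz rule\<close>

text \<open>What a dg-algebra is without its field of scalars. The field enters the construction only through
  finite-dimensionality, so it is kept out of the algebraic part.\<close>

locale dg_ring = ring A + graded_group A for A :: "('k, 'a, 'n::finite) dg_struct" (structure) +
  assumes A_one_piece: "\<one> \<in> piece A 0 0"
    and A_mult_piece:
      "\<lbrakk>a \<in> piece A h g; b \<in> piece A h' g'\<rbrakk> \<Longrightarrow> a \<otimes> b \<in> piece A (h + h') (g + g')"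
    and A_diff_add:
      "\<lbrakk>a \<in> carrier A; b \<in> carrier A\<rbrakk> \<Longrightarrow> diff A (a \<oplus> b) = diff A a \<oplus> diff A b"
    and A_diff_piece: "a \<in> piece A h g \<Longrightarrow> diff A a \<in> piece A (h - 1) g"
    and A_diff_diff: "a \<in> carrier A \<Longrightarrow> diff A (diff A a) = \<zero>"
    and A_leibniz:
      "\<lbrakk>a \<in> piece A h g; b \<in> carrier A\<rbrakk>
        \<Longrightarrow> diff A (a \<otimes> b) = (diff A a \<otimes> b) \<oplus> koszul_sign A h (a \<otimes> diff A b)"

lemma (in dg_algebra) dg_ring: "dg_ring A"
  by (intro dg_ring.intro dg_ring_axioms.intro graded_group.intro graded_group_axioms.intro)
    (auto intro: A.ring_axioms A.is_abelian_group graded one_piece mult_piece diff_add diff_piece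
        diff_diff leibniz)

text \<open>Differentials are only required to send pieces to pieces; additivity extends this to the whole
  carrier.\<close>

lemma (in graded_group) map_of_pieces_closed:
  assumes "abelian_group H"
    and add: "\<And>x y. \<lbrakk>x \<in> carrier M; y \<in> carrier M\<rbrakk> \<Longrightarrow> F (x \<oplus> y) = F x \<oplus>\<^bsub>H\<^esub> F y"
    and piece: "\<And>x h g. x \<in> piece M h g \<Longrightarrow> F x \<in> carrier H"
    and x: "x \<in> carrier M"
  shows "F x \<in> carrier H"
  using x
proof (induction x rule: graded_induct)
  case zero
  show ?case by (rule piece[OF piece_zero])
next
  case (add x y)
  interpret H: abelian_group H by fact
  from add show ?case by (simp add: assms(2))
next
  case (piece x h g)
  then show ?case by (rule assms(3))
qed

context abelian_group
begin

lemma koszul_sign_closed [simp]: "x \<in> carrier G \<Longrightarrow> koszul_sign G h x \<in> carrier G"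
  by (simp add: koszul_sign_def)

lemma koszul_sign_zero [simp]: "koszul_sign G h \<zero> = \<zero>"
  by (simp add: koszul_sign_def)

lemma koszul_sign_add:
  "x \<in> carrier G \<Longrightarrow> y \<in> carrier G \<Longrightarrow>
    koszul_sign G h (x \<oplus> y) = koszul_sign G h x \<oplus> koszul_sign G h y"
  by (simp add: koszul_sign_def minus_add)

end

context dg_ring
begin

text \<open>The additive extension of \<open>a \<mapsto> (-1)\<^sup>h a\<close>, \<open>a\<close> of degree
  \<open>h\<close>. With it the Leibniz rule reads \<open>d(a b) = (d a) b + sg(a) (d b)\<close> for
  all \<open>a\<close>, homogeneous or not, which avoids decomposing the coefficients of module
  elements.\<close>

definition sg :: "'a \<Rightarrow> 'a" where
  "sg a = (\<Oplus>i\<in>{i. component A i a \<noteq> \<zero>}. koszul_sign A (fst i) (component A i a))"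

lemma A_diff_closed [simp]: "a \<in> carrier A \<Longrightarrow> diff A a \<in> carrier A"
  by (rule map_of_pieces_closed[OF abelian_group_axioms])
    (auto intro: A_diff_add piece_carrier A_diff_piece)

lemma A_diff_zero [simp]: "diff A \<zero> = \<zero>"
  by (rule additive_zero[OF abelian_group_axioms]) (auto intro: A_diff_add)

lemma A_diff_uminus: "a \<in> carrier A \<Longrightarrow> diff A (\<ominus> a) = \<ominus> diff A a"
  by (rule additive_uminus[OF abelian_group_axioms]) (auto intro: A_diff_add)

lemma sg_superset:
  assumes "a \<in> carrier A" "finite S" "{i. component A i a \<noteq> \<zero>} \<subseteq> S"
  shows "sg a = (\<Oplus>i\<in>S. koszul_sign A (fst i) (component A i a))"
  unfolding sg_def
  by (rule add.finprod_mono_neutral_cong_left) (use assms component_closed[OF assms(1)] in auto)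

lemma sg_closed [simp]: "a \<in> carrier A \<Longrightarrow> sg a \<in> carrier A"
  unfolding sg_def by (intro finsum_closed) (auto simp: component_closed)

lemma sg_add:
  assumes "a \<in> carrier A" "b \<in> carrier A"
  shows "sg (a \<oplus> b) = sg a \<oplus> sg b"
proof -
  let ?S = "{i. component A i a \<noteq> \<zero>} \<union> {i. component A i b \<noteq> \<zero>}"
  have fin: "finite ?S" using component_finite assms by blast
  have sub: "{i. component A i (a \<oplus> b) \<noteq> \<zero>} \<subseteq> ?S"
    using assms by (auto simp: component_add)
  have cl: "component A i a \<in> carrier A" "component A i b \<in> carrier A" for i
    using assms by (auto simp: component_closed)
  have "sg (a \<oplus> b) = (\<Oplus>i\<in>?S. koszul_sign A (fst i) (component A i a) \<oplus>
      koszul_sign A (fst i) (component A i b))"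
    using assms cl by (subst sg_superset[OF _ fin sub]) (simp_all add: component_add koszul_sign_add)
  also have "\<dots> = sg a \<oplus> sg b"
    using cl fin assms
    by (subst finsum_addf) (simp_all add: sg_superset[of a ?S] sg_superset[of b ?S] Pi_iff)
  finally show ?thesis .
qed

lemma sg_of_piece:
  assumes "a \<in> piece A h g"
  shows "sg a = koszul_sign A h a"
proof -
  have a: "a \<in> carrier A" using assms piece_carrier by blast
  have "{i. component A i a \<noteq> \<zero>} \<subseteq> {(h, g)}" using component_other[OF assms] by blast
  from sg_superset[OF a _ this] show ?thesis
    using a by (simp add: component_same[OF assms])
qed

lemma sg_piece: "a \<in> piece A h g \<Longrightarrow> sg a \<in> piece A h g"
  by (simp add: sg_of_piece koszul_sign_def piece_uminus)

lemma sg_zero [simp]: "sg \<zero> = \<zero>"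
  using sg_of_piece[OF piece_zero] by simp

lemma sg_even: "a \<in> piece A 0 g \<Longrightarrow> sg a = a"
  by (simp add: sg_of_piece koszul_sign_def)

lemma additive_eqI:
  assumes "abelian_group H"
    and "\<And>x y. \<lbrakk>x \<in> carrier A; y \<in> carrier A\<rbrakk> \<Longrightarrow> F (x \<oplus> y) = F x \<oplus>\<^bsub>H\<^esub> F y"
    and "\<And>x y. \<lbrakk>x \<in> carrier A; y \<in> carrier A\<rbrakk> \<Longrightarrow> F' (x \<oplus> y) = F' x \<oplus>\<^bsub>H\<^esub> F' y"
    and "\<And>x h g. x \<in> piece A h g \<Longrightarrow> F x = F' x"
    and "x \<in> carrier A"
  shows "F x = F' x"
  using assms(5)
proof (induction x rule: graded_induct)
  case zero
  show ?case by (rule assms(4)[OF piece_zero])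
next
  case (add x y)
  then show ?case by (simp add: assms(2,3))
next
  case (piece x h g)
  then show ?case by (rule assms(4))
qed

lemma sg_mult:
  assumes "a \<in> carrier A" "b \<in> carrier A"
  shows "sg (a \<otimes> b) = sg a \<otimes> sg b"
proof (rule additive_eqI[OF abelian_group_axioms, of "\<lambda>a. sg (a \<otimes> b)" "\<lambda>a. sg a \<otimes> sg b"])
  fix a h g assume a: "a \<in> piece A h g"
  then have ac: "a \<in> carrier A" by (rule piece_carrier)
  show "sg (a \<otimes> b) = sg a \<otimes> sg b"
  proof (rule additive_eqI[OF abelian_group_axioms, of "\<lambda>b. sg (a \<otimes> b)" "\<lambda>b. sg a \<otimes> sg b"])
    fix b h' g' assume b: "b \<in> piece A h' g'"
    then have bc: "b \<in> carrier A" by (rule piece_carrier)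
    show "sg (a \<otimes> b) = sg a \<otimes> sg b"
      using sg_of_piece[OF a] sg_of_piece[OF b] sg_of_piece[OF A_mult_piece[OF a b]] ac bc
      by (auto simp: koszul_sign_def l_minus r_minus minus_minus)
  qed (use assms ac in \<open>simp_all add: r_distr sg_add\<close>)
qed (use assms in \<open>simp_all add: l_distr sg_add\<close>)

text \<open>The differential changes the parity of the degree. This sign makes the mixed terms of \<open>d (d
  (a x))\<close> cancel.\<close>

lemma sg_diff: "a \<in> carrier A \<Longrightarrow> sg (diff A a) = \<ominus> diff A (sg a)"
proof (rule additive_eqI[OF abelian_group_axioms, of "\<lambda>a. sg (diff A a)" "\<lambda>a. \<ominus> diff A (sg a)"])
  fix a h g assume a: "a \<in> piece A h g"
  show "sg (diff A a) = \<ominus> diff A (sg a)"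
    using sg_of_piece[OF a] sg_of_piece[OF A_diff_piece[OF a]] piece_carrier[OF a]
    by (simp add: koszul_sign_def minus_minus A_diff_uminus)
qed (simp_all add: sg_add A_diff_add minus_add)

lemma A_leibniz_sg:
  assumes "a \<in> carrier A" "b \<in> carrier A"
  shows "diff A (a \<otimes> b) = (diff A a \<otimes> b) \<oplus> (sg a \<otimes> diff A b)"
proof (rule additive_eqI[OF abelian_group_axioms, of "\<lambda>a. diff A (a \<otimes> b)"
      "\<lambda>a. (diff A a \<otimes> b) \<oplus> (sg a \<otimes> diff A b)"])
  fix a h g assume a: "a \<in> piece A h g"
  show "diff A (a \<otimes> b) = (diff A a \<otimes> b) \<oplus> (sg a \<otimes> diff A b)"
    using A_leibniz[OF a assms(2)] sg_of_piece[OF a] piece_carrier[OF a] assms(2)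
    by (simp add: koszul_sign_def l_minus)
next
  fix x y assume "x \<in> carrier A" "y \<in> carrier A"
  then show "(diff A (x \<oplus> y) \<otimes> b) \<oplus> (sg (x \<oplus> y) \<otimes> diff A b) =
     (diff A x \<otimes> b) \<oplus> (sg x \<otimes> diff A b) \<oplus> ((diff A y \<otimes> b) \<oplus> (sg y \<otimes> diff A b))"
    using assms by (simp add: A_diff_add sg_add l_distr a_ac)
qed (use assms in \<open>simp_all add: l_distr A_diff_add\<close>)

text \<open>For an idempotent \<open>e\<close> of degree zero this is what makes the left ideal \<open>A
  e\<close> a graded submodule.\<close>

lemma component_mult_degree_zero:
  assumes "e \<in> piece A 0 0" "a \<in> carrier A"
  shows "component A i (a \<otimes> e) = component A i a \<otimes> e"
proof (rule additive_eqI[OF abelian_group_axioms, of "\<lambda>a. component A i (a \<otimes> e)"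
      "\<lambda>a. component A i a \<otimes> e"])
  have e: "e \<in> carrier A" using assms(1) piece_carrier by blast
  fix a h g assume a: "a \<in> piece A h g"
  have ae: "a \<otimes> e \<in> piece A h g" using A_mult_piece[OF a assms(1)] by simp
  show "component A i (a \<otimes> e) = component A i a \<otimes> e"
    using component_same[OF a] component_other[OF a, of i] component_same[OF ae]
      component_other[OF ae, of i] e by (cases "i = (h, g)") simp_all
qed (use assms piece_carrier[OF assms(1)] in \<open>simp_all add: l_distr component_add component_closed\<close>)

end

context left_module
begin

lemma act_l_zero [simp]:
  assumes x: "x \<in> carrier M"
  shows "\<zero> \<odot>\<^bsub>M\<^esub> x = \<zero>\<^bsub>M\<^esub>"
proof (rule R.additive_zero[OF M.abelian_group_axioms, of "\<lambda>a. a \<odot>\<^bsub>M\<^esub> x"])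
qed (use x in \<open>auto simp: act_closed act_l_distr\<close>)

lemma act_r_zero [simp]:
  assumes a: "a \<in> carrier R"
  shows "a \<odot>\<^bsub>M\<^esub> \<zero>\<^bsub>M\<^esub> = \<zero>\<^bsub>M\<^esub>"
  by (rule M.additive_zero[OF M.abelian_group_axioms, of "\<lambda>x. a \<odot>\<^bsub>M\<^esub> x"])
    (use a in \<open>auto simp: act_closed act_r_distr\<close>)

lemma act_l_uminus:
  assumes "a \<in> carrier R" "x \<in> carrier M"
  shows "(\<ominus> a) \<odot>\<^bsub>M\<^esub> x = \<ominus>\<^bsub>M\<^esub> (a \<odot>\<^bsub>M\<^esub> x)"
  by (rule R.additive_uminus[OF M.abelian_group_axioms, of "\<lambda>a. a \<odot>\<^bsub>M\<^esub> x"])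
    (use assms in \<open>auto simp: act_closed act_l_distr\<close>)

lemma act_finsum:
  assumes "a \<in> carrier R" "f \<in> S \<rightarrow> carrier M" "finite S"
  shows "a \<odot>\<^bsub>M\<^esub> finsum M f S = (\<Oplus>\<^bsub>M\<^esub>i\<in>S. a \<odot>\<^bsub>M\<^esub> f i)"
  by (rule M.additive_finsum[OF M.abelian_group_axioms, of "\<lambda>x. a \<odot>\<^bsub>M\<^esub> x"])
    (use assms in \<open>auto simp: act_closed act_r_distr\<close>)

end

lemma (in dg_module) graded_group: "graded_group M"
  by (intro graded_group.intro graded_group_axioms.intro M.abelian_group_axioms graded)

sublocale dg_module < MG: graded_group M
  by (rule graded_group)

locale dg_ring_module = dg_ring A + M?: dg_module A M
  for A :: "('k, 'a, 'n::finite) dg_struct" (structure)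
    and M :: "('a, 'm, 'n) dg_struct" (structure)
begin

lemma diff_closed [simp]: "x \<in> carrier M \<Longrightarrow> diff M x \<in> carrier M"
  by (rule MG.map_of_pieces_closed[OF M.abelian_group_axioms])
    (auto intro: diff_add MG.piece_carrier diff_piece)

lemma diff_zero [simp]: "diff M \<zero>\<^bsub>M\<^esub> = \<zero>\<^bsub>M\<^esub>"
  by (rule M.additive_zero[OF M.abelian_group_axioms]) (auto intro: diff_add)

lemma diff_uminus: "x \<in> carrier M \<Longrightarrow> diff M (\<ominus>\<^bsub>M\<^esub> x) = \<ominus>\<^bsub>M\<^esub> diff M x"
  by (rule M.additive_uminus[OF M.abelian_group_axioms]) (auto intro: diff_add)

lemma leibniz_sg:
  assumes "a \<in> carrier A" "x \<in> carrier M"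
  shows "diff M (a \<odot>\<^bsub>M\<^esub> x) = (diff A a \<odot>\<^bsub>M\<^esub> x) \<oplus>\<^bsub>M\<^esub> (sg a \<odot>\<^bsub>M\<^esub> diff M x)"
proof (rule additive_eqI[OF M.abelian_group_axioms, of "\<lambda>a. diff M (a \<odot>\<^bsub>M\<^esub> x)"
      "\<lambda>a. (diff A a \<odot>\<^bsub>M\<^esub> x) \<oplus>\<^bsub>M\<^esub> (sg a \<odot>\<^bsub>M\<^esub> diff M x)"])
  fix a h g assume a: "a \<in> piece A h g"
  show "diff M (a \<odot>\<^bsub>M\<^esub> x) = (diff A a \<odot>\<^bsub>M\<^esub> x) \<oplus>\<^bsub>M\<^esub> (sg a \<odot>\<^bsub>M\<^esub> diff M x)"
    using leibniz[OF a assms(2)] sg_of_piece[OF a] piece_carrier[OF a] assms(2)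
    by (simp add: koszul_sign_def act_l_uminus)
next
  fix a b assume "a \<in> carrier A" "b \<in> carrier A"
  then show "(diff A (a \<oplus> b) \<odot>\<^bsub>M\<^esub> x) \<oplus>\<^bsub>M\<^esub> (sg (a \<oplus> b) \<odot>\<^bsub>M\<^esub> diff M x) =
    ((diff A a \<odot>\<^bsub>M\<^esub> x) \<oplus>\<^bsub>M\<^esub> (sg a \<odot>\<^bsub>M\<^esub> diff M x)) \<oplus>\<^bsub>M\<^esub>
    ((diff A b \<odot>\<^bsub>M\<^esub> x) \<oplus>\<^bsub>M\<^esub> (sg b \<odot>\<^bsub>M\<^esub> diff M x))"
    using assms by (simp add: A_diff_add sg_add act_l_distr act_closed M.a_ac)
qed (use assms in \<open>simp_all add: act_l_distr diff_add act_closed\<close>)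

end

section \<open>Twisted modules\<close>

context dg_ring
begin

text \<open>The dg-module on generators \<open>x\<^sub>i = e\<^sub>i x\<^sub>i\<close> of bidegree \<open>(p
  i, q i)\<close> with \<open>d x\<^sub>i = \<Sum>\<^sub>j z i j x\<^sub>j\<close>; the function
  \<open>f\<close> stands for \<open>\<Sum>\<^sub>i f(i) x\<^sub>i\<close>. The condition \<open>f i
  \<otimes> e i = f i\<close> makes the \<open>i\<close>-th summand a copy of \<open>A
  e\<^sub>i\<close>, and \<open>diff\<close> is what the Leibniz rule dictates.\<close>

definition twisted_module ::
  "('i \<Rightarrow> int) \<Rightarrow> ('i \<Rightarrow> int ^ 'n) \<Rightarrow> ('i \<Rightarrow> 'a) \<Rightarrow> ('i \<Rightarrow> 'i \<Rightarrow> 'a) \<Rightarrow> ('a, 'i \<Rightarrow> 'a, 'n) dg_struct" where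
  "twisted_module p q e z =
    (let F = {f. (\<forall>i. f i \<in> carrier A \<and> f i \<otimes> e i = f i) \<and> finite {i. f i \<noteq> \<zero>}}
     in \<lparr>carrier = F, mult = undefined, one = undefined,
         zero = (\<lambda>i. \<zero>), add = (\<lambda>f f' i. f i \<oplus> f' i), smult = (\<lambda>a f i. a \<otimes> f i),
         piece = (\<lambda>h g. {f \<in> F. \<forall>i. f i \<in> piece A (h - p i) (g - q i)}),
         diff = (\<lambda>f k. diff A (f k) \<oplus> (\<Oplus>i\<in>{i. f i \<noteq> \<zero>}. sg (f i) \<otimes> z i k))\<rparr>)"

definition single :: "'i \<Rightarrow> 'a \<Rightarrow> 'i \<Rightarrow> 'a" where
  "single i a = (\<lambda>j. if j = i then a else \<zero>)"

end

text \<open>The last assumption is \<open>d (d x\<^sub>i) = 0\<close> in coordinates.\<close>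

locale twisted = dg_ring A
  for A :: "('k, 'a, 'n::finite) dg_struct" (structure) +
  fixes p :: "'i \<Rightarrow> int" and q :: "'i \<Rightarrow> int ^ 'n" and e :: "'i \<Rightarrow> 'a" and z :: "'i \<Rightarrow> 'i \<Rightarrow> 'a"
  assumes e_piece: "e i \<in> piece A 0 0"
    and e_idem: "e i \<otimes> e i = e i"
    and e_diff: "diff A (e i) = \<zero>"
    and z_fin: "finite {j. z i j \<noteq> \<zero>}"
    and z_e: "z i j \<otimes> e j = z i j"
    and z_piece: "z i j \<in> piece A (p i - 1 - p j) (q i - q j)"
    and z_diff: "diff A (z i k) \<oplus> (\<Oplus>j\<in>{j. z i j \<noteq> \<zero>}. sg (z i j) \<otimes> z j k) = \<zero>"
begin

abbreviation T where "T \<equiv> twisted_module p q e z"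

lemma e_closed [simp]: "e i \<in> carrier A" using e_piece piece_carrier by blast

lemma z_closed [simp]: "z i j \<in> carrier A" using z_piece piece_carrier by blast

lemma T_carrier:
  "f \<in> carrier T \<longleftrightarrow> (\<forall>i. f i \<in> carrier A \<and> f i \<otimes> e i = f i) \<and> finite {i. f i \<noteq> \<zero>}"
  by (simp add: twisted_module_def)

lemma T_zero [simp]: "\<zero>\<^bsub>T\<^esub> = (\<lambda>i. \<zero>)" by (simp add: twisted_module_def)
lemma T_add [simp]: "f \<oplus>\<^bsub>T\<^esub> f' = (\<lambda>i. f i \<oplus> f' i)" by (simp add: twisted_module_def)
lemma T_smult [simp]: "a \<odot>\<^bsub>T\<^esub> f = (\<lambda>i. a \<otimes> f i)" by (simp add: twisted_module_def)
lemma T_piece: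
  "f \<in> piece T h g \<longleftrightarrow> f \<in> carrier T \<and> (\<forall>i. f i \<in> piece A (h - p i) (g - q i))"
  by (simp add: twisted_module_def)
lemma T_diff: "diff T f k = diff A (f k) \<oplus> (\<Oplus>i\<in>{i. f i \<noteq> \<zero>}. sg (f i) \<otimes> z i k)"
  by (simp add: twisted_module_def)

lemma T_closed: "f \<in> carrier T \<Longrightarrow> f i \<in> carrier A" by (simp add: T_carrier)
lemma T_fin: "f \<in> carrier T \<Longrightarrow> finite {i. f i \<noteq> \<zero>}" by (simp add: T_carrier)
lemma T_e: "f \<in> carrier T \<Longrightarrow> f i \<otimes> e i = f i" by (simp add: T_carrier)

lemma T_add_closed:
  assumes "f \<in> carrier T" "f' \<in> carrier T"
  shows "(\<lambda>i. f i \<oplus> f' i) \<in> carrier T"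
proof -
  have "finite ({i. f i \<noteq> \<zero>} \<union> {i. f' i \<noteq> \<zero>})" using assms T_fin by blast
  moreover have "{i. f i \<oplus> f' i \<noteq> \<zero>} \<subseteq> {i. f i \<noteq> \<zero>} \<union> {i. f' i \<noteq> \<zero>}" by auto
  ultimately have "finite {i. f i \<oplus> f' i \<noteq> \<zero>}" by (rule rev_finite_subset)
  then show ?thesis using assms by (simp add: T_carrier l_distr)
qed

lemma T_abelian_group: "abelian_group T"
proof (rule abelian_groupI)
  fix f assume f: "f \<in> carrier T"
  have "{i. \<ominus> f i \<noteq> \<zero>} \<subseteq> {i. f i \<noteq> \<zero>}" by auto
  then have "(\<lambda>i. \<ominus> f i) \<in> carrier T"
    using f T_fin[OF f] by (auto simp: T_carrier l_minus intro: finite_subset)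
  then show "\<exists>y\<in>carrier T. y \<oplus>\<^bsub>T\<^esub> f = \<zero>\<^bsub>T\<^esub>"
    by (rule rev_bexI) (use f in \<open>simp add: T_carrier l_neg\<close>)
qed (auto simp: T_add_closed, simp_all add: T_carrier a_ac)

lemma T_smult_closed:
  assumes "a \<in> carrier A" "f \<in> carrier T"
  shows "(\<lambda>i. a \<otimes> f i) \<in> carrier T"
proof -
  have "{i. a \<otimes> f i \<noteq> \<zero>} \<subseteq> {i. f i \<noteq> \<zero>}" using assms(1) by auto
  from finite_subset[OF this T_fin[OF assms(2)]] show ?thesis
    using assms by (simp add: T_carrier m_assoc)
qed

lemma T_left_module: "left_module A T"
proof (intro left_module.intro left_module_axioms.intro T_abelian_group ring_axioms)
qed (auto simp: T_smult_closed T_closed l_distr r_distr m_assoc)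

interpretation TL: left_module A T by (rule T_left_module)

lemma T_uminus: "f \<in> carrier T \<Longrightarrow> (\<ominus>\<^bsub>T\<^esub> f) = (\<lambda>i. \<ominus> f i)"
  using TL.act_l_uminus[of \<one> f] TL.act_one[of f]
  by (simp add: T_closed l_minus)

lemma T_eval_finsum:
  assumes "F \<in> S \<rightarrow> carrier T" "finite S"
  shows "(finsum T F S) i = (\<Oplus>s\<in>S. F s i)"
  by (rule TL.M.additive_finsum[OF abelian_group_axioms, of "\<lambda>f. f i"])
    (use assms in \<open>auto simp: T_closed\<close>)

lemma single_closed: "a \<in> carrier A \<Longrightarrow> a \<otimes> e i = a \<Longrightarrow> single i a \<in> carrier T"
  by (auto simp: T_carrier single_def)

text \<open>The elements \<open>a x\<^sub>i\<close> with \<open>a \<in> A e\<^sub>i\<close> span additively,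
  so identities between additive maps need only be checked on them.\<close>

lemma T_induct [consumes 1, case_names zero add single]:
  assumes "f \<in> carrier T" "P (\<lambda>i. \<zero>)"
    and add: "\<And>f f'. \<lbrakk>f \<in> carrier T; f' \<in> carrier T; P f; P f'\<rbrakk> \<Longrightarrow> P (\<lambda>i. f i \<oplus> f' i)"
    and single: "\<And>i a. \<lbrakk>a \<in> carrier A; a \<otimes> e i = a\<rbrakk> \<Longrightarrow> P (single i a)"
  shows "P f"
proof -
  have "\<forall>f. f \<in> carrier T \<and> {i. f i \<noteq> \<zero>} \<subseteq> S \<longrightarrow> P f" if "finite S" for S
    using that
  proof (induction S)
    case empty
    have "f = (\<lambda>i. \<zero>)" if "{i. f i \<noteq> \<zero>} \<subseteq> {}" for f :: "'i \<Rightarrow> 'a"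
      using that by auto
    then show ?case using assms(2) by auto
  next
    case (insert j S)
    show ?case
    proof (intro allI impI)
      fix f assume f: "f \<in> carrier T \<and> {i. f i \<noteq> \<zero>} \<subseteq> insert j S"
      let ?g = "f(j := \<zero>)"
      have sub: "{i. ?g i \<noteq> \<zero>} \<subseteq> S" using f by auto
      then have g: "?g \<in> carrier T"
        using f insert.hyps(1) by (auto simp: T_carrier intro: finite_subset)
      have s: "single j (f j) \<in> carrier T" using f by (intro single_closed) (auto simp: T_closed T_e)
      have "P (\<lambda>i. ?g i \<oplus> single j (f j) i)"
        using insert.IH g sub f by (intro add g s single) (auto simp: T_carrier)
      moreover have "(\<lambda>i. ?g i \<oplus> single j (f j) i) = f"
        using f by (auto simp: single_def T_carrier)
      ultimately show "P f" by simp
    qed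
  qed
  from this[OF T_fin[OF assms(1)]] assms(1) show ?thesis by blast
qed

lemma T_diff_superset:
  assumes "f \<in> carrier T" "finite S" "{i. f i \<noteq> \<zero>} \<subseteq> S"
  shows "diff T f k = diff A (f k) \<oplus> (\<Oplus>i\<in>S. sg (f i) \<otimes> z i k)"
proof -
  have "(\<Oplus>i\<in>{i. f i \<noteq> \<zero>}. sg (f i) \<otimes> z i k) = (\<Oplus>i\<in>S. sg (f i) \<otimes> z i k)"
    by (rule add.finprod_mono_neutral_cong_left) (use assms in \<open>auto simp: T_closed\<close>)
  then show ?thesis by (simp add: T_diff)
qed

lemma z_row: "z i \<in> piece T (p i - 1) (q i)"
  by (simp add: T_piece T_carrier z_fin z_e z_piece)

lemma z_row_closed: "z i \<in> carrier T"
  using z_row T_piece by blast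

lemma T_diff_z: "diff T (z i) = (\<lambda>k. \<zero>)"
  by (rule ext) (simp add: T_diff z_diff)

lemma T_diff_closed:
  assumes f: "f \<in> carrier T"
  shows "diff T f \<in> carrier T"
proof -
  \<comment> \<open>the boundary is supported on the support of \<open>f\<close> and those of the
                  finitely many rows \<open>z i\<close> involved\<close>
  let ?S = "{i. f i \<noteq> \<zero>} \<union> (\<Union>i\<in>{i. f i \<noteq> \<zero>}. {j. z i j \<noteq> \<zero>})"
  have fin: "finite ?S" using T_fin[OF f] z_fin by blast
  have "diff T f k = \<zero>" if "k \<notin> ?S" for k
  proof -
    have "(\<Oplus>i\<in>{i. f i \<noteq> \<zero>}. sg (f i) \<otimes> z i k) = \<zero>"
      by (rule add.finprod_one_eqI) (use that f in \<open>auto simp: T_closed\<close>)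
    then show ?thesis using that by (simp add: T_diff)
  qed
  then have "{k. diff T f k \<noteq> \<zero>} \<subseteq> ?S" by blast
  then have "finite {k. diff T f k \<noteq> \<zero>}" using fin finite_subset by blast
  moreover have cl: "(\<Oplus>i\<in>{i. f i \<noteq> \<zero>}. sg (f i) \<otimes> z i k) \<in> carrier A" for k
    by (rule finsum_closed) (use f in \<open>auto simp: T_closed\<close>)
  moreover have "diff T f k \<otimes> e k = diff T f k" for k
  proof -
    have "diff A (f k) = diff A (f k \<otimes> e k)" using T_e[OF f] by simp
    also have "\<dots> = diff A (f k) \<otimes> e k"
      using f by (subst A_leibniz_sg) (simp_all add: T_closed e_diff)
    finally have 1: "diff A (f k) \<otimes> e k = diff A (f k)" by simp
    have "(\<Oplus>i\<in>{i. f i \<noteq> \<zero>}. sg (f i) \<otimes> z i k) \<otimes> e k =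
        (\<Oplus>i\<in>{i. f i \<noteq> \<zero>}. sg (f i) \<otimes> z i k)"
      using f T_fin[OF f] by (subst finsum_ldistr) (auto simp: T_closed m_assoc z_e)
    with 1 cl f show ?thesis by (simp add: T_diff l_distr T_closed)
  qed
  ultimately show ?thesis using f cl by (simp add: T_carrier T_diff)
qed

lemma T_diff_add:
  assumes "f \<in> carrier T" "f' \<in> carrier T"
  shows "diff T (\<lambda>i. f i \<oplus> f' i) = (\<lambda>k. diff T f k \<oplus> diff T f' k)"
proof
  fix k
  let ?S = "{i. f i \<noteq> \<zero>} \<union> {i. f' i \<noteq> \<zero>}"
  have fin: "finite ?S" using assms T_fin by blast
  have cl: "f i \<in> carrier A" "f' i \<in> carrier A" for i using assms T_closed by blast+
  have s: "(\<Oplus>i\<in>?S. sg (f i) \<otimes> z i k) \<in> carrier A" "(\<Oplus>i\<in>?S. sg (f' i) \<otimes> z i k) \<in> carrier A"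
    using cl by (auto intro!: finsum_closed)
  have "diff T (\<lambda>i. f i \<oplus> f' i) k =
      diff A (f k \<oplus> f' k) \<oplus> (\<Oplus>i\<in>?S. sg (f i \<oplus> f' i) \<otimes> z i k)"
    by (rule T_diff_superset[OF T_add_closed[OF assms] fin]) auto
  also have "\<dots> = diff A (f k \<oplus> f' k) \<oplus> ((\<Oplus>i\<in>?S. sg (f i) \<otimes> z i k) \<oplus> (\<Oplus>i\<in>?S. sg (f' i) \<otimes> z i k))"
    using cl by (subst finsum_addf[symmetric]) (auto simp: sg_add l_distr)
  also have "\<dots> = (diff A (f k) \<oplus> (\<Oplus>i\<in>?S. sg (f i) \<otimes> z i k)) \<oplus>
      (diff A (f' k) \<oplus> (\<Oplus>i\<in>?S. sg (f' i) \<otimes> z i k))"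
    using cl s by (simp add: A_diff_add a_ac)
  also have "\<dots> = diff T f k \<oplus> diff T f' k"
    using T_diff_superset[OF assms(1) fin] T_diff_superset[OF assms(2) fin] by simp
  finally show "diff T (\<lambda>i. f i \<oplus> f' i) k = diff T f k \<oplus> diff T f' k" .
qed

lemma T_leibniz:
  assumes "a \<in> carrier A" "f \<in> carrier T"
  shows "diff T (\<lambda>i. a \<otimes> f i) = (\<lambda>k. diff A a \<otimes> f k \<oplus> sg a \<otimes> diff T f k)"
proof
  fix k
  let ?S = "{i. f i \<noteq> \<zero>}"
  have fin: "finite ?S" by (rule T_fin[OF assms(2)])
  have cl: "f i \<in> carrier A" for i using assms T_closed by blast
  have s: "(\<Oplus>i\<in>?S. sg (f i) \<otimes> z i k) \<in> carrier A" using cl by (auto intro!: finsum_closed)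
  have "diff T (\<lambda>i. a \<otimes> f i) k = diff A (a \<otimes> f k) \<oplus> (\<Oplus>i\<in>?S. sg (a \<otimes> f i) \<otimes> z i k)"
    by (rule T_diff_superset[OF T_smult_closed[OF assms] fin]) (use assms(1) in auto)
  also have "(\<Oplus>i\<in>?S. sg (a \<otimes> f i) \<otimes> z i k) = sg a \<otimes> (\<Oplus>i\<in>?S. sg (f i) \<otimes> z i k)"
    using cl fin assms(1) by (subst finsum_rdistr) (auto simp: sg_mult m_assoc)
  finally show "diff T (\<lambda>i. a \<otimes> f i) k = diff A a \<otimes> f k \<oplus> sg a \<otimes> diff T f k"
    using assms(1) cl s by (simp add: A_leibniz_sg T_diff r_distr a_assoc)
qed

lemma T_diff_single:
  assumes "a \<in> carrier A" "a \<otimes> e i = a"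
  shows "diff T (single i a) = (\<lambda>k. single i (diff A a) k \<oplus> sg a \<otimes> z i k)"
proof
  fix k
  have "diff T (single i a) k = diff A (single i a k) \<oplus> (\<Oplus>j\<in>{i}. sg (single i a j) \<otimes> z j k)"
    by (rule T_diff_superset[OF single_closed[OF assms]]) (auto simp: single_def)
  then show "diff T (single i a) k = single i (diff A a) k \<oplus> sg a \<otimes> z i k"
    using assms(1) by (simp add: single_def)
qed

text \<open>Since \<open>d e\<^sub>i = 0\<close>, the left ideal \<open>A e\<^sub>i\<close> is closed under
  the differential.\<close>

lemma diff_right_e:
  assumes "a \<in> carrier A" "a \<otimes> e i = a"
  shows "diff A a \<otimes> e i = diff A a"
  using A_leibniz_sg[OF assms(1), of "e i"] assms by (simp add: e_diff)

text \<open>For \<open>a x\<^sub>i\<close> one has \<open>d (a x\<^sub>i) = (d a) x\<^sub>i + sg(a)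
  z\<^sub>i\<close>. Applying \<open>d\<close> again, the two terms with \<open>z\<^sub>i\<close>
  cancel by \<open>sg_diff\<close>, and the remaining ones contain \<open>d (d a)\<close> or
  \<open>d z\<^sub>i\<close>.\<close>

lemma T_diff_diff:
  assumes "f \<in> carrier T"
  shows "diff T (diff T f) = (\<lambda>k. \<zero>)"
  using assms
proof (induction f rule: T_induct)
  case zero
  have "diff T (\<lambda>i. \<zero>) = (\<lambda>k. \<zero>)" by (rule ext) (simp add: T_diff)
  then show ?case by simp
next
  case (add f f')
  then show ?case by (simp add: T_diff_add T_diff_closed)
next
  case (single i a)
  have s: "single i (diff A a) \<in> carrier T"
    using single by (simp add: single_closed diff_right_e)
  have t: "(\<lambda>k. sg a \<otimes> z i k) \<in> carrier T"
    using single T_smult_closed z_row_closed by simp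
  have "diff T (diff T (single i a)) = diff T (\<lambda>k. single i (diff A a) k \<oplus> sg a \<otimes> z i k)"
    using single by (simp add: T_diff_single)
  also have "\<dots> = (\<lambda>k. diff T (single i (diff A a)) k \<oplus> diff T (\<lambda>k. sg a \<otimes> z i k) k)"
    by (rule T_diff_add[OF s t])
  also have "\<dots> = (\<lambda>k. \<zero>)"
  proof
    fix k
    have "diff T (single i (diff A a)) k = single i (diff A (diff A a)) k \<oplus> sg (diff A a) \<otimes> z i k"
      using single diff_right_e[of a i] by (subst T_diff_single) auto
    also have "\<dots> = \<ominus> (diff A (sg a) \<otimes> z i k)"
      using single by (simp add: A_diff_diff sg_diff l_minus single_def)
    finally show "diff T (single i (diff A a)) k \<oplus> diff T (\<lambda>k. sg a \<otimes> z i k) k = \<zero>"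
      using single by (simp add: T_leibniz z_row_closed T_diff_z l_neg)
  qed
  finally show ?case .
qed

lemma T_piece_subgroup: "additive_subgroup (piece T h g) T"
proof (rule TL.M.additive_subgroupI')
  show "\<zero>\<^bsub>T\<^esub> \<in> piece T h g"
    using TL.M.zero_closed by (simp add: T_piece)
  show "\<ominus>\<^bsub>T\<^esub> f \<in> piece T h g" if "f \<in> piece T h g" for f
  proof -
    have f: "f \<in> carrier T" and "\<And>i. f i \<in> piece A (h - p i) (g - q i)"
      using that by (auto simp: T_piece)
    then show ?thesis
      using TL.M.a_inv_closed[OF f] by (simp add: T_piece T_uminus[OF f] piece_uminus)
  qed
qed (auto simp: T_piece piece_add T_add_closed)

lemma T_component_closed:
  assumes "f \<in> carrier T"
  shows "(\<lambda>i. component A (h - p i, g - q i) (f i)) \<in> piece T h g"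
proof -
  have "{i. component A (h - p i, g - q i) (f i) \<noteq> \<zero>} \<subseteq> {i. f i \<noteq> \<zero>}" by auto
  from finite_subset[OF this T_fin[OF assms]] show ?thesis
    using assms by (auto simp: T_piece T_carrier component_closed component_piece
        component_mult_degree_zero[OF e_piece, symmetric])
qed

text \<open>Components are taken coordinate by coordinate, in degrees shifted by those of the generators.\<close>

lemma T_graded: "graded_by_pieces T"
proof (rule graded_by_piecesI[OF T_abelian_group T_piece_subgroup])
  let ?c = "\<lambda>j f i. component A (fst j - p i, snd j - q i) (f i)"
  show "?c (h, g) f \<in> piece T h g" if "f \<in> carrier T" for h g f
    using T_component_closed[OF that] by simp
  show "?c j (f \<oplus>\<^bsub>T\<^esub> f') = ?c j f \<oplus>\<^bsub>T\<^esub> ?c j f'" if "f \<in> carrier T" "f' \<in> carrier T" for j f f'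
    using that by (simp add: component_add T_closed)
  show "?c (h, g) f = f" if "f \<in> piece T h g" for h g f
    using that by (auto simp: T_piece component_same)
  show "?c j f = \<zero>\<^bsub>T\<^esub>" if f: "f \<in> piece T h g" and j: "j \<noteq> (h, g)" for h g j f
  proof -
    have "?c j f i = \<zero>" for i
    proof (rule component_other)
      show "f i \<in> piece A (h - p i) (g - q i)" using f by (simp add: T_piece)
      show "(fst j - p i, snd j - q i) \<noteq> (h - p i, g - q i)" using j by (cases j) auto
    qed
    then show ?thesis by simp
  qed
  fix f assume f: "f \<in> carrier T"
  let ?S = "\<Union>i\<in>{i. f i \<noteq> \<zero>}. (\<lambda>j. (fst j + p i, snd j + q i)) ` {j. component A j (f i) \<noteq> \<zero>}"
  have fin: "finite ?S"
    using T_fin[OF f] component_finite T_closed[OF f] by blast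
  have in_S: "j \<in> ?S" if "?c j f i \<noteq> \<zero>" for i j
  proof -
    have "f i \<noteq> \<zero>" using that by auto
    moreover have "j \<in> (\<lambda>j. (fst j + p i, snd j + q i)) ` {j. component A j (f i) \<noteq> \<zero>}"
      by (rule image_eqI[of _ _ "(fst j - p i, snd j - q i)"]) (use that in auto)
    ultimately show ?thesis by blast
  qed
  have sub: "{j. ?c j f \<noteq> \<zero>\<^bsub>T\<^esub>} \<subseteq> ?S" using in_S by (auto simp: fun_eq_iff)
  then show "finite {j. ?c j f \<noteq> \<zero>\<^bsub>T\<^esub>}" using fin by (rule finite_subset)
  have cl: "?c j f \<in> carrier T" for j
    using T_component_closed[OF f, of "fst j" "snd j"] T_piece by blast
  have "(\<Oplus>\<^bsub>T\<^esub>j\<in>{j. ?c j f \<noteq> \<zero>\<^bsub>T\<^esub>}. ?c j f) = (\<Oplus>\<^bsub>T\<^esub>j\<in>?S. ?c j f)"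
    by (rule TL.M.add.finprod_mono_neutral_cong_left[OF fin sub]) (use cl in auto)
  also have "\<dots> = f"
  proof
    fix i
    have "(\<Oplus>\<^bsub>T\<^esub>j\<in>?S. ?c j f) i = (\<Oplus>j\<in>?S. component A (fst j - p i, snd j - q i) (f i))"
      by (rule T_eval_finsum) (use cl fin in auto)
    also have "\<dots> = (\<Oplus>j\<in>(\<lambda>j. (fst j - p i, snd j - q i)) ` ?S. component A j (f i))"
      by (rule add.finprod_reindex[symmetric])
        (use f in \<open>auto simp: component_closed T_closed inj_on_def prod_eq_iff\<close>)
    also have "\<dots> = f i"
    proof (rule component_sum_superset[OF T_closed[OF f]])
      show "finite ((\<lambda>j. (fst j - p i, snd j - q i)) ` ?S)" using fin by blast
      show "{j. component A j (f i) \<noteq> \<zero>} \<subseteq> (\<lambda>j. (fst j - p i, snd j - q i)) ` ?S"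
      proof
        fix j assume "j \<in> {j. component A j (f i) \<noteq> \<zero>}"
        then have "?c (fst j + p i, snd j + q i) f i \<noteq> \<zero>" by simp
        from in_S[OF this] show "j \<in> (\<lambda>j. (fst j - p i, snd j - q i)) ` ?S"
          by (rule rev_image_eqI) simp
      qed
    qed
    finally show "(\<Oplus>\<^bsub>T\<^esub>j\<in>?S. ?c j f) i = f i" .
  qed
  finally show "(\<Oplus>\<^bsub>T\<^esub>j\<in>{j. ?c j f \<noteq> \<zero>\<^bsub>T\<^esub>}. ?c j f) = f" .
qed

lemma T_diff_piece:
  assumes "f \<in> piece T h g"
  shows "diff T f \<in> piece T (h - 1) g"
proof -
  have f: "f \<in> carrier T" and fp: "\<And>i. f i \<in> piece A (h - p i) (g - q i)"
    using assms by (auto simp: T_piece)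
  have "diff T f k \<in> piece A (h - 1 - p k) (g - q k)" for k
    unfolding T_diff
  proof (rule piece_add)
    show "diff A (f k) \<in> piece A (h - 1 - p k) (g - q k)"
      using A_diff_piece[OF fp[of k]] by (simp add: algebra_simps)
    show "(\<Oplus>i\<in>{i. f i \<noteq> \<zero>}. sg (f i) \<otimes> z i k) \<in> piece A (h - 1 - p k) (g - q k)"
    proof (rule finsum_in_subgroup[OF piece_subgroup], rule Pi_I)
      fix i
      show "sg (f i) \<otimes> z i k \<in> piece A (h - 1 - p k) (g - q k)"
        using A_mult_piece[OF sg_piece[OF fp[of i]] z_piece[of i k]] by (simp add: algebra_simps)
    qed
  qed
  then show ?thesis using T_diff_closed[OF f] by (simp add: T_piece)
qed

theorem T_dg_module: "dg_module A T"
proof (intro dg_module.intro dg_module_axioms.intro T_left_module T_graded)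
  fix a h g f h' g'
  assume a: "a \<in> piece A h g" and f: "f \<in> piece T h' g'"
  have "a \<otimes> f i \<in> piece A (h + h' - p i) (g + g' - q i)" for i
    using A_mult_piece[OF a, of "f i" "h' - p i" "g' - q i"] f by (simp add: T_piece algebra_simps)
  then show "a \<odot>\<^bsub>T\<^esub> f \<in> piece T (h + h') (g + g')"
    using f T_smult_closed[OF piece_carrier[OF a]] by (simp add: T_piece)
next
  fix a h g f assume a: "a \<in> piece A h g" and f: "f \<in> carrier T"
  have ac: "a \<in> carrier A" using a by (rule piece_carrier)
  have d: "diff T f \<in> carrier T" using f by (rule T_diff_closed)
  have "koszul_sign T h (a \<odot>\<^bsub>T\<^esub> diff T f) = (\<lambda>k. sg a \<otimes> diff T f k)"
    using T_uminus[OF T_smult_closed[OF ac d]] T_closed[OF d] ac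
    by (auto simp: koszul_sign_def sg_of_piece[OF a] l_minus)
  then show "diff T (a \<odot>\<^bsub>T\<^esub> f) = (diff A a \<odot>\<^bsub>T\<^esub> f) \<oplus>\<^bsub>T\<^esub> koszul_sign T h (a \<odot>\<^bsub>T\<^esub> diff T f)"
    using T_leibniz[OF ac f] by simp
qed (auto simp: T_diff_add T_diff_diff intro: T_diff_piece)

end

section \<open>Surjective quasi-isomorphisms and transport of structure\<close>

context abelian_group
begin

lemma mem_coset: "y \<in> B +> x \<longleftrightarrow> (\<exists>b\<in>B. y = b \<oplus> x)"
  by (auto simp: a_r_coset_def')

lemma coset_eq_iff:
  assumes B: "additive_subgroup B G" and xy: "x \<in> carrier G" "y \<in> carrier G"
  shows "B +> x = B +> y \<longleftrightarrow> x \<ominus> y \<in> B"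
proof
  interpret B: additive_subgroup B G by fact
  assume "B +> x = B +> y"
  moreover have "x \<in> B +> x" using xy B.zero_closed by (auto simp: mem_coset intro!: bexI[of _ \<zero>])
  ultimately obtain b where b: "b \<in> B" "x = b \<oplus> y" by (auto simp: mem_coset)
  then have "x \<ominus> y = b" using xy B.a_subset by (auto simp: minus_eq a_assoc r_neg)
  then show "x \<ominus> y \<in> B" using b by simp
next
  interpret B: additive_subgroup B G by fact
  have *: "B +> x \<subseteq> B +> y" if "x \<ominus> y \<in> B" "x \<in> carrier G" "y \<in> carrier G" for x y
  proof
    fix w assume "w \<in> B +> x"
    then obtain b where b: "b \<in> B" "w = b \<oplus> x" by (auto simp: mem_coset)
    have "w = (b \<oplus> (x \<ominus> y)) \<oplus> y"
      using b that B.a_subset by (auto simp: minus_eq a_assoc l_neg)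
    then show "w \<in> B +> y" using b that B.a_closed by (auto simp: mem_coset)
  qed
  assume d: "x \<ominus> y \<in> B"
  have "y \<ominus> x = \<ominus> (x \<ominus> y)" using xy by (simp add: minus_eq minus_add minus_minus a_comm)
  then have "y \<ominus> x \<in> B" using additive_subgroup_uminus[OF B d] by simp
  with d xy * show "B +> x = B +> y" by blast
qed

lemma coset_add:
  assumes B: "additive_subgroup B G" and xy: "x \<in> carrier G" "y \<in> carrier G"
  shows "set_add G (B +> x) (B +> y) = B +> (x \<oplus> y)"
proof -
  interpret B: additive_subgroup B G by fact
  show ?thesis
  proof (intro equalityI subsetI)
    fix w assume "w \<in> set_add G (B +> x) (B +> y)"
    then obtain b b' where b: "b \<in> B" "b' \<in> B" "w = (b \<oplus> x) \<oplus> (b' \<oplus> y)"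
      by (auto simp: set_add_def set_mult_def mem_coset)
    then have "w = (b \<oplus> b') \<oplus> (x \<oplus> y)"
      using xy B.a_subset by (simp add: subset_iff a_ac)
    then show "w \<in> B +> (x \<oplus> y)" using b B.a_closed by (auto simp: mem_coset)
  next
    fix w assume "w \<in> B +> (x \<oplus> y)"
    then obtain b where b: "b \<in> B" "w = b \<oplus> (x \<oplus> y)" by (auto simp: mem_coset)
    then have "w = (b \<oplus> x) \<oplus> (\<zero> \<oplus> y)" using xy B.a_subset by (auto simp: a_assoc)
    moreover have "b \<oplus> x \<in> B +> x" "\<zero> \<oplus> y \<in> B +> y"
      using b B.zero_closed by (auto simp: mem_coset)
    ultimately show "w \<in> set_add G (B +> x) (B +> y)"
      by (auto simp: set_add_def set_mult_def)
  qed
qed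

end

context dg_ring_module
begin

lemma boundaries_subgroup: "additive_subgroup (boundaries M) M"
proof (rule M.additive_subgroupI')
  show "\<zero>\<^bsub>M\<^esub> \<in> boundaries M" unfolding boundaries_def by (rule image_eqI[of _ _ "\<zero>\<^bsub>M\<^esub>"]) auto
  fix x assume x: "x \<in> boundaries M"
  then show "\<ominus>\<^bsub>M\<^esub> x \<in> boundaries M" unfolding boundaries_def
    by (auto simp flip: diff_uminus)
  fix y assume "y \<in> boundaries M"
  with x show "x \<oplus>\<^bsub>M\<^esub> y \<in> boundaries M" unfolding boundaries_def
    by (auto simp flip: diff_add)
qed (auto simp: boundaries_def)

lemma cycles_closed: "x \<in> cycles M \<Longrightarrow> x \<in> carrier M" by (simp add: cycles_def)

lemma homology_carrier:
  "carrier (homology M) = (\<lambda>x. boundaries M +>\<^bsub>M\<^esub> x) ` cycles M"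
  by (auto simp: homology_def A_FactGroup_def FactGroup_def RCOSETS_def a_r_coset_def r_coset_def)

lemma homology_mult: "X \<otimes>\<^bsub>homology M\<^esub> Y = set_add M X Y"
  by (auto simp: homology_def A_FactGroup_def FactGroup_def set_add_def set_mult_def)

end

text \<open>The hypothesis gives everything at once. With \<open>z = 0\<close> it lifts cycles of
  \<open>M\<close> to cycles of \<open>P\<close>, whence surjectivity on homology. For any
  \<open>m\<close>, a cycle \<open>z\<close> over the cycle \<open>d m\<close> exists by this first
  case, and then \<open>m\<close> itself lifts, whence surjectivity. A cycle \<open>z\<close> whose
  image is a boundary \<open>d m\<close> is itself a boundary, whence injectivity on homology.\<close>

theorem lifting_quasi_isomorphism:
  fixes A :: "('k, 'a, 'n::finite) dg_struct"
  assumes "dg_ring_module A P" "dg_ring_module A M"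
    and hom: "dg_hom A P M f"
    and lift: "\<And>z m. \<lbrakk>z \<in> carrier P; m \<in> carrier M; diff P z = \<zero>\<^bsub>P\<^esub>; f z = diff M m\<rbrakk>
      \<Longrightarrow> \<exists>y\<in>carrier P. diff P y = z \<and> f y = m"
  shows "quasi_isomorphism A P M f" "f ` carrier P = carrier M"
proof -
  interpret P: dg_ring_module A P by fact
  interpret M: dg_ring_module A M by fact
  have fc [simp]: "f x \<in> carrier M" if "x \<in> carrier P" for x
    using hom that by (auto simp: dg_hom_def)
  have fadd: "f (x \<oplus>\<^bsub>P\<^esub> y) = f x \<oplus>\<^bsub>M\<^esub> f y" if "x \<in> carrier P" "y \<in> carrier P" for x y
    using hom that by (auto simp: dg_hom_def)
  have fd: "f (diff P x) = diff M (f x)" if "x \<in> carrier P" for x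
    using hom that by (auto simp: dg_hom_def)
  have f0: "f \<zero>\<^bsub>P\<^esub> = \<zero>\<^bsub>M\<^esub>"
    by (rule P.M.additive_zero[OF M.M.abelian_group_axioms]) (auto simp: fadd)
  have fneg: "f (\<ominus>\<^bsub>P\<^esub> x) = \<ominus>\<^bsub>M\<^esub> f x" if "x \<in> carrier P" for x
    by (rule P.M.additive_uminus[OF M.M.abelian_group_axioms]) (auto simp: fadd that)
  \<comment> \<open>the case \<open>z = 0\<close>\<close>
  have cyc: "\<exists>y\<in>cycles P. f y = m" if "m \<in> cycles M" for m
    using lift[of "\<zero>\<^bsub>P\<^esub>" m] that by (auto simp: cycles_def f0)
  show "f ` carrier P = carrier M"
  proof (intro equalityI subsetI)
    fix m assume m: "m \<in> carrier M"
    \<comment> \<open>a cycle over \<open>d m\<close> is found first; then \<open>m\<close> lifts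
                    together with it\<close>
    then have "diff M m \<in> cycles M" by (simp add: cycles_def M.diff_diff)
    then obtain z where z: "z \<in> cycles P" "f z = diff M m" using cyc by blast
    then show "m \<in> f ` carrier P" using lift[of z m] m by (auto simp: cycles_def)
  qed auto
  have fB: "f b \<in> boundaries M" if "b \<in> boundaries P" for b
    using that by (auto simp: boundaries_def fd)
  have map: "homology_map M f (boundaries P +>\<^bsub>P\<^esub> x) = boundaries M +>\<^bsub>M\<^esub> f x"
    if x: "x \<in> carrier P" for x
  proof -
    have "boundaries M +>\<^bsub>M\<^esub> f y = boundaries M +>\<^bsub>M\<^esub> f x" if y: "y \<in> boundaries P +>\<^bsub>P\<^esub> x" for y
    proof -
      obtain b where b: "b \<in> boundaries P" "y = b \<oplus>\<^bsub>P\<^esub> x"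
        using y unfolding P.M.mem_coset by blast
      have bc: "b \<in> carrier P" using b(1) by (auto simp: boundaries_def)
      then have "f y \<ominus>\<^bsub>M\<^esub> f x = f b"
        using b x by (simp add: fadd M.M.minus_eq M.M.a_assoc M.M.r_neg)
      then show ?thesis
        using fB[OF b(1)] b(2) bc x by (subst M.M.coset_eq_iff[OF M.boundaries_subgroup]) auto
    qed
    moreover have "x \<in> boundaries P +>\<^bsub>P\<^esub> x"
      using x by (auto simp: P.M.mem_coset boundaries_def intro!: bexI[of _ "\<zero>\<^bsub>P\<^esub>"] image_eqI[of _ _ "\<zero>\<^bsub>P\<^esub>"])
    ultimately show ?thesis unfolding homology_map_def by blast
  qed
  have inj: "boundaries P +>\<^bsub>P\<^esub> x = boundaries P +>\<^bsub>P\<^esub> y"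
    if x: "x \<in> cycles P" and y: "y \<in> cycles P"
      and eq: "boundaries M +>\<^bsub>M\<^esub> f x = boundaries M +>\<^bsub>M\<^esub> f y" for x y
  proof -
    have c: "x \<in> carrier P" "y \<in> carrier P" "diff P x = \<zero>\<^bsub>P\<^esub>" "diff P y = \<zero>\<^bsub>P\<^esub>"
      using x y by (auto simp: cycles_def)
    have "f x \<ominus>\<^bsub>M\<^esub> f y \<in> boundaries M"
      using eq c M.M.coset_eq_iff[OF M.boundaries_subgroup] by simp
    then obtain m where m: "m \<in> carrier M" "f x \<ominus>\<^bsub>M\<^esub> f y = diff M m" by (auto simp: boundaries_def)
    have "diff P (x \<ominus>\<^bsub>P\<^esub> y) = \<zero>\<^bsub>P\<^esub>"
      using c by (simp add: P.M.minus_eq P.diff_add P.diff_uminus)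
    moreover have "f (x \<ominus>\<^bsub>P\<^esub> y) = diff M m"
      using c m by (simp add: P.M.minus_eq fadd fneg M.M.minus_eq)
    ultimately obtain w where "w \<in> carrier P" "diff P w = x \<ominus>\<^bsub>P\<^esub> y"
      using lift[of "x \<ominus>\<^bsub>P\<^esub> y" m] c m by auto
    then have "x \<ominus>\<^bsub>P\<^esub> y \<in> boundaries P" unfolding boundaries_def by force
    then show ?thesis using c P.M.coset_eq_iff[OF P.boundaries_subgroup] by simp
  qed
  have img: "homology_map M f ` carrier (homology P) = carrier (homology M)"
  proof (intro equalityI subsetI)
    fix X assume "X \<in> homology_map M f ` carrier (homology P)"
    then obtain x where x: "x \<in> cycles P" "X = boundaries M +>\<^bsub>M\<^esub> f x"
      by (auto simp: P.homology_carrier map P.cycles_closed)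
    then have "f x \<in> cycles M" using fd[of x] f0 by (auto simp: cycles_def)
    then show "X \<in> carrier (homology M)" using x by (auto simp: M.homology_carrier)
  next
    fix X assume "X \<in> carrier (homology M)"
    then obtain m where m: "m \<in> cycles M" "X = boundaries M +>\<^bsub>M\<^esub> m"
      by (auto simp: M.homology_carrier)
    then obtain x where x: "x \<in> cycles P" "f x = m" using cyc by blast
    then have "X = homology_map M f (boundaries P +>\<^bsub>P\<^esub> x)" using m map P.cycles_closed by simp
    then show "X \<in> homology_map M f ` carrier (homology P)"
      using x by (auto simp: P.homology_carrier)
  qed
  have "homology_map M f \<in> iso (homology P) (homology M)"
    unfolding iso_def hom_def bij_betw_def
  proof (intro CollectI conjI ballI inj_onI img)
    show "homology_map M f \<in> carrier (homology P) \<rightarrow> carrier (homology M)"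
      using img by blast
    fix X Y assume "X \<in> carrier (homology P)" "Y \<in> carrier (homology P)"
    then obtain x y where x: "x \<in> cycles P" "X = boundaries P +>\<^bsub>P\<^esub> x"
      and y: "y \<in> cycles P" "Y = boundaries P +>\<^bsub>P\<^esub> y"
      by (auto simp: P.homology_carrier)
    have c: "x \<in> carrier P" "y \<in> carrier P" using x y P.cycles_closed by auto
    show "homology_map M f (X \<otimes>\<^bsub>homology P\<^esub> Y) =
        homology_map M f X \<otimes>\<^bsub>homology M\<^esub> homology_map M f Y"
      using c by (simp add: P.homology_mult M.homology_mult x(2) y(2) map fadd
          P.M.coset_add[OF P.boundaries_subgroup] M.M.coset_add[OF M.boundaries_subgroup])
    assume "homology_map M f X = homology_map M f Y"
    then show "X = Y" using inj[OF x(1) y(1)] c by (simp add: x(2) y(2) map)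
  qed
  then show "quasi_isomorphism A P M f" using hom by (simp add: quasi_isomorphism_def)
qed

text \<open>The bijection \<open>j\<close> is only known on the carrier. This allows \<open>Y\<close> to be a
  structure on another type as well as a restriction of a structure to a subset which is recognised
  as a twisted module.\<close>

theorem dg_module_transport:
  fixes A :: "('k, 'a, 'n::finite) dg_struct"
  assumes "dg_ring_module A P"
    and bij: "bij_betw j (carrier P) (carrier Y)"
    and zero: "\<zero>\<^bsub>Y\<^esub> = j \<zero>\<^bsub>P\<^esub>"
    and add: "\<And>x y. \<lbrakk>x \<in> carrier P; y \<in> carrier P\<rbrakk> \<Longrightarrow> j x \<oplus>\<^bsub>Y\<^esub> j y = j (x \<oplus>\<^bsub>P\<^esub> y)"
    and act: "\<And>a x. \<lbrakk>a \<in> carrier A; x \<in> carrier P\<rbrakk> \<Longrightarrow> a \<odot>\<^bsub>Y\<^esub> j x = j (a \<odot>\<^bsub>P\<^esub> x)"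
    and diff: "\<And>x. x \<in> carrier P \<Longrightarrow> diff Y (j x) = j (diff P x)"
    and piece: "\<And>h g. piece Y h g = j ` piece P h g"
  shows "dg_module A Y"
proof -
  interpret P: dg_ring_module A P by fact
  have Y: "carrier Y = j ` carrier P" using bij by (simp add: bij_betw_def)
  have inj: "j x = j y \<longleftrightarrow> x = y" if "x \<in> carrier P" "y \<in> carrier P" for x y
    using bij that by (auto simp: bij_betw_def inj_on_def)
  have Yab: "abelian_group Y"
  proof (rule abelian_groupI)
    fix x assume "x \<in> carrier Y"
    then obtain x' where x: "x' \<in> carrier P" "x = j x'" by (auto simp: Y)
    then show "\<exists>y\<in>carrier Y. y \<oplus>\<^bsub>Y\<^esub> x = \<zero>\<^bsub>Y\<^esub>"
      unfolding Y by (intro bexI[of _ "j (\<ominus>\<^bsub>P\<^esub> x')"]) (auto simp: add zero P.M.l_neg)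
  qed (auto simp: Y zero add P.M.a_assoc, simp_all add: P.M.a_comm P.M.a_lcomm)
  interpret Y: abelian_group Y by fact
  have neg: "\<ominus>\<^bsub>Y\<^esub> j x = j (\<ominus>\<^bsub>P\<^esub> x)" if "x \<in> carrier P" for x
    by (rule P.M.additive_uminus[OF Yab, symmetric]) (auto simp: Y add that)
  have Ylm: "left_module A Y"
    by (intro left_module.intro left_module_axioms.intro P.ring_axioms Yab)
      (auto simp: Y add act P.act_closed P.act_l_distr P.act_r_distr P.act_assoc P.act_one)
  define i where "i = the_inv_into (carrier P) j"
  have ij [simp]: "i (j x) = x" if "x \<in> carrier P" for x
    unfolding i_def using bij that by (auto simp: bij_betw_def the_inv_into_f_f)
  have comp0: "j x \<noteq> \<zero>\<^bsub>Y\<^esub> \<longleftrightarrow> x \<noteq> \<zero>\<^bsub>P\<^esub>" if "x \<in> carrier P" for x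
    using inj that by (simp add: zero)
  have pc: "x \<in> carrier P" if "x \<in> piece P h g" for x h g using that by (rule P.MG.piece_carrier)
  have "graded_by_pieces Y"
  proof (rule graded_by_piecesI[OF Yab, where c = "\<lambda>k y. j (component P k (i y))"])
    show "additive_subgroup (piece Y h g) Y" for h g
    proof (rule Y.additive_subgroupI')
      show "\<zero>\<^bsub>Y\<^esub> \<in> piece Y h g" by (auto simp: piece zero)
      fix x assume "x \<in> piece Y h g"
      then obtain x' where x: "x' \<in> piece P h g" "x = j x'" by (auto simp: piece)
      show "\<ominus>\<^bsub>Y\<^esub> x \<in> piece Y h g"
        using x P.MG.piece_uminus[OF x(1)] by (auto simp: piece neg pc)
      fix y assume "y \<in> piece Y h g"
      then obtain y' where y: "y' \<in> piece P h g" "y = j y'" by (auto simp: piece)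
      show "x \<oplus>\<^bsub>Y\<^esub> y \<in> piece Y h g"
        using x y P.MG.piece_add[OF x(1) y(1)] by (auto simp: piece add pc)
    qed (auto simp: piece Y pc)
    fix y assume "y \<in> carrier Y"
    then obtain x where x: "x \<in> carrier P" "y = j x" by (auto simp: Y)
    have S: "{k. j (component P k (i y)) \<noteq> \<zero>\<^bsub>Y\<^esub>} = {k. component P k x \<noteq> \<zero>\<^bsub>P\<^esub>}"
      using x by (simp add: comp0 P.MG.component_closed)
    show "j (component P (h, g) (i y)) \<in> piece Y h g" for h g
      using x P.MG.component_piece by (simp add: piece)
    show "finite {k. j (component P k (i y)) \<noteq> \<zero>\<^bsub>Y\<^esub>}"
      using S P.MG.component_finite[OF x(1)] by simp
    have "j (\<Oplus>\<^bsub>P\<^esub>k\<in>{k. component P k x \<noteq> \<zero>\<^bsub>P\<^esub>}. component P k x) =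
        (\<Oplus>\<^bsub>Y\<^esub>k\<in>{k. component P k x \<noteq> \<zero>\<^bsub>P\<^esub>}. j (component P k x))"
      by (rule P.M.additive_finsum[OF Yab])
        (use P.MG.component_finite[OF x(1)] x(1) in \<open>auto simp: Y add P.MG.component_closed\<close>)
    moreover have "i y = x" using x by simp
    ultimately show "(\<Oplus>\<^bsub>Y\<^esub>k\<in>{k. j (component P k (i y)) \<noteq> \<zero>\<^bsub>Y\<^esub>}. j (component P k (i y))) = y"
      unfolding S P.MG.component_sum[OF x(1)] using x(2) by simp
    fix k y' assume "y' \<in> carrier Y"
    then obtain x' where x': "x' \<in> carrier P" "y' = j x'" by (auto simp: Y)
    show "j (component P k (i (y \<oplus>\<^bsub>Y\<^esub> y'))) = j (component P k (i y)) \<oplus>\<^bsub>Y\<^esub> j (component P k (i y'))"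
      using x x' by (simp add: add P.MG.component_add P.MG.component_closed)
  next
    fix h g y assume "y \<in> piece Y h g"
    then obtain x where x: "x \<in> piece P h g" "y = j x" by (auto simp: piece)
    show "j (component P (h, g) (i y)) = y" using x by (simp add: pc P.MG.component_same)
    fix k assume "k \<noteq> (h, g)"
    then show "j (component P k (i y)) = \<zero>\<^bsub>Y\<^esub>"
      using x by (simp add: pc P.MG.component_other zero)
  qed
  then show ?thesis
  proof (intro dg_module.intro dg_module_axioms.intro Ylm)
    fix a h g y h' g' assume a: "a \<in> piece A h g" and "y \<in> piece Y h' g'"
    then obtain x where x: "x \<in> piece P h' g'" "y = j x" by (auto simp: piece)
    show "a \<odot>\<^bsub>Y\<^esub> y \<in> piece Y (h + h') (g + g')"
      using P.act_piece[OF a x(1)] x P.piece_carrier[OF a] by (auto simp: piece act pc)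
  next
    fix h g y assume "y \<in> piece Y h g"
    then obtain x where x: "x \<in> piece P h g" "y = j x" by (auto simp: piece)
    show "diff Y y \<in> piece Y (h - 1) g"
      using P.diff_piece[OF x(1)] x by (auto simp: piece diff pc)
  next
    fix a h g y assume a: "a \<in> piece A h g" and "y \<in> carrier Y"
    then obtain x where x: "x \<in> carrier P" "y = j x" by (auto simp: Y)
    have ac: "a \<in> carrier A" using a by (rule P.piece_carrier)
    have "koszul_sign Y h (j w) = j (koszul_sign P h w)" if "w \<in> carrier P" for w
      using that by (simp add: koszul_sign_def neg)
    then show "diff Y (a \<odot>\<^bsub>Y\<^esub> y) = (diff A a \<odot>\<^bsub>Y\<^esub> y) \<oplus>\<^bsub>Y\<^esub> koszul_sign Y h (a \<odot>\<^bsub>Y\<^esub> diff Y y)"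
      using x ac P.leibniz[OF a x(1)] by (simp add: act diff add P.act_closed)
  qed (auto simp: Y add diff zero P.diff_add P.diff_diff)
qed

section \<open>Maps out of twisted modules and cell attachments\<close>

text \<open>An alias: in the locale \<open>dg_ring_module\<close> the original name denotes the fact about
  \<open>M\<close>.\<close>

lemmas (in dg_ring) A_finsum_cong = finsum_cong'

lemma (in dg_ring_module) component_diff:
  assumes "x \<in> carrier M"
  shows "component M (h, g) (diff M x) = diff M (component M (h + 1, g) x)"
  using assms
proof (induction x rule: MG.graded_induct)
  case (add x y)
  then show ?case by (simp add: diff_add MG.component_add MG.component_closed)
next
  case (piece x h' g')
  show ?case
  proof (cases "(h', g') = (h + 1, g)")
    case True
    with piece have x: "x \<in> piece M (h + 1) g" by simp
    from diff_piece[OF x] have "diff M x \<in> piece M h g" by simp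
    with x show ?thesis by (simp add: MG.component_same)
  next
    case False
    then have "component M (h + 1, g) x = \<zero>\<^bsub>M\<^esub>" using MG.component_other[OF piece] by auto
    moreover have "component M (h, g) (diff M x) = \<zero>\<^bsub>M\<^esub>"
      by (rule MG.component_other[OF diff_piece[OF piece]]) (use False in auto)
    ultimately show ?thesis by simp
  qed
qed simp

lemma dg_hom_component:
  assumes "dg_ring_module A P" "dg_ring_module A M" and hom: "dg_hom A P M f"
    and x: "x \<in> carrier P"
  shows "component M i (f x) = f (component P i x)"
proof -
  interpret P: dg_ring_module A P by fact
  interpret M: dg_ring_module A M by fact
  have fc: "f x \<in> carrier M" if "x \<in> carrier P" for x
    using hom that by (auto simp: dg_hom_def)
  have fadd: "f (x \<oplus>\<^bsub>P\<^esub> y) = f x \<oplus>\<^bsub>M\<^esub> f y" if "x \<in> carrier P" "y \<in> carrier P" for x y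
    using hom that by (auto simp: dg_hom_def)
  have f0: "f \<zero>\<^bsub>P\<^esub> = \<zero>\<^bsub>M\<^esub>"
    by (rule P.M.additive_zero[OF M.M.abelian_group_axioms]) (auto simp: fadd fc)
  have fp: "f x \<in> piece M h g" if "x \<in> piece P h g" for x h g
    using hom that unfolding dg_hom_def by blast
  show ?thesis using x
  proof (induction x rule: P.MG.graded_induct)
    case zero
    show ?case by (simp add: f0)
  next
    case (add x y)
    then show ?case by (simp add: fadd fc M.MG.component_add P.MG.component_add P.MG.component_closed)
  next
    case (piece x h g)
    show ?case
      using M.MG.component_same[OF fp[OF piece]] P.MG.component_same[OF piece]
        M.MG.component_other[OF fp[OF piece], of i] P.MG.component_other[OF piece, of i]
      by (cases "i = (h, g)") (simp_all add: f0)
  qed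
qed

text \<open>Both \<open>z\<close> and \<open>m\<close> split into components which again satisfy the
  conditions, because differentials and morphisms commute with taking components. The cells have
  homogeneous generators, so only homogeneous pairs can be made liftable by attaching them.\<close>

theorem lifting_from_pieces:
  fixes A :: "('k, 'a, 'n::finite) dg_struct"
  assumes "dg_ring_module A P" "dg_ring_module A M" and hom: "dg_hom A P M f"
    and lift: "\<And>h g z m. \<lbrakk>z \<in> piece P (h - 1) g; m \<in> piece M h g; diff P z = \<zero>\<^bsub>P\<^esub>; f z = diff M m\<rbrakk>
      \<Longrightarrow> \<exists>y\<in>carrier P. diff P y = z \<and> f y = m"
    and z: "z \<in> carrier P" "diff P z = \<zero>\<^bsub>P\<^esub>" and m: "m \<in> carrier M" and zm: "f z = diff M m"
  shows "\<exists>y\<in>carrier P. diff P y = z \<and> f y = m"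
proof -
  interpret P: dg_ring_module A P by fact
  interpret M: dg_ring_module A M by fact
  \<comment> \<open>the component of \<open>m\<close> of homological degree \<open>h\<close> is
                  matched with that of \<open>z\<close> of degree \<open>h - 1\<close>\<close>
  let ?sh = "\<lambda>i. (fst i - 1, snd i) :: int \<times> (int ^ 'n)"
  let ?S = "{i. component M i m \<noteq> \<zero>\<^bsub>M\<^esub>} \<union> ?sh -` {i. component P i z \<noteq> \<zero>\<^bsub>P\<^esub>}"
  have inj: "inj ?sh" by (auto simp: inj_on_def prod_eq_iff)
  have fin: "finite ?S"
    using M.MG.component_finite[OF m] finite_vimageI[OF P.MG.component_finite[OF z(1)] inj] by blast
  have "\<exists>y\<in>carrier P. diff P y = component P (?sh i) z \<and> f y = component M i m" for i
  proof -
    obtain h g where i: "i = (h, g)" by (cases i)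
    show ?thesis unfolding i fst_conv snd_conv
    proof (rule lift)
      show "component P (h - 1, g) z \<in> piece P (h - 1) g" by (rule P.MG.component_piece[OF z(1)])
      show "component M (h, g) m \<in> piece M h g" by (rule M.MG.component_piece[OF m])
      show "diff P (component P (h - 1, g) z) = \<zero>\<^bsub>P\<^esub>"
        using P.component_diff[OF z(1), of "h - 2" g] z(2) by simp
      show "f (component P (h - 1, g) z) = diff M (component M (h, g) m)"
        using M.component_diff[OF m, of "h - 1" g] dg_hom_component[OF assms(1-3) z(1)] zm by simp
    qed
  qed
  then obtain y where y: "\<And>i. y i \<in> carrier P" "\<And>i. diff P (y i) = component P (?sh i) z"
    "\<And>i. f (y i) = component M i m"
    by metis
  let ?y = "finsum P y ?S"
  have "diff P ?y = (\<Oplus>\<^bsub>P\<^esub>i\<in>?S. component P (?sh i) z)"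
    unfolding y(2)[symmetric]
    by (rule P.M.additive_finsum[OF P.M.abelian_group_axioms]) (use fin in \<open>auto simp: y P.diff_add\<close>)
  also have "\<dots> = (\<Oplus>\<^bsub>P\<^esub>i\<in>?sh ` ?S. component P i z)"
    by (rule P.M.add.finprod_reindex[symmetric])
      (use inj in \<open>auto simp: P.MG.component_closed z inj_on_def\<close>)
  also have "\<dots> = z"
  proof (rule P.MG.component_sum_superset[OF z(1)])
    show "{i. component P i z \<noteq> \<zero>\<^bsub>P\<^esub>} \<subseteq> ?sh ` ?S"
    proof
      fix i assume "i \<in> {i. component P i z \<noteq> \<zero>\<^bsub>P\<^esub>}"
      then show "i \<in> ?sh ` ?S" by (intro image_eqI[of _ _ "(fst i + 1, snd i)"]) auto
    qed
  qed (use fin in blast)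
  finally have 1: "diff P ?y = z" .
  have "f ?y = (\<Oplus>\<^bsub>M\<^esub>i\<in>?S. component M i m)"
    unfolding y(3)[symmetric]
    by (rule P.M.additive_finsum[OF M.M.abelian_group_axioms])
      (use hom fin in \<open>auto simp: y dg_hom_def\<close>)
  also have "\<dots> = m" by (rule M.MG.component_sum_superset[OF m fin]) auto
  finally have "f ?y = m" .
  with 1 show ?thesis using y(1) by (intro bexI[of _ ?y]) auto
qed

context dg_ring_module
begin

text \<open>The \<open>A\<close>-linear map sending the generators \<open>x\<^sub>i\<close> to \<open>u
  i\<close>.\<close>

definition phi :: "('i \<Rightarrow> 'm) \<Rightarrow> ('i \<Rightarrow> 'a) \<Rightarrow> 'm" where
  "phi u f = (\<Oplus>\<^bsub>M\<^esub>i\<in>{i. f i \<noteq> \<zero>}. f i \<odot>\<^bsub>M\<^esub> u i)"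

end

locale twisted_map = twisted A p q e z + dg_ring_module A M
  for A :: "('k, 'a, 'n::finite) dg_struct" (structure)
    and p :: "'i \<Rightarrow> int" and q :: "'i \<Rightarrow> int ^ 'n" and e :: "'i \<Rightarrow> 'a" and z :: "'i \<Rightarrow> 'i \<Rightarrow> 'a"
    and M :: "('a, 'm, 'n) dg_struct" (structure) +
  fixes u :: "'i \<Rightarrow> 'm"
  assumes u_piece: "u i \<in> piece M (p i) (q i)"
    and u_diff: "phi u (z i) = diff M (u i)"
begin

lemma u_closed [simp]: "u i \<in> carrier M" using u_piece MG.piece_carrier by blast

lemma phi_superset:
  assumes "f \<in> carrier T" "finite S" "{i. f i \<noteq> \<zero>} \<subseteq> S"
  shows "phi u f = (\<Oplus>\<^bsub>M\<^esub>i\<in>S. f i \<odot>\<^bsub>M\<^esub> u i)"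
  unfolding phi_def
  by (rule M.add.finprod_mono_neutral_cong_left)
    (use assms in \<open>auto simp: T_closed act_closed\<close>)

lemma phi_closed [simp]: "f \<in> carrier T \<Longrightarrow> phi u f \<in> carrier M"
  unfolding phi_def by (rule M.finsum_closed) (auto simp: T_closed act_closed)

lemma phi_add:
  assumes "f \<in> carrier T" "f' \<in> carrier T"
  shows "phi u (\<lambda>i. f i \<oplus> f' i) = phi u f \<oplus>\<^bsub>M\<^esub> phi u f'"
proof -
  let ?S = "{i. f i \<noteq> \<zero>} \<union> {i. f' i \<noteq> \<zero>}"
  have fin: "finite ?S" using assms T_fin by blast
  have cl: "f i \<in> carrier A" "f' i \<in> carrier A" for i using assms T_closed by blast+
  have "phi u (\<lambda>i. f i \<oplus> f' i) = (\<Oplus>\<^bsub>M\<^esub>i\<in>?S. (f i \<oplus> f' i) \<odot>\<^bsub>M\<^esub> u i)"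
    by (rule phi_superset[OF T_add_closed[OF assms] fin]) auto
  also have "\<dots> = (\<Oplus>\<^bsub>M\<^esub>i\<in>?S. f i \<odot>\<^bsub>M\<^esub> u i) \<oplus>\<^bsub>M\<^esub> (\<Oplus>\<^bsub>M\<^esub>i\<in>?S. f' i \<odot>\<^bsub>M\<^esub> u i)"
    using cl by (subst M.finsum_addf[symmetric]) (auto simp: act_l_distr act_closed)
  also have "\<dots> = phi u f \<oplus>\<^bsub>M\<^esub> phi u f'"
    using phi_superset[OF assms(1) fin] phi_superset[OF assms(2) fin] by simp
  finally show ?thesis .
qed

lemma phi_smult:
  assumes "a \<in> carrier A" "f \<in> carrier T"
  shows "phi u (\<lambda>i. a \<otimes> f i) = a \<odot>\<^bsub>M\<^esub> phi u f"
proof -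
  have fin: "finite {i. f i \<noteq> \<zero>}" by (rule T_fin[OF assms(2)])
  have "phi u (\<lambda>i. a \<otimes> f i) = (\<Oplus>\<^bsub>M\<^esub>i\<in>{i. f i \<noteq> \<zero>}. (a \<otimes> f i) \<odot>\<^bsub>M\<^esub> u i)"
    by (rule phi_superset[OF T_smult_closed[OF assms] fin]) (use assms(1) in auto)
  also have "\<dots> = a \<odot>\<^bsub>M\<^esub> phi u f"
    unfolding phi_def using assms fin
    by (subst act_finsum) (auto simp: T_closed act_closed act_assoc intro!: M.finsum_cong')
  finally show ?thesis .
qed

lemma phi_single:
  assumes "a \<in> carrier A" "a \<otimes> e i = a"
  shows "phi u (single i a) = a \<odot>\<^bsub>M\<^esub> u i"
proof -
  have "phi u (single i a) = (\<Oplus>\<^bsub>M\<^esub>j\<in>{i}. single i a j \<odot>\<^bsub>M\<^esub> u j)"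
    by (rule phi_superset[OF single_closed[OF assms]]) (auto simp: single_def)
  then show ?thesis using assms by (simp add: single_def act_closed)
qed

lemma phi_piece:
  assumes "f \<in> piece T h g"
  shows "phi u f \<in> piece M h g"
  unfolding phi_def
proof (rule M.finsum_in_subgroup[OF MG.piece_subgroup], rule Pi_I)
  fix i
  have "f i \<in> piece A (h - p i) (g - q i)" using assms by (simp add: T_piece)
  from act_piece[OF this u_piece[of i]] show "f i \<odot>\<^bsub>M\<^esub> u i \<in> piece M h g" by simp
qed

text \<open>By \<open>T_induct\<close> it suffices to look at \<open>a x\<^sub>i\<close>, where both sides are
  given by the Leibniz rule and the assumption on \<open>u\<close> is the case \<open>a =
  e\<^sub>i\<close>.\<close>

lemma phi_diff:
  assumes "f \<in> carrier T"
  shows "phi u (diff T f) = diff M (phi u f)"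
  using assms
proof (induction f rule: T_induct)
  case zero
  have "diff T (\<lambda>i. \<zero>) = (\<lambda>k. \<zero>)" by (rule ext) (simp add: T_diff)
  then show ?case by (simp add: phi_def)
next
  case (add f f')
  then show ?case by (simp add: T_diff_add T_diff_closed phi_add diff_add)
next
  case (single i a)
  have s: "single i (diff A a) \<in> carrier T"
    using single by (simp add: single_closed diff_right_e)
  have t: "(\<lambda>k. sg a \<otimes> z i k) \<in> carrier T"
    using single T_smult_closed z_row_closed by simp
  have "phi u (diff T (single i a)) = phi u (single i (diff A a)) \<oplus>\<^bsub>M\<^esub> phi u (\<lambda>k. sg a \<otimes> z i k)"
    using single by (simp add: T_diff_single phi_add[OF s t])
  also have "\<dots> = (diff A a \<odot>\<^bsub>M\<^esub> u i) \<oplus>\<^bsub>M\<^esub> (sg a \<odot>\<^bsub>M\<^esub> diff M (u i))"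
    using single diff_right_e[of a i] by (simp add: phi_single phi_smult z_row_closed u_diff)
  also have "\<dots> = diff M (phi u (single i a))"
    using single by (simp add: phi_single leibniz_sg)
  finally show ?case .
qed

theorem phi_dg_hom: "dg_hom A T M (phi u)"
  unfolding dg_hom_def by (auto simp: phi_add phi_smult phi_diff intro: phi_piece)

end

text \<open>All data of one generator \<open>x\<^sub>i\<close>: bidegree, idempotent, the coefficients of
  \<open>d x\<^sub>i\<close>, and the image of \<open>x\<^sub>i\<close> in \<open>M\<close>. The
  cells are always indexed by the natural numbers; a cell with idempotent zero contributes nothing
  and serves as a vacant place. Attaching a cell is then an update of a sequence, and the limit of
  infinitely many attachments has the same type.\<close>

record ('a, 'm, 'n) cell =
  hdeg :: int
  wdeg :: "int ^ 'n"
  idem :: 'a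
  bdry :: "nat \<Rightarrow> 'a"
  img :: 'm

locale cells =
  twisted_map A "\<lambda>i. hdeg (c i)" "\<lambda>i. wdeg (c i)" "\<lambda>i. idem (c i)" "\<lambda>i. bdry (c i)" M "\<lambda>i. img (c i)"
  for A :: "('k, 'a, 'n::finite) dg_struct" (structure)
    and M :: "('a, 'm, 'n) dg_struct" (structure)
    and c :: "nat \<Rightarrow> ('a, 'm, 'n) cell"

context dg_ring_module
begin

abbreviation cT :: "(nat \<Rightarrow> ('a, 'm, 'n) cell) \<Rightarrow> ('a, nat \<Rightarrow> 'a, 'n) dg_struct" where
  "cT c \<equiv> twisted_module (\<lambda>i. hdeg (c i)) (\<lambda>i. wdeg (c i)) (\<lambda>i. idem (c i)) (\<lambda>i. bdry (c i))"

abbreviation cphi :: "(nat \<Rightarrow> ('a, 'm, 'n) cell) \<Rightarrow> (nat \<Rightarrow> 'a) \<Rightarrow> 'm" where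
  "cphi c \<equiv> phi (\<lambda>i. img (c i))"

definition valid_cells :: "(nat \<Rightarrow> ('a, 'm, 'n) cell) \<Rightarrow> bool" where
  "valid_cells c \<longleftrightarrow> cells A M c"

definition trivial_from :: "nat \<Rightarrow> (nat \<Rightarrow> ('a, 'm, 'n) cell) \<Rightarrow> bool" where
  "trivial_from n c \<longleftrightarrow>
    (\<forall>i\<ge>n. idem (c i) = \<zero> \<and> bdry (c i) = (\<lambda>_. \<zero>) \<and> img (c i) = \<zero>\<^bsub>M\<^esub>)"

lemma valid_cellsD:
  assumes "valid_cells c"
  shows "idem (c i) \<in> piece A 0 0" "idem (c i) \<in> carrier A" "bdry (c i) j \<in> carrier A"
    "bdry (c i) j \<otimes> idem (c j) = bdry (c i) j"
    "bdry (c i) j \<in> piece A (hdeg (c i) - 1 - hdeg (c j)) (wdeg (c i) - wdeg (c j))"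
    "img (c i) \<in> piece M (hdeg (c i)) (wdeg (c i))" "img (c i) \<in> carrier M"
    "cphi c (bdry (c i)) = diff M (img (c i))"
    "finite {j. bdry (c i) j \<noteq> \<zero>}"
    "bdry (c i) \<in> carrier (cT c)"
    "idem (c i) \<otimes> idem (c i) = idem (c i)"
    "diff A (idem (c i)) = \<zero>"
proof -
  interpret cells A M c
    using assms by (simp add: valid_cells_def)
  show "idem (c i) \<in> piece A 0 0" "idem (c i) \<in> carrier A" "bdry (c i) j \<in> carrier A"
    "bdry (c i) j \<otimes> idem (c j) = bdry (c i) j"
    "bdry (c i) j \<in> piece A (hdeg (c i) - 1 - hdeg (c j)) (wdeg (c i) - wdeg (c j))"
    "img (c i) \<in> piece M (hdeg (c i)) (wdeg (c i))" "img (c i) \<in> carrier M"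
    "cphi c (bdry (c i)) = diff M (img (c i))"
    "finite {j. bdry (c i) j \<noteq> \<zero>}"
    "bdry (c i) \<in> carrier (cT c)"
    "idem (c i) \<otimes> idem (c i) = idem (c i)"
    "diff A (idem (c i)) = \<zero>"
    using e_piece z_e z_piece u_piece u_diff z_fin z_row_closed e_idem e_diff by simp_all
qed

text \<open>An element only depends on the cells in its support: two sequences of cells which agree there give
  it the same degrees, boundary and image.\<close>

lemma cT_agree:
  assumes agree: "\<And>i. f i \<noteq> \<zero> \<Longrightarrow> c i = c' i"
    and c: "\<And>i. idem (c i) \<in> carrier A" "\<And>i k. bdry (c i) k \<in> carrier A" "\<And>i. img (c i) \<in> carrier M"
    and c': "\<And>i. idem (c' i) \<in> carrier A"
  shows "f \<in> carrier (cT c) \<longleftrightarrow> f \<in> carrier (cT c')"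
    and "f \<in> piece (cT c) h g \<longleftrightarrow> f \<in> piece (cT c') h g"
    and "f \<in> carrier (cT c) \<Longrightarrow> diff (cT c') f = diff (cT c) f"
    and "f \<in> carrier (cT c) \<Longrightarrow> cphi c' f = cphi c f"
proof -
  have "f i \<otimes> idem (c i) = f i \<longleftrightarrow> f i \<otimes> idem (c' i) = f i" for i
    using agree[of i] c c' by (cases "f i = \<zero>") auto
  then show *: "f \<in> carrier (cT c) \<longleftrightarrow> f \<in> carrier (cT c')" by (simp add: twisted_module_def)
  have "f i \<in> piece A (h - hdeg (c i)) (g - wdeg (c i)) \<longleftrightarrow>
      f i \<in> piece A (h - hdeg (c' i)) (g - wdeg (c' i))" for i
    using agree[of i] by (cases "f i = \<zero>") auto
  moreover have "f \<in> piece (cT c) h g \<longleftrightarrow>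
      f \<in> carrier (cT c) \<and> (\<forall>i. f i \<in> piece A (h - hdeg (c i)) (g - wdeg (c i)))" for c
    by (simp add: twisted_module_def)
  ultimately show "f \<in> piece (cT c) h g \<longleftrightarrow> f \<in> piece (cT c') h g" using * by simp
  assume f: "f \<in> carrier (cT c)"
  then have fc: "f i \<in> carrier A" for i by (simp add: twisted_module_def)
  have "finsum A (\<lambda>i. sg (f i) \<otimes> bdry (c' i) k) {i. f i \<noteq> \<zero>} =
      finsum A (\<lambda>i. sg (f i) \<otimes> bdry (c i) k) {i. f i \<noteq> \<zero>}" for k
    by (rule A_finsum_cong) (use fc c in \<open>auto dest: agree\<close>)
  then show "diff (cT c') f = diff (cT c) f" by (simp add: twisted_module_def)
  show "cphi c' f = cphi c f"
    unfolding phi_def by (rule M.finsum_cong') (use fc c in \<open>auto simp: act_closed dest: agree\<close>)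
qed

text \<open>The next vacant place is filled by a generator \<open>x\<close> with \<open>d x = \<epsilon>
  w\<close> and image \<open>\<epsilon> m\<close>. No boundary of a cell involves a vacant place, so
  the old conditions persist; the new ones say that \<open>\<epsilon> w\<close> is a cycle over
  \<open>d (\<epsilon> m)\<close>, which follows from \<open>d \<epsilon> = 0\<close>.\<close>

lemma attach_valid:
  assumes c: "valid_cells c" and triv: "trivial_from n c"
    and eps: "\<epsilon> \<in> piece A 0 0" "\<epsilon> \<otimes> \<epsilon> = \<epsilon>" "diff A \<epsilon> = \<zero>"
    and m: "m \<in> piece M h g"
    and w: "w \<in> piece (cT c) (h - 1) g" "diff (cT c) w = (\<lambda>_. \<zero>)" "cphi c w = diff M m"
  defines "c' \<equiv> c(n := \<lparr>hdeg = h, wdeg = g, idem = \<epsilon>, bdry = (\<lambda>j. \<epsilon> \<otimes> w j), img = \<epsilon> \<odot>\<^bsub>M\<^esub> m\<rparr>)"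
  shows "valid_cells c'" "trivial_from (Suc n) c'"
proof -
  interpret c: cells A M c
    using c by (simp add: valid_cells_def)
  have ec: "\<epsilon> \<in> carrier A" using eps(1) piece_carrier by blast
  have mc: "m \<in> carrier M" using m MG.piece_carrier by blast
  have wc: "w \<in> carrier (cT c)" using w(1) c.T_piece by blast
  have wA: "w j \<in> carrier A" for j using wc c.T_closed by blast
  have wP: "w j \<in> piece A (h - 1 - hdeg (c j)) (g - wdeg (c j))" for j
    using w(1) by (simp add: c.T_piece)
  \<comment> \<open>place \<open>n\<close> is vacant, so no element and no boundary involves it\<close>
  have en: "idem (c n) = \<zero>" using triv by (simp add: trivial_from_def)
  have at_n: "f n = \<zero>" if "f \<in> carrier (cT c)" for f
    using c.T_e[OF that, of n] c.T_closed[OF that, of n] en by simp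
  have zn: "bdry (c i) n = \<zero>" for i by (rule at_n[OF c.z_row_closed])
  have wn: "w n = \<zero>" by (rule at_n[OF wc])
  have z': "bdry (c' i) = (if i = n then \<lambda>j. \<epsilon> \<otimes> w j else bdry (c i))" for i
    by (simp add: c'_def)
  have z'n: "bdry (c' i) n = \<zero>" for i by (simp add: z' wn zn ec)
  have ew: "(\<lambda>j. \<epsilon> \<otimes> w j) \<in> carrier (cT c)" by (rule c.T_smult_closed[OF ec wc])
  have z'T: "bdry (c' i) \<in> carrier (cT c)" for i by (simp add: z' ew c.z_row_closed)
  have z'd: "diff (cT c) (bdry (c' i)) = (\<lambda>_. \<zero>)" for i
    using c.T_diff_z c.T_leibniz[OF ec wc] w(2) by (simp add: z' eps(3) wA ec)
  have z'A: "bdry (c' i) j \<in> carrier A" for i j using z'T c.T_closed by blast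
  have u': "img (c' i) \<in> carrier M" for i by (simp add: c'_def act_closed ec mc)
  have agree: "bdry (c' i) j \<noteq> \<zero> \<Longrightarrow> c j = c' j" for i j
    using z'n[of i] by (auto simp: c'_def)
  have e': "idem (c' i) \<in> carrier A" for i by (simp add: c'_def ec)
  have eq: "diff (cT c') (bdry (c' i)) = diff (cT c) (bdry (c' i))"
    "cphi c' (bdry (c' i)) = cphi c (bdry (c' i))" for i
    using agree z'T[of i] e'
    by (intro cT_agree(3,4); simp)+
  show "valid_cells c'"
    unfolding valid_cells_def
  proof (intro cells.intro twisted_map.intro twisted.intro twisted_axioms.intro twisted_map_axioms.intro
      dg_ring_axioms dg_ring_module_axioms)
    show "idem (c' i) \<in> piece A 0 0" for i by (simp add: c'_def eps c.e_piece)
    show "idem (c' i) \<otimes> idem (c' i) = idem (c' i)" for i by (simp add: c'_def eps c.e_idem)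
    show "diff A (idem (c' i)) = \<zero>" for i by (simp add: c'_def eps c.e_diff)
    show "finite {j. bdry (c' i) j \<noteq> \<zero>}" for i by (rule c.T_fin[OF z'T])
    show "bdry (c' i) j \<otimes> idem (c' j) = bdry (c' i) j" for i j
    proof (cases "j = n")
      case True
      then show ?thesis using z'n e' by simp
    next
      case False
      then show ?thesis using c.T_e[OF z'T[of i], of j] by (simp add: c'_def)
    qed
    show "bdry (c' i) j \<in> piece A (hdeg (c' i) - 1 - hdeg (c' j)) (wdeg (c' i) - wdeg (c' j))" for i j
    proof (cases "j = n")
      case True
      then show ?thesis using z'n by simp
    next
      case j: False
      show ?thesis
      proof (cases "i = n")
        case True
        then show ?thesis using j A_mult_piece[OF eps(1) wP[of j]] by (simp add: c'_def)
      next
        case False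
        then show ?thesis using j c.z_piece[of i j] by (simp add: c'_def)
      qed
    qed
    show "diff A (bdry (c' i) k) \<oplus>
        (\<Oplus>j\<in>{j. bdry (c' i) j \<noteq> \<zero>}. sg (bdry (c' i) j) \<otimes> bdry (c' j) k) = \<zero>" for i k
    proof -
      have "diff (cT c') (bdry (c' i)) k = \<zero>" using eq(1) z'd by simp
      then show ?thesis by (simp add: twisted_module_def)
    qed
    show "img (c' i) \<in> piece M (hdeg (c' i)) (wdeg (c' i))" for i
      using act_piece[OF eps(1) m] c.u_piece[of i] by (simp add: c'_def)
    show "cphi c' (bdry (c' i)) = diff M (img (c' i))" for i
    proof (cases "i = n")
      case True
      have "cphi c (\<lambda>j. \<epsilon> \<otimes> w j) = diff M (\<epsilon> \<odot>\<^bsub>M\<^esub> m)"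
        using c.phi_smult[OF ec wc] w(3) leibniz_sg[OF ec mc] eps mc ec
        by (simp add: sg_even act_closed)
      then show ?thesis using True eq(2)[of i] by (simp add: z') (simp add: c'_def)
    next
      case False
      then show ?thesis using eq(2)[of i] c.u_diff[of i] by (simp add: z') (simp add: c'_def)
    qed
  qed
  show "trivial_from (Suc n) c'" using triv by (simp add: trivial_from_def c'_def)
qed

end

section \<open>Strictly monotone ranks of families of subspaces\<close>

text \<open>The substitute for dimension: a rank which strictly increases along strict inclusions and is
  bounded, so that any process which strictly enlarges a member of \<open>\<W>\<close> must end. It
  needs no bases for subspaces of \<open>M\<^sub>g \<oplus> P\<^sub>g\<close>.\<close>

definition bounded_rank :: "'b set set \<Rightarrow> bool" where
  "bounded_rank \<W> \<longleftrightarrow> (\<exists>(r :: 'b set \<Rightarrow> nat) N. (\<forall>W\<in>\<W>. r W \<le> N) \<and>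
     (\<forall>W\<in>\<W>. \<forall>W'\<in>\<W>. W \<subset> W' \<longrightarrow> r W < r W'))"

lemma bounded_rankE:
  assumes "bounded_rank \<W>"
  obtains r N where "\<And>W. W \<in> \<W> \<Longrightarrow> r W \<le> (N :: nat)"
    "\<And>W W'. W \<in> \<W> \<Longrightarrow> W' \<in> \<W> \<Longrightarrow> W \<subset> W' \<Longrightarrow> r W < r W'"
proof -
  obtain r N where *: "(\<forall>W\<in>\<W>. r W \<le> (N :: nat)) \<and> (\<forall>W\<in>\<W>. \<forall>W'\<in>\<W>. W \<subset> W' \<longrightarrow> r W < r W')"
    using assms unfolding bounded_rank_def by blast
  show ?thesis by (rule that[of r N]) (use * in simp_all)
qed

text \<open>Models the additivity of dimension in an extension \<open>0 \<rightarrow> U \<rightarrow> V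
  \<rightarrow> V/U \<rightarrow> 0\<close>: \<open>\<kappa> W\<close> plays the role of \<open>W
  \<inter> U\<close> and \<open>\<pi> W\<close> that of the image of \<open>W\<close> in the
  quotient, and the sum of their ranks is a rank for \<open>W\<close>. The last assumption is the
  five lemma.\<close>

lemma bounded_rank_extension:
  assumes "bounded_rank \<W>\<^sub>1" "bounded_rank \<W>\<^sub>2"
    and "\<And>W. W \<in> \<W> \<Longrightarrow> \<kappa> W \<in> \<W>\<^sub>1" "\<And>W. W \<in> \<W> \<Longrightarrow> \<pi> W \<in> \<W>\<^sub>2"
    and "\<And>W W'. W \<in> \<W> \<Longrightarrow> W' \<in> \<W> \<Longrightarrow> W \<subseteq> W' \<Longrightarrow> \<kappa> W \<subseteq> \<kappa> W'"
    and "\<And>W W'. W \<in> \<W> \<Longrightarrow> W' \<in> \<W> \<Longrightarrow> W \<subseteq> W' \<Longrightarrow> \<pi> W \<subseteq> \<pi> W'"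
    and "\<And>W W'. \<lbrakk>W \<in> \<W>; W' \<in> \<W>; W \<subseteq> W'; \<kappa> W = \<kappa> W'; \<pi> W = \<pi> W'\<rbrakk> \<Longrightarrow> W' \<subseteq> W"
  shows "bounded_rank \<W>"
proof -
  obtain r1 N1 where 1: "\<And>W. W \<in> \<W>\<^sub>1 \<Longrightarrow> r1 W \<le> (N1 :: nat)"
    "\<And>W W'. W \<in> \<W>\<^sub>1 \<Longrightarrow> W' \<in> \<W>\<^sub>1 \<Longrightarrow> W \<subset> W' \<Longrightarrow> r1 W < r1 W'"
    by (rule bounded_rankE[OF assms(1)]) blast
  obtain r2 N2 where 2: "\<And>W. W \<in> \<W>\<^sub>2 \<Longrightarrow> r2 W \<le> (N2 :: nat)"
    "\<And>W W'. W \<in> \<W>\<^sub>2 \<Longrightarrow> W' \<in> \<W>\<^sub>2 \<Longrightarrow> W \<subset> W' \<Longrightarrow> r2 W < r2 W'"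
    by (rule bounded_rankE[OF assms(2)]) blast
  show ?thesis
    unfolding bounded_rank_def
  proof (intro exI[of _ "\<lambda>W. r1 (\<kappa> W) + r2 (\<pi> W)"] exI[of _ "N1 + N2"] conjI ballI impI)
    fix W assume "W \<in> \<W>"
    then show "r1 (\<kappa> W) + r2 (\<pi> W) \<le> N1 + N2"
      using 1(1) 2(1) assms(3,4) by (simp add: add_mono)
  next
    fix W W' assume W: "W \<in> \<W>" "W' \<in> \<W>" "W \<subset> W'"
    have \<kappa>: "r1 (\<kappa> W) < r1 (\<kappa> W') \<or> \<kappa> W = \<kappa> W'"
      using 1(2)[OF assms(3)[OF W(1)] assms(3)[OF W(2)]] assms(5)[OF W(1,2)] W(3) by blast
    have \<pi>: "r2 (\<pi> W) < r2 (\<pi> W') \<or> \<pi> W = \<pi> W'"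
      using 2(2)[OF assms(4)[OF W(1)] assms(4)[OF W(2)]] assms(6)[OF W(1,2)] W(3) by blast
    have "\<not> (\<kappa> W = \<kappa> W' \<and> \<pi> W = \<pi> W')"
      using assms(7)[OF W(1,2)] W(3) by blast
    with \<kappa> \<pi> show "r1 (\<kappa> W) + r2 (\<pi> W) < r1 (\<kappa> W') + r2 (\<pi> W')" by auto
  qed
qed

lemma bounded_rank_mono: "bounded_rank \<W>' \<Longrightarrow> \<W> \<subseteq> \<W>' \<Longrightarrow> bounded_rank \<W>"
  unfolding bounded_rank_def by (meson subset_iff)

lemma bounded_rank_reindex:
  assumes "bounded_rank \<W>'" "\<And>W. W \<in> \<W> \<Longrightarrow> \<kappa> W \<in> \<W>'"
    "\<And>W W'. W \<in> \<W> \<Longrightarrow> W' \<in> \<W> \<Longrightarrow> W \<subset> W' \<Longrightarrow> \<kappa> W \<subset> \<kappa> W'"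
  shows "bounded_rank \<W>"
proof -
  obtain r N where 1: "\<And>W. W \<in> \<W>' \<Longrightarrow> r W \<le> (N :: nat)"
    "\<And>W W'. W \<in> \<W>' \<Longrightarrow> W' \<in> \<W>' \<Longrightarrow> W \<subset> W' \<Longrightarrow> r W < r W'"
    by (rule bounded_rankE[OF assms(1)]) blast
  show ?thesis unfolding bounded_rank_def
    by (intro exI[of _ "\<lambda>W. r (\<kappa> W)"] exI[of _ N]) (simp add: 1 assms(2,3))
qed

locale scalar_action = K?: field K + G?: abelian_group G
  for K :: "('k, 'x) ring_scheme" (structure) and G :: "('g, 'y) ring_scheme" (structure) +
  fixes sc :: "'k \<Rightarrow> 'g \<Rightarrow> 'g"
  assumes sc_closed: "\<lbrakk>c \<in> carrier K; x \<in> carrier G\<rbrakk> \<Longrightarrow> sc c x \<in> carrier G"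
    and sc_l_distr: "\<lbrakk>c \<in> carrier K; d \<in> carrier K; x \<in> carrier G\<rbrakk>
      \<Longrightarrow> sc (c \<oplus>\<^bsub>K\<^esub> d) x = sc c x \<oplus>\<^bsub>G\<^esub> sc d x"
    and sc_r_distr: "\<lbrakk>c \<in> carrier K; x \<in> carrier G; y \<in> carrier G\<rbrakk>
      \<Longrightarrow> sc c (x \<oplus>\<^bsub>G\<^esub> y) = sc c x \<oplus>\<^bsub>G\<^esub> sc c y"
    and sc_assoc: "\<lbrakk>c \<in> carrier K; d \<in> carrier K; x \<in> carrier G\<rbrakk>
      \<Longrightarrow> sc (c \<otimes>\<^bsub>K\<^esub> d) x = sc c (sc d x)"
    and sc_one: "x \<in> carrier G \<Longrightarrow> sc \<one>\<^bsub>K\<^esub> x = x"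
begin

definition subsp :: "'g set \<Rightarrow> bool" where
  "subsp W \<longleftrightarrow> additive_subgroup W G \<and> (\<forall>c\<in>carrier K. \<forall>x\<in>W. sc c x \<in> W)"

definition lin :: "'g set \<Rightarrow> 'g set" where
  "lin B = {(\<Oplus>\<^bsub>G\<^esub>b\<in>B. sc (c b) b) | c. c \<in> B \<rightarrow> carrier K}"

lemma sc_zero: "x \<in> carrier G \<Longrightarrow> sc \<zero>\<^bsub>K\<^esub> x = \<zero>\<^bsub>G\<^esub>"
  by (rule K.additive_zero[OF G.abelian_group_axioms, of "\<lambda>c. sc c x"])
    (auto simp: sc_closed sc_l_distr)

lemma sc_r_zero: "c \<in> carrier K \<Longrightarrow> sc c \<zero>\<^bsub>G\<^esub> = \<zero>\<^bsub>G\<^esub>"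
  by (rule G.additive_zero[OF G.abelian_group_axioms, of "sc c"])
    (auto simp: sc_closed sc_r_distr)

lemma sc_uminus: "c \<in> carrier K \<Longrightarrow> x \<in> carrier G \<Longrightarrow> sc (\<ominus>\<^bsub>K\<^esub> c) x = \<ominus>\<^bsub>G\<^esub> sc c x"
  by (rule K.additive_uminus[OF G.abelian_group_axioms, of "\<lambda>c. sc c x"])
    (auto simp: sc_closed sc_l_distr)

lemma subsp_of_closed:
  assumes "W \<subseteq> carrier G" "\<zero>\<^bsub>G\<^esub> \<in> W" "\<And>x y. x \<in> W \<Longrightarrow> y \<in> W \<Longrightarrow> x \<oplus>\<^bsub>G\<^esub> y \<in> W"
    "\<And>c x. c \<in> carrier K \<Longrightarrow> x \<in> W \<Longrightarrow> sc c x \<in> W"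
  shows "subsp W"
proof -
  have "\<ominus>\<^bsub>G\<^esub> x \<in> W" if "x \<in> W" for x
  proof -
    have "x \<in> carrier G" using that assms(1) by blast
    then have "\<ominus>\<^bsub>G\<^esub> x = sc (\<ominus>\<^bsub>K\<^esub> \<one>\<^bsub>K\<^esub>) x" by (simp add: sc_uminus sc_one)
    then show ?thesis using assms(4)[OF _ that] by simp
  qed
  with assms show ?thesis unfolding subsp_def
    by (intro conjI ballI G.additive_subgroupI') auto
qed

lemma subspD:
  assumes "subsp W"
  shows "W \<subseteq> carrier G" "\<zero>\<^bsub>G\<^esub> \<in> W" "\<And>x y. x \<in> W \<Longrightarrow> y \<in> W \<Longrightarrow> x \<oplus>\<^bsub>G\<^esub> y \<in> W"
    "\<And>c x. c \<in> carrier K \<Longrightarrow> x \<in> W \<Longrightarrow> sc c x \<in> W" "\<And>x. x \<in> W \<Longrightarrow> \<ominus>\<^bsub>G\<^esub> x \<in> W"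
proof -
  have "additive_subgroup W G" using assms by (simp add: subsp_def)
  then interpret W: additive_subgroup W G .
  show "W \<subseteq> carrier G" "\<zero>\<^bsub>G\<^esub> \<in> W" "\<And>x y. x \<in> W \<Longrightarrow> y \<in> W \<Longrightarrow> x \<oplus>\<^bsub>G\<^esub> y \<in> W"
    using W.a_subset W.zero_closed W.a_closed by auto
  show "\<And>c x. c \<in> carrier K \<Longrightarrow> x \<in> W \<Longrightarrow> sc c x \<in> W" using assms by (simp add: subsp_def)
  show "\<And>x. x \<in> W \<Longrightarrow> \<ominus>\<^bsub>G\<^esub> x \<in> W"
    using G.additive_subgroup_uminus[OF W.additive_subgroup_axioms] .
qed

lemma lin_insert:
  assumes "finite B" "b \<notin> B" "insert b B \<subseteq> carrier G"
  shows "lin (insert b B) = {v \<oplus>\<^bsub>G\<^esub> sc c b | v c. v \<in> lin B \<and> c \<in> carrier K}"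
proof (intro equalityI subsetI)
  fix x assume "x \<in> lin (insert b B)"
  then obtain c where c: "c \<in> insert b B \<rightarrow> carrier K" "x = (\<Oplus>\<^bsub>G\<^esub>b\<in>insert b B. sc (c b) b)"
    unfolding lin_def by blast
  have f: "(\<lambda>b. sc (c b) b) \<in> B \<rightarrow> carrier G" "sc (c b) b \<in> carrier G"
    using c(1) assms(3) by (auto intro!: sc_closed)
  have "x = (\<Oplus>\<^bsub>G\<^esub>b\<in>B. sc (c b) b) \<oplus>\<^bsub>G\<^esub> sc (c b) b"
    unfolding c(2) using assms f G.finsum_closed[OF f(1)] by (simp add: G.a_comm)
  moreover have "(\<Oplus>\<^bsub>G\<^esub>b\<in>B. sc (c b) b) \<in> lin B" unfolding lin_def using c(1) by blast
  ultimately show "x \<in> {v \<oplus>\<^bsub>G\<^esub> sc c b | v c. v \<in> lin B \<and> c \<in> carrier K}" using c(1) by blast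
next
  fix x assume "x \<in> {v \<oplus>\<^bsub>G\<^esub> sc c b | v c. v \<in> lin B \<and> c \<in> carrier K}"
  then obtain c k where c: "c \<in> B \<rightarrow> carrier K" "k \<in> carrier K"
    "x = (\<Oplus>\<^bsub>G\<^esub>b\<in>B. sc (c b) b) \<oplus>\<^bsub>G\<^esub> sc k b"
    unfolding lin_def by blast
  let ?c = "c(b := k)"
  have f: "(\<lambda>b. sc (c b) b) \<in> B \<rightarrow> carrier G" "sc k b \<in> carrier G"
    using c assms(3) by (auto intro!: sc_closed)
  have eq: "(\<Oplus>\<^bsub>G\<^esub>b\<in>B. sc (?c b) b) = (\<Oplus>\<^bsub>G\<^esub>b\<in>B. sc (c b) b)"
    by (rule G.finsum_cong') (use f(1) assms(2) in auto)
  have f': "(\<lambda>b. sc (?c b) b) \<in> B \<rightarrow> carrier G" using f(1) assms(2) by auto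
  have "(\<Oplus>\<^bsub>G\<^esub>b\<in>insert b B. sc (?c b) b) = x"
    unfolding c(3) using assms f f' eq G.finsum_closed[OF f(1)]
    by (subst G.finsum_insert) (auto simp: G.a_comm)
  moreover have "?c \<in> insert b B \<rightarrow> carrier K" using c by auto
  ultimately show "x \<in> lin (insert b B)" unfolding lin_def by blast
qed

lemma lin_subsp: "finite B \<Longrightarrow> B \<subseteq> carrier G \<Longrightarrow> subsp (lin B)"
proof (induction B rule: finite_induct)
  case empty
  have "lin {} = {\<zero>\<^bsub>G\<^esub>}" by (auto simp: lin_def)
  moreover have "subsp {\<zero>\<^bsub>G\<^esub>}" by (rule subsp_of_closed) (simp_all add: sc_r_zero)
  ultimately show ?case by simp
next
  case (insert b B)
  have b: "b \<in> carrier G" using insert by simp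
  have "subsp (lin B)" using insert by simp
  note W = subspD[OF this]
  show ?case
    unfolding lin_insert[OF insert.hyps insert.prems]
  proof (rule subsp_of_closed)
    show "{v \<oplus>\<^bsub>G\<^esub> sc c b | v c. v \<in> lin B \<and> c \<in> carrier K} \<subseteq> carrier G"
      using W(1) b by (auto simp: sc_closed)
    have "\<zero>\<^bsub>G\<^esub> = \<zero>\<^bsub>G\<^esub> \<oplus>\<^bsub>G\<^esub> sc \<zero>\<^bsub>K\<^esub> b" using b by (simp add: sc_zero)
    then show "\<zero>\<^bsub>G\<^esub> \<in> {v \<oplus>\<^bsub>G\<^esub> sc c b | v c. v \<in> lin B \<and> c \<in> carrier K}" using W(2) by blast
  next
    fix x y assume "x \<in> {v \<oplus>\<^bsub>G\<^esub> sc c b | v c. v \<in> lin B \<and> c \<in> carrier K}"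
      "y \<in> {v \<oplus>\<^bsub>G\<^esub> sc c b | v c. v \<in> lin B \<and> c \<in> carrier K}"
    then obtain v c w d where v: "v \<in> lin B" "c \<in> carrier K" "x = v \<oplus>\<^bsub>G\<^esub> sc c b"
      and w: "w \<in> lin B" "d \<in> carrier K" "y = w \<oplus>\<^bsub>G\<^esub> sc d b" by blast
    have "v \<in> carrier G" "w \<in> carrier G" using v w W(1) by auto
    then have "x \<oplus>\<^bsub>G\<^esub> y = (v \<oplus>\<^bsub>G\<^esub> w) \<oplus>\<^bsub>G\<^esub> sc (c \<oplus>\<^bsub>K\<^esub> d) b"
      using v w b by (simp add: sc_l_distr sc_closed G.a_ac)
    then show "x \<oplus>\<^bsub>G\<^esub> y \<in> {v \<oplus>\<^bsub>G\<^esub> sc c b | v c. v \<in> lin B \<and> c \<in> carrier K}"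
      using v w W(3) K.a_closed by blast
  next
    fix k x assume k: "k \<in> carrier K" and "x \<in> {v \<oplus>\<^bsub>G\<^esub> sc c b | v c. v \<in> lin B \<and> c \<in> carrier K}"
    then obtain v c where v: "v \<in> lin B" "c \<in> carrier K" "x = v \<oplus>\<^bsub>G\<^esub> sc c b" by blast
    have "v \<in> carrier G" using v W(1) by auto
    then have "sc k x = sc k v \<oplus>\<^bsub>G\<^esub> sc (k \<otimes>\<^bsub>K\<^esub> c) b"
      using v k b by (simp add: sc_r_distr sc_closed sc_assoc)
    then show "sc k x \<in> {v \<oplus>\<^bsub>G\<^esub> sc c b | v c. v \<in> lin B \<and> c \<in> carrier K}"
      using v k W(4) K.m_closed by blast
  qed
qed

lemma lin_superset: "finite B \<Longrightarrow> B \<subseteq> carrier G \<Longrightarrow> B \<subseteq> lin B"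
proof (induction B rule: finite_induct)
  case (insert b B)
  have b: "b \<in> carrier G" using insert by simp
  have "subsp (lin B)" using insert lin_subsp by simp
  note W = subspD[OF this]
  show ?case
  proof
    fix x assume "x \<in> insert b B"
    then have "x = \<zero>\<^bsub>G\<^esub> \<oplus>\<^bsub>G\<^esub> sc \<one>\<^bsub>K\<^esub> b \<or> (x \<in> lin B \<and> x = x \<oplus>\<^bsub>G\<^esub> sc \<zero>\<^bsub>K\<^esub> b)"
      using b insert W(1) by (auto simp: sc_one sc_zero)
    then show "x \<in> lin (insert b B)"
      unfolding lin_insert[OF insert.hyps insert.prems]
      using W(2) K.one_closed K.zero_closed by blast
  qed
qed (simp add: lin_def)

text \<open>A new vector raises the rank by at most one. For \<open>W\<close> in the span of \<open>B\<close>
  and \<open>b\<close> the extension lemma is used with \<open>W \<inter> lin B\<close> and a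
  two-valued \<open>\<pi>\<close> which tells whether \<open>W\<close> leaves \<open>lin B\<close>.
  If it does, some \<open>w \<in> W\<close> has an invertible coefficient at \<open>b\<close> and
  every element of a larger subspace can be moved into \<open>lin B\<close> by subtracting a
  multiple of \<open>w\<close>.\<close>

lemma lin_bounded_rank:
  "finite B \<Longrightarrow> B \<subseteq> carrier G \<Longrightarrow> bounded_rank {W. subsp W \<and> W \<subseteq> lin B}"
proof (induction B rule: finite_induct)
  case empty
  have "lin {} = {\<zero>\<^bsub>G\<^esub>}" by (auto simp: lin_def)
  then have "\<not> (subsp W \<and> W \<subset> W')" if "W' \<subseteq> lin {}" for W W'
    using that subspD(2)[of W] by auto
  then show ?case unfolding bounded_rank_def
    by (intro exI[of _ "\<lambda>_. 0"] exI[of _ 0]) blast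
next
  case (insert b B)
  have b: "b \<in> carrier G" using insert by simp
  have L: "subsp (lin B)" using insert lin_subsp by simp
  note LD = subspD[OF L]
  show ?case
  proof (rule bounded_rank_extension[of "{W. subsp W \<and> W \<subseteq> lin B}" "{{}, {()}}"])
    show "bounded_rank {W. subsp W \<and> W \<subseteq> lin B}" using insert by simp
    show "bounded_rank {{}, {()}}"
      unfolding bounded_rank_def by (intro exI[of _ card] exI[of _ 1]) auto
    let ?\<kappa> = "\<lambda>W. W \<inter> lin B" and ?\<pi> = "\<lambda>W. if W \<subseteq> lin B then {} else {()}"
    fix W assume "W \<in> {W. subsp W \<and> W \<subseteq> lin (insert b B)}"
    then have W: "subsp W" "W \<subseteq> lin (insert b B)" by auto
    note WD = subspD[OF W(1)]
    show "?\<kappa> W \<in> {W. subsp W \<and> W \<subseteq> lin B}"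
    proof (intro CollectI conjI subsp_of_closed)
      show "W \<inter> lin B \<subseteq> carrier G" using WD(1) by blast
    qed (simp_all add: WD(2-4) LD(2-4))
    show "?\<pi> W \<in> {{}, {()}}" by simp
    fix W' assume "W' \<in> {W. subsp W \<and> W \<subseteq> lin (insert b B)}"
    then have W': "subsp W'" "W' \<subseteq> lin (insert b B)" by auto
    note WD' = subspD[OF W'(1)]
    assume sub: "W \<subseteq> W'"
    show "?\<kappa> W \<subseteq> ?\<kappa> W'" "?\<pi> W \<subseteq> ?\<pi> W'" using sub by auto
    assume \<kappa>: "?\<kappa> W = ?\<kappa> W'" and \<pi>: "?\<pi> W = ?\<pi> W'"
    show "W' \<subseteq> W"
    proof (cases "W' \<subseteq> lin B")
      case True
      have "W' \<inter> lin B \<subseteq> W" using \<kappa> by (metis inf_le1)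
      then show ?thesis using True by (simp add: inf.absorb1)
    next
      case False
      then have "\<not> W \<subseteq> lin B" using \<pi> by (auto split: if_splits)
      then obtain w where w: "w \<in> W" "w \<notin> lin B" by blast
      then obtain v c where v: "v \<in> lin B" "c \<in> carrier K" "w = v \<oplus>\<^bsub>G\<^esub> sc c b"
        using W(2) lin_insert[OF insert.hyps insert.prems] by blast
      have c0: "c \<noteq> \<zero>\<^bsub>K\<^esub>"
      proof
        assume "c = \<zero>\<^bsub>K\<^esub>"
        then have "w = v" using v b LD(1) by (auto simp: sc_zero)
        then show False using v w by simp
      qed
      then have cU: "c \<in> Units K" using v(2) K.field_Units by blast
      show ?thesis
      proof
        fix w' assume w': "w' \<in> W'"
        then obtain v' c' where v': "v' \<in> lin B" "c' \<in> carrier K" "w' = v' \<oplus>\<^bsub>G\<^esub> sc c' b"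
          using W'(2) lin_insert[OF insert.hyps insert.prems] by blast
        have vc: "v \<in> carrier G" "v' \<in> carrier G" "w \<in> carrier G" "w' \<in> carrier G"
          using v v' w w' LD(1) WD(1) WD'(1) by auto
        define d where "d = c' \<otimes>\<^bsub>K\<^esub> inv\<^bsub>K\<^esub> c"
        have d: "d \<in> carrier K" using v'(2) cU by (simp add: d_def)
        have dc: "d \<otimes>\<^bsub>K\<^esub> c = c'"
          using v'(2) v(2) cU by (simp add: d_def K.m_assoc)
        have dw: "sc d w = sc d v \<oplus>\<^bsub>G\<^esub> sc c' b"
          using v d b vc by (simp add: sc_r_distr sc_closed dc flip: sc_assoc)
        have "w' \<oplus>\<^bsub>G\<^esub> \<ominus>\<^bsub>G\<^esub> sc d w = v' \<oplus>\<^bsub>G\<^esub> \<ominus>\<^bsub>G\<^esub> sc d v"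
        proof -
          have s: "sc c' b \<in> carrier G" "sc d v \<in> carrier G" using v' d vc b by (auto simp: sc_closed)
          have "w' \<oplus>\<^bsub>G\<^esub> \<ominus>\<^bsub>G\<^esub> sc d w = (v' \<oplus>\<^bsub>G\<^esub> sc c' b) \<oplus>\<^bsub>G\<^esub> (\<ominus>\<^bsub>G\<^esub> sc d v \<oplus>\<^bsub>G\<^esub> \<ominus>\<^bsub>G\<^esub> sc c' b)"
            unfolding dw v'(3) using s by (simp add: G.minus_add)
          also have "\<dots> = (v' \<oplus>\<^bsub>G\<^esub> \<ominus>\<^bsub>G\<^esub> sc d v) \<oplus>\<^bsub>G\<^esub> (sc c' b \<oplus>\<^bsub>G\<^esub> \<ominus>\<^bsub>G\<^esub> sc c' b)"
            using s vc by (simp add: G.a_ac)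
          finally show ?thesis using s vc by (simp add: G.r_neg)
        qed
        moreover have "v' \<oplus>\<^bsub>G\<^esub> \<ominus>\<^bsub>G\<^esub> sc d v \<in> lin B" using v v' d by (simp add: LD(3-5))
        moreover have "w' \<oplus>\<^bsub>G\<^esub> \<ominus>\<^bsub>G\<^esub> sc d w \<in> W'" using w w' d sub by (simp add: WD'(3-5) subsetD)
        ultimately have 1: "w' \<oplus>\<^bsub>G\<^esub> \<ominus>\<^bsub>G\<^esub> sc d w \<in> W" using \<kappa> by auto
        have "w' = (w' \<oplus>\<^bsub>G\<^esub> \<ominus>\<^bsub>G\<^esub> sc d w) \<oplus>\<^bsub>G\<^esub> sc d w"
          using vc d by (simp add: G.a_assoc G.l_neg sc_closed)
        then show "w' \<in> W" using WD(3)[OF 1 WD(4)[OF d w(1)]] by simp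
      qed
    qed
  qed
qed

theorem fin_dim_bounded_rank:
  assumes "fin_dim K sc G V" "V \<subseteq> carrier G"
  shows "bounded_rank {W. subsp W \<and> W \<subseteq> V}"
proof -
  obtain B where "spans K sc G B V" using assms(1) unfolding fin_dim_def by blast
  then have B: "finite B" "B \<subseteq> V" and
    ex: "\<forall>v\<in>V. \<exists>c\<in>B \<rightarrow> carrier K. v = (\<Oplus>\<^bsub>G\<^esub>b\<in>B. sc (c b) b)"
    unfolding spans_def by blast+
  have "V \<subseteq> lin B" using ex unfolding lin_def by auto
  moreover have "B \<subseteq> carrier G" using B(2) assms(2) by simp
  ultimately show ?thesis
    by (intro bounded_rank_mono[OF lin_bounded_rank[OF B(1)]]) auto
qed

end

section \<open>Primitive idempotents and weight spaces\<close>

text \<open>If \<open>A\<^sub>0 = \<Oplus> L\<close> is a sum of simple left ideals and \<open>1 = \<Sum>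
  g\<^sub>L\<close> is the decomposition of the unit, then \<open>a = \<Sum> a g\<^sub>L\<close>
  must be the decomposition of any \<open>a\<close>. For \<open>a \<in> L\<close> this gives
  \<open>a g\<^sub>L = a\<close> and \<open>a g\<^bsub>L'\<^esub> = 0\<close> for \<open>L' \<noteq>
  L\<close>; so the \<open>g\<^sub>L\<close> are orthogonal idempotents and \<open>L = A\<^sub>0
  g\<^sub>L\<close>. Simplicity is phrased for sets \<open>J\<close> closed under the module
  operations.\<close>

lemma (in dg_ring) semisimple_idempotents:
  assumes "semisimple_ring (A\<lparr>carrier := piece A 0 0\<rparr>)"
  obtains E where "finite E" "E \<subseteq> piece A 0 0" "\<And>\<epsilon>. \<epsilon> \<in> E \<Longrightarrow> \<epsilon> \<otimes> \<epsilon> = \<epsilon>"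
    "(\<Oplus>\<epsilon>\<in>E. \<epsilon>) = \<one>"
    "\<And>\<epsilon> J. \<lbrakk>\<epsilon> \<in> E; J \<subseteq> {a \<in> piece A 0 0. a \<otimes> \<epsilon> = a}; \<zero> \<in> J;
        \<And>x y. x \<in> J \<Longrightarrow> y \<in> J \<Longrightarrow> x \<oplus> y \<in> J;
        \<And>a x. a \<in> piece A 0 0 \<Longrightarrow> x \<in> J \<Longrightarrow> a \<otimes> x \<in> J\<rbrakk>
      \<Longrightarrow> J = {\<zero>} \<or> J = {a \<in> piece A 0 0. a \<otimes> \<epsilon> = a}"
proof -
  let ?R = "A\<lparr>carrier := piece A 0 0\<rparr>"
  obtain \<L> where R: "ring ?R" and simple: "\<And>L. L \<in> \<L> \<Longrightarrow> simple_left_ideal ?R L"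
    and sum: "internal_direct_sum ?R \<L> (\<lambda>L. L)"
    using assms unfolding semisimple_ring_def by blast
  interpret R: ring ?R by (rule R)
  have pc: "x \<in> piece A 0 0 \<Longrightarrow> x \<in> carrier A" for x by (rule piece_carrier)
  have fs: "finsum ?R f S = finsum A f S" if "finite S" "f \<in> S \<rightarrow> piece A 0 0" for f :: "'b \<Rightarrow> 'a" and S
    using that
  proof (induction S)
    case (insert x S)
    have f: "f \<in> S \<rightarrow> piece A 0 0" "f x \<in> piece A 0 0" using insert.prems by auto
    then have "f \<in> S \<rightarrow> carrier A" "f x \<in> carrier A" using pc by auto
    then show ?case using insert f by simp
  qed simp
  have ideal: "L \<subseteq> piece A 0 0" "\<zero> \<in> L" "\<And>a x. a \<in> piece A 0 0 \<Longrightarrow> x \<in> L \<Longrightarrow> a \<otimes> x \<in> L"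
    if "L \<in> \<L>" for L
  proof -
    have l: "left_ideal ?R L" using simple[OF that] by (simp add: simple_left_ideal_def)
    then interpret L: additive_subgroup L ?R by (simp add: left_ideal_def)
    show "L \<subseteq> piece A 0 0" using L.a_subset by simp
    show "\<zero> \<in> L" using L.zero_closed by simp
    show "\<And>a x. a \<in> piece A 0 0 \<Longrightarrow> x \<in> L \<Longrightarrow> a \<otimes> x \<in> L" using l by (simp add: left_ideal_def)
  qed
  have uniq: "f = f'"
    if f: "\<And>L. L \<in> \<L> \<Longrightarrow> f L \<in> L" "\<And>L. L \<notin> \<L> \<Longrightarrow> f L = \<zero>"
      and f': "\<And>L. L \<in> \<L> \<Longrightarrow> f' L \<in> L" "\<And>L. L \<notin> \<L> \<Longrightarrow> f' L = \<zero>"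
      and S: "finite S" "\<And>L. f L \<noteq> \<zero> \<Longrightarrow> L \<in> S" "\<And>L. f' L \<noteq> \<zero> \<Longrightarrow> L \<in> S"
      and eq: "finsum A f S = finsum A f' S" for f f' S
  proof -
    have dec: "(\<forall>i\<in>\<L>. f i \<in> i) \<and> (\<forall>i. i \<notin> \<L> \<longrightarrow> f i = \<zero>\<^bsub>?R\<^esub>) \<and> finite {i. f i \<noteq> \<zero>\<^bsub>?R\<^esub>} \<and>
        finsum A f S = finsum ?R f {i. f i \<noteq> \<zero>\<^bsub>?R\<^esub>}"
      if f: "\<And>L. L \<in> \<L> \<Longrightarrow> f L \<in> L" "\<And>L. L \<notin> \<L> \<Longrightarrow> f L = \<zero>" and S': "\<And>L. f L \<noteq> \<zero> \<Longrightarrow> L \<in> S" for f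
    proof -
      have sub: "{i. f i \<noteq> \<zero>} \<subseteq> S" using S' by blast
      then have fin: "finite {i. f i \<noteq> \<zero>}" using S(1) by (rule finite_subset)
      have fp: "f L \<in> piece A 0 0" for L
        using f[of L] ideal(1)[of L] by (cases "L \<in> \<L>") auto
      have "finsum A f S = finsum A f {i. f i \<noteq> \<zero>}"
        by (rule add.finprod_mono_neutral_cong_right) (use S(1) sub pc[OF fp] in auto)
      also have "\<dots> = finsum ?R f {i. f i \<noteq> \<zero>}" by (rule fs[symmetric]) (use fin fp in auto)
      finally show ?thesis using f fin by simp
    qed
    have "finsum A f S \<in> carrier ?R"
    proof -
      have "f L \<in> piece A 0 0" for L
        using f[of L] ideal(1)[of L] by (cases "L \<in> \<L>") auto
      then show ?thesis by (simp add: finsum_in_subgroup[OF piece_subgroup])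
    qed
    then have ex1: "\<exists>!g. (\<forall>i\<in>\<L>. g i \<in> i) \<and> (\<forall>i. i \<notin> \<L> \<longrightarrow> g i = \<zero>\<^bsub>?R\<^esub>) \<and> finite {i. g i \<noteq> \<zero>\<^bsub>?R\<^esub>} \<and>
        finsum A f S = finsum ?R g {i. g i \<noteq> \<zero>\<^bsub>?R\<^esub>}"
      using sum unfolding internal_direct_sum_def by blast
    have 1: "(\<forall>i\<in>\<L>. f i \<in> i) \<and> (\<forall>i. i \<notin> \<L> \<longrightarrow> f i = \<zero>\<^bsub>?R\<^esub>) \<and> finite {i. f i \<noteq> \<zero>\<^bsub>?R\<^esub>} \<and>
        finsum A f S = finsum ?R f {i. f i \<noteq> \<zero>\<^bsub>?R\<^esub>}"
      by (rule dec) (fact f(1), fact f(2), fact S(2))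
    have 2: "(\<forall>i\<in>\<L>. f' i \<in> i) \<and> (\<forall>i. i \<notin> \<L> \<longrightarrow> f' i = \<zero>\<^bsub>?R\<^esub>) \<and> finite {i. f' i \<noteq> \<zero>\<^bsub>?R\<^esub>} \<and>
        finsum A f S = finsum ?R f' {i. f' i \<noteq> \<zero>\<^bsub>?R\<^esub>}"
      unfolding eq by (rule dec) (fact f'(1), fact f'(2), fact S(3))
    show "f = f'"
      using the1_equality[of _ f, OF ex1 1] the1_equality[of _ f', OF ex1 2] by (rule trans[OF sym])
  qed
  have "\<one> \<in> carrier ?R" using A_one_piece by simp
  then have "\<exists>!g. (\<forall>i\<in>\<L>. g i \<in> i) \<and> (\<forall>i. i \<notin> \<L> \<longrightarrow> g i = \<zero>\<^bsub>?R\<^esub>) \<and> finite {i. g i \<noteq> \<zero>\<^bsub>?R\<^esub>} \<and>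
        \<one> = finsum ?R g {i. g i \<noteq> \<zero>\<^bsub>?R\<^esub>}"
    using sum unfolding internal_direct_sum_def by blast
  then obtain g where "(\<forall>i\<in>\<L>. g i \<in> i) \<and> (\<forall>i. i \<notin> \<L> \<longrightarrow> g i = \<zero>\<^bsub>?R\<^esub>) \<and> finite {i. g i \<noteq> \<zero>\<^bsub>?R\<^esub>} \<and>
        \<one> = finsum ?R g {i. g i \<noteq> \<zero>\<^bsub>?R\<^esub>}" by (rule ex1E)
  then have g: "\<forall>i\<in>\<L>. g i \<in> i" "\<forall>i. i \<notin> \<L> \<longrightarrow> g i = \<zero>" "finite {i. g i \<noteq> \<zero>}"
      "\<one> = finsum ?R g {i. g i \<noteq> \<zero>}" by simp_all
  let ?S = "{i. g i \<noteq> \<zero>}"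
  have gp: "g L \<in> piece A 0 0" for L
    using g(1,2) ideal(1)[of L] by (cases "L \<in> \<L>") auto
  have gc: "g L \<in> carrier A" for L using pc[OF gp] .
  have one: "(\<Oplus>L\<in>?S. g L) = \<one>" using g(4) fs[OF g(3), of g] gp by simp
  \<comment> \<open>both sides are decompositions of \<open>a = a \<cdot> 1\<close>, one of them
                  concentrated in \<open>L0\<close>\<close>
  have ag: "a \<otimes> g L = (if L = L0 then a else \<zero>)" if L0: "L0 \<in> \<L>" "a \<in> L0" for a L0 L
  proof -
    have a: "a \<in> piece A 0 0" using ideal(1) that by blast
    have "(\<lambda>L. a \<otimes> g L) = (\<lambda>L. if L = L0 then a else \<zero>)"
    proof (rule uniq[of _ _ "insert L0 ?S"])
      show "a \<otimes> g L \<in> L" if "L \<in> \<L>" for L using ideal(3)[OF that a] g(1) that by blast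
      show "a \<otimes> g L = \<zero>" if "L \<notin> \<L>" for L using g(2) that pc[OF a] by simp
      show "(if L = L0 then a else \<zero>) \<in> L" if "L \<in> \<L>" for L using ideal(2)[OF that] L0 by simp
      show "(if L = L0 then a else \<zero>) = \<zero>" if "L \<notin> \<L>" for L using L0 that by auto
      show "finite (insert L0 ?S)" using g(3) by simp
      show "L \<in> insert L0 ?S" if "a \<otimes> g L \<noteq> \<zero>" for L using that pc[OF a] by auto
      show "L \<in> insert L0 ?S" if "(if L = L0 then a else \<zero>) \<noteq> \<zero>" for L
        using that by (auto split: if_splits)
      have "(\<Oplus>L\<in>insert L0 ?S. a \<otimes> g L) = a \<otimes> (\<Oplus>L\<in>insert L0 ?S. g L)"
        by (rule finsum_rdistr[symmetric]) (use g(3) gc pc[OF a] in auto)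
      also have "(\<Oplus>L\<in>insert L0 ?S. g L) = (\<Oplus>L\<in>?S. g L)"
        by (rule add.finprod_mono_neutral_cong_right) (use g(3) gc in auto)
      also have "a \<otimes> \<dots> = a" using one pc[OF a] by simp
      also have "a = (\<Oplus>L\<in>insert L0 ?S. if L = L0 then a else \<zero>)"
        using add.finprod_singleton[of L0 "insert L0 ?S" "\<lambda>_. a"] g(3) pc[OF a]
        by (simp add: eq_commute)
      finally show "(\<Oplus>L\<in>insert L0 ?S. a \<otimes> g L) = (\<Oplus>L\<in>insert L0 ?S. if L = L0 then a else \<zero>)" .
    qed
    then show ?thesis by (rule fun_cong)
  qed
  have SL: "L \<in> \<L>" if "L \<in> ?S" for L using g(2) that by blast
  have gg: "g L \<otimes> g L' = (if L = L' then g L else \<zero>)" if "L \<in> ?S" for L L'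
    using ag[OF SL[OF that], of "g L" L'] g(1) SL[OF that] by auto
  have inj: "inj_on g ?S"
  proof (rule inj_onI)
    fix L L' assume L: "L \<in> ?S" "L' \<in> ?S" "g L = g L'"
    then have "g L \<otimes> g L' = g L" using gg[OF L(1), of L] by simp
    then show "L = L'" using gg[OF L(1), of L'] L(1) by (auto split: if_splits)
  qed
  show ?thesis
  proof (rule that[of "g ` ?S"])
    show "finite (g ` ?S)" using g(3) by simp
    show "g ` ?S \<subseteq> piece A 0 0" using gp by blast
    show "\<epsilon> \<otimes> \<epsilon> = \<epsilon>" if "\<epsilon> \<in> g ` ?S" for \<epsilon> using that gg by auto
    show "(\<Oplus>\<epsilon>\<in>g ` ?S. \<epsilon>) = \<one>"
      using add.finprod_reindex[of "\<lambda>x. x" g ?S] inj gc one by auto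
    fix \<epsilon> J assume eps: "\<epsilon> \<in> g ` ?S" and J: "J \<subseteq> {a \<in> piece A 0 0. a \<otimes> \<epsilon> = a}" "\<zero> \<in> J"
      "\<And>x y. x \<in> J \<Longrightarrow> y \<in> J \<Longrightarrow> x \<oplus> y \<in> J"
      "\<And>a x. a \<in> piece A 0 0 \<Longrightarrow> x \<in> J \<Longrightarrow> a \<otimes> x \<in> J"
    from eps obtain L where L: "L \<in> ?S" "\<epsilon> = g L" by blast
    have LL: "L \<in> \<L>" using SL L(1) by blast
    have gL: "g L \<in> L" using g(1) LL by blast
    have Leq: "{a \<in> piece A 0 0. a \<otimes> \<epsilon> = a} = L"
    proof (intro equalityI subsetI)
      fix a assume "a \<in> {a \<in> piece A 0 0. a \<otimes> \<epsilon> = a}"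
      then have "a \<in> piece A 0 0" "a \<otimes> g L = a" using L(2) by auto
      with ideal(3)[OF LL this(1) gL] show "a \<in> L" by simp
    next
      fix a assume "a \<in> L"
      then show "a \<in> {a \<in> piece A 0 0. a \<otimes> \<epsilon> = a}"
        using ag[OF LL, of a L] ideal(1)[OF LL] L(2) by auto
    qed
    have Jp: "J \<subseteq> piece A 0 0" using J(1) by blast
    have "left_ideal ?R J"
      unfolding left_ideal_def
    proof (intro conjI ballI R.additive_subgroupI')
      fix x assume x: "x \<in> J"
      have "\<ominus>\<^bsub>?R\<^esub> x = (\<ominus>\<^bsub>?R\<^esub> \<one>\<^bsub>?R\<^esub>) \<otimes>\<^bsub>?R\<^esub> x"
        using R.l_minus[of "\<one>\<^bsub>?R\<^esub>" x] R.one_closed x Jp by (simp add: subsetD pc)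
      then show "\<ominus>\<^bsub>?R\<^esub> x \<in> J"
        using J(4)[OF _ x, of "\<ominus>\<^bsub>?R\<^esub> \<one>\<^bsub>?R\<^esub>"] R.a_inv_closed[OF R.one_closed] by simp
    qed (use Jp J(2-4) in simp_all)
    moreover have "J \<subseteq> L" using J(1) Leq by simp
    ultimately have "J = {\<zero>} \<or> J = L"
      using simple[OF LL] by (simp add: simple_left_ideal_def)
    then show "J = {\<zero>} \<or> J = {a \<in> piece A 0 0. a \<otimes> \<epsilon> = a}" using Leq by simp
  qed
qed

text \<open>In the locale \<open>dg_ring_module\<close> the original names denote the facts about
  \<open>M\<close>.\<close>

lemmas (in dg_ring) A_additive_subgroupI' = additive_subgroupI'
lemmas (in dg_ring) A_group_simps = a_assoc l_neg r_neg

context dg_ring_module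
begin

lemma component_act_degree_zero:
  assumes a: "a \<in> piece A 0 0" and x: "x \<in> carrier M"
  shows "component M i (a \<odot>\<^bsub>M\<^esub> x) = a \<odot>\<^bsub>M\<^esub> component M i x"
  using x
proof (induction x rule: MG.graded_induct)
  case zero
  show ?case using piece_carrier[OF a] by simp
next
  case (add x y)
  then show ?case using piece_carrier[OF a]
    by (simp add: act_r_distr MG.component_add MG.component_closed act_closed)
next
  case (piece x h g)
  have ax: "a \<odot>\<^bsub>M\<^esub> x \<in> piece M h g" using act_piece[OF a piece] by simp
  show ?case
    using MG.component_same[OF ax] MG.component_same[OF piece] MG.component_other[OF ax, of i]
      MG.component_other[OF piece, of i] piece_carrier[OF a] by (cases "i = (h, g)") simp_all
qed

lemma zpart_act: "a \<in> piece A 0 0 \<Longrightarrow> x \<in> zpart M g \<Longrightarrow> a \<odot>\<^bsub>M\<^esub> x \<in> zpart M g"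
  using piece_carrier[of a 0 0] by (simp add: MG.zpart_iff component_act_degree_zero act_closed)

lemma zpart_diff: "x \<in> zpart M g \<Longrightarrow> diff M x \<in> zpart M g"
  by (simp add: MG.zpart_iff component_diff)

lemma zpart_add: "x \<in> zpart M g \<Longrightarrow> y \<in> zpart M g \<Longrightarrow> x \<oplus>\<^bsub>M\<^esub> y \<in> zpart M g"
  by (simp add: MG.zpart_iff MG.component_add)

lemma zpart_uminus: "x \<in> zpart M g \<Longrightarrow> \<ominus>\<^bsub>M\<^esub> x \<in> zpart M g"
  by (simp add: MG.zpart_iff MG.component_uminus)

text \<open>With \<open>S = K \<cdot> 1\<close> these three notions are the \<open>K\<close>-subspaces of
  \<open>A\<close>, of \<open>M\<close> and of \<open>M \<oplus> (\<Oplus>\<^sub>i A)\<close>; using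
  a set \<open>S\<close> of elements of \<open>A\<close> keeps the field out of the construction.\<close>

definition A_sub :: "'a set \<Rightarrow> 'a set \<Rightarrow> bool" where
  "A_sub S W \<longleftrightarrow> additive_subgroup W A \<and> (\<forall>s\<in>S. \<forall>x\<in>W. s \<otimes> x \<in> W)"

definition M_sub :: "'a set \<Rightarrow> 'm set \<Rightarrow> bool" where
  "M_sub S W \<longleftrightarrow> additive_subgroup W M \<and> (\<forall>s\<in>S. \<forall>x\<in>W. s \<odot>\<^bsub>M\<^esub> x \<in> W)"

definition pair_sub :: "'a set \<Rightarrow> ('m \<times> (nat \<Rightarrow> 'a)) set \<Rightarrow> bool" where
  "pair_sub S W \<longleftrightarrow> (\<zero>\<^bsub>M\<^esub>, \<lambda>_. \<zero>) \<in> W \<and>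
    (\<forall>m f m' f'. (m, f) \<in> W \<longrightarrow> (m', f') \<in> W \<longrightarrow> (m \<oplus>\<^bsub>M\<^esub> m', \<lambda>i. f i \<oplus> f' i) \<in> W) \<and>
    (\<forall>m f. (m, f) \<in> W \<longrightarrow> (\<ominus>\<^bsub>M\<^esub> m, \<lambda>i. \<ominus> f i) \<in> W) \<and>
    (\<forall>s\<in>S. \<forall>m f. (m, f) \<in> W \<longrightarrow> (s \<odot>\<^bsub>M\<^esub> m, \<lambda>i. s \<otimes> f i) \<in> W)"

lemma pair_subD:
  assumes "pair_sub S W"
  shows "(\<zero>\<^bsub>M\<^esub>, \<lambda>_. \<zero>) \<in> W"
    "\<And>m f m' f'. (m, f) \<in> W \<Longrightarrow> (m', f') \<in> W \<Longrightarrow> (m \<oplus>\<^bsub>M\<^esub> m', \<lambda>i. f i \<oplus> f' i) \<in> W"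
    "\<And>m f. (m, f) \<in> W \<Longrightarrow> (\<ominus>\<^bsub>M\<^esub> m, \<lambda>i. \<ominus> f i) \<in> W"
    "\<And>s m f. s \<in> S \<Longrightarrow> (m, f) \<in> W \<Longrightarrow> (s \<odot>\<^bsub>M\<^esub> m, \<lambda>i. s \<otimes> f i) \<in> W"
  using assms unfolding pair_sub_def by (simp_all add: Ball_def)

text \<open>Induction on the number of coordinates. The last coordinate gives a map to \<open>V n\<close>,
  whose kernel consists of pairs with one coordinate less; \<open>bounded_rank_extension\<close>
  applies to this kernel and the image.\<close>

lemma pair_rank:
  assumes S: "S \<subseteq> carrier A"
    and U: "bounded_rank {W. M_sub S W \<and> W \<subseteq> U}" "U \<subseteq> carrier M"
    and V: "\<And>i. bounded_rank {W. A_sub S W \<and> W \<subseteq> V i}" "\<And>i. V i \<subseteq> carrier A"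
  shows "bounded_rank {W. pair_sub S W \<and>
    W \<subseteq> {(m, f). m \<in> U \<and> (\<forall>i<n. f i \<in> V i) \<and> (\<forall>i\<ge>n. f i = \<zero>)}}"
proof (induction n)
  case 0
  let ?\<W> = "{W. pair_sub S W \<and> W \<subseteq> {(m, f). m \<in> U \<and> (\<forall>i<0. f i \<in> V i) \<and> (\<forall>i\<ge>0. f i = \<zero>)}}"
  show ?case
  proof (rule bounded_rank_reindex[OF U(1), of _ "\<lambda>W. fst ` W"])
    fix W assume "W \<in> ?\<W>"
    then have W: "pair_sub S W" and sub: "\<And>m f. (m, f) \<in> W \<Longrightarrow> m \<in> U \<and> f = (\<lambda>_. \<zero>)" by auto
    note WD = pair_subD[OF W]
    have mem: "m \<in> fst ` W \<longleftrightarrow> (m, \<lambda>_. \<zero>) \<in> W" for m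
    proof
      assume "m \<in> fst ` W"
      then obtain f where "(m, f) \<in> W" by auto
      then show "(m, \<lambda>_. \<zero>) \<in> W" using sub[of m f] by simp
    qed force
    have "M_sub S (fst ` W)"
      unfolding M_sub_def
    proof (intro conjI ballI M.additive_subgroupI')
      show "fst ` W \<subseteq> carrier M" using U(2) by (auto dest: sub)
      show "\<zero>\<^bsub>M\<^esub> \<in> fst ` W" using WD(1) mem by simp
      fix x assume x: "x \<in> fst ` W"
      show "\<ominus>\<^bsub>M\<^esub> x \<in> fst ` W" using WD(3)[of x "\<lambda>_. \<zero>"] x unfolding mem by simp
      show "x \<oplus>\<^bsub>M\<^esub> y \<in> fst ` W" if "y \<in> fst ` W" for y
        using WD(2)[of x "\<lambda>_. \<zero>" y "\<lambda>_. \<zero>"] x that unfolding mem by simp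
      show "s \<odot>\<^bsub>M\<^esub> x \<in> fst ` W" if "s \<in> S" for s
        using WD(4)[OF that, of x "\<lambda>_. \<zero>"] x S that unfolding mem by (simp add: subsetD)
    qed
    moreover have "fst ` W \<subseteq> U" by (auto dest: sub)
    ultimately show "fst ` W \<in> {W. M_sub S W \<and> W \<subseteq> U}" by simp
    fix W' assume "W' \<in> ?\<W>"
    then have sub': "\<And>m f. (m, f) \<in> W' \<Longrightarrow> m \<in> U \<and> f = (\<lambda>_. \<zero>)" by auto
    assume "W \<subset> W'"
    then obtain m f where mf: "(m, f) \<in> W'" "(m, f) \<notin> W" by auto
    then have "m \<notin> fst ` W" using mem sub'[OF mf(1)] by auto
    moreover have "m \<in> fst ` W'" using mf(1) by force
    ultimately show "fst ` W \<subset> fst ` W'" using \<open>W \<subset> W'\<close> by blast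
  qed
next
  case (Suc n)
  let ?X = "\<lambda>n. {(m, f). m \<in> U \<and> (\<forall>i<n. f i \<in> V i) \<and> (\<forall>i\<ge>n. f i = \<zero>)}"
  let ?\<kappa> = "\<lambda>W. {(m, f). (m, f) \<in> W \<and> f n = \<zero>}"
  let ?\<pi> = "\<lambda>W. (\<lambda>(m, f). f n) ` W"
  show ?case
  proof (rule bounded_rank_extension[OF Suc.IH V(1)[of n], of _ ?\<kappa> ?\<pi>])
    fix W assume "W \<in> {W. pair_sub S W \<and> W \<subseteq> ?X (Suc n)}"
    then have W: "pair_sub S W" and sub: "W \<subseteq> ?X (Suc n)" by auto
    note WD = pair_subD[OF W]
    have cl: "m \<in> carrier M" "f i \<in> carrier A" if "(m, f) \<in> W" for m f i
    proof -
      have *: "m \<in> U" "\<forall>i<Suc n. f i \<in> V i" "\<forall>i\<ge>Suc n. f i = \<zero>" using sub that by auto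
      then show "m \<in> carrier M" using U(2) by blast
      show "f i \<in> carrier A" using * V(2)[of i] by (cases "i < Suc n") auto
    qed
    have "pair_sub S (?\<kappa> W)"
      unfolding pair_sub_def using WD cl S by (auto simp: subsetD)
    moreover have "?\<kappa> W \<subseteq> ?X n"
    proof clarify
      fix m f assume mf: "(m, f) \<in> W" "f n = \<zero>"
      then have *: "m \<in> U" "\<forall>i<Suc n. f i \<in> V i" "\<forall>i\<ge>Suc n. f i = \<zero>" using sub by auto
      then show "m \<in> U \<and> (\<forall>i<n. f i \<in> V i) \<and> (\<forall>i\<ge>n. f i = \<zero>)"
        using mf(2) by (metis Suc_leI less_SucI order_le_less)
    qed
    ultimately show "?\<kappa> W \<in> {W. pair_sub S W \<and> W \<subseteq> ?X n}" by simp
    have "A_sub S (?\<pi> W)"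
      unfolding A_sub_def
    proof (intro conjI ballI A_additive_subgroupI')
      show "?\<pi> W \<subseteq> carrier A" using cl by auto
      show "\<zero> \<in> ?\<pi> W" using WD(1) by force
      fix x assume "x \<in> ?\<pi> W"
      then obtain m f where x: "(m, f) \<in> W" "x = f n" by auto
      show "\<ominus> x \<in> ?\<pi> W" by (rule image_eqI[OF _ WD(3)[OF x(1)]]) (simp add: x(2))
      show "x \<oplus> y \<in> ?\<pi> W" if y': "y \<in> ?\<pi> W" for y
      proof -
        obtain m' f' where y: "(m', f') \<in> W" "y = f' n" using y' by auto
        show ?thesis by (rule image_eqI[OF _ WD(2)[OF x(1) y(1)]]) (simp add: x(2) y(2))
      qed
      show "s \<otimes> x \<in> ?\<pi> W" if "s \<in> S" for s by (rule image_eqI[OF _ WD(4)[OF that x(1)]]) (simp add: x(2))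
    qed
    moreover have "?\<pi> W \<subseteq> V n" using sub by auto
    ultimately show "?\<pi> W \<in> {W. A_sub S W \<and> W \<subseteq> V n}" by simp
    fix W' assume "W' \<in> {W. pair_sub S W \<and> W \<subseteq> ?X (Suc n)}"
    then have W': "pair_sub S W'" and sub': "W' \<subseteq> ?X (Suc n)" by auto
    note WD' = pair_subD[OF W']
    have cl': "m \<in> carrier M" "f i \<in> carrier A" if "(m, f) \<in> W'" for m f i
    proof -
      have *: "m \<in> U" "\<forall>i<Suc n. f i \<in> V i" "\<forall>i\<ge>Suc n. f i = \<zero>" using sub' that by auto
      then show "m \<in> carrier M" using U(2) by blast
      show "f i \<in> carrier A" using * V(2)[of i] by (cases "i < Suc n") auto
    qed
    assume le: "W \<subseteq> W'"
    show "?\<kappa> W \<subseteq> ?\<kappa> W'" "?\<pi> W \<subseteq> ?\<pi> W'" using le by blast+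
    assume eq: "?\<kappa> W = ?\<kappa> W'" "?\<pi> W = ?\<pi> W'"
    show "W' \<subseteq> W"
    proof clarify
      fix m' f' assume mf': "(m', f') \<in> W'"
      then have "f' n \<in> ?\<pi> W'" by force
      \<comment> \<open>equal images: some element of \<open>W\<close> has the same last coordinate,
                      and the difference lies in the common kernel\<close>
      then obtain m f where mf: "(m, f) \<in> W" "f n = f' n" unfolding eq(2)[symmetric] by force
      have mfW': "(m, f) \<in> W'" using mf(1) le by blast
      note c = cl'[OF mf'] cl'[OF mfW']
      have "f' n \<oplus> \<ominus> f n = \<zero>" using c(2)[of n] mf(2) by (simp add: A_group_simps)
      then have "(m' \<oplus>\<^bsub>M\<^esub> \<ominus>\<^bsub>M\<^esub> m, \<lambda>i. f' i \<oplus> \<ominus> f i) \<in> ?\<kappa> W'"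
        using WD'(2)[OF mf' WD'(3)[OF mfW']] by simp
      then have "(m' \<oplus>\<^bsub>M\<^esub> \<ominus>\<^bsub>M\<^esub> m, \<lambda>i. f' i \<oplus> \<ominus> f i) \<in> W" unfolding eq(1)[symmetric] by simp
      from WD(2)[OF this mf(1)]
      show "(m', f') \<in> W" using c by (simp add: A_group_simps M.a_assoc M.l_neg)
    qed
  qed
qed

end

context twisted
begin

lemma T_dg_ring_module: "dg_ring_module A T"
  by (intro dg_ring_module.intro dg_ring_axioms T_dg_module)

lemma T_component:
  assumes "f \<in> carrier T"
  shows "component T (h, g) f = (\<lambda>i. component A (h - p i, g - q i) (f i))"
proof -
  interpret T: dg_ring_module A T by (rule T_dg_ring_module)
  show ?thesis using assms
  proof (induction f rule: T.MG.graded_induct)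
    case zero
    show ?case using T.MG.component_zero[of "(h, g)"] by simp
  next
    case (add f f')
    then show ?case using T.MG.component_add[of f f' "(h, g)"] by (simp add: component_add T_closed)
  next
    case (piece f h' g')
    show ?case
    proof (cases "(h', g') = (h, g)")
      case True
      then show ?thesis using piece T.MG.component_same[OF piece]
        by (auto simp: T_piece component_same)
    next
      case False
      have "component A (h - p i, g - q i) (f i) = \<zero>" for i
        by (rule component_other[of _ "h' - p i" "g' - q i"]) (use piece False in \<open>auto simp: T_piece\<close>)
      then show ?thesis using T.MG.component_other[OF piece, of "(h, g)"] False by auto
    qed
  qed
qed

lemma zpart_T_iff: "f \<in> zpart T g \<longleftrightarrow> f \<in> carrier T \<and> (\<forall>i. f i \<in> zpart A (g - q i))"
proof -
  interpret T: dg_ring_module A T by (rule T_dg_ring_module)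
  show ?thesis
  proof (cases "f \<in> carrier T")
    case f: True
    have "f \<in> zpart T g \<longleftrightarrow> (\<forall>h g'. g' \<noteq> g \<longrightarrow> (\<forall>i. component A (h - p i, g' - q i) (f i) = \<zero>))"
      using f by (simp add: T.MG.zpart_iff T_component fun_eq_iff)
    also have "\<dots> \<longleftrightarrow> (\<forall>i h g'. g' \<noteq> g - q i \<longrightarrow> component A (h, g') (f i) = \<zero>)"
    proof safe
      fix i h g' assume *: "\<forall>h g'. g' \<noteq> g \<longrightarrow> (\<forall>i. component A (h - p i, g' - q i) (f i) = \<zero>)"
        and "g' \<noteq> g - q i"
      then have "g' + q i \<noteq> g" by auto
      with * have "component A (h + p i - p i, g' + q i - q i) (f i) = \<zero>" by blast
      then show "component A (h, g') (f i) = \<zero>" by simp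
    qed simp
    finally show ?thesis using f by (auto simp: zpart_iff T_closed)
  qed (auto simp: T.MG.zpart_iff)
qed

end

section \<open>Completing one weight\<close>

lemma (in dg_ring) component_mult_degree_zero_left:
  assumes "e \<in> piece A 0 0" "a \<in> carrier A"
  shows "component A i (e \<otimes> a) = e \<otimes> component A i a"
proof (rule additive_eqI[OF abelian_group_axioms, of "\<lambda>a. component A i (e \<otimes> a)"
      "\<lambda>a. e \<otimes> component A i a"])
  have e: "e \<in> carrier A" using assms(1) piece_carrier by blast
  fix a h g assume a: "a \<in> piece A h g"
  have ae: "e \<otimes> a \<in> piece A h g" using A_mult_piece[OF assms(1) a] by simp
  show "component A i (e \<otimes> a) = e \<otimes> component A i a"
    using component_same[OF a] component_other[OF a, of i] component_same[OF ae]
      component_other[OF ae, of i] e by (cases "i = (h, g)") simp_all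
qed (use assms piece_carrier[OF assms(1)] in \<open>simp_all add: r_distr component_add component_closed\<close>)

lemma (in dg_ring) zpart_A_add: "a \<in> zpart A g \<Longrightarrow> b \<in> zpart A g \<Longrightarrow> a \<oplus> b \<in> zpart A g"
  by (simp add: zpart_iff component_add)

text \<open>In the locale \<open>dg_ring_module\<close> the original names denote the facts about
  \<open>M\<close>.\<close>

lemmas (in dg_ring) A_finsum_closed = finsum_closed
lemmas (in dg_ring) A_finsum_insert = finsum_insert
lemmas (in dg_ring) A_r_neg1 = r_neg1

text \<open>The properties of \<open>A\<close> and \<open>M\<close> that the construction inside a single
  weight depends on: \<open>A\<^sub>0 = A\<^sup>0\<^sub>0\<close>, a decomposition of its unit into
  idempotents \<open>\<epsilon> \<in> E\<close> with simple \<open>A\<^sub>0 \<epsilon>\<close>, and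
  finite dimension of all weight spaces in the form of bounded ranks.\<close>

locale cell_attachment = dg_ring_module A M
  for A :: "('k, 'a, 'n::finite) dg_struct" (structure)
    and M :: "('a, 'm, 'n) dg_struct" (structure) +
  fixes E S :: "'a set" and b :: int
  assumes A_below: "h < 0 \<Longrightarrow> piece A h g = {\<zero>}"
    and A_weight_zero: "0 < h \<Longrightarrow> piece A h 0 = {\<zero>}"
    and E_fin: "finite E" and E_piece: "E \<subseteq> piece A 0 0"
    and E_idem: "\<epsilon> \<in> E \<Longrightarrow> \<epsilon> \<otimes> \<epsilon> = \<epsilon>"
    and E_sum: "(\<Oplus>\<epsilon>\<in>E. \<epsilon>) = \<one>"
    and E_simple: "\<lbrakk>\<epsilon> \<in> E; J \<subseteq> {a \<in> piece A 0 0. a \<otimes> \<epsilon> = a}; \<zero> \<in> J;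
        \<And>x y. x \<in> J \<Longrightarrow> y \<in> J \<Longrightarrow> x \<oplus> y \<in> J;
        \<And>a x. a \<in> piece A 0 0 \<Longrightarrow> x \<in> J \<Longrightarrow> a \<otimes> x \<in> J\<rbrakk>
      \<Longrightarrow> J = {\<zero>} \<or> J = {a \<in> piece A 0 0. a \<otimes> \<epsilon> = a}"
    and S_piece: "S \<subseteq> piece A 0 0"
    and rank_A: "bounded_rank {W. A_sub S W \<and> W \<subseteq> zpart A g}"
    and rank_M: "bounded_rank {W. M_sub S W \<and> W \<subseteq> zpart M g}"
    and M_below: "h < b \<Longrightarrow> piece M h g = {\<zero>\<^bsub>M\<^esub>}"
begin

lemma A00_closed: "a \<in> piece A 0 0 \<Longrightarrow> a \<in> carrier A" by (rule piece_carrier)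

lemma zpart_A_zero: "zpart A 0 = piece A 0 0"
proof (intro equalityI subsetI)
  fix a assume a: "a \<in> zpart A 0"
  then have ac: "a \<in> carrier A" by (rule zpart_carrier)
  have "component A (h, g) a = \<zero>" if "(h, g) \<noteq> (0, 0)" for h g
  proof (cases "g = 0")
    case True
    then have "piece A h g = {\<zero>}" using that A_below[of h g] A_weight_zero[of h] by force
    then show ?thesis using component_piece[OF ac, of h g] by blast
  next
    case False
    then show ?thesis using a by (simp add: zpart_iff)
  qed
  then show "a \<in> piece A 0 0" using ac by (simp add: piece_iff_component split_paired_all)
qed (rule piece_zpart)

text \<open>The boundary would have degree \<open>-1\<close>.\<close>

lemma A00_diff:
  assumes "a \<in> piece A 0 0"
  shows "diff A a = \<zero>"
  using A_diff_piece[OF assms] A_below[of "-1" 0] by simp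

text \<open>The pairs \<open>(f y, d y)\<close> for \<open>y\<close> of weight \<open>g\<close>. A pair
  \<open>(m, w)\<close> with \<open>d w = 0\<close> and \<open>f w = d m\<close> is an obstruction
  to be removed exactly when it is missing here.\<close>

definition lifted :: "(nat \<Rightarrow> ('a, 'm, 'n) cell) \<Rightarrow> int ^ 'n \<Rightarrow> ('m \<times> (nat \<Rightarrow> 'a)) set" where
  "lifted c g = (\<lambda>y. (cphi c y, diff (cT c) y)) ` zpart (cT c) g"

text \<open>The stages of the construction: finitely many cells, all of homological degree at least
  \<open>b\<close>. The restriction to nonzero idempotents is due to the vacant places, whose
  degrees are arbitrary.\<close>

definition good :: "nat \<Rightarrow> (nat \<Rightarrow> ('a, 'm, 'n) cell) \<Rightarrow> bool" where
  "good n c \<longleftrightarrow> valid_cells c \<and> trivial_from n c \<and> (\<forall>i. idem (c i) \<noteq> \<zero> \<longrightarrow> b \<le> hdeg (c i))"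

definition extends ::
  "int ^ 'n \<Rightarrow> nat \<Rightarrow> (nat \<Rightarrow> ('a, 'm, 'n) cell) \<Rightarrow> nat \<Rightarrow> (nat \<Rightarrow> ('a, 'm, 'n) cell) \<Rightarrow> bool" where
  "extends g n c n' c' \<longleftrightarrow> n \<le> n' \<and> (\<forall>i<n. c' i = c i) \<and> (\<forall>i. n \<le> i \<longrightarrow> i < n' \<longrightarrow> wdeg (c' i) = g)"

lemma extends_refl: "extends g n c n c"
  by (simp add: extends_def)

lemma extends_trans:
  assumes "extends g n c n1 c1" "extends g n1 c1 n2 c2"
  shows "extends g n c n2 c2"
  unfolding extends_def
proof (intro conjI allI impI)
  show "n \<le> n2" using assms by (simp add: extends_def)
  show "c2 i = c i" if "i < n" for i using assms that by (simp add: extends_def)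
  show "wdeg (c2 i) = g" if "n \<le> i" "i < n2" for i
    using assms that unfolding extends_def by (cases "i < n1") auto
qed

lemma valid_cells_cells: "valid_cells c \<Longrightarrow> cells A M c"
  by (simp add: valid_cells_def)

lemma cT_trivial:
  assumes "valid_cells c" "trivial_from n c" "f \<in> carrier (cT c)" "n \<le> i"
  shows "f i = \<zero>"
proof -
  interpret c: cells A M c by (rule valid_cells_cells[OF assms(1)])
  show ?thesis
    using c.T_e[OF assms(3), of i] c.T_closed[OF assms(3), of i] assms(2,4) by (simp add: trivial_from_def)
qed

lemma lifted_bounds:
  assumes "valid_cells c" "(m, f) \<in> lifted c g"
  shows "m \<in> zpart M g" "f \<in> zpart (cT c) g"
proof -
  interpret c: cells A M c by (rule valid_cells_cells[OF assms(1)])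
  interpret T: dg_ring_module A "cT c" by (rule c.T_dg_ring_module)
  obtain y where y: "y \<in> zpart (cT c) g" "m = cphi c y" "f = diff (cT c) y"
    using assms(2) by (auto simp: lifted_def)
  then have yc: "y \<in> carrier (cT c)" by (simp add: T.MG.zpart_iff)
  have "component M i (cphi c y) = cphi c (component (cT c) i y)" for i
    by (rule dg_hom_component[OF c.T_dg_ring_module dg_ring_module_axioms c.phi_dg_hom yc])
  moreover have "cphi c (\<lambda>_. \<zero>) = \<zero>\<^bsub>M\<^esub>" by (simp add: phi_def)
  ultimately show "m \<in> zpart M g" using y yc by (simp add: MG.zpart_iff T.MG.zpart_iff)
  show "f \<in> zpart (cT c) g" using y T.zpart_diff by simp
qed

text \<open>Elements of \<open>A\<^sub>0\<close> are cycles of even degree, so \<open>y \<mapsto> (f y, d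
  y)\<close> is linear over \<open>A\<^sub>0\<close>.\<close>

lemma lifted_closed:
  assumes "valid_cells c"
  shows "pair_sub (piece A 0 0) (lifted c g)"
proof -
  interpret c: cells A M c by (rule valid_cells_cells[OF assms(1)])
  interpret T: dg_ring_module A "cT c" by (rule c.T_dg_ring_module)
  have zc: "y \<in> carrier (cT c)" if "y \<in> zpart (cT c) g" for y using that by (simp add: T.MG.zpart_iff)
  have act: "(a \<odot>\<^bsub>M\<^esub> m, \<lambda>i. a \<otimes> f i) \<in> lifted c g"
    if a: "a \<in> piece A 0 0" and mf: "(m, f) \<in> lifted c g" for a m f
  proof -
    obtain y where y: "y \<in> zpart (cT c) g" "m = cphi c y" "f = diff (cT c) y"
      using mf by (auto simp: lifted_def)
    note yc = zc[OF y(1)]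
    have ac: "a \<in> carrier A" by (rule A00_closed[OF a])
    have "(\<lambda>i. a \<otimes> y i) \<in> zpart (cT c) g" using T.zpart_act[OF a y(1)] by simp
    moreover have "cphi c (\<lambda>i. a \<otimes> y i) = a \<odot>\<^bsub>M\<^esub> m" using c.phi_smult[OF ac yc] y(2) by simp
    moreover have "diff (cT c) (\<lambda>i. a \<otimes> y i) = (\<lambda>i. a \<otimes> f i)"
      using c.T_leibniz[OF ac yc] c.T_closed[OF yc] c.T_closed[OF c.T_diff_closed[OF yc]] ac
      by (simp add: y(3) A00_diff[OF a] sg_even[OF a])
    ultimately show ?thesis unfolding lifted_def by (intro image_eqI) auto
  qed
  have neg1: "\<ominus> \<one> \<in> piece A 0 0" using A_one_piece by (rule piece_uminus)
  show ?thesis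
    unfolding pair_sub_def
  proof (intro conjI allI impI ballI)
    have "(\<lambda>_. \<zero>) \<in> zpart (cT c) g" using T.MG.zero_zpart[of g] by simp
    moreover have "cphi c (\<lambda>_. \<zero>) = \<zero>\<^bsub>M\<^esub>" by (simp add: phi_def)
    moreover have "diff (cT c) (\<lambda>_. \<zero>) = (\<lambda>_. \<zero>)" using T.diff_zero by simp
    ultimately show "(\<zero>\<^bsub>M\<^esub>, \<lambda>_. \<zero>) \<in> lifted c g" unfolding lifted_def by (intro image_eqI) auto
    fix m f assume mf: "(m, f) \<in> lifted c g"
    have mc: "m \<in> carrier M" using lifted_bounds(1)[OF assms mf] by (rule MG.zpart_carrier)
    have fc: "f i \<in> carrier A" for i using zc[OF lifted_bounds(2)[OF assms mf]] c.T_closed by blast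
    show "(\<ominus>\<^bsub>M\<^esub> m, \<lambda>i. \<ominus> f i) \<in> lifted c g"
      using act[OF neg1 mf] mc fc by (simp add: act_l_uminus act_one l_minus)
    show "(a \<odot>\<^bsub>M\<^esub> m, \<lambda>i. a \<otimes> f i) \<in> lifted c g" if "a \<in> piece A 0 0" for a
      by (rule act[OF that mf])
    obtain y where y: "y \<in> zpart (cT c) g" "m = cphi c y" "f = diff (cT c) y"
      using mf by (auto simp: lifted_def)
    fix m' f' assume "(m', f') \<in> lifted c g"
    then obtain y' where y': "y' \<in> zpart (cT c) g" "m' = cphi c y'" "f' = diff (cT c) y'"
      by (auto simp: lifted_def)
    have "(\<lambda>i. y i \<oplus> y' i) \<in> zpart (cT c) g" using T.zpart_add[OF y(1) y'(1)] by simp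
    then show "(m \<oplus>\<^bsub>M\<^esub> m', \<lambda>i. f i \<oplus> f' i) \<in> lifted c g"
      unfolding lifted_def using y y' c.phi_add[OF zc zc, OF y(1) y'(1)] c.T_diff_add[OF zc zc, OF y(1) y'(1)]
      by (intro image_eqI) auto
  qed
qed

lemmas lifted_zero = pair_subD(1)[OF lifted_closed]
  and lifted_add = pair_subD(2)[OF lifted_closed]
  and lifted_uminus = pair_subD(3)[OF lifted_closed]
  and lifted_act = pair_subD(4)[OF lifted_closed]

lemma lifted_pair_sub: "valid_cells c \<Longrightarrow> pair_sub S (lifted c g)"
  using lifted_closed[of c g] S_piece unfolding pair_sub_def by blast

text \<open>The pair is the sum of its multiples by the \<open>\<epsilon> \<in> E\<close>, and the liftable
  pairs are closed under sums.\<close>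

lemma exists_idempotent_not_lifted:
  assumes c: "valid_cells c" and nl: "(m, f) \<notin> lifted c g" and m: "m \<in> carrier M" and f: "f \<in> carrier (cT c)"
  shows "\<exists>\<epsilon>\<in>E. (\<epsilon> \<odot>\<^bsub>M\<^esub> m, \<lambda>i. \<epsilon> \<otimes> f i) \<notin> lifted c g"
proof (rule ccontr)
  interpret c: cells A M c by (rule valid_cells_cells[OF c])
  have fA: "f i \<in> carrier A" for i using f c.T_closed by blast
  assume "\<not> ?thesis"
  then have all: "\<And>\<epsilon>. \<epsilon> \<in> E \<Longrightarrow> (\<epsilon> \<odot>\<^bsub>M\<^esub> m, \<lambda>i. \<epsilon> \<otimes> f i) \<in> lifted c g" by blast
  have "((\<Oplus>\<epsilon>\<in>F. \<epsilon>) \<odot>\<^bsub>M\<^esub> m, \<lambda>i. (\<Oplus>\<epsilon>\<in>F. \<epsilon>) \<otimes> f i) \<in> lifted c g" if "finite F" "F \<subseteq> E" for F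
    using that
  proof (induction F rule: finite_induct)
    case empty
    show ?case using lifted_zero[OF c] m fA by simp
  next
    case (insert \<epsilon> F)
    have F: "F \<subseteq> carrier A" and e: "\<epsilon> \<in> carrier A" "\<epsilon> \<in> E" "F \<subseteq> E"
      using insert.prems E_piece A00_closed by auto
    have s: "(\<Oplus>\<epsilon>\<in>F. \<epsilon>) \<in> carrier A" using F by (intro A_finsum_closed) auto
    have "(\<Oplus>\<epsilon>\<in>insert \<epsilon> F. \<epsilon>) = \<epsilon> \<oplus> (\<Oplus>\<epsilon>\<in>F. \<epsilon>)"
      using insert.hyps F e by (intro A_finsum_insert) auto
    then show ?case
      using lifted_add[OF c all[OF e(2)] insert.IH[OF e(3)]] e s m fA
      by (simp add: act_l_distr l_distr)
  qed
  from this[OF E_fin subset_refl] show False using nl m fA by (simp add: E_sum act_one)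
qed

text \<open>Attaching \<open>\<epsilon> x\<close> with \<open>f x = \<epsilon> m\<close> and \<open>d x =
  \<epsilon> w\<close> for a suitable \<open>\<epsilon>\<close> makes \<open>\<epsilon> (m,
  w)\<close> liftable. As \<open>x\<close> has weight \<open>g\<close>, its coefficients in weight
  \<open>g\<close> lie in \<open>A\<^sub>0 \<epsilon>\<close>; so the new elements of weight
  \<open>g\<close> are exactly the \<open>y + a x\<close> with \<open>a \<in> A\<^sub>0
  \<epsilon>\<close>, which is the last conclusion.\<close>

lemma attach_step:
  assumes good: "good n c" and m: "m \<in> piece M h g" and w: "w \<in> piece (cT c) (h - 1) g"
    and dw: "diff (cT c) w = (\<lambda>_. \<zero>)" and pw: "cphi c w = diff M m" and nl: "(m, w) \<notin> lifted c g"
  obtains \<epsilon> c' where "\<epsilon> \<in> E" "(\<epsilon> \<odot>\<^bsub>M\<^esub> m, \<lambda>i. \<epsilon> \<otimes> w i) \<notin> lifted c g"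
    "good (Suc n) c'" "extends g n c (Suc n) c'"
    "\<And>f h g. f \<in> carrier (cT c) \<Longrightarrow> f \<in> piece (cT c') h g \<longleftrightarrow> f \<in> piece (cT c) h g"
    "\<And>f. f \<in> carrier (cT c) \<Longrightarrow> cphi c' f = cphi c f \<and> diff (cT c') f = diff (cT c) f"
    "\<And>y. y \<in> zpart (cT c) g \<Longrightarrow> y \<in> zpart (cT c') g"
    "(\<epsilon> \<odot>\<^bsub>M\<^esub> m, \<lambda>i. \<epsilon> \<otimes> w i) \<in> lifted c' g"
    "\<And>y'. y' \<in> zpart (cT c') g \<Longrightarrow> \<exists>y a. y \<in> zpart (cT c) g \<and> a \<in> piece A 0 0 \<and> a \<otimes> \<epsilon> = a \<and>
        y' = (\<lambda>i. y i \<oplus> single n a i) \<and>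
        cphi c' y' = cphi c y \<oplus>\<^bsub>M\<^esub> (a \<odot>\<^bsub>M\<^esub> (\<epsilon> \<odot>\<^bsub>M\<^esub> m)) \<and>
        diff (cT c') y' = (\<lambda>i. diff (cT c) y i \<oplus> (a \<otimes> (\<epsilon> \<otimes> w i)))"
proof -
  have c: "valid_cells c" and triv: "trivial_from n c"
    and below: "\<And>i. idem (c i) \<noteq> \<zero> \<Longrightarrow> b \<le> hdeg (c i)" using good by (auto simp: good_def)
  interpret c: cells A M c by (rule valid_cells_cells[OF c])
  have wc: "w \<in> carrier (cT c)" using w c.T_piece by blast
  have wA: "w i \<in> carrier A" for i using c.T_closed[OF wc] .
  have mc: "m \<in> carrier M" using m MG.piece_carrier by blast
  obtain \<epsilon> where eps: "\<epsilon> \<in> E" "(\<epsilon> \<odot>\<^bsub>M\<^esub> m, \<lambda>i. \<epsilon> \<otimes> w i) \<notin> lifted c g"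
    using exists_idempotent_not_lifted[OF c nl mc wc] by blast
  have eP: "\<epsilon> \<in> piece A 0 0" and eC: "\<epsilon> \<in> carrier A" using eps(1) E_piece A00_closed by auto
  define c' where
    "c' = c(n := \<lparr>hdeg = h, wdeg = g, idem = \<epsilon>, bdry = (\<lambda>j. \<epsilon> \<otimes> w j), img = \<epsilon> \<odot>\<^bsub>M\<^esub> m\<rparr>)"
  note att = attach_valid[OF c triv eP E_idem[OF eps(1)] A00_diff[OF eP] m w dw pw, folded c'_def]
  interpret c': cells A M c' by (rule valid_cells_cells[OF att(1)])
  \<comment> \<open>in degree \<open>h < b\<close> both \<open>m\<close> and \<open>w\<close> vanish,
                  and the zero pair is liftable\<close>
  have hb: "b \<le> h"
  proof (rule ccontr)
    assume "\<not> b \<le> h"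
    then have "m = \<zero>\<^bsub>M\<^esub>" using m M_below by auto
    moreover have "w i = \<zero>" for i
    proof (cases "idem (c i) = \<zero>")
      case True
      then show ?thesis using c.T_e[OF wc, of i] wA[of i] by simp
    next
      case False
      then have "h - 1 - hdeg (c i) < 0" using below[of i] \<open>\<not> b \<le> h\<close> by simp
      from A_below[OF this] have "piece A (h - 1 - hdeg (c i)) (g - wdeg (c i)) = {\<zero>}" .
      moreover have "w i \<in> piece A (h - 1 - hdeg (c i)) (g - wdeg (c i))"
        using w by (simp add: c.T_piece)
      ultimately show ?thesis by simp
    qed
    then have "w = (\<lambda>_. \<zero>)" by (rule ext)
    ultimately have "(m, w) = (\<zero>\<^bsub>M\<^esub>, \<lambda>_. \<zero>)" by simp
    then show False using lifted_zero[OF c, of g] nl by simp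
  qed
  have good': "good (Suc n) c'"
    unfolding good_def using att below hb by (auto simp: c'_def)
  have ext: "extends g n c (Suc n) c'"
    by (auto simp: extends_def c'_def less_Suc_eq)
  have old: "(f \<in> carrier (cT c) \<longleftrightarrow> f \<in> carrier (cT c')) \<and>
      (f \<in> piece (cT c) h g \<longleftrightarrow> f \<in> piece (cT c') h g) \<and>
      (f \<in> carrier (cT c) \<longrightarrow> diff (cT c') f = diff (cT c) f \<and> cphi c' f = cphi c f)"
    if "f n = \<zero>" for f h g
  proof -
    have ag: "f i \<noteq> \<zero> \<Longrightarrow> c i = c' i" for i using that by (auto simp: c'_def)
    show ?thesis
      using cT_agree[where f = f and c = c and c' = c', OF ag valid_cellsD(2)[OF c] valid_cellsD(3)[OF c] valid_cellsD(7)[OF c]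
          valid_cellsD(2)[OF att(1)]] by blast
  qed
  have at_n: "f n = \<zero>" if "f \<in> carrier (cT c)" for f
    using cT_trivial[OF c triv that] by simp
  have zp: "y \<in> zpart (cT c) g" if "y \<in> zpart (cT c') g" "y n = \<zero>" for y
    unfolding c.zpart_T_iff
  proof (intro conjI allI)
    show "y \<in> carrier (cT c)" using old[of y, OF that(2)] that(1) by (simp add: c'.zpart_T_iff)
    have "y i \<in> zpart A (g - wdeg (c' i))" for i using that(1) by (simp add: c'.zpart_T_iff)
    moreover have "wdeg (c' i) = wdeg (c i)" if "i \<noteq> n" for i using that by (simp add: c'_def)
    ultimately show "y i \<in> zpart A (g - wdeg (c i))" for i
      using that(2) by (cases "i = n") (simp, metis)
  qed
  have zp': "y \<in> zpart (cT c') g" if "y \<in> zpart (cT c) g" for y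
    unfolding c'.zpart_T_iff
  proof (intro conjI allI)
    have yc: "y \<in> carrier (cT c)" using that by (simp add: c.zpart_T_iff)
    show "y \<in> carrier (cT c')" using old[of y, OF at_n[OF yc]] yc by simp
    show "y i \<in> zpart A (g - wdeg (c' i))" for i
      using that at_n[OF yc] by (cases "i = n") (simp, simp add: c.zpart_T_iff c'_def)
  qed
  have idn: "idem (c' n) = \<epsilon>" "bdry (c' n) = (\<lambda>j. \<epsilon> \<otimes> w j)" "img (c' n) = \<epsilon> \<odot>\<^bsub>M\<^esub> m" "wdeg (c' n) = g"
    by (simp_all add: c'_def)
  have sn: "single n a \<in> zpart (cT c') g \<and> cphi c' (single n a) = a \<odot>\<^bsub>M\<^esub> (\<epsilon> \<odot>\<^bsub>M\<^esub> m) \<and>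
      diff (cT c') (single n a) = (\<lambda>i. a \<otimes> (\<epsilon> \<otimes> w i))" if a: "a \<in> piece A 0 0" "a \<otimes> \<epsilon> = a" for a
  proof -
    have ac: "a \<in> carrier A" by (rule A00_closed[OF a(1)])
    have ae: "a \<otimes> idem (c' n) = a" using a(2) idn by simp
    have "single n a i \<in> zpart A (g - wdeg (c' i))" for i
      using a(1) idn(4) by (auto simp: single_def zpart_A_zero)
    then have "single n a \<in> zpart (cT c') g"
      using c'.single_closed[OF ac ae] by (simp add: c'.zpart_T_iff)
    moreover have "cphi c' (single n a) = a \<odot>\<^bsub>M\<^esub> (\<epsilon> \<odot>\<^bsub>M\<^esub> m)"
      using c'.phi_single[OF ac ae] idn by simp
    moreover have "diff (cT c') (single n a) = (\<lambda>i. a \<otimes> (\<epsilon> \<otimes> w i))"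
      using c'.T_diff_single[OF ac ae] ac wA eC
      by (simp add: idn A00_diff[OF a(1)] sg_even[OF a(1)] single_def)
    ultimately show ?thesis by simp
  qed
  show ?thesis
  proof (rule that[OF eps good' ext])
    show "f \<in> piece (cT c') h g \<longleftrightarrow> f \<in> piece (cT c) h g" if "f \<in> carrier (cT c)" for f h g
      using old[of f, OF at_n[OF that]] by blast
    show "cphi c' f = cphi c f \<and> diff (cT c') f = diff (cT c) f" if "f \<in> carrier (cT c)" for f
      using old[of f, OF at_n[OF that]] that by blast
    show "y \<in> zpart (cT c') g" if "y \<in> zpart (cT c) g" for y by (rule zp'[OF that])
    show "(\<epsilon> \<odot>\<^bsub>M\<^esub> m, \<lambda>i. \<epsilon> \<otimes> w i) \<in> lifted c' g"
      unfolding lifted_def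
    proof (rule image_eqI[of _ _ "single n \<epsilon>"])
      have "\<epsilon> \<odot>\<^bsub>M\<^esub> (\<epsilon> \<odot>\<^bsub>M\<^esub> m) = \<epsilon> \<odot>\<^bsub>M\<^esub> m" "\<And>i. \<epsilon> \<otimes> (\<epsilon> \<otimes> w i) = \<epsilon> \<otimes> w i"
        using E_idem[OF eps(1)] eC mc wA by (simp_all flip: act_assoc m_assoc)
      then show "(\<epsilon> \<odot>\<^bsub>M\<^esub> m, \<lambda>i. \<epsilon> \<otimes> w i) = (cphi c' (single n \<epsilon>), diff (cT c') (single n \<epsilon>))"
        using sn[OF eP E_idem[OF eps(1)]] by simp
      show "single n \<epsilon> \<in> zpart (cT c') g" using sn[OF eP E_idem[OF eps(1)]] by simp
    qed
    fix y' assume y': "y' \<in> zpart (cT c') g"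
    let ?y = "y'(n := \<zero>)" and ?a = "y' n"
    have yc': "y' \<in> carrier (cT c')" using y' by (simp add: c'.zpart_T_iff)
    have aP: "?a \<in> piece A 0 0" using y' idn(4) by (simp add: c'.zpart_T_iff flip: zpart_A_zero) (metis cancel_comm_monoid_add_class.diff_cancel)
    have ae: "?a \<otimes> \<epsilon> = ?a" using c'.T_e[OF yc', of n] idn(1) by simp
    have aC: "?a \<in> carrier A" by (rule A00_closed[OF aP])
    have yA: "y' i \<in> carrier A" for i by (rule c'.T_closed[OF yc'])
    have "finite {i. ?y i \<noteq> \<zero>}" by (rule finite_subset[OF _ c'.T_fin[OF yc']]) auto
    then have ycc: "?y \<in> carrier (cT c')"
      using yc' valid_cellsD(2)[OF att(1)] by (auto simp: c'.T_carrier)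
    have "?y \<in> zpart (cT c') g" using y' ycc by (auto simp: c'.zpart_T_iff)
    then have y1: "?y \<in> zpart (cT c) g" by (rule zp) simp
    have y1c: "?y \<in> carrier (cT c)" using y1 by (simp add: c.zpart_T_iff)
    have sc: "single n ?a \<in> carrier (cT c')" using sn[OF aP ae] by (simp add: c'.zpart_T_iff)
    have eq: "y' = (\<lambda>i. ?y i \<oplus> single n ?a i)" using yA by (auto simp: single_def)
    have o: "diff (cT c') ?y = diff (cT c) ?y" "cphi c' ?y = cphi c ?y" using old[of ?y] y1c by auto
    have "cphi c' y' = cphi c ?y \<oplus>\<^bsub>M\<^esub> (?a \<odot>\<^bsub>M\<^esub> (\<epsilon> \<odot>\<^bsub>M\<^esub> m))"
      by (subst eq) (use c'.phi_add[OF ycc sc] sn[OF aP ae] o in simp)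
    moreover have "diff (cT c') y' = (\<lambda>i. diff (cT c) ?y i \<oplus> (?a \<otimes> (\<epsilon> \<otimes> w i)))"
      by (subst eq) (use c'.T_diff_add[OF ycc sc] sn[OF aP ae] o in simp)
    ultimately show "\<exists>y a. y \<in> zpart (cT c) g \<and> a \<in> piece A 0 0 \<and> a \<otimes> \<epsilon> = a \<and>
        y' = (\<lambda>i. y i \<oplus> single n a i) \<and>
        cphi c' y' = cphi c y \<oplus>\<^bsub>M\<^esub> (a \<odot>\<^bsub>M\<^esub> (\<epsilon> \<odot>\<^bsub>M\<^esub> m)) \<and>
        diff (cT c') y' = (\<lambda>i. diff (cT c) y i \<oplus> (a \<otimes> (\<epsilon> \<otimes> w i)))"
      using y1 aP ae eq by blast
  qed
qed

definition cycles_lift :: "(nat \<Rightarrow> ('a, 'm, 'n) cell) \<Rightarrow> int ^ 'n \<Rightarrow> bool" where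
  "cycles_lift c g \<longleftrightarrow> (\<forall>h. \<forall>m\<in>piece M h g. diff M m = \<zero>\<^bsub>M\<^esub> \<longrightarrow> (m, \<lambda>_. \<zero>) \<in> lifted c g)"

text \<open>The lifting property required by \<open>lifting_from_pieces\<close>, restricted to weight
  \<open>g\<close>.\<close>

definition weight_done :: "(nat \<Rightarrow> ('a, 'm, 'n) cell) \<Rightarrow> int ^ 'n \<Rightarrow> bool" where
  "weight_done c g \<longleftrightarrow> (\<forall>h. \<forall>m\<in>piece M h g. \<forall>w\<in>piece (cT c) (h - 1) g.
     diff (cT c) w = (\<lambda>_. \<zero>) \<longrightarrow> cphi c w = diff M m \<longrightarrow> (m, w) \<in> lifted c g)"

text \<open>As long as some cycle \<open>m\<close> of \<open>M\<^sub>g\<close> is not the image of a cycle, a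
  generator with boundary zero is attached for it. This strictly enlarges the subspace
  \<open>R\<close> of images of cycles in the finite-dimensional \<open>M\<^sub>g\<close>, so it
  happens only finitely often.\<close>

lemma complete_cycles:
  assumes "good n c"
  shows "\<exists>n' c'. good n' c' \<and> extends g n c n' c' \<and> cycles_lift c' g"
proof -
  obtain r N where r: "\<And>W. W \<in> {W. M_sub S W \<and> W \<subseteq> zpart M g} \<Longrightarrow> r W \<le> (N :: nat)"
    "\<And>W W'. W \<in> {W. M_sub S W \<and> W \<subseteq> zpart M g} \<Longrightarrow> W' \<in> {W. M_sub S W \<and> W \<subseteq> zpart M g} \<Longrightarrow>
      W \<subset> W' \<Longrightarrow> r W < r W'"
    by (rule bounded_rankE[OF rank_M[of g]]) blast
  define R where "R c = {m \<in> zpart M g. diff M m = \<zero>\<^bsub>M\<^esub> \<and> (m, \<lambda>_. \<zero>) \<in> lifted c g}" for c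
  have R: "R c \<in> {W. M_sub S W \<and> W \<subseteq> zpart M g}" if c: "valid_cells c" for c
  proof (intro CollectI conjI)
    show "R c \<subseteq> zpart M g" by (auto simp: R_def)
    show "M_sub S (R c)"
      unfolding M_sub_def
    proof (intro conjI ballI M.additive_subgroupI')
      show "R c \<subseteq> carrier M" unfolding R_def using MG.zpart_carrier by blast
      show "\<zero>\<^bsub>M\<^esub> \<in> R c" using lifted_zero[OF c] by (simp add: R_def)
      fix x assume x: "x \<in> R c"
      then have xc: "x \<in> carrier M" by (simp add: R_def MG.zpart_iff)
      show "\<ominus>\<^bsub>M\<^esub> x \<in> R c"
        using x lifted_uminus[OF c, of x "\<lambda>_. \<zero>"] xc by (simp add: R_def zpart_uminus diff_uminus)
      show "s \<odot>\<^bsub>M\<^esub> x \<in> R c" if "s \<in> S" for s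
      proof -
        have s: "s \<in> piece A 0 0" using that S_piece by blast
        then show ?thesis
          using x lifted_act[OF c s, of x "\<lambda>_. \<zero>"] xc A00_closed[OF s]
          by (simp add: R_def zpart_act leibniz_sg A00_diff)
      qed
      fix y assume y: "y \<in> R c"
      then have yc: "y \<in> carrier M" by (simp add: R_def MG.zpart_iff)
      show "x \<oplus>\<^bsub>M\<^esub> y \<in> R c"
        using x y lifted_add[OF c, of x "\<lambda>_. \<zero>" g y "\<lambda>_. \<zero>"] xc yc by (simp add: R_def zpart_add diff_add)
    qed
  qed
  show ?thesis using assms
  proof (induction "N - r (R c)" arbitrary: n c rule: less_induct)
    case less
    have c: "valid_cells c" using less.prems by (simp add: good_def)
    interpret c: cells A M c by (rule valid_cells_cells[OF c])
    interpret T: dg_ring_module A "cT c" by (rule c.T_dg_ring_module)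
    show ?case
    proof (cases "cycles_lift c g")
      case True
      then show ?thesis using less.prems extends_refl by blast
    next
      case False
      then obtain h m where m: "m \<in> piece M h g" "diff M m = \<zero>\<^bsub>M\<^esub>" "(m, \<lambda>_. \<zero>) \<notin> lifted c g"
        unfolding cycles_lift_def by blast
      have w: "(\<lambda>_. \<zero>) \<in> piece (cT c) (h - 1) g" using T.MG.piece_zero[of "h - 1" g] by simp
      have dw: "diff (cT c) (\<lambda>_. \<zero>) = (\<lambda>_. \<zero>)" using T.diff_zero by simp
      have pw: "cphi c (\<lambda>_. \<zero>) = diff M m" by (simp add: phi_def m(2))
      show ?thesis
      proof (rule attach_step[OF less.prems m(1) w dw pw m(3)])
        fix \<epsilon> c'
        assume eps: "\<epsilon> \<in> E" and nl: "(\<epsilon> \<odot>\<^bsub>M\<^esub> m, \<lambda>i. \<epsilon> \<otimes> \<zero>) \<notin> lifted c g"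
          and good': "good (Suc n) c'" and ext: "extends g n c (Suc n) c'"
          and old: "\<And>f. f \<in> carrier (cT c) \<Longrightarrow> cphi c' f = cphi c f \<and> diff (cT c') f = diff (cT c) f"
          and zp: "\<And>y. y \<in> zpart (cT c) g \<Longrightarrow> y \<in> zpart (cT c') g"
          and l: "(\<epsilon> \<odot>\<^bsub>M\<^esub> m, \<lambda>i. \<epsilon> \<otimes> \<zero>) \<in> lifted c' g"
        have c': "valid_cells c'" using good' by (simp add: good_def)
        have eP: "\<epsilon> \<in> piece A 0 0" using eps E_piece by blast
        have eC: "\<epsilon> \<in> carrier A" by (rule A00_closed[OF eP])
        have mc: "m \<in> carrier M" using m(1) MG.piece_carrier by blast
        have mono: "lifted c g \<subseteq> lifted c' g"
        proof
          fix x assume "x \<in> lifted c g"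
          then obtain y where y: "y \<in> zpart (cT c) g" "x = (cphi c y, diff (cT c) y)" by (auto simp: lifted_def)
          have "y \<in> carrier (cT c)" using y(1) by (simp add: T.MG.zpart_iff)
          then show "x \<in> lifted c' g" unfolding lifted_def
            using old[of y] zp[OF y(1)] y(2) by (intro image_eqI[of _ _ y]) simp_all
        qed
        have "\<epsilon> \<odot>\<^bsub>M\<^esub> m \<in> R c'"
          using l eC mc m(2) zpart_act[OF eP MG.piece_zpart[OF m(1)]]
          by (simp add: R_def leibniz_sg A00_diff[OF eP])
        moreover have "\<epsilon> \<odot>\<^bsub>M\<^esub> m \<notin> R c" using nl eC by (simp add: R_def)
        moreover have "R c \<subseteq> R c'" using mono by (auto simp: R_def)
        ultimately have "R c \<subset> R c'" by blast
        then have "N - r (R c') < N - r (R c)"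
          using r(2)[OF R[OF c] R[OF c']] r(1)[OF R[OF c']] by simp
        from less.hyps[OF this good'] show ?thesis using extends_trans[OF ext] by blast
      qed
    qed
  qed
qed

text \<open>After \<open>complete_cycles\<close>, generators are attached for pairs \<open>(m, w)\<close> that
  are not liftable. Two invariants hold: the cycles \<open>w\<close> which may occur in such pairs
  (those over boundaries \<open>d m\<close>) involve only the \<open>n0\<close> cells present at the
  beginning, and \<open>lifted\<close> stays in the finite-dimensional space \<open>Amb\<close> of
  pairs supported on these cells. Hence \<open>lifted\<close>, which grows in each step, becomes
  stationary.\<close>

lemma complete_weight:
  assumes "good n c"
  shows "\<exists>n' c'. good n' c' \<and> extends g n c n' c' \<and> weight_done c' g"
proof -
  obtain n0 c0 where good0: "good n0 c0" and ext0: "extends g n c n0 c0" and cyc0: "cycles_lift c0 g"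
    using complete_cycles[OF assms] by blast
  have c0: "valid_cells c0" and triv0: "trivial_from n0 c0" using good0 by (auto simp: good_def)
  \<comment> \<open>pairs supported on the cells present at the start of this phase;
                  finite-dimensional by \<open>pair_rank\<close>\<close>
  define Amb where "Amb = {(m, f). m \<in> zpart M g \<and> (\<forall>i<n0. f i \<in> zpart A (g - wdeg (c0 i))) \<and> (\<forall>i\<ge>n0. f i = \<zero>)}"
  have "bounded_rank {W. pair_sub S W \<and> W \<subseteq> Amb}"
    unfolding Amb_def
  proof (rule pair_rank)
    show "S \<subseteq> carrier A" using S_piece A00_closed by blast
    show "zpart M g \<subseteq> carrier M" using MG.zpart_carrier by blast
    show "zpart A (g - wdeg (c0 i)) \<subseteq> carrier A" for i using zpart_carrier by blast
  qed (rule rank_M rank_A)+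
  then obtain r N where r: "\<And>W. W \<in> {W. pair_sub S W \<and> W \<subseteq> Amb} \<Longrightarrow> r W \<le> (N :: nat)"
    "\<And>W W'. W \<in> {W. pair_sub S W \<and> W \<subseteq> Amb} \<Longrightarrow> W' \<in> {W. pair_sub S W \<and> W \<subseteq> Amb} \<Longrightarrow>
      W \<subset> W' \<Longrightarrow> r W < r W'"
    by (rule bounded_rankE) blast
  \<comment> \<open>no cycle over a boundary involves a cell attached in this phase\<close>
  define Q where "Q c \<longleftrightarrow> (\<forall>h. \<forall>m\<in>piece M h g. \<forall>w\<in>piece (cT c) (h - 1) g.
     diff (cT c) w = (\<lambda>_. \<zero>) \<longrightarrow> cphi c w = diff M m \<longrightarrow> (\<forall>i\<ge>n0. w i = \<zero>))" for c
  have ambI: "(m, w) \<in> Amb"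
    if "valid_cells c" "extends g n0 c0 n c" "m \<in> zpart M g" "w \<in> zpart (cT c) g" "\<forall>i\<ge>n0. w i = \<zero>" for n c m w
  proof -
    interpret c: cells A M c by (rule valid_cells_cells[OF that(1)])
    have "w i \<in> zpart A (g - wdeg (c i))" for i using that(4) by (simp add: c.zpart_T_iff)
    moreover have "c i = c0 i" if "i < n0" for i using \<open>extends g n0 c0 n c\<close> that by (simp add: extends_def)
    ultimately have "w i \<in> zpart A (g - wdeg (c0 i))" if "i < n0" for i using that by metis
    then show ?thesis using that(3,5) by (simp add: Amb_def)
  qed
  have main: "\<exists>n' c'. good n' c' \<and> extends g n c n' c' \<and> weight_done c' g"
    if "good n c" "extends g n0 c0 n c" "cycles_lift c g" "Q c" "lifted c g \<subseteq> Amb" for n c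
    using that
  proof (induction "N - r (lifted c g)" arbitrary: n c rule: less_induct)
    case less
    note good = less.prems(1) and ext = less.prems(2) and cyc = less.prems(3) and Q = less.prems(4)
      and amb = less.prems(5)
    have c: "valid_cells c" using good by (simp add: good_def)
    interpret c: cells A M c by (rule valid_cells_cells[OF c])
    interpret T: dg_ring_module A "cT c" by (rule c.T_dg_ring_module)
    show ?case
    proof (cases "weight_done c g")
      case True
      then show ?thesis using good extends_refl by blast
    next
      case False
      then obtain h m w where m: "m \<in> piece M h g" and w: "w \<in> piece (cT c) (h - 1) g"
        and dw: "diff (cT c) w = (\<lambda>_. \<zero>)" and pw: "cphi c w = diff M m" and nl: "(m, w) \<notin> lifted c g"
        unfolding weight_done_def by blast
      have w0: "\<forall>i\<ge>n0. w i = \<zero>" using Q m w dw pw unfolding Q_def by blast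
      have mz: "m \<in> zpart M g" and wz: "w \<in> zpart (cT c) g"
        using MG.piece_zpart[OF m] T.MG.piece_zpart[OF w] by auto
      have mc: "m \<in> carrier M" and wc: "w \<in> carrier (cT c)"
        using MG.piece_carrier[OF m] T.MG.piece_carrier[OF w] by auto
      have wA: "w i \<in> carrier A" for i by (rule c.T_closed[OF wc])
      show ?thesis
      proof (rule attach_step[OF good m w dw pw nl])
        fix \<epsilon> c'
        assume eps: "\<epsilon> \<in> E" and nl': "(\<epsilon> \<odot>\<^bsub>M\<^esub> m, \<lambda>i. \<epsilon> \<otimes> w i) \<notin> lifted c g"
          and good': "good (Suc n) c'" and ext': "extends g n c (Suc n) c'"
          and op: "\<And>f h g. f \<in> carrier (cT c) \<Longrightarrow> f \<in> piece (cT c') h g \<longleftrightarrow> f \<in> piece (cT c) h g"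
          and old: "\<And>f. f \<in> carrier (cT c) \<Longrightarrow> cphi c' f = cphi c f \<and> diff (cT c') f = diff (cT c) f"
          and zp: "\<And>y. y \<in> zpart (cT c) g \<Longrightarrow> y \<in> zpart (cT c') g"
          and l: "(\<epsilon> \<odot>\<^bsub>M\<^esub> m, \<lambda>i. \<epsilon> \<otimes> w i) \<in> lifted c' g"
          and dec: "\<And>y'. y' \<in> zpart (cT c') g \<Longrightarrow> \<exists>y a. y \<in> zpart (cT c) g \<and> a \<in> piece A 0 0 \<and> a \<otimes> \<epsilon> = a \<and>
            y' = (\<lambda>i. y i \<oplus> single n a i) \<and>
            cphi c' y' = cphi c y \<oplus>\<^bsub>M\<^esub> (a \<odot>\<^bsub>M\<^esub> (\<epsilon> \<odot>\<^bsub>M\<^esub> m)) \<and>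
            diff (cT c') y' = (\<lambda>i. diff (cT c) y i \<oplus> (a \<otimes> (\<epsilon> \<otimes> w i)))"
        have c': "valid_cells c'" using good' by (simp add: good_def)
        interpret c': cells A M c' by (rule valid_cells_cells[OF c'])
        interpret T': dg_ring_module A "cT c'" by (rule c'.T_dg_ring_module)
        have eP: "\<epsilon> \<in> piece A 0 0" using eps E_piece by blast
        have eC: "\<epsilon> \<in> carrier A" by (rule A00_closed[OF eP])
        have emc: "\<epsilon> \<odot>\<^bsub>M\<^esub> m \<in> carrier M" using eC mc by (rule act_closed)
        have mono: "lifted c g \<subseteq> lifted c' g"
        proof
          fix x assume "x \<in> lifted c g"
          then obtain y where y: "y \<in> zpart (cT c) g" "x = (cphi c y, diff (cT c) y)" by (auto simp: lifted_def)
          have "y \<in> carrier (cT c)" using y(1) by (simp add: T.MG.zpart_iff)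
          then show "x \<in> lifted c' g" unfolding lifted_def
            using old[of y] zp[OF y(1)] y(2) by (intro image_eqI[of _ _ y]) simp_all
        qed
        have cyc': "cycles_lift c' g" using cyc mono unfolding cycles_lift_def by blast
        have ext0': "extends g n0 c0 (Suc n) c'" by (rule extends_trans[OF ext ext'])
        \<comment> \<open>the \<open>a \<in> A\<^sub>0 \<epsilon>\<close> whose multiple lifts form a
                        submodule without \<open>\<epsilon>\<close>, which is zero as
                        \<open>A\<^sub>0 \<epsilon>\<close> is simple\<close>
        have no_mult: "a = \<zero>"
          if a: "a \<in> piece A 0 0" "a \<otimes> \<epsilon> = a"
            and al: "(a \<odot>\<^bsub>M\<^esub> (\<epsilon> \<odot>\<^bsub>M\<^esub> m), \<lambda>i. a \<otimes> (\<epsilon> \<otimes> w i)) \<in> lifted c g" for a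
        proof -
          define J where "J = {a \<in> piece A 0 0. a \<otimes> \<epsilon> = a \<and>
            (a \<odot>\<^bsub>M\<^esub> (\<epsilon> \<odot>\<^bsub>M\<^esub> m), \<lambda>i. a \<otimes> (\<epsilon> \<otimes> w i)) \<in> lifted c g}"
          have "J = {\<zero>} \<or> J = {a \<in> piece A 0 0. a \<otimes> \<epsilon> = a}"
          proof (rule E_simple[OF eps])
            show "J \<subseteq> {a \<in> piece A 0 0. a \<otimes> \<epsilon> = a}" by (auto simp: J_def)
            show "\<zero> \<in> J" using lifted_zero[OF c] eC emc wA by (simp add: J_def)
            show "x \<oplus> y \<in> J" if "x \<in> J" "y \<in> J" for x y
            proof -
              have xy: "x \<in> piece A 0 0" "y \<in> piece A 0 0" "x \<otimes> \<epsilon> = x" "y \<otimes> \<epsilon> = y"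
                using that by (auto simp: J_def)
              note cl = A00_closed[OF xy(1)] A00_closed[OF xy(2)]
              have "(x \<odot>\<^bsub>M\<^esub> (\<epsilon> \<odot>\<^bsub>M\<^esub> m) \<oplus>\<^bsub>M\<^esub> y \<odot>\<^bsub>M\<^esub> (\<epsilon> \<odot>\<^bsub>M\<^esub> m), \<lambda>i. x \<otimes> (\<epsilon> \<otimes> w i) \<oplus> y \<otimes> (\<epsilon> \<otimes> w i)) \<in> lifted c g"
                using that lifted_add[OF c] by (simp add: J_def)
              then show ?thesis
                using xy cl eC emc wA piece_add[OF xy(1,2)] by (simp add: J_def act_l_distr l_distr)
            qed
            show "a \<otimes> x \<in> J" if "a \<in> piece A 0 0" "x \<in> J" for a x
            proof -
              have x: "x \<in> piece A 0 0" "x \<otimes> \<epsilon> = x" using that by (auto simp: J_def)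
              note cl = A00_closed[OF that(1)] A00_closed[OF x(1)]
              have "(a \<odot>\<^bsub>M\<^esub> (x \<odot>\<^bsub>M\<^esub> (\<epsilon> \<odot>\<^bsub>M\<^esub> m)), \<lambda>i. a \<otimes> (x \<otimes> (\<epsilon> \<otimes> w i))) \<in> lifted c g"
                using that lifted_act[OF c] by (simp add: J_def)
              then show ?thesis
                using x cl eC emc wA A_mult_piece[OF that(1) x(1)] by (simp add: J_def act_assoc m_assoc)
            qed
          qed
          moreover have "\<epsilon> \<notin> J"
          proof -
            have "\<epsilon> \<odot>\<^bsub>M\<^esub> (\<epsilon> \<odot>\<^bsub>M\<^esub> m) = \<epsilon> \<odot>\<^bsub>M\<^esub> m" "\<And>i. \<epsilon> \<otimes> (\<epsilon> \<otimes> w i) = \<epsilon> \<otimes> w i"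
              using E_idem[OF eps] eC mc wA by (simp_all flip: act_assoc m_assoc)
            then show ?thesis using nl' by (simp add: J_def)
          qed
          ultimately have "J = {\<zero>}" using eP E_idem[OF eps] by blast
          moreover have "a \<in> J" using a al by (simp add: J_def)
          ultimately show ?thesis by simp
        qed
        have Q': "Q c'"
          unfolding Q_def
        proof (intro allI ballI impI)
          fix h' m' w' i
          assume m': "m' \<in> piece M h' g" and w': "w' \<in> piece (cT c') (h' - 1) g"
            and dw': "diff (cT c') w' = (\<lambda>_. \<zero>)" and pw': "cphi c' w' = diff M m'" and i: "n0 \<le> i"
          obtain y a where y: "y \<in> zpart (cT c) g" and a: "a \<in> piece A 0 0" "a \<otimes> \<epsilon> = a"
            and w'eq: "w' = (\<lambda>i. y i \<oplus> single n a i)"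
            and p: "cphi c' w' = cphi c y \<oplus>\<^bsub>M\<^esub> (a \<odot>\<^bsub>M\<^esub> (\<epsilon> \<odot>\<^bsub>M\<^esub> m))"
            and d: "diff (cT c') w' = (\<lambda>i. diff (cT c) y i \<oplus> (a \<otimes> (\<epsilon> \<otimes> w i)))"
            using dec[OF T'.MG.piece_zpart[OF w']] by blast
          have yc: "y \<in> carrier (cT c)" using y by (simp add: T.MG.zpart_iff)
          have ac: "a \<in> carrier A" by (rule A00_closed[OF a(1)])
          have mc': "m' \<in> carrier M" using m' MG.piece_carrier by blast
          have dyc: "diff (cT c) y i \<in> carrier A" for i by (rule c.T_closed[OF c.T_diff_closed[OF yc]])
          have yl: "(cphi c y, diff (cT c) y) \<in> lifted c g" using y by (auto simp: lifted_def)
          \<comment> \<open>\<open>w' = y + a x\<close> is a cycle over \<open>d m'\<close>. The pair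
                          \<open>(d m', 0)\<close> lifts because cycles do, so subtracting the
                          lifted pair of \<open>y\<close> from it shows that \<open>a (\<epsilon> m,
                          \<epsilon> w)\<close> lifts.\<close>
          have "(diff M m', \<lambda>_. \<zero>) \<in> lifted c g"
            using cyc diff_piece[OF m'] diff_diff[OF mc'] unfolding cycles_lift_def by blast
          from lifted_add[OF c lifted_uminus[OF c yl] this]
          have "(\<ominus>\<^bsub>M\<^esub> cphi c y \<oplus>\<^bsub>M\<^esub> diff M m', \<lambda>i. \<ominus> diff (cT c) y i \<oplus> \<zero>) \<in> lifted c g" .
          moreover have "\<ominus>\<^bsub>M\<^esub> cphi c y \<oplus>\<^bsub>M\<^esub> diff M m' = a \<odot>\<^bsub>M\<^esub> (\<epsilon> \<odot>\<^bsub>M\<^esub> m)"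
            unfolding pw'[symmetric] p using c.phi_closed[OF yc] ac emc by (simp add: act_closed M.r_neg1)
          moreover have "(\<lambda>i. \<ominus> diff (cT c) y i \<oplus> \<zero>) = (\<lambda>i. a \<otimes> (\<epsilon> \<otimes> w i))"
          proof
            fix i
            have "diff (cT c) y i \<oplus> (a \<otimes> (\<epsilon> \<otimes> w i)) = \<zero>" using fun_cong[OF d[unfolded dw'], of i] by simp
            then have "\<ominus> diff (cT c) y i \<oplus> (diff (cT c) y i \<oplus> (a \<otimes> (\<epsilon> \<otimes> w i))) = \<ominus> diff (cT c) y i \<oplus> \<zero>" by simp
            then show "\<ominus> diff (cT c) y i \<oplus> \<zero> = a \<otimes> (\<epsilon> \<otimes> w i)"
              using dyc[of i] ac eC wA[of i] by (simp add: A_r_neg1)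
          qed
          ultimately have "a = \<zero>" using no_mult[OF a] by simp
          then have "w' = y" using w'eq c.T_closed[OF yc] by (auto simp: single_def)
          then have "w' \<in> piece (cT c) (h' - 1) g" "diff (cT c) w' = (\<lambda>_. \<zero>)" "cphi c w' = diff M m'"
            using w' dw' pw' op[OF yc] old[OF yc] by auto
          then show "w' i = \<zero>" using Q m' i unfolding Q_def by blast
        qed
        have amb': "lifted c' g \<subseteq> Amb"
        proof
          fix x assume "x \<in> lifted c' g"
          then obtain y' where y': "y' \<in> zpart (cT c') g" "x = (cphi c' y', diff (cT c') y')"
            by (auto simp: lifted_def)
          obtain y a where y: "y \<in> zpart (cT c) g" and a: "a \<in> piece A 0 0"
            and p: "cphi c' y' = cphi c y \<oplus>\<^bsub>M\<^esub> (a \<odot>\<^bsub>M\<^esub> (\<epsilon> \<odot>\<^bsub>M\<^esub> m))"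
            and d: "diff (cT c') y' = (\<lambda>i. diff (cT c) y i \<oplus> (a \<otimes> (\<epsilon> \<otimes> w i)))"
            using dec[OF y'(1)] by blast
          have "(cphi c y, diff (cT c) y) \<in> Amb" using y amb by (auto simp: lifted_def)
          moreover have "(a \<odot>\<^bsub>M\<^esub> (\<epsilon> \<odot>\<^bsub>M\<^esub> m), \<lambda>i. a \<otimes> (\<epsilon> \<otimes> w i)) \<in> Amb"
          proof (rule ambI[OF c ext])
            show "a \<odot>\<^bsub>M\<^esub> (\<epsilon> \<odot>\<^bsub>M\<^esub> m) \<in> zpart M g" by (rule zpart_act[OF a zpart_act[OF eP mz]])
            show "(\<lambda>i. a \<otimes> (\<epsilon> \<otimes> w i)) \<in> zpart (cT c) g"
              using T.zpart_act[OF a T.zpart_act[OF eP wz]] by simp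
            show "\<forall>i\<ge>n0. a \<otimes> (\<epsilon> \<otimes> w i) = \<zero>" using w0 A00_closed[OF a] eC by simp
          qed
          ultimately show "x \<in> Amb"
            unfolding y'(2) p d Amb_def by (simp add: zpart_add zpart_A_add)
        qed
        have "lifted c g \<subset> lifted c' g" using mono l nl' by blast
        then have "N - r (lifted c' g) < N - r (lifted c g)"
          using r(2)[of "lifted c g" "lifted c' g"] r(1)[of "lifted c' g"] lifted_pair_sub[OF c]
            lifted_pair_sub[OF c'] amb amb' by simp
        from less.hyps[OF this good' ext0' cyc' Q' amb'] show ?thesis
          using extends_trans[OF ext'] by blast
      qed
    qed
  qed
  have "Q c0"
    unfolding Q_def
  proof (intro allI ballI impI)
    interpret c0: cells A M c0 by (rule valid_cells_cells[OF c0])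
    fix h m w i assume "w \<in> piece (cT c0) (h - 1) g" "n0 \<le> i"
    then show "w i = \<zero>" using cT_trivial[OF c0 triv0] by (simp add: c0.T_piece)
  qed
  moreover have "lifted c0 g \<subseteq> Amb"
  proof clarify
    interpret c0: cells A M c0 by (rule valid_cells_cells[OF c0])
    fix m f assume mf: "(m, f) \<in> lifted c0 g"
    have "f \<in> carrier (cT c0)" using lifted_bounds(2)[OF c0 mf] by (simp add: c0.zpart_T_iff)
    then show "(m, f) \<in> Amb"
      using cT_trivial[OF c0 triv0] by (intro ambI[OF c0 extends_refl] lifted_bounds[OF c0 mf]) simp
  qed
  ultimately obtain n' c' where "good n' c'" "extends g n0 c0 n' c'" "weight_done c' g"
    using main[OF good0 extends_refl cyc0] by blast
  then show ?thesis using extends_trans[OF ext0] by blast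
qed

end

section \<open>Cones\<close>

locale ordered_lattice =
  fixes lt :: "int ^ 'n::finite \<Rightarrow> int ^ 'n \<Rightarrow> bool"
  assumes order: "additive_total_order lt"
begin

lemma lt_irrefl: "\<not> lt x x"
  using order by (simp add: additive_total_order_def irreflp_def)

lemma lt_trans: "lt x y \<Longrightarrow> lt y z \<Longrightarrow> lt x z"
  using order unfolding additive_total_order_def by (meson transpE)

lemma lt_total: "x = y \<or> lt x y \<or> lt y x"
  using order unfolding additive_total_order_def by (metis totalpD)

lemma lt_add: "lt x y \<Longrightarrow> lt (x + z) (y + z)"
  using order by (simp add: additive_total_order_def)

lemma pos_add: "lt 0 x \<Longrightarrow> lt 0 y \<Longrightarrow> lt 0 (x + y)"
  using lt_add[of 0 x y] lt_trans[of 0 y "x + y"] by simp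

lemma pos_diff: "lt x y \<Longrightarrow> lt 0 (y - x)"
  using lt_add[of x y "- x"] by simp

lemma pos_scale_nat: "lt 0 x \<Longrightarrow> lt 0 (int (Suc k) *s x)"
proof (induction k)
  case (Suc k)
  have "int (Suc (Suc k)) *s x = int (Suc k) *s x + x" by (simp add: vec_eq_iff algebra_simps)
  then show ?case using Suc pos_add by simp
qed simp

lemma pos_scale: "lt 0 x \<Longrightarrow> 0 < k \<Longrightarrow> lt 0 (k *s x)"
  using pos_scale_nat[of x "nat k - 1"] by simp

lemma nonneg_sum_pos:
  assumes "finite S" "\<And>s. s \<in> S \<Longrightarrow> lt 0 s" "\<And>s. s \<in> S \<Longrightarrow> 0 \<le> a s" "\<exists>s\<in>S. a s \<noteq> 0"
  shows "lt 0 (\<Sum>s\<in>S. a s *s s)"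
proof -
  have "(\<Sum>s\<in>S. a s *s s) = 0 \<and> (\<forall>s\<in>S. a s = 0) \<or> lt 0 (\<Sum>s\<in>S. a s *s s)"
    using assms(1-3)
  proof (induction S)
    case (insert x S)
    have "a x *s x = 0 \<and> a x = 0 \<or> lt 0 (a x *s x)"
      using insert.prems pos_scale[of x "a x"] by (cases "a x = 0") (auto simp: order_less_le)
    moreover have "(\<Sum>s\<in>S. a s *s s) = 0 \<and> (\<forall>s\<in>S. a s = 0) \<or> lt 0 (\<Sum>s\<in>S. a s *s s)"
      using insert.prems by (intro insert.IH) auto
    moreover have "(\<Sum>s\<in>insert x S. a s *s s) = a x *s x + (\<Sum>s\<in>S. a s *s s)"
      using insert.hyps by simp
    ultimately show ?case by (elim disjE conjE) (simp_all add: pos_add)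
  qed simp
  then show ?thesis using assms(4) by auto
qed

end

lemma real_vec_scale: "real_vec (k *s x) = real_of_int k *\<^sub>R real_vec x"
  by (simp add: real_vec_def vec_eq_iff)

lemma real_vec_diff: "real_vec (x - y) = real_vec x - real_vec y"
  by (simp add: real_vec_def vec_eq_iff)

lemma real_vec_zero [simp]: "real_vec 0 = 0"
  by (simp add: real_vec_def vec_eq_iff)

lemma real_vec_eq_zero_iff: "real_vec x = 0 \<longleftrightarrow> x = 0"
  by (simp add: real_vec_def vec_eq_iff)

text \<open>A cone on a finite set of generators. Unlike \<open>cone_of\<close> it leaves the number of
  generators free while they are being exchanged.\<close>

definition set_cone :: "(int ^ 'n::finite) set \<Rightarrow> (real ^ 'n) set" where
  "set_cone S = {\<Sum>s\<in>S. \<alpha> s *\<^sub>R real_vec s | \<alpha>. \<forall>s\<in>S. 0 \<le> \<alpha> s}"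

lemma set_cone_zero: "0 \<in> set_cone S"
  unfolding set_cone_def by (intro CollectI exI[of _ "\<lambda>_. 0"]) simp

lemma set_cone_add:
  fixes S :: "(int ^ 'n::finite) set"
  shows "x \<in> set_cone S \<Longrightarrow> y \<in> set_cone S \<Longrightarrow> x + y \<in> set_cone S"
  unfolding set_cone_def
proof clarify
  fix \<alpha> \<beta> :: "(int ^ 'n) \<Rightarrow> real" assume "\<forall>s\<in>S. 0 \<le> \<alpha> s" "\<forall>s\<in>S. 0 \<le> \<beta> s"
  then show "\<exists>\<gamma>. (\<Sum>s\<in>S. \<alpha> s *\<^sub>R real_vec s) + (\<Sum>s\<in>S. \<beta> s *\<^sub>R real_vec s) =
      (\<Sum>s\<in>S. \<gamma> s *\<^sub>R real_vec s) \<and> (\<forall>s\<in>S. 0 \<le> \<gamma> s)"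
    by (intro exI[of _ "\<lambda>s. \<alpha> s + \<beta> s"]) (simp add: scaleR_left_distrib sum.distrib)
qed

lemma set_cone_scale:
  fixes S :: "(int ^ 'n::finite) set"
  shows "x \<in> set_cone S \<Longrightarrow> 0 \<le> c \<Longrightarrow> c *\<^sub>R x \<in> set_cone S"
  unfolding set_cone_def
proof clarify
  fix \<alpha> :: "(int ^ 'n) \<Rightarrow> real" assume "\<forall>s\<in>S. 0 \<le> \<alpha> s" "0 \<le> c"
  then show "\<exists>\<gamma>. c *\<^sub>R (\<Sum>s\<in>S. \<alpha> s *\<^sub>R real_vec s) = (\<Sum>s\<in>S. \<gamma> s *\<^sub>R real_vec s) \<and> (\<forall>s\<in>S. 0 \<le> \<gamma> s)"
    by (intro exI[of _ "\<lambda>s. c * \<alpha> s"]) (simp add: scaleR_right.sum)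
qed

lemma set_cone_mem: "finite S \<Longrightarrow> s \<in> S \<Longrightarrow> real_vec s \<in> set_cone S"
  unfolding set_cone_def
  by (intro CollectI exI[of _ "\<lambda>t. if t = s then 1 else 0"])
    (simp add: if_distrib[of "\<lambda>c. c *\<^sub>R _"] sum.delta cong: if_cong)

lemma set_cone_least:
  assumes "finite S" "\<And>s. s \<in> S \<Longrightarrow> real_vec s \<in> set_cone S'"
  shows "set_cone S \<subseteq> set_cone S'"
proof -
  have "(\<Sum>s\<in>F. \<alpha> s *\<^sub>R real_vec s) \<in> set_cone S'" if "finite F" "F \<subseteq> S" "\<forall>s\<in>S. 0 \<le> \<alpha> s" for F \<alpha>
    using that
  proof (induction F)
    case (insert x F)
    then show ?case using assms(2) by (simp add: set_cone_add set_cone_scale)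
  qed (simp add: set_cone_zero)
  then show ?thesis using assms(1) by (auto simp: set_cone_def)
qed

lemma set_cone_mono: "finite S' \<Longrightarrow> S \<subseteq> S' \<Longrightarrow> set_cone S \<subseteq> set_cone S'"
  by (rule set_cone_least) (auto intro: finite_subset set_cone_mem)

lemma cone_of_eq_set_cone:
  fixes v :: "'n::finite \<Rightarrow> int ^ 'n"
  shows "cone_of v = set_cone (range v)"
proof (intro equalityI subsetI)
  fix x assume "x \<in> cone_of v"
  then obtain \<alpha> where \<alpha>: "\<forall>i. \<alpha> i \<ge> 0" "x = (\<Sum>i\<in>UNIV. \<alpha> i *\<^sub>R real_vec (v i))"
    by (auto simp: cone_of_def)
  have "(\<Sum>i\<in>I. \<alpha> i *\<^sub>R real_vec (v i)) \<in> set_cone (range v)" if "finite I" for I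
    using that
  proof (induction I)
    case (insert i I)
    then show ?case using \<alpha>(1) by (simp add: set_cone_add set_cone_scale set_cone_mem)
  qed (simp add: set_cone_zero)
  then show "x \<in> set_cone (range v)" using \<alpha>(2) by simp
next
  fix x assume "x \<in> set_cone (range v)"
  then obtain \<beta> where \<beta>: "\<forall>s\<in>range v. 0 \<le> \<beta> s" "x = (\<Sum>s\<in>range v. \<beta> s *\<^sub>R real_vec s)"
    by (auto simp: set_cone_def)
  let ?k = "inv_into UNIV v"
  have "(\<Sum>s\<in>range v. \<beta> s *\<^sub>R real_vec s) = (\<Sum>i\<in>?k ` range v. \<beta> (v i) *\<^sub>R real_vec (v i))"
    by (subst sum.reindex) (auto simp: inj_on_def f_inv_into_f intro: inv_into_injective)
  also have "\<dots> = (\<Sum>i\<in>UNIV. (if i \<in> ?k ` range v then \<beta> (v i) else 0) *\<^sub>R real_vec (v i))"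
    by (rule sum.mono_neutral_cong_left) auto
  finally show "x \<in> cone_of v"
    unfolding cone_of_def \<beta>(2) using \<beta>(1)
    by (intro CollectI exI[of _ "\<lambda>i. if i \<in> ?k ` range v then \<beta> (v i) else 0"]) auto
qed

context ordered_lattice
begin

text \<open>A relation between positive vectors has coefficients of both signs, say \<open>a\<^sub>i > 0 >
  a\<^sub>j\<close>. After a change of sign of the relation, if necessary, \<open>w = (-a\<^sub>j) j
  - a\<^sub>i i\<close> is zero or positive. Replacing \<open>j\<close> by \<open>w\<close> enlarges
  the cone, since \<open>j\<close> is a nonnegative combination of \<open>w\<close> and
  \<open>i\<close>. In the relation the two terms of \<open>i\<close> and \<open>j\<close> merge
  into the single term \<open>-w\<close>, so its support shrinks; when \<open>w\<close> vanishes or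
  is already a generator, a generator has been saved.\<close>

lemma reduce_generators:
  assumes "finite S" "\<And>s. s \<in> S \<Longrightarrow> lt 0 s" "(\<Sum>s\<in>S. a s *s s) = 0" "\<exists>s\<in>S. a s \<noteq> 0"
  shows "\<exists>S'. finite S' \<and> (\<forall>s\<in>S'. lt 0 s) \<and> card S' < card S \<and> set_cone S \<subseteq> set_cone S'"
  using assms
proof (induction "card {s \<in> S. a s \<noteq> 0}" arbitrary: S a rule: less_induct)
  case less
  note fin = less.prems(1) and pos = less.prems(2) and rel = less.prems(3) and nz = less.prems(4)
  have "\<exists>i\<in>S. 0 < a i"
  proof (rule ccontr)
    assume *: "\<not> ?thesis"
    have "lt 0 (\<Sum>s\<in>S. (- a s) *s s)"
      by (rule nonneg_sum_pos[OF fin pos]) (use * nz in force)+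
    moreover have "(\<Sum>s\<in>S. (- a s) *s s) = - (\<Sum>s\<in>S. a s *s s)"
      by (simp add: sum_negf[symmetric] vec_eq_iff)
    ultimately show False using rel lt_irrefl by simp
  qed
  then obtain i0 where i0: "i0 \<in> S" "0 < a i0" by blast
  have "\<exists>j\<in>S. a j < 0"
  proof (rule ccontr)
    assume *: "\<not> ?thesis"
    have "lt 0 (\<Sum>s\<in>S. a s *s s)"
      by (rule nonneg_sum_pos[OF fin pos]) (use * nz in force)+
    then show False using rel lt_irrefl by simp
  qed
  then obtain j0 where j0: "j0 \<in> S" "a j0 < 0" by blast
  \<comment> \<open>the relation is replaced by its negative if this is needed to make
                  \<open>w\<close> below nonnegative\<close>
  have "\<exists>i j a'. i \<in> S \<and> j \<in> S \<and> 0 < a' i \<and> a' j < 0 \<and> (\<Sum>s\<in>S. a' s *s s) = 0 \<and>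
      {s \<in> S. a' s \<noteq> 0} = {s \<in> S. a s \<noteq> 0} \<and>
      ((- a' j) *s j - a' i *s i = 0 \<or> lt 0 ((- a' j) *s j - a' i *s i))"
  proof (cases "(- a j0) *s j0 = a i0 *s i0 \<or> lt (a i0 *s i0) ((- a j0) *s j0)")
    case True
    then have "(- a j0) *s j0 - a i0 *s i0 = 0 \<or> lt 0 ((- a j0) *s j0 - a i0 *s i0)"
      using pos_diff[of "a i0 *s i0" "(- a j0) *s j0"] by force
    then show ?thesis using i0 j0 rel by blast
  next
    case False
    then have "lt ((- a j0) *s j0) (a i0 *s i0)" using lt_total by metis
    then have "lt 0 ((- (- a i0)) *s i0 - (- a j0) *s j0)" using pos_diff[of "(- a j0) *s j0"] by simp
    moreover have "(\<Sum>s\<in>S. (- a s) *s s) = 0"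
    proof -
      have "(\<Sum>s\<in>S. (- a s) *s s) = - (\<Sum>s\<in>S. a s *s s)"
        by (simp add: sum_negf[symmetric] vec_eq_iff)
      then show ?thesis using rel by simp
    qed
    ultimately show ?thesis using i0 j0
      by (intro exI[of _ j0] exI[of _ i0] exI[of _ "\<lambda>s. - a s"]) auto
  qed
  then obtain i j a' where ij: "i \<in> S" "j \<in> S" "0 < a' i" "a' j < 0"
    and rel': "(\<Sum>s\<in>S. a' s *s s) = 0" and supp: "{s \<in> S. a' s \<noteq> 0} = {s \<in> S. a s \<noteq> 0}"
    and cmp: "(- a' j) *s j - a' i *s i = 0 \<or> lt 0 ((- a' j) *s j - a' i *s i)"
    by blast
  define w where "w = (- a' j) *s j - a' i *s i"
  have neq: "i \<noteq> j" using ij by auto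
  \<comment> \<open>so \<open>j\<close> lies in the cone on \<open>w\<close> and \<open>i\<close>\<close>
  have jw: "real_vec j = inverse (real_of_int (- a' j)) *\<^sub>R (real_vec w + real_of_int (a' i) *\<^sub>R real_vec i)"
  proof -
    have "real_vec w + real_of_int (a' i) *\<^sub>R real_vec i = real_of_int (- a' j) *\<^sub>R real_vec j"
      by (simp add: w_def real_vec_diff real_vec_scale del: of_int_minus)
    then show ?thesis using ij(4) by simp
  qed
  have le: "set_cone S \<subseteq> set_cone S'"
    if "finite S'" "S - {j} \<subseteq> S'" "real_vec w \<in> set_cone S'" for S'
  proof (rule set_cone_least[OF fin])
    fix s assume s: "s \<in> S"
    have "real_vec i \<in> set_cone S'" using ij(1) neq that by (intro set_cone_mem) auto
    then have "real_vec j \<in> set_cone S'"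
      unfolding jw using that(3) ij(3,4) by (intro set_cone_scale set_cone_add) auto
    then show "real_vec s \<in> set_cone S'"
      using s that by (cases "s = j") (auto intro: set_cone_mem)
  qed
  have cardj: "card (S - {j}) = card S - 1" "0 < card S" using fin ij(2) by (auto simp: card_gt_0_iff)
  show ?case
  proof (cases "w = 0 \<or> w \<in> S - {j}")
    case True
    then have "real_vec w \<in> set_cone (S - {j})"
      using fin by (auto simp: set_cone_zero intro: set_cone_mem)
    then have "set_cone S \<subseteq> set_cone (S - {j})" using fin by (intro le) auto
    then show ?thesis using fin pos cardj by (intro exI[of _ "S - {j}"]) auto
  next
    case False
    then have w: "lt 0 w" "w \<noteq> 0" "w \<notin> S - {j}" using cmp by (auto simp: w_def)
    let ?S = "insert w (S - {j})"
    \<comment> \<open>the old relation in terms of the new generators\<close>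
    define a1 where "a1 = (\<lambda>s. if s = w then -1 else if s = i then 0 else a' s)"
    have iw: "i \<noteq> w" using ij w(3) by auto
    have "(\<Sum>s\<in>?S. a1 s *s s) = - w + (\<Sum>s\<in>S - {j}. a1 s *s s)"
      using fin w(3) by (subst sum.insert) (auto simp: a1_def vec_eq_iff)
    also have "(\<Sum>s\<in>S - {j}. a1 s *s s) = a1 i *s i + (\<Sum>s\<in>S - {j} - {i}. a1 s *s s)"
      using fin ij neq by (intro sum.remove) auto
    also have "a1 i *s i = 0" using iw by (simp add: a1_def)
    also have "(\<Sum>s\<in>S - {j} - {i}. a1 s *s s) = (\<Sum>s\<in>S - {j} - {i}. a' s *s s)"
      using w(3) by (intro sum.cong) (auto simp: a1_def)
    finally have s1: "(\<Sum>s\<in>?S. a1 s *s s) = - w + (0 + (\<Sum>s\<in>S - {j} - {i}. a' s *s s))" .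
    have "(\<Sum>s\<in>S. a' s *s s) = a' j *s j + (a' i *s i + (\<Sum>s\<in>S - {j} - {i}. a' s *s s))"
      using fin ij neq by (subst sum.remove[of S j], simp, simp, subst sum.remove[of "S - {j}" i]) auto
    then have X: "(\<Sum>s\<in>S - {j} - {i}. a' s *s s) = - (a' j *s j + a' i *s i)"
      using rel' by (intro minus_unique[symmetric]) (simp add: add.assoc)
    have r1: "(\<Sum>s\<in>?S. a1 s *s s) = 0"
      unfolding s1 X by (simp add: w_def vec_eq_iff)
    have "{s \<in> ?S. a1 s \<noteq> 0} = insert w ({s \<in> S. a s \<noteq> 0} - {i, j})"
      unfolding supp[symmetric] using w(3) by (auto simp: a1_def)
    moreover have "{i, j} \<subseteq> {s \<in> S. a s \<noteq> 0}" unfolding supp[symmetric] using ij by auto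
    then have "card ({s \<in> S. a s \<noteq> 0} - {i, j}) = card {s \<in> S. a s \<noteq> 0} - 2"
      "2 \<le> card {s \<in> S. a s \<noteq> 0}"
      using fin neq card_mono[of "{s \<in> S. a s \<noteq> 0}" "{i, j}"] by (auto simp: card_Diff_subset)
    ultimately have d: "card {s \<in> ?S. a1 s \<noteq> 0} < card {s \<in> S. a s \<noteq> 0}"
      using fin w(3) by (simp add: card_insert_if)
    have f1: "finite ?S" and p1: "\<And>s. s \<in> ?S \<Longrightarrow> lt 0 s" using fin w(1) by (auto intro: pos)
    have n1: "\<exists>s\<in>?S. a1 s \<noteq> 0" by (intro bexI[of _ w]) (auto simp: a1_def)
    obtain S' where S': "finite S'" "\<forall>s\<in>S'. lt 0 s" "card S' < card ?S" "set_cone ?S \<subseteq> set_cone S'"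
      using less.hyps[OF d f1 p1 r1 n1] by blast
    have "card ?S = card S" using fin w(3) cardj by simp
    moreover have "set_cone S \<subseteq> set_cone ?S" using fin by (intro le set_cone_mem) auto
    ultimately show ?thesis using S' by auto
  qed
qed

text \<open>Positivity for \<open>\<prec>\<close> need not come from a linear functional on
  \<open>\<real>\<^sup>n\<close>, and the union of the generators of two cones may be dependent. A
  positive functional is available on independent generators, and passing to these costs nothing but
  a larger cone.\<close>

lemma independent_generators:
  assumes "finite S" "\<And>s. s \<in> S \<Longrightarrow> lt 0 s"
  shows "\<exists>S'. finite S' \<and> (\<forall>s\<in>S'. lt 0 s) \<and> set_cone S \<subseteq> set_cone S' \<and>
    (\<forall>a. (\<Sum>s\<in>S'. a s *s s) = 0 \<longrightarrow> (\<forall>s\<in>S'. a s = 0))"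
  using assms
proof (induction "card S" arbitrary: S rule: less_induct)
  case less
  show ?case
  proof (cases "\<forall>a. (\<Sum>s\<in>S. a s *s s) = 0 \<longrightarrow> (\<forall>s\<in>S. a s = 0)")
    case True
    then show ?thesis using less.prems by blast
  next
    case False
    then obtain a where "(\<Sum>s\<in>S. a s *s s) = 0" "\<exists>s\<in>S. a s \<noteq> 0" by blast
    from reduce_generators[OF less.prems this] obtain S' where
      S': "finite S'" "\<forall>s\<in>S'. lt 0 s" "card S' < card S" "set_cone S \<subseteq> set_cone S'" by blast
    have pos': "\<And>s. s \<in> S' \<Longrightarrow> lt 0 s" using S'(2) by simp
    obtain T where T: "finite T" "\<forall>s\<in>T. lt 0 s" "set_cone S' \<subseteq> set_cone T"
      "\<forall>a. (\<Sum>s\<in>T. a s *s s) = 0 \<longrightarrow> (\<forall>s\<in>T. a s = 0)"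
      using less.hyps[OF S'(3,1)] pos' by auto
    have "set_cone S \<subseteq> set_cone T" using T(3) S'(4) by simp
    then show ?thesis using T by (intro exI[of _ T] conjI)
  qed
qed

end

text \<open>Over \<open>\<rat>\<close> there is a basis theory, and relations can be cleared of denominators
  to integer ones.\<close>

definition rat_vec :: "int ^ 'n::finite \<Rightarrow> rat ^ 'n" where
  "rat_vec x = (\<chi> j. of_int (x $ j))"

lemma rat_vec_inj: "inj rat_vec"
  by (auto simp: inj_def rat_vec_def vec_eq_iff)

lemma common_denominator:
  assumes "finite X"
  obtains N :: int where "0 < N" "\<And>x. x \<in> X \<Longrightarrow> of_int N * (c x :: rat) \<in> \<int>"
proof -
  have "\<exists>N :: int. 0 < N \<and> (\<forall>x\<in>X. of_int N * c x \<in> \<int>)"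
    using assms
  proof (induction X)
    case empty
    show ?case by (intro exI[of _ 1]) simp
  next
    case (insert y X)
    then obtain N :: int where N: "0 < N" "\<forall>x\<in>X. of_int N * c x \<in> \<int>" by blast
    obtain a d where ad: "c y = of_int a / of_int d" "0 < d"
      using quotient_of_div[of "c y"] quotient_of_denom_pos[of "c y"] by (metis surj_pair)
    have "of_int (N * d) * c x \<in> \<int>" if "x \<in> insert y X" for x
    proof (cases "x = y")
      case True
      have "of_int (N * d) * c y = of_int (N * a)" using ad by simp
      then show ?thesis using True by (metis Ints_of_int)
    next
      case False
      then have "of_int N * c x \<in> \<int>" using N(2) that by blast
      then have "of_int d * (of_int N * c x) \<in> \<int>" by (rule Ints_mult[OF Ints_of_int])
      then show ?thesis by (simp add: mult.commute mult.left_commute)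
    qed
    then show ?case using N(1) ad(2) by (intro exI[of _ "N * d"]) simp
  qed
  then show ?thesis using that by blast
qed

lemma rat_vec_independent:
  fixes S :: "(int ^ 'n::finite) set"
  assumes S: "finite S" and indep: "\<And>a. (\<Sum>s\<in>S. a s *s s) = 0 \<Longrightarrow> \<forall>s\<in>S. a s = 0"
  shows "vec.independent (rat_vec ` S)"
proof
  assume "vec.dependent (rat_vec ` S)"
  then obtain u where u: "\<exists>v\<in>rat_vec ` S. u v \<noteq> 0" "(\<Sum>v\<in>rat_vec ` S. u v *s v) = 0"
    using S by (auto simp: vec.dependent_finite)
  obtain N :: int where N: "0 < N" "\<And>s. s \<in> S \<Longrightarrow> of_int N * u (rat_vec s) \<in> \<int>"
    by (rule common_denominator[OF S, of "\<lambda>s. u (rat_vec s)"]) blast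
  define a where "a s = \<lfloor>of_int N * u (rat_vec s)\<rfloor>" for s
  have a: "of_int (a s) = of_int N * u (rat_vec s)" if "s \<in> S" for s
    using N(2)[OF that] unfolding a_def by (auto elim!: Ints_cases)
  have s0: "(\<Sum>s\<in>S. u (rat_vec s) *s rat_vec s) = 0"
    using u(2) sum.reindex[OF inj_on_subset[OF rat_vec_inj subset_UNIV], of "\<lambda>v. u v *s v" S] by simp
  have "(\<Sum>s\<in>S. a s *s s) = 0"
  proof (simp only: vec_eq_iff, intro allI)
    fix j
    have "(of_int ((\<Sum>s\<in>S. a s *s s) $ j) :: rat) = (\<Sum>s\<in>S. of_int N * (u (rat_vec s) * of_int (s $ j)))"
      by (simp add: a mult.assoc)
    also have "\<dots> = of_int N * (\<Sum>s\<in>S. u (rat_vec s) *s rat_vec s) $ j"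
      by (simp add: rat_vec_def sum_distrib_left)
    finally have "(of_int ((\<Sum>s\<in>S. a s *s s) $ j) :: rat) = 0" using s0 by simp
    then show "(\<Sum>s\<in>S. a s *s s) $ j = 0 $ j" by (simp only: of_int_eq_0_iff zero_index)
  qed
  then have "\<forall>s\<in>S. a s = 0" by (rule indep)
  then have "\<forall>s\<in>S. u (rat_vec s) = 0" using a N(1) by fastforce
  then show False using u(1) by auto
qed

text \<open>A linear map may be prescribed on an independent set. Take the value 1 on all of \<open>S\<close>
  and clear denominators of the coefficients. The value is taken in \<open>\<rat>\<^sup>n\<close>,
  and one coordinate \<open>k\<close> of it is used.\<close>

lemma positive_functional:
  fixes S :: "(int ^ 'n::finite) set"
  assumes S: "finite S" and indep: "\<And>a. (\<Sum>s\<in>S. a s *s s) = 0 \<Longrightarrow> \<forall>s\<in>S. a s = 0"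
  obtains c :: "int ^ 'n" where "\<And>s. s \<in> S \<Longrightarrow> 0 < (\<Sum>j\<in>UNIV. c $ j * s $ j)" "card S \<le> CARD('n)"
proof -
  have ind: "vec.independent (rat_vec ` S)" by (rule rat_vec_independent[OF assms])
  have "card (rat_vec ` S) \<le> CARD('n)"
    using vec.independent_card_le_dim[OF subset_UNIV ind] by (simp add: vec.dim_UNIV card_cart_basis)
  then have card: "card S \<le> CARD('n)"
    by (simp add: card_image inj_on_subset[OF rat_vec_inj])
  obtain g :: "rat ^ 'n \<Rightarrow> rat ^ 'n" where g: "Vector_Spaces.linear (*s) (*s) g"
    "\<forall>x\<in>rat_vec ` S. g x = (\<chi> j. 1)"
    using vec.linear_independent_extend[OF ind, of "\<lambda>_. \<chi> j. 1"] by blast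
  interpret g: Vector_Spaces.linear "(*s)" "(*s)" g by (rule g(1))
  obtain k :: 'n where True by simp
  obtain N :: int where N: "0 < N" "\<And>j. j \<in> UNIV \<Longrightarrow> of_int N * (g (axis j 1) $ k) \<in> \<int>"
    by (rule common_denominator[of "UNIV :: 'n set" "\<lambda>j. g (axis j 1) $ k"]) auto
  define c :: "int ^ 'n" where "c = (\<chi> j. \<lfloor>of_int N * (g (axis j 1) $ k)\<rfloor>)"
  have c: "of_int (c $ j) = of_int N * (g (axis j 1) $ k)" for j
    using N(2)[of j] unfolding c_def by (auto elim!: Ints_cases)
  have "0 < (\<Sum>j\<in>UNIV. c $ j * s $ j)" if "s \<in> S" for s
  proof -
    have "rat_vec s = (\<Sum>j\<in>UNIV. of_int (s $ j) *s axis j 1)"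
      by (simp add: vec_eq_iff rat_vec_def axis_def if_distrib[of "\<lambda>x. _ * x"] cong: if_cong)
    then have "g (rat_vec s) = (\<Sum>j\<in>UNIV. of_int (s $ j) *s g (axis j 1))"
      by (simp add: g.sum g.scale)
    then have "(\<Sum>j\<in>UNIV. of_int (s $ j) * g (axis j 1) $ k) = 1"
      using g(2) that by (auto simp: vec_eq_iff)
    moreover have "(of_int (\<Sum>j\<in>UNIV. c $ j * s $ j) :: rat) =
        of_int N * (\<Sum>j\<in>UNIV. of_int (s $ j) * g (axis j 1) $ k)"
      by (simp add: c sum_distrib_left mult.assoc mult.left_commute mult.commute)
    ultimately have "(of_int (\<Sum>j\<in>UNIV. c $ j * s $ j) :: rat) = of_int N" by simp
    then show ?thesis using N(1) by (simp only: of_int_eq_iff)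
  qed
  then show ?thesis using card that by blast
qed

text \<open>On independent positive generators of a cone containing both \<open>C\<^sub>1\<close> and
  \<open>C\<^sub>2\<close> there is an integer functional \<open>L\<close> with values at least 1.
  For \<open>x = \<Sum> \<alpha>\<^sub>i v\<^sub>i\<close> in the cone this gives
  \<open>\<alpha>\<^sub>i \<le> L x\<close> for all \<open>i\<close>. So \<open>L x = 0\<close>
  forces \<open>x = 0\<close>, and a bound on \<open>L x\<close> bounds the coordinates of
  \<open>x\<close>.\<close>

theorem common_cone:
  fixes lt :: "int ^ 'n::finite \<Rightarrow> int ^ 'n \<Rightarrow> bool"
  assumes order: "additive_total_order lt"
    and C1: "compatible_cone lt C\<^sub>1" and C2: "compatible_cone lt C\<^sub>2"
  obtains C and L :: "int ^ 'n \<Rightarrow> int" where "compatible_cone lt C" "C\<^sub>1 \<subseteq> C" "C\<^sub>2 \<subseteq> C"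
    "0 \<in> C" "\<And>x y. x \<in> C \<Longrightarrow> y \<in> C \<Longrightarrow> x + y \<in> C"
    "\<And>x y. L (x + y) = L x + L y" "\<And>x. real_vec x \<in> C \<Longrightarrow> x \<noteq> 0 \<Longrightarrow> 0 < L x"
    "\<And>N. finite {x. real_vec x \<in> C \<and> L x \<le> N}"
proof -
  interpret ordered_lattice lt by (rule ordered_lattice.intro[OF order])
  obtain v1 where v1: "\<forall>i. lt 0 (v1 i)" "C\<^sub>1 = cone_of v1" using C1 by (auto simp: compatible_cone_def)
  obtain v2 where v2: "\<forall>i. lt 0 (v2 i)" "C\<^sub>2 = cone_of v2" using C2 by (auto simp: compatible_cone_def)
  let ?V = "range v1 \<union> range v2"
  have "\<exists>S. finite S \<and> (\<forall>s\<in>S. lt 0 s) \<and> set_cone ?V \<subseteq> set_cone S \<and>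
    (\<forall>a. (\<Sum>s\<in>S. a s *s s) = 0 \<longrightarrow> (\<forall>s\<in>S. a s = 0))"
    by (rule independent_generators) (use v1 v2 in auto)
  then obtain S where S: "finite S" "\<forall>s\<in>S. lt 0 s" "set_cone ?V \<subseteq> set_cone S"
    and indep: "\<And>a. (\<Sum>s\<in>S. a s *s s) = 0 \<Longrightarrow> \<forall>s\<in>S. a s = 0" by blast
  obtain c :: "int ^ 'n" where c: "\<And>s. s \<in> S \<Longrightarrow> 0 < (\<Sum>j\<in>UNIV. c $ j * s $ j)" and card: "card S \<le> CARD('n)"
    by (rule positive_functional[OF S(1) indep]) blast+
  define L where "L x = (\<Sum>j\<in>UNIV. c $ j * x $ j)" for x :: "int ^ 'n"
  have "S \<noteq> {}"
  proof
    assume "S = {}"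
    then have "set_cone S = {0}" by (simp add: set_cone_def)
    moreover have "real_vec (v1 undefined) \<in> set_cone S"
      using S(3) set_cone_mem[of ?V "v1 undefined"] by auto
    ultimately have "v1 undefined = 0" by (simp add: real_vec_eq_zero_iff)
    then show False using v1(1) lt_irrefl by metis
  qed
  have "\<exists>f. f ` S \<subseteq> (UNIV :: 'n set) \<and> inj_on f S"
    using card_le_inj[OF S(1), of "UNIV :: 'n set"] card by auto
  then obtain f :: "int ^ 'n \<Rightarrow> 'n" where f: "inj_on f S" by blast
  obtain s0 where s0: "s0 \<in> S" using \<open>S \<noteq> {}\<close> by blast
  \<comment> \<open>cones in the definition of compatibility have exactly \<open>n\<close> generators,
                  so \<open>S\<close> is enumerated with repetitions; this needs \<open>S\<close> to
                  be nonempty\<close>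
  define v where "v i = (if i \<in> f ` S then inv_into S f i else s0)" for i
  have v: "range v = S"
  proof (intro equalityI subsetI)
    fix x assume "x \<in> range v"
    then show "x \<in> S" using s0 by (auto simp: v_def inv_into_into)
  next
    fix x assume "x \<in> S"
    then have "x = v (f x)" using f by (simp add: v_def)
    then show "x \<in> range v" by (rule range_eqI)
  qed
  have CS: "cone_of v = set_cone S" by (simp add: cone_of_eq_set_cone v)
  have Lv: "1 \<le> L (v i)" for i using c[of "v i"] v by (auto simp: L_def)
  have Lr: "real_of_int (L x) = (\<Sum>j\<in>UNIV. real_of_int (c $ j) * real_vec x $ j)" for x
    by (simp add: L_def real_vec_def)
  have Lcone: "real_of_int (L x) = (\<Sum>i\<in>UNIV. \<alpha> i * real_of_int (L (v i)))"
    if "real_vec x = (\<Sum>i\<in>UNIV. \<alpha> i *\<^sub>R real_vec (v i))" for x \<alpha>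
  proof -
    have "real_of_int (L x) = (\<Sum>j\<in>UNIV. \<Sum>i\<in>UNIV. real_of_int (c $ j) * (\<alpha> i * real_vec (v i) $ j))"
      unfolding Lr that by (simp add: sum_distrib_left)
    also have "\<dots> = (\<Sum>i\<in>UNIV. \<Sum>j\<in>UNIV. real_of_int (c $ j) * (\<alpha> i * real_vec (v i) $ j))"
      by (rule sum.swap)
    also have "\<dots> = (\<Sum>i\<in>UNIV. \<alpha> i * real_of_int (L (v i)))"
      unfolding Lr by (simp add: sum_distrib_left mult.left_commute)
    finally show ?thesis .
  qed
  have ge: "\<alpha> i \<le> real_of_int (L x)"
    if "\<forall>i. 0 \<le> \<alpha> i" "real_vec x = (\<Sum>i\<in>UNIV. \<alpha> i *\<^sub>R real_vec (v i))" for x \<alpha> i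
  proof -
    have "\<alpha> i * 1 \<le> \<alpha> i * real_of_int (L (v i))"
      using that(1) Lv[of i] by (intro mult_left_mono) auto
    also have "\<dots> \<le> (\<Sum>i\<in>UNIV. \<alpha> i * real_of_int (L (v i)))"
    proof (rule member_le_sum)
      show "0 \<le> \<alpha> k * real_of_int (L (v k))" for k
        using that(1) Lv[of k] by (intro mult_nonneg_nonneg) auto
    qed auto
    finally show ?thesis using Lcone[OF that(2)] by simp
  qed
  have Lpos: "0 < L x" if x: "real_vec x \<in> cone_of v" "x \<noteq> 0" for x
  proof (rule ccontr)
    assume "\<not> 0 < L x"
    obtain \<alpha> where \<alpha>: "\<forall>i. 0 \<le> \<alpha> i" "real_vec x = (\<Sum>i\<in>UNIV. \<alpha> i *\<^sub>R real_vec (v i))"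
      using x(1) by (auto simp: cone_of_def)
    have "\<alpha> i = 0" for i using ge[OF \<alpha>, of i] spec[OF \<alpha>(1), of i] \<open>\<not> 0 < L x\<close> by linarith
    then have "real_vec x = 0" using \<alpha>(2) by simp
    then show False using x(2) by (simp add: real_vec_eq_zero_iff)
  qed
  have fin: "finite {x. real_vec x \<in> cone_of v \<and> L x \<le> N}" for N
  proof -
    \<comment> \<open>the coefficients are at most \<open>N\<close>, which bounds every coordinate\<close>
    define B where "B = \<lceil>\<bar>real_of_int N\<bar> * (\<Sum>i\<in>UNIV. \<Sum>j\<in>UNIV. \<bar>real_vec (v i) $ j\<bar>)\<rceil>"
    have bound: "x $ j \<in> {- B..B}" if x: "real_vec x \<in> cone_of v" "L x \<le> N" for x j
    proof -
      obtain \<alpha> where \<alpha>: "\<forall>i. 0 \<le> \<alpha> i" "real_vec x = (\<Sum>i\<in>UNIV. \<alpha> i *\<^sub>R real_vec (v i))"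
        using x(1) by (auto simp: cone_of_def)
      have "\<bar>real_vec x $ j\<bar> = \<bar>\<Sum>i\<in>UNIV. \<alpha> i * real_vec (v i) $ j\<bar>" unfolding \<alpha>(2) by simp
      also have "\<dots> \<le> (\<Sum>i\<in>UNIV. \<bar>\<alpha> i * real_vec (v i) $ j\<bar>)" by (rule sum_abs)
      also have "\<dots> \<le> (\<Sum>i\<in>UNIV. \<bar>real_of_int N\<bar> * (\<Sum>j\<in>UNIV. \<bar>real_vec (v i) $ j\<bar>))"
      proof (rule sum_mono)
        fix i
        have "\<alpha> i \<le> \<bar>real_of_int N\<bar>" using ge[OF \<alpha>, of i] x(2) by simp
        moreover have "\<bar>real_vec (v i) $ j\<bar> \<le> (\<Sum>j\<in>UNIV. \<bar>real_vec (v i) $ j\<bar>)"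
          by (rule member_le_sum) auto
        ultimately show "\<bar>\<alpha> i * real_vec (v i) $ j\<bar> \<le> \<bar>real_of_int N\<bar> * (\<Sum>j\<in>UNIV. \<bar>real_vec (v i) $ j\<bar>)"
          using \<alpha>(1) by (simp add: abs_mult mult_mono)
      qed
      also have "\<dots> \<le> real_of_int B" unfolding B_def by (simp add: sum_distrib_left)
      finally have "\<bar>real_of_int (x $ j)\<bar> \<le> real_of_int B" by (simp add: real_vec_def)
      then show ?thesis by auto
    qed
    have "{x. real_vec x \<in> cone_of v \<and> L x \<le> N} \<subseteq> vec_lambda ` (PiE UNIV (\<lambda>_. {- B..B}))"
    proof
      fix x assume "x \<in> {x. real_vec x \<in> cone_of v \<and> L x \<le> N}"
      then have "vec_nth x \<in> PiE UNIV (\<lambda>_. {- B..B})" using bound by auto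
      then show "x \<in> vec_lambda ` (PiE UNIV (\<lambda>_. {- B..B}))" by (intro image_eqI[of _ _ "vec_nth x"]) simp_all
    qed
    moreover have "finite (PiE (UNIV :: 'n set) (\<lambda>_. {- B..B}))" by (rule finite_PiE) auto
    ultimately show ?thesis by (meson finite_imageI finite_subset)
  qed
  show ?thesis
  proof (rule that[of "cone_of v" L])
    have "\<forall>i. lt 0 (v i)" using S(2) v by blast
    then show "compatible_cone lt (cone_of v)" unfolding compatible_cone_def by (intro exI[of _ v]) simp
    have "finite ?V" by simp
    then have "set_cone (range v1) \<subseteq> set_cone S" "set_cone (range v2) \<subseteq> set_cone S"
      using S(3) set_cone_mono[of ?V "range v1"] set_cone_mono[of ?V "range v2"] by simp_all
    then show "C\<^sub>1 \<subseteq> cone_of v" "C\<^sub>2 \<subseteq> cone_of v"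
      unfolding v1(2) v2(2) cone_of_eq_set_cone[of v1] cone_of_eq_set_cone[of v2] CS by simp_all
    show "0 \<in> cone_of v" unfolding CS by (rule set_cone_zero)
    show "x + y \<in> cone_of v" if "x \<in> cone_of v" "y \<in> cone_of v" for x y
      using that unfolding CS by (rule set_cone_add)
    show "L (x + y) = L x + L y" for x y by (simp add: L_def distrib_left sum.distrib)
  qed (fact Lpos, fact fin)
qed

section \<open>Filtration by homological degree\<close>

theorem dg_first_isomorphism:
  fixes A :: "('k, 'a, 'n::finite) dg_struct"
  assumes "dg_ring_module A M" "dg_ring_module A P" and hom: "dg_hom A M P f"
    and surj: "f ` carrier M = carrier P" and N: "N = {x \<in> carrier M. f x = \<zero>\<^bsub>P\<^esub>}"
  shows "dg_isomorphic A (dg_quotient M N) P"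
proof -
  interpret M: dg_ring_module A M by fact
  interpret P: dg_ring_module A P by fact
  have fc [simp]: "f x \<in> carrier P" if "x \<in> carrier M" for x
    using hom that by (auto simp: dg_hom_def)
  have fadd: "f (x \<oplus>\<^bsub>M\<^esub> y) = f x \<oplus>\<^bsub>P\<^esub> f y" if "x \<in> carrier M" "y \<in> carrier M" for x y
    using hom that by (auto simp: dg_hom_def)
  have fact: "f (a \<odot>\<^bsub>M\<^esub> x) = a \<odot>\<^bsub>P\<^esub> f x" if "a \<in> carrier A" "x \<in> carrier M" for a x
    using hom that by (auto simp: dg_hom_def)
  have fd: "f (diff M x) = diff P (f x)" if "x \<in> carrier M" for x
    using hom that by (auto simp: dg_hom_def)
  have fp: "f x \<in> piece P h g" if "x \<in> piece M h g" for x h g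
    using hom that unfolding dg_hom_def by blast
  have f0: "f \<zero>\<^bsub>M\<^esub> = \<zero>\<^bsub>P\<^esub>"
    by (rule M.M.additive_zero[OF P.M.abelian_group_axioms]) (auto simp: fadd)
  have fneg: "f (\<ominus>\<^bsub>M\<^esub> x) = \<ominus>\<^bsub>P\<^esub> f x" if "x \<in> carrier M" for x
    by (rule M.M.additive_uminus[OF P.M.abelian_group_axioms]) (auto simp: fadd that)
  have Nsub: "additive_subgroup N M"
    by (rule M.M.additive_subgroupI') (auto simp: N f0 fadd fneg)
  have Nc: "x \<in> carrier M" if "x \<in> N" for x using that by (simp add: N)
  have coset_iff: "N +>\<^bsub>M\<^esub> x = N +>\<^bsub>M\<^esub> y \<longleftrightarrow> f x = f y" if "x \<in> carrier M" "y \<in> carrier M" for x y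
  proof -
    have "x \<ominus>\<^bsub>M\<^esub> y \<in> N \<longleftrightarrow> f x \<ominus>\<^bsub>P\<^esub> f y = \<zero>\<^bsub>P\<^esub>"
      using that by (simp add: N M.M.minus_eq P.M.minus_eq fadd fneg)
    also have "\<dots> \<longleftrightarrow> f x = f y"
    proof
      assume "f x \<ominus>\<^bsub>P\<^esub> f y = \<zero>\<^bsub>P\<^esub>"
      then have "f x \<oplus>\<^bsub>P\<^esub> \<ominus>\<^bsub>P\<^esub> f y \<oplus>\<^bsub>P\<^esub> f y = \<zero>\<^bsub>P\<^esub> \<oplus>\<^bsub>P\<^esub> f y" by (simp add: P.M.minus_eq)
      then show "f x = f y" using that by (simp add: P.M.a_assoc P.M.l_neg)
    next
      assume "f x = f y"
      then show "f x \<ominus>\<^bsub>P\<^esub> f y = \<zero>\<^bsub>P\<^esub>" using that by (simp add: P.M.minus_eq P.M.r_neg)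
    qed
    finally show ?thesis using M.M.coset_eq_iff[OF Nsub that] by simp
  qed
  have memc: "y \<in> carrier M \<and> f y = f x" if "y \<in> N +>\<^bsub>M\<^esub> x" "x \<in> carrier M" for x y
    using that unfolding M.M.mem_coset by (auto simp: N fadd)
  have self: "x \<in> N +>\<^bsub>M\<^esub> x" if "x \<in> carrier M" for x
    unfolding M.M.mem_coset using that by (intro bexI[of _ "\<zero>\<^bsub>M\<^esub>"]) (simp_all add: N f0)
  \<comment> \<open>\<open>f\<close> is constant on cosets of its kernel\<close>
  define h where "h X = f (SOME x. x \<in> X)" for X
  have h: "h (N +>\<^bsub>M\<^esub> x) = f x" if "x \<in> carrier M" for x
    unfolding h_def
    using memc[OF someI[of "\<lambda>y. y \<in> N +>\<^bsub>M\<^esub> x", OF self[OF that]] that] by simp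
  have Q: "carrier (dg_quotient M N) = (\<lambda>x. N +>\<^bsub>M\<^esub> x) ` carrier M"
    by (auto simp: dg_quotient_def A_RCOSETS_def RCOSETS_def a_r_coset_def)
  have Qadd: "(N +>\<^bsub>M\<^esub> x) \<oplus>\<^bsub>dg_quotient M N\<^esub> (N +>\<^bsub>M\<^esub> y) = N +>\<^bsub>M\<^esub> (x \<oplus>\<^bsub>M\<^esub> y)"
    if "x \<in> carrier M" "y \<in> carrier M" for x y
    using M.M.coset_add[OF Nsub that] by (simp add: dg_quotient_def)
  have Un: "(\<Union>y\<in>N +>\<^bsub>M\<^esub> x. N +>\<^bsub>M\<^esub> F y) = N +>\<^bsub>M\<^esub> F x"
    if x: "x \<in> carrier M" and F: "\<And>y. y \<in> carrier M \<Longrightarrow> F y \<in> carrier M"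
      "\<And>y y'. y \<in> carrier M \<Longrightarrow> y' \<in> carrier M \<Longrightarrow> f y = f y' \<Longrightarrow> f (F y) = f (F y')" for x F
  proof -
    have "N +>\<^bsub>M\<^esub> F y = N +>\<^bsub>M\<^esub> F x" if "y \<in> N +>\<^bsub>M\<^esub> x" for y
      using memc[OF that x] x F(1)[of x] F(1)[of y] F(2)[of y x] coset_iff by simp
    then have "(\<Union>y\<in>N +>\<^bsub>M\<^esub> x. N +>\<^bsub>M\<^esub> F y) = (\<Union>y\<in>N +>\<^bsub>M\<^esub> x. N +>\<^bsub>M\<^esub> F x)"
      by (rule SUP_cong[OF refl])
    also have "\<dots> = N +>\<^bsub>M\<^esub> F x" using self[OF x] by auto
    finally show ?thesis .
  qed
  have Qact: "a \<odot>\<^bsub>dg_quotient M N\<^esub> (N +>\<^bsub>M\<^esub> x) = N +>\<^bsub>M\<^esub> (a \<odot>\<^bsub>M\<^esub> x)"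
    if "a \<in> carrier A" "x \<in> carrier M" for a x
    using Un[of x "\<lambda>x. a \<odot>\<^bsub>M\<^esub> x"] that by (simp add: dg_quotient_def M.act_closed fact)
  have Qdiff: "diff (dg_quotient M N) (N +>\<^bsub>M\<^esub> x) = N +>\<^bsub>M\<^esub> diff M x" if "x \<in> carrier M" for x
    using Un[of x "diff M"] that by (simp add: dg_quotient_def fd)
  have Qpiece: "piece (dg_quotient M N) i g = (\<lambda>x. N +>\<^bsub>M\<^esub> x) ` piece M i g" for i g
    by (simp add: dg_quotient_def)
  show ?thesis
    unfolding dg_isomorphic_def
  proof (intro exI[of _ h] conjI)
    show "bij_betw h (carrier (dg_quotient M N)) (carrier P)"
      unfolding bij_betw_def
    proof
      show "inj_on h (carrier (dg_quotient M N))"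
      proof (rule inj_onI)
        fix X Y assume "X \<in> carrier (dg_quotient M N)" "Y \<in> carrier (dg_quotient M N)"
        then obtain x y where "x \<in> carrier M" "y \<in> carrier M" "X = N +>\<^bsub>M\<^esub> x" "Y = N +>\<^bsub>M\<^esub> y"
          unfolding Q by blast
        moreover assume "h X = h Y"
        ultimately show "X = Y" using coset_iff[of x y] h by simp
      qed
      show "h ` carrier (dg_quotient M N) = carrier P"
        unfolding Q surj[symmetric] by (force simp: h)
    qed
    show "dg_hom A (dg_quotient M N) P h"
      unfolding dg_hom_def
    proof (intro conjI ballI allI)
      show "h ` piece (dg_quotient M N) i g \<subseteq> piece P i g" for i g
        using fp by (auto simp: Qpiece h M.MG.piece_carrier)
    qed (auto simp: Q h Qadd Qact Qdiff fadd fact fd M.act_closed)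
  qed
qed

text \<open>The structure of \<open>T\<close> carried over to another type by an injection \<open>J\<close> of
  the whole types.\<close>

definition dg_image :: "('p \<Rightarrow> 'y) \<Rightarrow> ('a, 'p, 'n::finite) dg_struct \<Rightarrow> ('a, 'y, 'n) dg_struct" where
  "dg_image J T =
    (let i = inv_into UNIV J
     in \<lparr>carrier = J ` carrier T, mult = undefined, one = undefined, zero = J \<zero>\<^bsub>T\<^esub>,
         add = (\<lambda>x y. J (i x \<oplus>\<^bsub>T\<^esub> i y)), smult = (\<lambda>a x. J (a \<odot>\<^bsub>T\<^esub> i x)),
         piece = (\<lambda>h g. J ` piece T h g), diff = (\<lambda>x. J (diff T (i x)))\<rparr>)"

lemma dg_image_simps:
  assumes "inj J"
  shows "carrier (dg_image J T) = J ` carrier T" "\<zero>\<^bsub>dg_image J T\<^esub> = J \<zero>\<^bsub>T\<^esub>"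
    "J x \<oplus>\<^bsub>dg_image J T\<^esub> J y = J (x \<oplus>\<^bsub>T\<^esub> y)" "a \<odot>\<^bsub>dg_image J T\<^esub> J x = J (a \<odot>\<^bsub>T\<^esub> x)"
    "piece (dg_image J T) h g = J ` piece T h g" "diff (dg_image J T) (J x) = J (diff T x)"
  using assms by (simp_all add: dg_image_def Let_def)

lemma dg_image_dg_module:
  assumes "dg_ring_module A T" "inj J"
  shows "dg_module A (dg_image J T)"
  by (rule dg_module_transport[OF assms(1), of J])
    (use assms(2) in \<open>auto simp: dg_image_simps bij_betw_def intro: inj_on_subset\<close>)

lemma dg_restrict_simps:
  "carrier (dg_restrict M N) = N" "\<zero>\<^bsub>dg_restrict M N\<^esub> = \<zero>\<^bsub>M\<^esub>"
  "x \<oplus>\<^bsub>dg_restrict M N\<^esub> y = x \<oplus>\<^bsub>M\<^esub> y" "a \<odot>\<^bsub>dg_restrict M N\<^esub> x = a \<odot>\<^bsub>M\<^esub> x"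
  "piece (dg_restrict M N) h g = N \<inter> piece M h g" "diff (dg_restrict M N) = diff M"
  by (simp_all add: dg_restrict_def)

context dg_ring
begin

lemma twisted_zero:
  assumes "\<And>i. e i \<in> piece A 0 0" "\<And>i. e i \<otimes> e i = e i" "\<And>i. diff A (e i) = \<zero>"
  shows "twisted A p q e (\<lambda>_ _. \<zero>)"
  by (intro twisted.intro dg_ring_axioms twisted_axioms.intro)
    (use assms piece_carrier[OF assms(1)] in auto)

lemma free_simps:
  "f \<in> carrier (free_dg_module A I p q) \<longleftrightarrow>
     (\<forall>i\<in>I. f i \<in> carrier A) \<and> (\<forall>i. i \<notin> I \<longrightarrow> f i = \<zero>) \<and> finite {i. f i \<noteq> \<zero>}"
  "\<zero>\<^bsub>free_dg_module A I p q\<^esub> = (\<lambda>i. \<zero>)"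
  "f \<oplus>\<^bsub>free_dg_module A I p q\<^esub> f' = (\<lambda>i. f i \<oplus> f' i)"
  "a \<odot>\<^bsub>free_dg_module A I p q\<^esub> f = (\<lambda>i. a \<otimes> f i)"
  "f \<in> piece (free_dg_module A I p q) h g \<longleftrightarrow>
     f \<in> carrier (free_dg_module A I p q) \<and> (\<forall>i\<in>I. f i \<in> piece A (h - p i) (g - q i))"
  "diff (free_dg_module A I p q) f = (\<lambda>i. diff A (f i))"
  by (simp_all add: free_dg_module_def)

text \<open>For idempotents \<open>e\<^sub>i\<close> that are cycles, the submodule \<open>\<Oplus>\<^sub>i A
  e\<^sub>i\<close> of a free module is the twisted module with zero twist.\<close>

lemma free_summand_submodule:
  fixes e :: "'i \<Rightarrow> 'a" and I :: "'i set" and p :: "'i \<Rightarrow> int" and q :: "'i \<Rightarrow> int ^ 'n"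
  assumes e: "\<And>i. e i \<in> piece A 0 0" "\<And>i. e i \<otimes> e i = e i" "\<And>i. diff A (e i) = \<zero>"
    and out: "\<And>i. i \<notin> I \<Longrightarrow> e i = \<zero>"
  defines "N \<equiv> {f \<in> carrier (free_dg_module A I p q). \<forall>i. f i \<otimes> e i = f i}"
  shows "dg_submodule A (free_dg_module A I p q) N"
proof -
  interpret Z: twisted A p q e "\<lambda>_ _. \<zero>" by (rule twisted_zero[OF e])
  have N: "N = carrier Z.T"
  proof (intro equalityI subsetI)
    fix f assume f: "f \<in> carrier Z.T"
    have "f i = \<zero>" if "i \<notin> I" for i
      using Z.T_e[OF f, of i] Z.T_closed[OF f, of i] out[OF that] by simp
    then show "f \<in> N" using f by (simp add: N_def free_simps Z.T_carrier)
  next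
    fix f assume "f \<in> N"
    then have f: "\<forall>i\<in>I. f i \<in> carrier A" "\<forall>i. i \<notin> I \<longrightarrow> f i = \<zero>" "finite {i. f i \<noteq> \<zero>}"
      "\<forall>i. f i \<otimes> e i = f i" by (auto simp: N_def free_simps)
    have "f i \<in> carrier A" for i using f(1,2) by (cases "i \<in> I") auto
    then show "f \<in> carrier Z.T" using f(3,4) by (simp add: Z.T_carrier)
  qed
  have "dg_module A (dg_restrict (free_dg_module A I p q) N)"
  proof (rule dg_module_transport[OF Z.T_dg_ring_module, of "\<lambda>x. x"])
    show "bij_betw (\<lambda>x. x) (carrier Z.T) (carrier (dg_restrict (free_dg_module A I p q) N))"
      by (simp add: dg_restrict_simps N bij_betw_def)
    show "diff (dg_restrict (free_dg_module A I p q) N) f = diff Z.T f" if f: "f \<in> carrier Z.T" for f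
    proof
      fix k
      have "(\<Oplus>i\<in>{i. f i \<noteq> \<zero>}. sg (f i) \<otimes> \<zero>) = \<zero>"
        by (rule add.finprod_one_eqI) (use f in \<open>auto simp: Z.T_closed\<close>)
      then show "diff (dg_restrict (free_dg_module A I p q) N) f k = diff Z.T f k"
        using Z.T_closed[OF f] by (simp add: dg_restrict_simps free_simps Z.T_diff)
    qed
    show "piece (dg_restrict (free_dg_module A I p q) N) h g = (\<lambda>x. x) ` piece Z.T h g" for h g
    proof (intro equalityI subsetI)
      fix f assume "f \<in> piece (dg_restrict (free_dg_module A I p q) N) h g"
      then have f: "f \<in> N" "\<forall>i\<in>I. f i \<in> piece A (h - p i) (g - q i)"
        by (auto simp: dg_restrict_simps free_simps)
      have "f i \<in> piece A (h - p i) (g - q i)" for i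
        using f by (cases "i \<in> I") (auto simp: N_def free_simps)
      then show "f \<in> (\<lambda>x. x) ` piece Z.T h g" using f(1) by (simp add: Z.T_piece N)
    next
      fix f assume "f \<in> (\<lambda>x. x) ` piece Z.T h g"
      then have f: "f \<in> N" "\<forall>i. f i \<in> piece A (h - p i) (g - q i)" by (auto simp: Z.T_piece N)
      then show "f \<in> piece (dg_restrict (free_dg_module A I p q) N) h g"
        by (simp add: dg_restrict_simps free_simps(5)) (simp add: N_def)
    qed
  qed (simp_all add: dg_restrict_simps free_simps)
  then show ?thesis unfolding dg_submodule_def by (auto simp: N_def)
qed

text \<open>The complement of \<open>A e\<^sub>i\<close> is \<open>A (1 - e\<^sub>i)\<close>, a submodule of
  the same kind.\<close>

lemma free_direct_summand:
  fixes e :: "'i \<Rightarrow> 'a" and I :: "'i set" and p :: "'i \<Rightarrow> int" and q :: "'i \<Rightarrow> int ^ 'n"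
  assumes e: "\<And>i. e i \<in> piece A 0 0" "\<And>i. e i \<otimes> e i = e i" "\<And>i. diff A (e i) = \<zero>"
    and out: "\<And>i. i \<notin> I \<Longrightarrow> e i = \<zero>"
  shows "direct_summand A (free_dg_module A I p q)
    {f \<in> carrier (free_dg_module A I p q). \<forall>i. f i \<otimes> e i = f i}"
proof -
  let ?F = "free_dg_module A I p q"
  have ec: "e i \<in> carrier A" for i by (rule piece_carrier[OF e(1)])
  define e' where "e' i = (if i \<in> I then \<one> \<oplus> \<ominus> e i else \<zero>)" for i
  have ec': "e' i \<in> carrier A" for i by (simp add: e'_def ec)
  have d1: "diff A \<one> = \<zero>"
  proof -
    have "diff A \<one> = diff A (\<one> \<otimes> \<one>)" by simp
    also have "\<dots> = diff A \<one> \<oplus> diff A \<one>"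
      by (subst A_leibniz_sg) (simp_all add: sg_even[OF A_one_piece])
    finally show ?thesis by (metis A_diff_closed add.l_cancel_one one_closed)
  qed
  have e'1: "e' i \<in> piece A 0 0" for i
    using piece_add[OF A_one_piece piece_uminus[OF e(1)]] by (simp add: e'_def)
  have e'2: "e' i \<otimes> e' i = e' i" for i
    using ec[of i] e(2)[of i] by (simp add: e'_def l_distr r_distr l_minus r_minus minus_minus a_assoc l_neg r_neg)
  have e'3: "diff A (e' i) = \<zero>" for i
    using ec[of i] by (simp add: e'_def A_diff_add A_diff_uminus e(3) d1)
  let ?N = "{f \<in> carrier ?F. \<forall>i. f i \<otimes> e i = f i}" and ?N' = "{f \<in> carrier ?F. \<forall>i. f i \<otimes> e' i = f i}"
  have fe': "f i \<otimes> e' i = f i \<oplus> \<ominus> (f i \<otimes> e i)" if "f \<in> carrier ?F" for f i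
    using that ec[of i] by (cases "i \<in> I") (auto simp: e'_def free_simps r_distr r_minus out)
  have fc: "f i \<in> carrier A" if "f \<in> carrier ?F" for f i
    using that by (cases "i \<in> I") (auto simp: free_simps)
  show ?thesis
    unfolding direct_summand_def
  proof (intro conjI exI[of _ ?N'])
    show "dg_submodule A ?F ?N" by (rule free_summand_submodule[OF e out])
    show "dg_submodule A ?F ?N'"
      by (rule free_summand_submodule[OF e'1 e'2 e'3]) (simp add: e'_def)
    show "?N \<inter> ?N' = {\<zero>\<^bsub>?F\<^esub>}"
    proof (intro equalityI subsetI)
      fix f assume f: "f \<in> ?N \<inter> ?N'"
      have "f i = \<zero>" for i
      proof -
        have "f i = f i \<otimes> e' i" using f by simp
        also have "\<dots> = f i \<oplus> \<ominus> f i" using f fe'[of f i] by simp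
        finally show ?thesis using f fc[of f i] by (simp add: r_neg)
      qed
      then show "f \<in> {\<zero>\<^bsub>?F\<^esub>}" by (auto simp: free_simps)
    qed (auto simp: free_simps ec ec')
    show "set_add ?F ?N ?N' = carrier ?F"
    proof (intro equalityI subsetI)
      fix f assume "f \<in> set_add ?F ?N ?N'"
      then obtain a b where ab: "a \<in> carrier ?F" "b \<in> carrier ?F" "f = (\<lambda>i. a i \<oplus> b i)"
        by (auto simp: set_add_def set_mult_def free_simps(3))
      have "{i. a i \<oplus> b i \<noteq> \<zero>} \<subseteq> {i. a i \<noteq> \<zero>} \<union> {i. b i \<noteq> \<zero>}" by auto
      moreover have "finite ({i. a i \<noteq> \<zero>} \<union> {i. b i \<noteq> \<zero>})" using ab by (simp add: free_simps)
      ultimately have "finite {i. a i \<oplus> b i \<noteq> \<zero>}" by (rule finite_subset)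
      then show "f \<in> carrier ?F" using ab by (auto simp: free_simps)
    next
      fix f assume f: "f \<in> carrier ?F"
      have sub: "finite {i. f i \<otimes> u i \<noteq> \<zero>}" if "\<And>i. u i \<in> carrier A" for u
      proof (rule finite_subset[of _ "{i. f i \<noteq> \<zero>}"])
        show "{i. f i \<otimes> u i \<noteq> \<zero>} \<subseteq> {i. f i \<noteq> \<zero>}" using that by auto
      qed (use f in \<open>simp add: free_simps\<close>)
      have "(\<lambda>i. f i \<otimes> e i) \<in> ?N" using f sub[of e, OF ec] ec fc[OF f] e(2) by (auto simp: free_simps m_assoc)
      moreover have "(\<lambda>i. f i \<otimes> e' i) \<in> ?N'"
        using f sub[of e', OF ec'] ec' fc[OF f] e'2 by (auto simp: free_simps m_assoc)
      moreover have "f = (\<lambda>i. f i \<otimes> e i \<oplus> f i \<otimes> e' i)"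
      proof
        fix i
        have "f i \<otimes> e i \<oplus> (\<ominus> (f i \<otimes> e i) \<oplus> f i) = f i"
          using fc[OF f, of i] ec[of i] by (simp add: r_neg2)
        then show "f i = f i \<otimes> e i \<oplus> f i \<otimes> e' i"
          using fc[OF f, of i] ec[of i] by (simp add: fe'[OF f] a_comm)
      qed
      ultimately show "f \<in> set_add ?F ?N ?N'"
        by (auto simp: set_add_def set_mult_def free_simps(3))
    qed
  qed
qed

end

text \<open>Generators bounded below over an algebra in nonnegative degrees. This is what makes the filtration
  by the homological degree of the generators start at zero and respect the differential.\<close>

locale bounded_twisted = twisted A p q e z
  for A :: "('k, 'a, 'n::finite) dg_struct" (structure)
    and p :: "'i \<Rightarrow> int" and q :: "'i \<Rightarrow> int ^ 'n" and e :: "'i \<Rightarrow> 'a" and z :: "'i \<Rightarrow> 'i \<Rightarrow> 'a" +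
  fixes b :: int
  assumes A_below: "h < 0 \<Longrightarrow> piece A h g = {\<zero>}"
    and e_below: "e i \<noteq> \<zero> \<Longrightarrow> b \<le> p i"
begin

text \<open>The coefficient \<open>z i j\<close> has degree \<open>p i - 1 - p j\<close>, which must not be
  negative.\<close>

lemma z_lower:
  assumes "z i j \<noteq> \<zero>"
  shows "p j < p i"
proof (rule ccontr)
  assume "\<not> p j < p i"
  then have "piece A (p i - 1 - p j) (q i - q j) = {\<zero>}" by (intro A_below) simp
  then show False using z_piece[of i j] assms by simp
qed

lemma T_support: "f \<in> carrier T \<Longrightarrow> f i \<noteq> \<zero> \<Longrightarrow> e i \<noteq> \<zero>"
  using T_e[of f i] T_closed[of f i] by force

text \<open>The generators of degree at least \<open>k\<close> are removed by setting their idempotents to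
  zero; the result is again a twisted module over the same index type, and a submodule of
  \<open>T\<close>.\<close>

definition trunc_e :: "int \<Rightarrow> 'i \<Rightarrow> 'a" where
  "trunc_e k i = (if p i < k then e i else \<zero>)"

definition trunc_z :: "int \<Rightarrow> 'i \<Rightarrow> 'i \<Rightarrow> 'a" where
  "trunc_z k i = (if p i < k then z i else (\<lambda>_. \<zero>))"

lemma trunc_twisted: "twisted A p q (trunc_e k) (trunc_z k)"
proof (intro twisted.intro dg_ring_axioms twisted_axioms.intro)
  fix i j
  show "trunc_e k i \<in> piece A 0 0" "trunc_e k i \<otimes> trunc_e k i = trunc_e k i"
    "diff A (trunc_e k i) = \<zero>" "finite {j. trunc_z k i j \<noteq> \<zero>}"
    using e_piece e_idem e_diff z_fin by (simp_all add: trunc_e_def trunc_z_def)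
  show "trunc_z k i j \<in> piece A (p i - 1 - p j) (q i - q j)"
    using z_piece by (simp add: trunc_z_def)
  show "trunc_z k i j \<otimes> trunc_e k j = trunc_z k i j"
  proof (cases "trunc_z k i j = \<zero>")
    case False
    then have "p i < k" "z i j \<noteq> \<zero>" by (auto simp: trunc_z_def split: if_splits)
    then have "p j < k" using z_lower by fastforce
    then show ?thesis using z_e by (simp add: trunc_z_def trunc_e_def)
  qed (simp add: trunc_e_def)
  have "(\<Oplus>j\<in>{j. z i j \<noteq> \<zero>}. sg (z i j) \<otimes> trunc_z k j l) = (\<Oplus>j\<in>{j. z i j \<noteq> \<zero>}. sg (z i j) \<otimes> z j l)"
    if "p i < k" for l
  proof (rule finsum_cong')
    fix j' assume "j' \<in> {j. z i j \<noteq> \<zero>}"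
    then have "p j' < k" using z_lower[of i j'] that by simp
    then show "sg (z i j') \<otimes> trunc_z k j' l = sg (z i j') \<otimes> z j' l" by (simp add: trunc_z_def)
  qed auto
  then show "diff A (trunc_z k i l) \<oplus>
      (\<Oplus>j\<in>{j. trunc_z k i j \<noteq> \<zero>}. sg (trunc_z k i j) \<otimes> trunc_z k j l) = \<zero>" for l
    using z_diff[of i l] by (cases "p i < k") (simp_all add: trunc_z_def)
qed

abbreviation TT where "TT k \<equiv> twisted_module p q (trunc_e k) (trunc_z k)"

lemma TT_carrier: "f \<in> carrier (TT k) \<longleftrightarrow> f \<in> carrier T \<and> (\<forall>i. f i \<noteq> \<zero> \<longrightarrow> p i < k)"
proof -
  interpret k: twisted A p q "trunc_e k" "trunc_z k" by (rule trunc_twisted)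
  have "f i \<otimes> trunc_e k i = f i \<longleftrightarrow> f i \<otimes> e i = f i \<and> (f i \<noteq> \<zero> \<longrightarrow> p i < k)" if "f i \<in> carrier A" for i
    using that by (cases "f i = \<zero>") (auto simp: trunc_e_def)
  then show ?thesis unfolding k.T_carrier T_carrier by blast
qed

lemma TT_piece: "f \<in> piece (TT k) h g \<longleftrightarrow> f \<in> carrier (TT k) \<and> f \<in> piece T h g"
proof -
  interpret k: twisted A p q "trunc_e k" "trunc_z k" by (rule trunc_twisted)
  show ?thesis by (auto simp: k.T_piece T_piece TT_carrier)
qed

lemma TT_diff:
  assumes "f \<in> carrier (TT k)"
  shows "diff (TT k) f = diff T f"
proof
  interpret k: twisted A p q "trunc_e k" "trunc_z k" by (rule trunc_twisted)
  fix l
  have f: "f \<in> carrier T" "\<And>i. f i \<noteq> \<zero> \<Longrightarrow> p i < k" using assms by (auto simp: TT_carrier)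
  have "(\<Oplus>i\<in>{i. f i \<noteq> \<zero>}. sg (f i) \<otimes> trunc_z k i l) = (\<Oplus>i\<in>{i. f i \<noteq> \<zero>}. sg (f i) \<otimes> z i l)"
    by (rule finsum_cong') (use T_closed[OF f(1)] in \<open>auto simp: trunc_z_def dest: f(2)\<close>)
  then show "diff (TT k) f l = diff T f l" by (simp add: k.T_diff T_diff)
qed

lemma TT_restrict_dg_module:
  assumes J: "inj J"
  shows "dg_module A (dg_restrict (dg_image J T) (J ` carrier (TT k)))"
proof -
  interpret k: twisted A p q "trunc_e k" "trunc_z k" by (rule trunc_twisted)
  show ?thesis
  proof (rule dg_module_transport[OF k.T_dg_ring_module, of J])
    show "bij_betw J (carrier (TT k)) (carrier (dg_restrict (dg_image J T) (J ` carrier (TT k))))"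
      using J by (auto simp: dg_restrict_simps bij_betw_def intro: inj_on_subset)
    show "piece (dg_restrict (dg_image J T) (J ` carrier (TT k))) h g = J ` piece (TT k) h g" for h g
      using J by (auto simp: dg_restrict_simps dg_image_simps TT_piece inj_eq)
  qed (use J in \<open>simp_all add: dg_restrict_simps dg_image_simps TT_diff\<close>)
qed

text \<open>Reading off the coefficients of the generators of degree exactly \<open>k\<close> maps onto
  \<open>\<Oplus> A e\<^sub>i\<close> with kernel the truncation below \<open>k\<close>. It commutes
  with the differentials since the boundary of a generator has no component of the same or a higher
  degree. The free module must be indexed by elements of the type of the quotient; the injection
  \<open>\<iota>\<close> provides them.\<close>

lemma TT_quotient_relatively_projective:
  fixes J :: "('i \<Rightarrow> 'a) \<Rightarrow> 'y" and \<iota> :: "'i \<Rightarrow> 'y set"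
  assumes J: "inj J" and \<iota>: "inj \<iota>"
  shows "relatively_projective A
    (dg_quotient (dg_restrict (dg_image J T) (J ` carrier (TT (k + 1)))) (J ` carrier (TT k)))"
proof -
  let ?Y = "dg_image J T" and ?k = "inv_into UNIV \<iota>"
  let ?M = "dg_restrict ?Y (J ` carrier (TT (k + 1)))"
  define I where "I = \<iota> ` {i. p i = k}"
  define e' where "e' x = (if x \<in> I then e (?k x) else \<zero>)" for x
  let ?F = "free_dg_module A I (\<lambda>x. p (?k x)) (\<lambda>x. q (?k x))"
  let ?N = "{f \<in> carrier ?F. \<forall>i. f i \<otimes> e' i = f i}"
  have k\<iota> [simp]: "?k (\<iota> i) = i" for i using \<iota> by simp
  have e'1: "e' x \<in> piece A 0 0" "e' x \<otimes> e' x = e' x" "diff A (e' x) = \<zero>" for x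
    using e_piece e_idem e_diff by (simp_all add: e'_def)
  have e'0: "x \<notin> I \<Longrightarrow> e' x = \<zero>" for x by (simp add: e'_def)
  have ds: "direct_summand A ?F ?N" by (rule free_direct_summand[OF e'1 e'0])
  then have "dg_module A (dg_restrict ?F ?N)" by (simp add: direct_summand_def dg_submodule_def)
  then have P: "dg_ring_module A (dg_restrict ?F ?N)" by (intro dg_ring_module.intro dg_ring_axioms)
  have M: "dg_ring_module A ?M"
    by (intro dg_ring_module.intro dg_ring_axioms TT_restrict_dg_module[OF J])
  \<comment> \<open>the coefficients in degree exactly \<open>k\<close>, reindexed by \<open>I\<close>\<close>
  define R where "R f = (\<lambda>x. if x \<in> I then f (?k x) else \<zero>)" for f :: "'i \<Rightarrow> 'a"
  define G where "G y = R (inv_into UNIV J y)" for y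
  have GJ [simp]: "G (J f) = R f" for f using J by (simp add: G_def)
  have I_iff: "\<iota> i \<in> I \<longleftrightarrow> p i = k" for i using \<iota> by (auto simp: I_def inj_eq)
  have I_ex: "\<exists>i. x = \<iota> i \<and> p i = k" if "x \<in> I" for x using that by (auto simp: I_def)
  have R\<iota>: "R f (\<iota> i) = (if p i = k then f i else \<zero>)" for f i by (simp add: R_def I_iff)
  have fT: "f \<in> carrier T" "\<And>i. f i \<noteq> \<zero> \<Longrightarrow> p i \<le> k" if "f \<in> carrier (TT (k + 1))" for f
    using that by (auto simp: TT_carrier)
  have RF: "R f \<in> ?N" if f: "f \<in> carrier (TT (k + 1))" for f
  proof -
    have "{x. R f x \<noteq> \<zero>} \<subseteq> \<iota> ` {i. f i \<noteq> \<zero>}"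
      by (auto simp: R_def split: if_splits dest!: I_ex)
    then have "finite {x. R f x \<noteq> \<zero>}"
      using T_fin[OF fT(1)[OF f]] by (meson finite_imageI finite_subset)
    then show ?thesis
      using T_closed[OF fT(1)[OF f]] T_e[OF fT(1)[OF f]] by (auto simp: free_simps R_def e'_def)
  qed
  have "dg_isomorphic A (dg_quotient ?M (J ` carrier (TT k))) (dg_restrict ?F ?N)"
  proof (rule dg_first_isomorphism[OF M P, of G])
    show "dg_hom A ?M (dg_restrict ?F ?N) G"
      unfolding dg_hom_def
    proof (intro conjI ballI allI)
      show "G \<in> carrier ?M \<rightarrow> carrier (dg_restrict ?F ?N)"
      proof
        fix y assume "y \<in> carrier ?M"
        then obtain f where "f \<in> carrier (TT (k + 1))" "y = J f" by (auto simp: dg_restrict_simps)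
        then show "G y \<in> carrier (dg_restrict ?F ?N)" using RF[of f] unfolding dg_restrict_simps by simp
      qed
      fix x assume "x \<in> carrier ?M"
      then obtain f where f: "f \<in> carrier (TT (k + 1))" "x = J f" by (auto simp: dg_restrict_simps)
      note fc = T_closed[OF fT(1)[OF f(1)]]
      show "G (x \<oplus>\<^bsub>?M\<^esub> y) = G x \<oplus>\<^bsub>dg_restrict ?F ?N\<^esub> G y" if y: "y \<in> carrier ?M" for y
      proof -
        obtain f' where "y = J f'" using y by (auto simp: dg_restrict_simps)
        then show ?thesis using J f by (auto simp: dg_restrict_simps dg_image_simps free_simps R_def)
      qed
      show "G (diff ?M x) = diff (dg_restrict ?F ?N) (G x)"
      proof -
        have "R (diff T f) y = diff A (R f y)" for y
        proof (cases "y \<in> I")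
          case True
          then obtain i where i: "y = \<iota> i" "p i = k" using I_ex by blast
          have "(\<Oplus>j\<in>{j. f j \<noteq> \<zero>}. sg (f j) \<otimes> z j i) = \<zero>"
          proof (rule add.finprod_one_eqI)
            fix j assume "j \<in> {j. f j \<noteq> \<zero>}"
            then have "\<not> p i < p j" using fT(2)[OF f(1), of j] i(2) by simp
            then have "z j i = \<zero>" using z_lower by blast
            then show "sg (f j) \<otimes> z j i = \<zero>" using fc by simp
          qed
          then show ?thesis using i fc by (simp add: R\<iota> T_diff)
        next
          case False
          then show ?thesis by (simp add: R_def)
        qed
        then show ?thesis using J f(2) by (auto simp: dg_restrict_simps dg_image_simps free_simps)
      qed
    next
      fix a x assume a: "a \<in> carrier A" and "x \<in> carrier ?M"
      then obtain f where f: "f \<in> carrier (TT (k + 1))" "x = J f" by (auto simp: dg_restrict_simps)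
      show "G (a \<odot>\<^bsub>?M\<^esub> x) = a \<odot>\<^bsub>dg_restrict ?F ?N\<^esub> G x"
        using J f a by (auto simp: dg_restrict_simps dg_image_simps free_simps R_def)
    next
      fix h g
      show "G ` piece ?M h g \<subseteq> piece (dg_restrict ?F ?N) h g"
      proof
        fix y assume "y \<in> G ` piece ?M h g"
        then obtain x where "x \<in> piece ?M h g" "y = G x" by blast
        then obtain f where f: "f \<in> carrier (TT (k + 1))" "f \<in> piece T h g" "y = R f"
          using J by (auto simp: dg_restrict_simps dg_image_simps inj_eq)
        have "R f x \<in> piece A (h - p (?k x)) (g - q (?k x))" for x
          using f(2) by (simp add: R_def T_piece)
        then show "y \<in> piece (dg_restrict ?F ?N) h g"
          using RF[OF f(1)] f(3) by (simp add: dg_restrict_simps free_simps(5))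
      qed
    qed
    show "G ` carrier ?M = carrier (dg_restrict ?F ?N)"
    proof (intro equalityI subsetI)
      fix y assume "y \<in> G ` carrier ?M"
      then obtain f where "f \<in> carrier (TT (k + 1))" "y = R f" by (auto simp: dg_restrict_simps)
      then show "y \<in> carrier (dg_restrict ?F ?N)" using RF by (simp only: dg_restrict_simps)
    next
      fix y assume "y \<in> carrier (dg_restrict ?F ?N)"
      then have y: "\<forall>x\<in>I. y x \<in> carrier A" "\<forall>x. x \<notin> I \<longrightarrow> y x = \<zero>" "finite {x. y x \<noteq> \<zero>}"
        "\<forall>x. y x \<otimes> e' x = y x" by (auto simp: dg_restrict_simps free_simps)
      define f where "f i = (if p i = k then y (\<iota> i) else \<zero>)" for i
      have "finite (\<iota> -` {x. y x \<noteq> \<zero>})" using y(3) \<iota> by (intro finite_vimageI)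
      moreover have "{i. f i \<noteq> \<zero>} \<subseteq> \<iota> -` {x. y x \<noteq> \<zero>}" by (auto simp: f_def)
      ultimately have "finite {i. f i \<noteq> \<zero>}" by (rule rev_finite_subset)
      moreover have "f i \<in> carrier A \<and> f i \<otimes> e i = f i" for i
      proof (cases "p i = k")
        case True
        then have "y (\<iota> i) \<in> carrier A" "y (\<iota> i) \<otimes> e' (\<iota> i) = y (\<iota> i)" using y I_iff by blast+
        then show ?thesis using True by (simp add: f_def e'_def I_iff)
      next
        case False
        then show ?thesis by (simp add: f_def)
      qed
      ultimately have "f \<in> carrier (TT (k + 1))"
        by (auto simp: TT_carrier T_carrier f_def)
      moreover have "y = R f"
      proof
        fix x
        show "y x = R f x"
        proof (cases "x \<in> I")
          case True
          then obtain i where "x = \<iota> i" "p i = k" using I_ex by blast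
          then show ?thesis by (simp add: R\<iota> f_def)
        next
          case False
          then show ?thesis using y(2) by (simp add: R_def)
        qed
      qed
      ultimately show "y \<in> G ` carrier ?M"
        by (intro image_eqI[of _ _ "J f"]) (simp_all add: dg_restrict_simps)
    qed
    show "J ` carrier (TT k) = {x \<in> carrier ?M. G x = \<zero>\<^bsub>dg_restrict ?F ?N\<^esub>}"
    proof (intro equalityI subsetI)
      fix x assume "x \<in> J ` carrier (TT k)"
      then obtain f where f: "f \<in> carrier (TT k)" "x = J f" by blast
      have "f \<in> carrier (TT (k + 1))" using f(1) by (force simp: TT_carrier)
      moreover have "R f y = \<zero>" for y
      proof (cases "y \<in> I")
        case True
        then obtain i where "y = \<iota> i" "p i = k" using I_ex by blast
        then show ?thesis using f(1) by (auto simp: R\<iota> TT_carrier)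
      qed (simp add: R_def)
      ultimately show "x \<in> {x \<in> carrier ?M. G x = \<zero>\<^bsub>dg_restrict ?F ?N\<^esub>}"
        using f(2) by (auto simp: dg_restrict_simps free_simps)
    next
      fix x assume "x \<in> {x \<in> carrier ?M. G x = \<zero>\<^bsub>dg_restrict ?F ?N\<^esub>}"
      then obtain f where f: "f \<in> carrier (TT (k + 1))" "x = J f" and "R f = (\<lambda>_. \<zero>)"
        by (auto simp: dg_restrict_simps free_simps)
      then have R0: "R f (\<iota> i) = \<zero>" for i by simp
      have "p i < k" if "f i \<noteq> \<zero>" for i
        using fT(2)[OF f(1) that] that R0[of i] unfolding R\<iota> by (cases "p i = k") simp_all
      then show "x \<in> J ` carrier (TT k)" using f fT(1)[OF f(1)] by (auto simp: TT_carrier)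
    qed
  qed
  with ds show ?thesis unfolding relatively_projective_def
    by (intro exI[of _ I] exI[of _ "\<lambda>x. p (?k x)"] exI[of _ "\<lambda>x. q (?k x)"] exI[of _ ?N] conjI)
qed

text \<open>The filtration starts at \<open>b\<close>, below which there are no generators, and is exhaustive
  because elements have finite support.\<close>

theorem property_P_image:
  fixes J :: "('i \<Rightarrow> 'a) \<Rightarrow> 'y" and \<iota> :: "'i \<Rightarrow> 'y set"
  assumes J: "inj J" and \<iota>: "inj \<iota>"
  shows "property_P A (dg_image J T)"
  unfolding property_P_def
proof (intro exI[of _ "\<lambda>r. J ` carrier (TT (b + int r))"] conjI allI)
  have zT: "(\<lambda>_. \<zero>) \<in> carrier T" by (simp add: T_carrier)
  have "f = (\<lambda>_. \<zero>)" if "f \<in> carrier (TT b)" for f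
  proof
    fix i show "f i = \<zero>"
      using that T_support[of f i] e_below[of i] by (force simp: TT_carrier)
  qed
  then have "carrier (TT b) = {\<lambda>_. \<zero>}" using zT by (auto simp: TT_carrier)
  then show "J ` carrier (TT (b + int 0)) = {\<zero>\<^bsub>dg_image J T\<^esub>}"
    using J by (simp add: dg_image_simps)
  show "dg_submodule A (dg_image J T) (J ` carrier (TT (b + int r)))" for r
    unfolding dg_submodule_def using TT_restrict_dg_module[OF J] J
    by (auto simp: dg_image_simps TT_carrier)
  show "J ` carrier (TT (b + int r)) \<subseteq> J ` carrier (TT (b + int (Suc r)))" for r
    by (rule image_mono) (force simp: TT_carrier)
  show "(\<Union>r. J ` carrier (TT (b + int r))) = carrier (dg_image J T)"
  proof -
    have "\<exists>r. f \<in> carrier (TT (b + int r))" if f: "f \<in> carrier T" for f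
    proof -
      have fin: "finite (p ` {i. f i \<noteq> \<zero>})" using T_fin[OF f] by simp
      obtain B where B: "\<And>i. f i \<noteq> \<zero> \<Longrightarrow> p i \<le> B"
        using finite_imp_Sup_less[OF fin] Max_ge[OF fin] by blast
      have "p i < b + int (nat (B - b + 1))" if "f i \<noteq> \<zero>" for i using B[OF that] by simp
      then show ?thesis using f unfolding TT_carrier by blast
    qed
    then have "(\<Union>r. carrier (TT (b + int r))) = carrier T" by (auto simp: TT_carrier)
    then show ?thesis using J by (simp add: dg_image_simps flip: image_UN)
  qed
  show "relatively_projective A (dg_quotient (dg_restrict (dg_image J T)
      (J ` carrier (TT (b + int (Suc r))))) (J ` carrier (TT (b + int r))))" for r
    using TT_quotient_relatively_projective[OF J \<iota>, of "b + int r"] by (simp add: ac_simps)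
qed

lemma T_below: "h < b \<Longrightarrow> piece T h g = {\<zero>\<^bsub>T\<^esub>}"
proof (intro equalityI subsetI)
  fix f assume h: "h < b" and f: "f \<in> piece T h g"
  then have fc: "f \<in> carrier T" by (simp add: T_piece)
  have "f i = \<zero>" for i
  proof (rule ccontr)
    assume "f i \<noteq> \<zero>"
    then have "b \<le> p i" using T_support[OF fc] e_below by blast
    then have "piece A (h - p i) (g - q i) = {\<zero>}" using h by (intro A_below) simp
    then show False using f \<open>f i \<noteq> \<zero>\<close> by (auto simp: T_piece)
  qed
  then show "f \<in> {\<zero>\<^bsub>T\<^esub>}" by auto
qed (simp add: T_piece T_carrier)

text \<open>The generators are the elements \<open>e\<^sub>i x\<^sub>i\<close> with \<open>e\<^sub>i \<noteq>
  0\<close>; being nonzero, each of them lies in pieces of its own weight \<open>q i\<close> only.\<close>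

theorem cblf_generated_image:
  fixes J :: "('i \<Rightarrow> 'a) \<Rightarrow> 'y"
  assumes J: "inj J" and C: "compatible_cone lt C"
    and q: "\<And>i. e i \<noteq> \<zero> \<Longrightarrow> real_vec (q i - e0) \<in> C"
    and fin: "\<And>g. finite {i. q i = g \<and> e i \<noteq> \<zero>}"
  shows "cblf_generated lt A (dg_image J T)" "bounded_below (dg_image J T)"
proof -
  let ?Y = "dg_image J T"
  interpret T: dg_ring_module A T by (rule T_dg_ring_module)
  have "dg_ring_module A ?Y"
    by (intro dg_ring_module.intro dg_ring_axioms dg_image_dg_module T_dg_ring_module J)
  then interpret Y: dg_ring_module A ?Y .
  show bb: "bounded_below ?Y"
    unfolding bounded_below_def using J T_below by (intro exI[of _ b]) (simp add: dg_image_simps)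
  define x where "x i = single i (e i)" for i
  have xc: "x i \<in> carrier T" for i using single_closed[of "e i" i] e_idem by (simp add: x_def)
  have xp: "x i \<in> piece T (p i) (q i)" for i
    using xc e_piece by (simp add: T_piece x_def single_def)
  have xdeg: "g = q i" if "x i \<in> piece T h g" "e i \<noteq> \<zero>" for i h g
  proof -
    have "x i i \<in> piece A (h - p i) (g - q i)" using that(1) by (simp add: T_piece)
    then have "e i \<in> piece A (h - p i) (g - q i)" by (simp add: x_def single_def)
    then have "(h - p i, g - q i) = (0, 0)"
      using component_same[OF e_piece[of i]] component_other[of "e i" "h - p i" "g - q i" "(0, 0)"] that(2) by metis
    then show ?thesis by simp
  qed
  let ?X = "(\<lambda>i. J (x i)) ` {i. e i \<noteq> \<zero>}"
  have Xg: "?X \<inter> (\<Union>h. piece ?Y h g) \<subseteq> (\<lambda>i. J (x i)) ` {i. q i = g \<and> e i \<noteq> \<zero>}" for g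
    using J xdeg by (auto simp: dg_image_simps inj_eq)
  have gen: "generates A ?Y ?X"
    unfolding generates_def
  proof (intro conjI ballI)
    show "?X \<subseteq> carrier ?Y" using J xc by (auto simp: dg_image_simps)
    fix m assume "m \<in> carrier ?Y"
    then obtain f where f: "f \<in> carrier T" "m = J f" using J by (auto simp: dg_image_simps)
    let ?S = "{i. f i \<noteq> \<zero>}"
    have fS: "finite ?S" by (rule T_fin[OF f(1)])
    have eS: "e i \<noteq> \<zero>" if "i \<in> ?S" for i using T_support[OF f(1)] that by simp
    have fA: "f i \<in> carrier A" for i by (rule T_closed[OF f(1)])
    \<comment> \<open>generators with nonzero coefficient are distinct elements, so their index can be
                    recovered\<close>
    define K where "K y = (THE i. i \<in> ?S \<and> y = J (x i))" for y
    have xinj: "i = i'" if "x i = x i'" "e i \<noteq> \<zero>" for i i'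
      using fun_cong[OF that(1), of i] that(2) by (auto simp: x_def single_def split: if_splits)
    have K: "K (J (x i)) = i" if "i \<in> ?S" for i
      unfolding K_def using that eS[OF that] J by (intro the_equality) (auto simp: inj_eq intro: xinj[symmetric])
    have inj: "inj_on (\<lambda>i. J (x i)) ?S" by (rule inj_on_inverseI[of _ K]) (rule K)
    let ?Z = "(\<lambda>i. J (x i)) ` ?S"
    have fx: "(\<lambda>k. f i \<otimes> x i k) \<in> carrier T" for i using T_smult_closed[OF fA xc] .
    have "(\<Oplus>\<^bsub>?Y\<^esub>y\<in>?Z. f (K y) \<odot>\<^bsub>?Y\<^esub> y) = (\<Oplus>\<^bsub>?Y\<^esub>i\<in>?S. f (K (J (x i))) \<odot>\<^bsub>?Y\<^esub> J (x i))"
      by (rule Y.M.add.finprod_reindex[OF _ inj])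
        (use J in \<open>auto simp: dg_image_simps intro!: imageI T_smult_closed fA xc\<close>)
    also have "\<dots> = (\<Oplus>\<^bsub>?Y\<^esub>i\<in>?S. J (\<lambda>k. f i \<otimes> x i k))"
      by (rule Y.M.finsum_cong') (use J K fx in \<open>auto simp: dg_image_simps\<close>)
    also have "\<dots> = J (\<Oplus>\<^bsub>T\<^esub>i\<in>?S. (\<lambda>k. f i \<otimes> x i k))"
      by (rule T.M.additive_finsum[OF Y.M.abelian_group_axioms, symmetric])
        (use J fx fS in \<open>auto simp: dg_image_simps\<close>)
    also have "(\<Oplus>\<^bsub>T\<^esub>i\<in>?S. (\<lambda>k. f i \<otimes> x i k)) = f"
    proof
      fix k
      have "(\<Oplus>\<^bsub>T\<^esub>i\<in>?S. (\<lambda>k. f i \<otimes> x i k)) k = (\<Oplus>i\<in>?S. f i \<otimes> x i k)"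
        by (rule T_eval_finsum) (use fx fS in auto)
      also have "\<dots> = (\<Oplus>i\<in>?S. if k = i then f k else \<zero>)"
        using T_e[OF f(1)] fA by (intro finsum_cong') (auto simp: x_def single_def)
      also have "\<dots> = f k"
      proof (cases "k \<in> ?S")
        case True
        then show ?thesis using add.finprod_singleton[of k ?S "\<lambda>_. f k"] fS fA by simp
      next
        case False
        have "(\<Oplus>i\<in>?S. if k = i then f k else \<zero>) = \<zero>"
          by (rule add.finprod_one_eqI) (use False in auto)
        then show ?thesis using False by simp
      qed
      finally show "(\<Oplus>\<^bsub>T\<^esub>i\<in>?S. (\<lambda>k. f i \<otimes> x i k)) k = f k" .
    qed
    finally have "m = (\<Oplus>\<^bsub>?Y\<^esub>y\<in>?Z. f (K y) \<odot>\<^bsub>?Y\<^esub> y)" using f(2) by simp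
    moreover have "?Z \<subseteq> ?X" using eS by blast
    moreover have "(\<lambda>y. f (K y)) \<in> ?Z \<rightarrow> carrier A" using fA by simp
    moreover have "finite ?Z" using fS by simp
    ultimately show "\<exists>Z a. finite Z \<and> Z \<subseteq> ?X \<and> a \<in> Z \<rightarrow> carrier A \<and> m = (\<Oplus>\<^bsub>?Y\<^esub>y\<in>Z. a y \<odot>\<^bsub>?Y\<^esub> y)"
      by blast
  qed
  show "cblf_generated lt A ?Y"
    unfolding cblf_generated_def
  proof (intro conjI exI[of _ ?X] bb gen allI exI[of _ e0] exI[of _ C] C impI)
    show "?X \<subseteq> (\<Union>h g. piece ?Y h g)" using J xp by (auto simp: dg_image_simps)
    show "finite (?X \<inter> (\<Union>h. piece ?Y h g))" for g
      by (rule finite_subset[OF Xg]) (use fin in blast)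
    fix g assume "real_vec (g - e0) \<notin> C"
    then have empty: "{i. q i = g \<and> e i \<noteq> \<zero>} = {}" using q by blast
    show "?X \<inter> (\<Union>h. piece ?Y h g) \<subseteq> {\<zero>\<^bsub>?Y\<^esub>}" using Xg[of g] unfolding empty by blast
  qed
qed

end

section \<open>All weights: the limit of the attachments\<close>

context dg_ring_module
begin

text \<open>The conditions on a cell involve this cell and those in its boundary only. So a sequence each cell
  of which has a neighbourhood in some valid sequence is valid; in particular, limits of attachments
  are.\<close>

lemma valid_cells_local:
  assumes "\<And>i. \<exists>c'. valid_cells c' \<and> c' i = c i \<and> (\<forall>j. bdry (c i) j \<noteq> \<zero> \<longrightarrow> c' j = c j)"
  shows "valid_cells c"
proof -
  have c1: "idem (c i) \<in> piece A 0 0" "idem (c i) \<otimes> idem (c i) = idem (c i)" "diff A (idem (c i)) = \<zero>"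
    "finite {j. bdry (c i) j \<noteq> \<zero>}" "img (c i) \<in> piece M (hdeg (c i)) (wdeg (c i))" for i
  proof -
    obtain c' where c': "valid_cells c'" "c' i = c i" using assms[of i] by blast
    show "idem (c i) \<in> piece A 0 0" "idem (c i) \<otimes> idem (c i) = idem (c i)" "diff A (idem (c i)) = \<zero>"
      "finite {j. bdry (c i) j \<noteq> \<zero>}" "img (c i) \<in> piece M (hdeg (c i)) (wdeg (c i))"
      using valid_cellsD[OF c'(1), of i] c'(2) by simp_all
  qed
  have ec: "idem (c i) \<in> carrier A" for i by (rule piece_carrier[OF c1(1)])
  have row: "(bdry (c i) j \<otimes> idem (c j) = bdry (c i) j) \<and>
      bdry (c i) j \<in> piece A (hdeg (c i) - 1 - hdeg (c j)) (wdeg (c i) - wdeg (c j)) \<and>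
      diff (cT c) (bdry (c i)) = (\<lambda>_. \<zero>) \<and> cphi c (bdry (c i)) = diff M (img (c i))" for i j
  proof -
    obtain c' where c': "valid_cells c'" "c' i = c i" and ag: "\<And>j. bdry (c i) j \<noteq> \<zero> \<Longrightarrow> c' j = c j"
      using assms[of i] by blast
    interpret c': cells A M c' using c'(1) by (simp add: valid_cells_def)
    have z: "bdry (c i) \<in> carrier (cT c')" using valid_cellsD(10)[OF c'(1), of i] c'(2) by simp
    note agree = cT_agree[where f = "bdry (c i)" and c = c' and c' = c, OF ag valid_cellsD(2)[OF c'(1)]
        valid_cellsD(3)[OF c'(1)] valid_cellsD(7)[OF c'(1)] ec]
    have "bdry (c i) j \<otimes> idem (c j) = bdry (c i) j \<and>
        bdry (c i) j \<in> piece A (hdeg (c i) - 1 - hdeg (c j)) (wdeg (c i) - wdeg (c j))"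
    proof (cases "bdry (c i) j = \<zero>")
      case True
      then show ?thesis using ec by simp
    next
      case False
      then show ?thesis
        using valid_cellsD(4,5)[OF c'(1), where i = i and j = j] c'(2) ag[OF False] by simp
    qed
    moreover have "diff (cT c) (bdry (c i)) = (\<lambda>_. \<zero>)"
      using agree(3)[OF _ z] c'.T_diff_z[of i] c'(2) by simp
    moreover have "cphi c (bdry (c i)) = diff M (img (c i))"
      using agree(4)[OF _ z] valid_cellsD(8)[OF c'(1), of i] c'(2) by simp
    ultimately show ?thesis by blast
  qed
  show ?thesis
    unfolding valid_cells_def
  proof (intro cells.intro twisted_map.intro twisted.intro twisted_axioms.intro twisted_map_axioms.intro
      dg_ring_axioms dg_ring_module_axioms)
    show "diff A (bdry (c i) k) \<oplus> (\<Oplus>j\<in>{j. bdry (c i) j \<noteq> \<zero>}. sg (bdry (c i) j) \<otimes> bdry (c j) k) = \<zero>" for i k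
    proof -
      have "diff (cT c) (bdry (c i)) k = \<zero>" using row[of i] by simp
      then show ?thesis by (simp add: twisted_module_def)
    qed
  qed (use c1 row in blast)+
qed

lemma valid_trivial_cells:
  "valid_cells (\<lambda>_. \<lparr>hdeg = h, wdeg = g, idem = \<zero>, bdry = (\<lambda>_. \<zero>), img = \<zero>\<^bsub>M\<^esub>\<rparr>)"
  unfolding valid_cells_def
  by (intro cells.intro twisted_map.intro twisted.intro twisted_axioms.intro twisted_map_axioms.intro
      dg_ring_axioms dg_ring_module_axioms) (simp_all add: phi_def)

end

context cell_attachment
begin

text \<open>In weight \<open>g\<close> the additional generators have coefficients in \<open>A\<^bsub>g -
  g'\<^esub> = 0\<close>, where \<open>g'\<close> is the weight of the generator. The elements of
  weight \<open>g\<close> thus remain the same, and so do their lifts.\<close>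

lemma weight_done_preserved:
  assumes c: "valid_cells c" and c': "valid_cells c'" and triv: "trivial_from n c"
    and same: "\<And>i. i < n \<Longrightarrow> c' i = c i"
    and new: "\<And>i. n \<le> i \<Longrightarrow> idem (c' i) \<noteq> \<zero> \<Longrightarrow> zpart A (g - wdeg (c' i)) = {\<zero>}"
    and don: "weight_done c g"
  shows "weight_done c' g"
proof -
  interpret c: cells A M c by (rule valid_cells_cells[OF c])
  interpret c': cells A M c' by (rule valid_cells_cells[OF c'])
  interpret T': dg_ring_module A "cT c'" by (rule c'.T_dg_ring_module)
  have supp: "f i = \<zero>" if f: "f \<in> zpart (cT c') g" and i: "n \<le> i" for f i
  proof (cases "idem (c' i) = \<zero>")
    case True
    have "f \<in> carrier (cT c')" using f by (simp add: c'.zpart_T_iff)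
    then show ?thesis using c'.T_e[of f i] c'.T_closed[of f i] True by simp
  next
    case False
    then show ?thesis using new[OF i False] f by (auto simp: c'.zpart_T_iff)
  qed
  have agree: "(f \<in> carrier (cT c) \<longleftrightarrow> f \<in> carrier (cT c')) \<and>
      (f \<in> piece (cT c) h g' \<longleftrightarrow> f \<in> piece (cT c') h g') \<and>
      (f \<in> carrier (cT c) \<longrightarrow> diff (cT c') f = diff (cT c) f \<and> cphi c' f = cphi c f)"
    if "\<And>i. n \<le> i \<Longrightarrow> f i = \<zero>" for f h g'
  proof -
    have ag: "c i = c' i" if "f i \<noteq> \<zero>" for i
    proof -
      have "i < n" using \<open>\<And>i. n \<le> i \<Longrightarrow> f i = \<zero>\<close>[of i] that by (meson not_less)
      then show ?thesis using same by simp
    qed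
    show ?thesis
      using cT_agree[where f = f and c = c and c' = c', OF ag valid_cellsD(2)[OF c] valid_cellsD(3)[OF c]
          valid_cellsD(7)[OF c] valid_cellsD(2)[OF c']] by blast
  qed
  show ?thesis
    unfolding weight_done_def
  proof (intro allI ballI impI)
    fix h m w
    assume m: "m \<in> piece M h g" and w: "w \<in> piece (cT c') (h - 1) g"
      and dw: "diff (cT c') w = (\<lambda>_. \<zero>)" and pw: "cphi c' w = diff M m"
    have w0: "\<And>i. n \<le> i \<Longrightarrow> w i = \<zero>" by (rule supp[OF T'.MG.piece_zpart[OF w]])
    have wc: "w \<in> piece (cT c) (h - 1) g" using agree[of w, OF w0] w by blast
    have "w \<in> carrier (cT c)" using wc by (simp add: c.T_piece)
    then have "diff (cT c) w = (\<lambda>_. \<zero>)" "cphi c w = diff M m" using agree[of w, OF w0] dw pw by simp_all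
    then have "(m, w) \<in> lifted c g" using don m wc unfolding weight_done_def by blast
    then obtain y where y: "y \<in> zpart (cT c) g" "m = cphi c y" "w = diff (cT c) y" by (auto simp: lifted_def)
    have yc: "y \<in> carrier (cT c)" using y(1) by (simp add: c.zpart_T_iff)
    have y0: "\<And>i. n \<le> i \<Longrightarrow> y i = \<zero>" by (rule cT_trivial[OF c triv yc])
    note ay = agree[of y, OF y0]
    have "y i \<in> zpart A (g - wdeg (c' i))" for i
    proof (cases "i < n")
      case True
      then show ?thesis using y(1) same[OF True] by (simp add: c.zpart_T_iff)
    next
      case False
      then show ?thesis using y0[of i] by simp
    qed
    then have "y \<in> zpart (cT c') g" using ay yc by (simp add: c'.zpart_T_iff)
    moreover have "cphi c' y = m" "diff (cT c') y = w" using ay yc y by simp_all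
    ultimately show "(m, w) \<in> lifted c' g" unfolding lifted_def by (intro image_eqI[of _ _ y]) simp_all
  qed
qed

definition extends_in ::
  "(int ^ 'n) set \<Rightarrow> nat \<Rightarrow> (nat \<Rightarrow> ('a, 'm, 'n) cell) \<Rightarrow> nat \<Rightarrow> (nat \<Rightarrow> ('a, 'm, 'n) cell) \<Rightarrow> bool" where
  "extends_in F n c n' c' \<longleftrightarrow>
     n \<le> n' \<and> (\<forall>i<n. c' i = c i) \<and> (\<forall>i. n \<le> i \<longrightarrow> i < n' \<longrightarrow> wdeg (c' i) \<in> F)"

text \<open>Weights of the same level do not interact, so they are completed one after the other.\<close>

lemma complete_level:
  assumes "finite F" "good n c"
    and "\<And>g g'. g \<in> F \<Longrightarrow> g' \<in> F \<Longrightarrow> g \<noteq> g' \<Longrightarrow> zpart A (g - g') = {\<zero>}"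
  shows "\<exists>n' c'. good n' c' \<and> extends_in F n c n' c' \<and> (\<forall>g\<in>F. weight_done c' g)"
  using assms(1,3)
proof (induction F)
  case empty
  show ?case using assms(2) by (intro exI[of _ n] exI[of _ c]) (simp add: extends_in_def)
next
  case (insert g F)
  obtain n1 c1 where 1: "good n1 c1" "extends_in F n c n1 c1" "\<forall>g\<in>F. weight_done c1 g"
    using insert by auto
  obtain n2 c2 where 2: "good n2 c2" "extends g n1 c1 n2 c2" "weight_done c2 g"
    using complete_weight[OF 1(1)] by blast
  have "extends_in (insert g F) n c n2 c2"
    unfolding extends_in_def
  proof (intro conjI allI impI)
    show "n \<le> n2" using 1(2) 2(2) by (simp add: extends_in_def extends_def)
    show "c2 i = c i" if "i < n" for i using 1(2) 2(2) that by (simp add: extends_in_def extends_def)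
    show "wdeg (c2 i) \<in> insert g F" if "n \<le> i" "i < n2" for i
      using 1(2) 2(2) that unfolding extends_in_def extends_def by (cases "i < n1") auto
  qed
  moreover have "weight_done c2 g'" if "g' \<in> F" for g'
  proof (rule weight_done_preserved[of c1 c2 n1])
    show "valid_cells c1" "valid_cells c2" "trivial_from n1 c1" using 1(1) 2(1) by (auto simp: good_def)
    show "c2 i = c1 i" if "i < n1" for i using 2(2) that by (simp add: extends_def)
    show "zpart A (g' - wdeg (c2 i)) = {\<zero>}" if i: "n1 \<le> i" "idem (c2 i) \<noteq> \<zero>" for i
    proof -
      have "i < n2" using 2(1) i(2) unfolding good_def trivial_from_def by (meson not_less)
      then have "wdeg (c2 i) = g" using 2(2) i(1) by (simp add: extends_def)
      moreover have "g' \<noteq> g" using insert.hyps \<open>g' \<in> F\<close> by blast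
      ultimately show ?thesis using insert.prems \<open>g' \<in> F\<close> by simp
    qed
    show "weight_done c1 g'" using 1(3) that by blast
  qed
  ultimately show ?case using 2(1,3) by blast
qed

text \<open>Level by level, for \<open>N = 0, 1, 2, \<dots>\<close>, the finitely many weights \<open>g \<in>
  e0 + C\<close> with \<open>L (g - e0) = N\<close> are completed. Cells that have been attached are
  never changed, so the stages have a limit. A weight of level \<open>N\<close> is finished after
  stage \<open>N\<close>: cells of the same or a higher level do not contribute to it because
  \<open>A\<^sub>v \<noteq> 0\<close> implies \<open>v = 0\<close> or \<open>L v > 0\<close>. For
  the same reason each weight has only finitely many generators. Weights outside \<open>e0 +
  C\<close> are zero in both modules.\<close>

theorem exists_resolving_cells:
  fixes L :: "int ^ 'n \<Rightarrow> int"
  assumes C0: "0 \<in> C" and Cadd: "\<And>x y. x \<in> C \<Longrightarrow> y \<in> C \<Longrightarrow> x + y \<in> C"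
    and Ladd: "\<And>x y. L (x + y) = L x + L y" and Lpos: "\<And>x. real_vec x \<in> C \<Longrightarrow> x \<noteq> 0 \<Longrightarrow> 0 < L x"
    and Lfin: "\<And>N. finite {x. real_vec x \<in> C \<and> L x \<le> N}"
    and A_off: "\<And>g. real_vec g \<notin> C \<Longrightarrow> zpart A g = {\<zero>}"
    and M_off: "\<And>g. real_vec (g - e0) \<notin> C \<Longrightarrow> zpart M g = {\<zero>\<^bsub>M\<^esub>}"
  obtains c where "valid_cells c" "\<And>i. idem (c i) \<noteq> \<zero> \<Longrightarrow> b \<le> hdeg (c i)"
    "\<And>i. idem (c i) \<noteq> \<zero> \<Longrightarrow> real_vec (wdeg (c i) - e0) \<in> C"
    "\<And>g. finite {i. wdeg (c i) = g \<and> idem (c i) \<noteq> \<zero>}"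
    "\<And>g. weight_done c g"
proof -
  have L0: "L 0 = 0" using Ladd[of 0 0] by simp
  have Ldiff: "L (x - y) = L x - L y" for x y using Ladd[of "x - y" y] by simp
  have Lnn: "0 \<le> L x" if "real_vec x \<in> C" for x using Lpos[OF that] L0 by (cases "x = 0") auto
  define level where "level N = {g. real_vec (g - e0) \<in> C \<and> L (g - e0) = int N}" for N
  have level_fin: "finite (level N)" for N
  proof (rule finite_subset)
    show "level N \<subseteq> (\<lambda>x. x + e0) ` {x. real_vec x \<in> C \<and> L x \<le> int N}"
      by (rule subsetI, rule_tac x = "x - e0" in image_eqI) (auto simp: level_def)
  qed (use Lfin in blast)
  have A_off': "zpart A (g - g') = {\<zero>}" if "g \<noteq> g'" "L g \<le> L g'" for g g'
  proof (rule A_off)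
    show "real_vec (g - g') \<notin> C" using Lpos[of "g - g'"] Ldiff[of g g'] that by auto
  qed
  have level_L: "L g = int N + L e0" if "g \<in> level N" for g N
    using that by (simp add: level_def Ldiff)
  \<comment> \<open>the vacant place that fills up finite sequences of cells\<close>
  define t where "t = \<lparr>hdeg = b, wdeg = e0, idem = \<zero>, bdry = (\<lambda>_ :: nat. \<zero>), img = \<zero>\<^bsub>M\<^esub>\<rparr>"
  have tv: "valid_cells (\<lambda>_. t)" unfolding t_def by (rule valid_trivial_cells)
  have "\<exists>s. \<forall>N. (good (fst (s N)) (snd (s N)) \<and> (N = 0 \<longrightarrow> fst (s N) = 0)) \<and>
      (extends_in (level N) (fst (s N)) (snd (s N)) (fst (s (Suc N))) (snd (s (Suc N))) \<and>
       (\<forall>g\<in>level N. weight_done (snd (s (Suc N))) g))"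
  proof (rule dependent_nat_choice)
    have "good 0 (\<lambda>_. t)" using tv by (simp add: good_def trivial_from_def t_def)
    then show "\<exists>x. good (fst x) (snd x) \<and> ((0::nat) = 0 \<longrightarrow> fst x = 0)"
      by (intro exI[of _ "(0, \<lambda>_. t)"]) simp
  next
    fix x :: "nat \<times> (nat \<Rightarrow> ('a, 'm, 'n) cell)" and N :: nat
    assume "good (fst x) (snd x) \<and> (N = 0 \<longrightarrow> fst x = 0)"
    then have x: "good (fst x) (snd x)" by simp
    obtain n' c' where *: "good n' c'" "extends_in (level N) (fst x) (snd x) n' c'" "\<forall>g\<in>level N. weight_done c' g"
      using complete_level[OF level_fin[of N] x] A_off' level_L by fastforce
    show "\<exists>y. (good (fst y) (snd y) \<and> (Suc N = 0 \<longrightarrow> fst y = 0)) \<and> (extends_in (level N) (fst x) (snd x) (fst y) (snd y) \<and>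
        (\<forall>g\<in>level N. weight_done (snd y) g))"
      by (rule exI[of _ "(n', c')"]) (use * in simp)
  qed
  then obtain s where s: "\<And>N. (good (fst (s N)) (snd (s N)) \<and> (N = 0 \<longrightarrow> fst (s N) = 0)) \<and>
      (extends_in (level N) (fst (s N)) (snd (s N)) (fst (s (Suc N))) (snd (s (Suc N))) \<and>
       (\<forall>g\<in>level N. weight_done (snd (s (Suc N))) g))" by blast
  define n where "n N = fst (s N)" for N
  define c where "c N = snd (s N)" for N
  have good: "good (n N) (c N)" and ext: "extends_in (level N) (n N) (c N) (n (Suc N)) (c (Suc N))"
    and don: "g \<in> level N \<Longrightarrow> weight_done (c (Suc N)) g" for N g
    using s[of N] by (simp_all add: n_def c_def)
  have n0: "n 0 = 0" using s[of 0] by (simp add: n_def)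
  have mono: "n N \<le> n N' \<and> (\<forall>i<n N. c N' i = c N i)" if "N \<le> N'" for N N'
    using that
  proof (induction N' rule: dec_induct)
    case (step m)
    then show ?case using ext[of m] by (fastforce simp: extends_in_def)
  qed simp
  \<comment> \<open>the stages never change the cells below \<open>n N\<close>; if \<open>n\<close> is
                  bounded, the remaining places stay vacant\<close>
  define d where "d i = (if \<exists>N. i < n N then c (LEAST N. i < n N) i else t)" for i
  have d: "d i = c N i" if "i < n N" for i N
  proof -
    have l: "i < n (LEAST N. i < n N)" by (rule LeastI[of _ N]) (rule that)
    have "(LEAST N. i < n N) \<le> N" by (rule Least_le) (rule that)
    then have "c N i = c (LEAST N. i < n N) i" using mono l by blast
    then show ?thesis using that by (auto simp: d_def)
  qed
  have dt: "d i = t" if "\<And>N. \<not> i < n N" for i using that by (simp add: d_def)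
  have gv: "valid_cells (c N)" "trivial_from (n N) (c N)" for N using good[of N] by (auto simp: good_def)
  have dv: "valid_cells d"
  proof (rule valid_cells_local)
    fix i
    \<comment> \<open>the stage in which cell \<open>i\<close> is present contains its whole boundary\<close>
    show "\<exists>c'. valid_cells c' \<and> c' i = d i \<and> (\<forall>j. bdry (d i) j \<noteq> \<zero> \<longrightarrow> c' j = d j)"
    proof (cases "\<exists>N. i < n N")
      case True
      then obtain N where N: "i < n N" by blast
      have "c N j = d j" if "bdry (d i) j \<noteq> \<zero>" for j
      proof -
        have "bdry (c N i) j \<noteq> \<zero>" using that d[OF N] by simp
        then have "j < n N" using cT_trivial[OF gv valid_cellsD(10)[OF gv(1)]] by (meson not_less)
        then show ?thesis using d by simp
      qed
      then show ?thesis using gv(1)[of N] d[OF N] by (intro exI[of _ "c N"]) simp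
    next
      case False
      then have "d i = t" using dt by blast
      then show ?thesis using tv by (intro exI[of _ "\<lambda>_. t"]) (simp add: t_def)
    qed
  qed
  have stage: "\<exists>K. n K \<le> i \<and> i < n (Suc K) \<and> wdeg (d i) \<in> level K" if i: "i < n N" for i N
  proof -
    define K' where "K' = (LEAST N. i < n N)"
    have K': "i < n K'" unfolding K'_def by (rule LeastI[of _ N]) (rule i)
    then have "K' \<noteq> 0" using n0 by (metis not_less_zero)
    then obtain K where K: "K' = Suc K" by (cases K') auto
    have "n K \<le> i"
    proof (rule ccontr)
      assume "\<not> n K \<le> i"
      then have "K' \<le> K" unfolding K'_def by (intro Least_le) simp
      then show False using K by simp
    qed
    then show ?thesis using K K' ext[of K] d[OF K'] by (auto simp: extends_in_def)
  qed
  have used: "\<exists>N. i < n N" if "idem (d i) \<noteq> \<zero>" for i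
  proof (rule ccontr)
    assume "\<nexists>N. i < n N"
    then have "d i = t" using dt by blast
    then show False using that by (simp add: t_def)
  qed
  have wd: "\<exists>K. n K \<le> i \<and> i < n (Suc K) \<and> wdeg (d i) \<in> level K" if "idem (d i) \<noteq> \<zero>" for i
    using used[OF that] stage by blast
  show ?thesis
  proof (rule that[OF dv])
    show "b \<le> hdeg (d i)" if nz: "idem (d i) \<noteq> \<zero>" for i
    proof -
      obtain N where "i < n N" using used[OF nz] by blast
      then show ?thesis using d[of i N] good[of N] nz by (simp add: good_def)
    qed
    show wC: "real_vec (wdeg (d i) - e0) \<in> C" if "idem (d i) \<noteq> \<zero>" for i
      using wd[OF that] by (auto simp: level_def)
    show "finite {i. wdeg (d i) = g \<and> idem (d i) \<noteq> \<zero>}" for g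
    proof (rule finite_subset)
      show "{i. wdeg (d i) = g \<and> idem (d i) \<noteq> \<zero>} \<subseteq> {..<n (Suc (nat (L g - L e0)))}"
      proof clarify
        fix i assume "idem (d i) \<noteq> \<zero>" "g = wdeg (d i)"
        then obtain K where K: "i < n (Suc K)" "g \<in> level K" using wd by blast
        have "nat (L g - L e0) = K" using level_L[OF K(2)] by simp
        then show "i < n (Suc (nat (L (wdeg (d i)) - L e0)))" using K(1) \<open>g = wdeg (d i)\<close> by simp
      qed
    qed simp
    show "weight_done d g" for g
    proof (cases "real_vec (g - e0) \<in> C")
      case True
      define N where "N = nat (L (g - e0))"
      have gN: "g \<in> level N" using True Lnn[OF True] by (simp add: level_def N_def)
      show ?thesis
      proof (rule weight_done_preserved[OF gv(1) dv gv(2)])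
        show "d i = c (Suc N) i" if "i < n (Suc N)" for i by (rule d[OF that])
        show "weight_done (c (Suc N)) g" by (rule don[OF gN])
        show "zpart A (g - wdeg (d i)) = {\<zero>}" if i: "n (Suc N) \<le> i" "idem (d i) \<noteq> \<zero>" for i
        proof -
          obtain K where K: "i < n (Suc K)" "wdeg (d i) \<in> level K" using wd[OF i(2)] by blast
          have "\<not> K \<le> N"
          proof
            assume "K \<le> N"
            then have "n (Suc K) \<le> n (Suc N)" using mono[of "Suc K" "Suc N"] by simp
            then show False using K(1) i(1) by simp
          qed
          then show ?thesis using level_L[OF gN] level_L[OF K(2)] by (intro A_off') auto
        qed
      qed
    next
      case False
      interpret d: cells A M d by (rule valid_cells_cells[OF dv])
      interpret T: dg_ring_module A "cT d" by (rule d.T_dg_ring_module)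
      show ?thesis
        unfolding weight_done_def
      proof (intro allI ballI impI)
        fix h m w assume m: "m \<in> piece M h g" and w: "w \<in> piece (cT d) (h - 1) g"
        have "m = \<zero>\<^bsub>M\<^esub>" using MG.piece_zpart[OF m] M_off[OF False] by simp
        moreover have "w i = \<zero>" for i
        proof (cases "idem (d i) = \<zero>")
          case True
          have "w \<in> carrier (cT d)" using w by (simp add: d.T_piece)
          then show ?thesis using d.T_e[of w i] d.T_closed[of w i] True by simp
        next
          case nz: False
          have "real_vec (g - wdeg (d i)) \<notin> C"
          proof
            assume "real_vec (g - wdeg (d i)) \<in> C"
            then have "real_vec (g - wdeg (d i)) + real_vec (wdeg (d i) - e0) \<in> C"
              using Cadd wd[OF nz] by (auto simp: level_def)
            then show False using False by (simp add: real_vec_diff)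
          qed
          then show ?thesis using A_off T.MG.piece_zpart[OF w] by (auto simp: d.zpart_T_iff)
        qed
        then have "w = (\<lambda>_. \<zero>)" by (rule HOL.ext)
        ultimately show "(m, w) \<in> lifted d g" using lifted_zero[OF dv] by simp
      qed
    qed
  qed
qed

end

section \<open>Scalars, the underlying type, and the resolution\<close>

lemma (in dg_algebra) smult_is_mult:
  assumes "c \<in> carrier K" "a \<in> carrier A"
  shows "(c \<odot>\<^bsub>A\<^esub> \<one>\<^bsub>A\<^esub>) \<otimes>\<^bsub>A\<^esub> a = c \<odot>\<^bsub>A\<^esub> a"
  using smult_mult_left[OF assms(1) A.one_closed assms(2)] assms(2) by simp

lemma (in dg_algebra) scalar_action_algebra: "scalar_action K A (smult A)"
  by (intro scalar_action.intro scalar_action_axioms.intro K.field_axioms A.is_abelian_group)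
    (simp_all add: smult_closed smult_l_distr smult_r_distr smult_assoc1)

lemma (in dg_algebra) scalar_action_module:
  assumes "dg_module A M"
  shows "scalar_action K M (\<lambda>c x. (c \<odot>\<^bsub>A\<^esub> \<one>\<^bsub>A\<^esub>) \<odot>\<^bsub>M\<^esub> x)"
proof -
  interpret M: dg_module A M by fact
  have c: "c \<odot>\<^bsub>A\<^esub> \<one>\<^bsub>A\<^esub> \<in> carrier A" if "c \<in> carrier K" for c using that by (simp add: smult_closed)
  show ?thesis
  proof (intro scalar_action.intro scalar_action_axioms.intro K.field_axioms M.M.abelian_group_axioms)
    fix c d x assume "c \<in> carrier K" "d \<in> carrier K" "x \<in> carrier M"
    then show "((c \<otimes>\<^bsub>K\<^esub> d) \<odot>\<^bsub>A\<^esub> \<one>\<^bsub>A\<^esub>) \<odot>\<^bsub>M\<^esub> x = (c \<odot>\<^bsub>A\<^esub> \<one>\<^bsub>A\<^esub>) \<odot>\<^bsub>M\<^esub> ((d \<odot>\<^bsub>A\<^esub> \<one>\<^bsub>A\<^esub>) \<odot>\<^bsub>M\<^esub> x)"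
      by (simp add: c smult_assoc1 smult_is_mult flip: M.act_assoc)
  qed (simp_all add: c smult_l_distr M.act_closed M.act_l_distr M.act_r_distr M.act_one)
qed

text \<open>The graded dimension sums over the nonzero \<open>A\<^sup>h\<^sub>g\<close>, and such a sum is
  zero by convention if there are infinitely many of them; likewise \<open>vdim\<close> is only
  meaningful for finite-dimensional pieces. Both are excluded by projecting a finite spanning set of
  \<open>A\<^sub>g\<close> to the pieces: it spans each piece, and only finitely many projections
  are nonzero.\<close>

lemma (in dg_algebra) zpart_zero_off_cone:
  assumes fd: "fin_dim K (smult A) A (zpart A g)" and z: "graded_dimension K A g = 0"
  shows "zpart A g = {\<zero>\<^bsub>A\<^esub>}"
proof -
  interpret R: dg_ring A by (rule dg_ring)
  interpret V: scalar_action K A "smult A" by (rule scalar_action_algebra)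
  obtain B where B: "finite B" "B \<subseteq> zpart A g"
    and span: "\<And>v. v \<in> zpart A g \<Longrightarrow> \<exists>c\<in>B \<rightarrow> carrier K. v = (\<Oplus>\<^bsub>A\<^esub>b\<in>B. c b \<odot>\<^bsub>A\<^esub> b)"
    using fd unfolding fin_dim_def spans_def by blast
  have Bc: "b \<in> carrier A" if "b \<in> B" for b using that B(2) R.zpart_carrier by blast
  have comp_smult: "component A i (c \<odot>\<^bsub>A\<^esub> x) = c \<odot>\<^bsub>A\<^esub> component A i x" if "c \<in> carrier K" "x \<in> carrier A" for c x i
    using R.component_mult_degree_zero_left[OF piece_smult[OF that(1) one_piece] that(2), of i]
      that R.component_closed[OF that(2), of i] by (simp add: smult_is_mult)
  have in_lin: "x \<in> V.lin (component A (h, g) ` B)" if x: "x \<in> piece A h g" for x h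
  proof -
    obtain c where c: "c \<in> B \<rightarrow> carrier K" "x = (\<Oplus>\<^bsub>A\<^esub>b\<in>B. c b \<odot>\<^bsub>A\<^esub> b)"
      using span[OF R.piece_zpart[OF x]] by blast
    have cB: "c b \<in> carrier K" if "b \<in> B" for b using c(1) that by blast
    let ?B = "component A (h, g) ` B"
    have fB: "finite ?B" "?B \<subseteq> carrier A" using B(1) Bc R.component_closed by auto
    have L: "V.subsp (V.lin ?B)" by (rule V.lin_subsp[OF fB])
    have "x = component A (h, g) x" using R.component_same[OF x] by simp
    also have "\<dots> = (\<Oplus>\<^bsub>A\<^esub>b\<in>B. component A (h, g) (c b \<odot>\<^bsub>A\<^esub> b))"
      unfolding c(2) by (rule R.component_finsum) (use B(1) cB Bc in \<open>auto intro: smult_closed\<close>)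
    also have "\<dots> \<in> V.lin ?B"
    proof (rule M.finsum_in_subgroup)
      show "additive_subgroup (V.lin ?B) A" using L by (simp add: V.subsp_def)
      show "(\<lambda>b. component A (h, g) (c b \<odot>\<^bsub>A\<^esub> b)) \<in> B \<rightarrow> V.lin ?B"
      proof
        fix b assume b: "b \<in> B"
        have "component A (h, g) b \<in> V.lin ?B" using V.lin_superset[OF fB] b by blast
        then show "component A (h, g) (c b \<odot>\<^bsub>A\<^esub> b) \<in> V.lin ?B"
          using V.subspD(4)[OF L cB[OF b]] by (simp add: comp_smult[OF cB[OF b] Bc[OF b]])
      qed
    qed
    finally show ?thesis .
  qed
  let ?H = "{h. piece A h g \<noteq> {\<zero>\<^bsub>A\<^esub>}}"
  have finH: "finite ?H"
  proof (rule finite_subset)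
    show "?H \<subseteq> (\<Union>b\<in>B. fst ` {i. component A i b \<noteq> \<zero>\<^bsub>A\<^esub>})"
    proof
      fix h assume "h \<in> ?H"
      then obtain x where x: "x \<in> piece A h g" "x \<noteq> \<zero>\<^bsub>A\<^esub>" using R.piece_zero by blast
      show "h \<in> (\<Union>b\<in>B. fst ` {i. component A i b \<noteq> \<zero>\<^bsub>A\<^esub>})"
      proof (rule ccontr)
        assume "h \<notin> (\<Union>b\<in>B. fst ` {i. component A i b \<noteq> \<zero>\<^bsub>A\<^esub>})"
        then have "component A (h, g) ` B \<subseteq> {\<zero>\<^bsub>A\<^esub>}" by force
        moreover have "V.lin X \<subseteq> {\<zero>\<^bsub>A\<^esub>}" if "X \<subseteq> {\<zero>\<^bsub>A\<^esub>}" for X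
        proof
          fix v assume "v \<in> V.lin X"
          then obtain c where c: "c \<in> X \<rightarrow> carrier K" "v = (\<Oplus>\<^bsub>A\<^esub>b\<in>X. c b \<odot>\<^bsub>A\<^esub> b)"
            unfolding V.lin_def by blast
          have "v = \<zero>\<^bsub>A\<^esub>" unfolding c(2)
          proof (rule M.add.finprod_one_eqI)
            fix x assume x: "x \<in> X"
            then have "x = \<zero>\<^bsub>A\<^esub>" "c x \<in> carrier K" using that c(1) by auto
            then show "c x \<odot>\<^bsub>A\<^esub> x = \<zero>\<^bsub>A\<^esub>" using V.sc_r_zero[of "c x"] by simp
          qed
          then show "v \<in> {\<zero>\<^bsub>A\<^esub>}" by simp
        qed
        ultimately show False using in_lin[OF x(1)] x(2) by blast
      qed
    qed
    show "finite (\<Union>b\<in>B. fst ` {i. component A i b \<noteq> \<zero>\<^bsub>A\<^esub>})"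
      by (intro finite_UN_I finite_imageI R.component_finite Bc B(1))
  qed
  have "?H = {}"
  proof (rule ccontr)
    assume "?H \<noteq> {}"
    then obtain h where h: "h \<in> ?H" by blast
    have "int (vdim K (smult A) A (piece A h g)) = 0"
      using z finH h unfolding graded_dimension_def by (subst (asm) sum_nonneg_eq_0_iff) auto
    then have v0: "vdim K (smult A) A (piece A h g) = 0" by simp
    let ?B = "component A (h, g) ` B"
    have "spans K (smult A) A ?B (piece A h g)"
      unfolding spans_def
    proof (intro conjI ballI)
      show "finite ?B" using B(1) by simp
      show "?B \<subseteq> piece A h g" using R.component_piece Bc by blast
      fix v assume "v \<in> piece A h g"
      then show "\<exists>c\<in>?B \<rightarrow> carrier K. v = (\<Oplus>\<^bsub>A\<^esub>b\<in>?B. c b \<odot>\<^bsub>A\<^esub> b)"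
        using in_lin[of v h] unfolding V.lin_def by blast
    qed
    then have "\<exists>d B. spans K (smult A) A B (piece A h g) \<and> card B = d" by blast
    then have "\<exists>B. spans K (smult A) A B (piece A h g) \<and> card B = vdim K (smult A) A (piece A h g)"
      unfolding vdim_def by (rule LeastI_ex)
    then obtain B' where B': "spans K (smult A) A B' (piece A h g)" "card B' = 0" using v0 by auto
    then have "B' = {}" by (simp add: spans_def)
    then have "v = \<zero>\<^bsub>A\<^esub>" if "v \<in> piece A h g" for v
      using B'(1) that unfolding spans_def by simp
    then have "piece A h g = {\<zero>\<^bsub>A\<^esub>}" using R.piece_zero by blast
    then show False using h by simp
  qed
  then show ?thesis using R.zpart_eq_zero_iff by blast
qed

text \<open>The resolution has carrier \<open>nat \<Rightarrow> 'a\<close> and must be moved into the type of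
  sets of \<open>K\<close>-valued functions on words in \<open>A\<close> with an element of
  \<open>M\<close> attached. Words encode the pairs \<open>(f i, i)\<close>, with \<open>i\<close>
  as the length of a padding, and a word is represented by a function with value \<open>k1\<close>
  at this word only. Then \<open>f\<close> becomes the set representing its graph. Only two distinct
  scalars are needed.\<close>

lemma injection_into_bar_elem:
  assumes "k0 \<noteq> (k1 :: 'k)"
  obtains J :: "(nat \<Rightarrow> 'a) \<Rightarrow> ('k, 'a, 'm) bar_elem" and \<iota> :: "nat \<Rightarrow> ('k, 'a, 'm) bar_elem set"
  where "inj J" "inj \<iota>"
proof -
  define pt :: "'a list \<Rightarrow> 'a list \<times> 'm \<Rightarrow> 'k" where
    "pt w = (\<lambda>x. if x = (w, undefined) then k1 else k0)" for w
  have pt: "w = w'" if "pt w = pt w'" for w w'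
    using fun_cong[OF that, of "(w, undefined)"] assms by (auto simp: pt_def split: if_splits)
  define J :: "(nat \<Rightarrow> 'a) \<Rightarrow> ('k, 'a, 'm) bar_elem" where
    "J f = range (\<lambda>i. pt (f i # replicate i undefined))" for f
  have "inj J"
  proof (rule injI, rule ext)
    fix f f' i assume "J f = J f'"
    then have "pt (f i # replicate i undefined) \<in> J f'" by (auto simp: J_def)
    then obtain i' where "pt (f i # replicate i undefined) = pt (f' i' # replicate i' undefined)"
      by (auto simp: J_def)
    from pt[OF this] have "f i = f' i'" "replicate i (undefined :: 'a) = replicate i' undefined" by auto
    then show "f i = f' i" by (metis length_replicate)
  qed
  moreover have "inj (\<lambda>i. {{pt (replicate i undefined)}})"
  proof (rule injI)
    fix i i' assume "{{pt (replicate i undefined)}} = {{pt (replicate i' undefined)}}"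
    then have "pt (replicate i undefined) = pt (replicate i' undefined)" by simp
    from pt[OF this] show "i = i'" by (metis length_replicate)
  qed
  ultimately show ?thesis by (rule that)
qed

theorem theorem9p13:
  fixes lt :: "int ^ 'n::finite \<Rightarrow> int ^ 'n \<Rightarrow> bool"
    and K :: "('k, 'x) ring_scheme"
    and A :: "('k, 'a, 'n) dg_struct"
    and M :: "('a, 'm, 'n) dg_struct"
  assumes "additive_total_order lt"
    and "dg_algebra K A"
    and "cblf_positive lt K A"
    and "dg_module A M"
    and "cblf_dimensional lt K A M"
  shows "\<exists>(P :: ('a, ('k, 'a, 'm) bar_elem, 'n) dg_struct) f.
           cblf_cell_module lt A P \<and>
           quasi_isomorphism A P M f \<and> f ` carrier P = carrier M"
proof -
  interpret alg: dg_algebra K A by fact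
  interpret R: dg_ring A by (rule alg.dg_ring)
  have "dg_ring_module A M" by (intro dg_ring_module.intro R.dg_ring_axioms) fact
  then interpret M: dg_ring_module A M .
  obtain CA where CA: "compatible_cone lt CA" "graded_dimension K A \<in> series_in_cone CA"
    and below: "\<And>h g. h < 0 \<Longrightarrow> piece A h g = {\<zero>\<^bsub>A\<^esub>}" and wzero: "\<And>h. 0 < h \<Longrightarrow> piece A h 0 = {\<zero>\<^bsub>A\<^esub>}"
    and fdA: "\<And>g. fin_dim K (smult A) A (zpart A g)"
    and ss: "semisimple_ring (A\<lparr>carrier := piece A 0 0\<rparr>)"
    using assms(3) unfolding cblf_positive_def by blast
  obtain e0 CM where CM: "compatible_cone lt CM"
    and Moff: "\<And>g. real_vec (g - e0) \<notin> CM \<Longrightarrow> zpart M g = {\<zero>\<^bsub>M\<^esub>}"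
    and fdM: "\<And>g. fin_dim K (\<lambda>c x. (c \<odot>\<^bsub>A\<^esub> \<one>\<^bsub>A\<^esub>) \<odot>\<^bsub>M\<^esub> x) M (zpart M g)"
    and bbM: "bounded_below M"
    using assms(5) unfolding cblf_dimensional_def by blast
  obtain b where b: "\<And>h g. h < b \<Longrightarrow> piece M h g = {\<zero>\<^bsub>M\<^esub>}"
    using bbM unfolding bounded_below_def by blast
  obtain C and L :: "int ^ 'n \<Rightarrow> int" where C: "compatible_cone lt C" "CA \<subseteq> C" "CM \<subseteq> C" "0 \<in> C"
    and Cadd: "\<And>x y. x \<in> C \<Longrightarrow> y \<in> C \<Longrightarrow> x + y \<in> C" and Ladd: "\<And>x y. L (x + y) = L x + L y"
    and Lpos: "\<And>x. real_vec x \<in> C \<Longrightarrow> x \<noteq> 0 \<Longrightarrow> 0 < L x"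
    and Lfin: "\<And>N. finite {x. real_vec x \<in> C \<and> L x \<le> N}"
    by (rule common_cone[OF assms(1) CA(1) CM]) blast
  obtain E where E: "finite E" "E \<subseteq> piece A 0 0" "\<And>\<epsilon>. \<epsilon> \<in> E \<Longrightarrow> \<epsilon> \<otimes>\<^bsub>A\<^esub> \<epsilon> = \<epsilon>"
    "(\<Oplus>\<^bsub>A\<^esub>\<epsilon>\<in>E. \<epsilon>) = \<one>\<^bsub>A\<^esub>"
    "\<And>\<epsilon> J. \<lbrakk>\<epsilon> \<in> E; J \<subseteq> {a \<in> piece A 0 0. a \<otimes>\<^bsub>A\<^esub> \<epsilon> = a}; \<zero>\<^bsub>A\<^esub> \<in> J;
        \<And>x y. x \<in> J \<Longrightarrow> y \<in> J \<Longrightarrow> x \<oplus>\<^bsub>A\<^esub> y \<in> J;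
        \<And>a x. a \<in> piece A 0 0 \<Longrightarrow> x \<in> J \<Longrightarrow> a \<otimes>\<^bsub>A\<^esub> x \<in> J\<rbrakk>
      \<Longrightarrow> J = {\<zero>\<^bsub>A\<^esub>} \<or> J = {a \<in> piece A 0 0. a \<otimes>\<^bsub>A\<^esub> \<epsilon> = a}"
    by (rule R.semisimple_idempotents[OF ss]) blast
  \<comment> \<open>multiplication by these elements is the action of the field, on \<open>A\<close>
                  as well as on \<open>M\<close>\<close>
  define S where "S = (\<lambda>c. c \<odot>\<^bsub>A\<^esub> \<one>\<^bsub>A\<^esub>) ` carrier K"
  have rank_A: "bounded_rank {W. M.A_sub S W \<and> W \<subseteq> zpart A g}" for g
  proof (rule bounded_rank_mono)
    interpret V: scalar_action K A "smult A" by (rule alg.scalar_action_algebra)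
    show "bounded_rank {W. V.subsp W \<and> W \<subseteq> zpart A g}"
      by (rule V.fin_dim_bounded_rank[OF fdA]) (use R.zpart_carrier in blast)
    show "{W. M.A_sub S W \<and> W \<subseteq> zpart A g} \<subseteq> {W. V.subsp W \<and> W \<subseteq> zpart A g}"
    proof clarify
      fix W assume W: "M.A_sub S W" "W \<subseteq> zpart A g"
      have "c \<odot>\<^bsub>A\<^esub> x \<in> W" if "c \<in> carrier K" "x \<in> W" for c x
      proof -
        have "(c \<odot>\<^bsub>A\<^esub> \<one>\<^bsub>A\<^esub>) \<otimes>\<^bsub>A\<^esub> x \<in> W" using W(1) that by (simp add: M.A_sub_def S_def)
        moreover have "x \<in> carrier A" using W(2) that(2) R.zpart_carrier by blast
        ultimately show ?thesis using alg.smult_is_mult[OF that(1)] by simp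
      qed
      then show "V.subsp W" using W(1) by (simp add: V.subsp_def M.A_sub_def)
    qed
  qed
  have rank_M: "bounded_rank {W. M.M_sub S W \<and> W \<subseteq> zpart M g}" for g
  proof (rule bounded_rank_mono)
    interpret V: scalar_action K M "\<lambda>c x. (c \<odot>\<^bsub>A\<^esub> \<one>\<^bsub>A\<^esub>) \<odot>\<^bsub>M\<^esub> x"
      by (rule alg.scalar_action_module[OF assms(4)])
    show "bounded_rank {W. V.subsp W \<and> W \<subseteq> zpart M g}"
      by (rule V.fin_dim_bounded_rank[OF fdM]) (use M.MG.zpart_carrier in blast)
    show "{W. M.M_sub S W \<and> W \<subseteq> zpart M g} \<subseteq> {W. V.subsp W \<and> W \<subseteq> zpart M g}"
      by (auto simp: V.subsp_def M.M_sub_def S_def)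
  qed
  interpret att: cell_attachment A M E S b
  proof
    show "S \<subseteq> piece A 0 0" using alg.piece_smult[OF _ alg.one_piece] by (auto simp: S_def)
  qed (fact below | fact wzero | fact E(1) | fact E(2) | fact E(3) | fact E(4) | fact E(5) |
      fact rank_A | fact rank_M | fact b)+
  have Aoff: "zpart A g = {\<zero>\<^bsub>A\<^esub>}" if "real_vec g \<notin> C" for g
  proof (rule alg.zpart_zero_off_cone[OF fdA])
    show "graded_dimension K A g = 0" using CA(2) that C(2) by (auto simp: series_in_cone_def)
  qed
  have Moff': "zpart M g = {\<zero>\<^bsub>M\<^esub>}" if "real_vec (g - e0) \<notin> C" for g
    using Moff that C(3) by blast
  obtain c where c: "M.valid_cells c" "\<And>i. idem (c i) \<noteq> \<zero>\<^bsub>A\<^esub> \<Longrightarrow> b \<le> hdeg (c i)"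
    "\<And>i. idem (c i) \<noteq> \<zero>\<^bsub>A\<^esub> \<Longrightarrow> real_vec (wdeg (c i) - e0) \<in> C"
    "\<And>g. finite {i. wdeg (c i) = g \<and> idem (c i) \<noteq> \<zero>\<^bsub>A\<^esub>}" "\<And>g. att.weight_done c g"
    by (rule att.exists_resolving_cells[OF C(4) Cadd Ladd Lpos Lfin Aoff Moff']) blast+
  interpret c: cells A M c by (rule att.valid_cells_cells[OF c(1)])
  interpret bt: bounded_twisted A "\<lambda>i. hdeg (c i)" "\<lambda>i. wdeg (c i)" "\<lambda>i. idem (c i)" "\<lambda>i. bdry (c i)" b
    by unfold_locales (fact below, fact c(2))
  interpret T: dg_ring_module A c.T by (rule c.T_dg_ring_module)
  have "\<one>\<^bsub>K\<^esub> \<noteq> \<zero>\<^bsub>K\<^esub>" by (rule alg.K.one_not_zero)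
  then obtain J :: "(nat \<Rightarrow> 'a) \<Rightarrow> ('k, 'a, 'm) bar_elem" and \<iota> :: "nat \<Rightarrow> ('k, 'a, 'm) bar_elem set"
    where J: "inj J" and \<iota>: "inj \<iota>" by (rule injection_into_bar_elem)
  let ?P = "dg_image J c.T"
  have Pmod: "dg_module A ?P" by (rule dg_image_dg_module[OF c.T_dg_ring_module J])
  then have Pr: "dg_ring_module A ?P" by (intro dg_ring_module.intro R.dg_ring_axioms)
  let ?f = "\<lambda>y. M.phi (\<lambda>i. img (c i)) (inv_into UNIV J y)"
  have fJ: "?f (J y) = M.phi (\<lambda>i. img (c i)) y" for y using J by simp
  have hom: "dg_hom A ?P M ?f"
    unfolding dg_hom_def
  proof (intro conjI ballI allI)
    show "?f ` piece ?P h g \<subseteq> piece M h g" for h g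
      using J c.phi_piece by (auto simp: dg_image_simps)
  qed (use J in \<open>auto simp: dg_image_simps c.phi_diff T.act_closed
        c.phi_add[simplified] c.phi_smult[simplified]\<close>)
  have lift: "\<exists>y\<in>carrier ?P. diff ?P y = z \<and> ?f y = m"
    if z: "z \<in> piece ?P (h - 1) g" and m: "m \<in> piece M h g" and dz: "diff ?P z = \<zero>\<^bsub>?P\<^esub>"
      and fz: "?f z = diff M m" for h g z m
  proof -
    obtain w where w: "w \<in> piece c.T (h - 1) g" "z = J w" using z J by (auto simp: dg_image_simps)
    have "J (diff c.T w) = J (\<lambda>_. \<zero>\<^bsub>A\<^esub>)" using dz J w(2) by (simp add: dg_image_simps)
    then have "diff c.T w = (\<lambda>_. \<zero>\<^bsub>A\<^esub>)" using J by (simp add: inj_eq)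
    moreover have "M.phi (\<lambda>i. img (c i)) w = diff M m" using fz w(2) fJ by simp
    ultimately have "(m, w) \<in> att.lifted c g"
      using c(5)[of g] m w(1) unfolding att.weight_done_def by blast
    then obtain y where "y \<in> carrier c.T" "m = M.phi (\<lambda>i. img (c i)) y" "w = diff c.T y"
      by (auto simp: att.lifted_def T.MG.zpart_iff)
    then show ?thesis using J w(2) by (intro bexI[of _ "J y"]) (auto simp: dg_image_simps)
  qed
  note lift' = lifting_from_pieces[OF Pr M.dg_ring_module_axioms hom lift]
  have "quasi_isomorphism A ?P M ?f" "?f ` carrier ?P = carrier M"
    by (rule lifting_quasi_isomorphism[OF Pr M.dg_ring_module_axioms hom]; rule lift'; assumption)+
  moreover have "cblf_cell_module lt A ?P"
    unfolding cblf_cell_module_def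
    using Pmod bt.property_P_image[OF J \<iota>] bt.cblf_generated_image[OF J C(1) c(3,4)] by blast
  ultimately show ?thesis by blast
qed

end
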